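(* Let $\mathcal{E}$ be any connected locally connected topos and $U$ any cover of $\mathcal{E}$. Let $A$ be any representing object of one of the points $f_i$ ($i\in\gamma_!U$) of $\mathcal{P}_U\simeq Split(U)$. Then $A$ is necessarily a Galois object (thus in particular a connected cover), $Split(U)=Split(A)$, and $\mathcal{P}_U\cong\mathcal{P}_A$.
   Context: All topoi are Grothendieck topoi over the category $\mathcal{S}$ of sets; $\gamma:\mathcal{E}\to\mathcal{S}$ is the structure morphism. $\mathcal{E}$ is locally connected if $\gamma^*$ has a left adjoint $\gamma_!$ (set of connected components), and connected if $\gamma^*$ is full and faithful. A cover is an epimorphic family $U=\{U_i\to1\}_{i\in I}$; $U$ also denotes the coproduct $\sum_iU_i$. An object $X$ is $U$-split if there are sets $S_i$ and isomorphisms $\gamma^*S_i\times U_i\cong X\times U_i$ over $U_i$ for all $i$. $Split(U)\subset\mathcal{E}$ is the full subcategory of $U$-split objects. A Galois object is a non-empty connected object $A$ with $A\to1$ epimorphic such that the canonical morphism $A\times\gamma^*Aut(A)\to A\times A$ is an isomorphism. $\mathcal{P}_U$ is the push-out topos of $\varphi_U:\mathcal{E}/U\to\mathcal{E}$ and $\rho_U:\mathcal{E}/U\to\mathcal{S}/\gamma_!U$, where $\varphi_U^*(X)=X\times U$ and $\rho_U^*(S\to\gamma_!U)=\gamma^*S\times_{\gamma^*\gamma_!U}U$. Explicitly, its objects are triples $\langle X,S\to\gamma_!U,\theta\rangle$ with $\theta:X\times U\to\gamma^*S\times_{\gamma^*\gamma_!U}U$ an isomorphism over $U$, and its morphisms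 are pairs $(X\to X',\,S\to S'\text{ over }\gamma_!U)$ compatible with the isomorphisms. The projection $\langle X,S\to\gamma_!U,\theta\rangle\mapsto X$ is an equivalence of $\mathcal{P}_U$ with $Split(U)$. For $i\in\gamma_!U$, $f_i$ is the point of $\mathcal{P}_U$ with inverse image $f_i^*\langle X,S\to\gamma_!U,\theta\rangle=S_i$ (the fiber over $i$); it is an essential point, so that $f_i^*$ is representable, and a representing object of $f_i$ is an object $A$ of $\mathcal{P}_U\simeq Split(U)$, viewed as an object of $\mathcal{E}$, with $f_i^*\cong[A,-]$. $Split(A)$ and $\mathcal{P}_A$ denote the same constructions for the cover consisting of the single object $A$. *)

theory Defs
  imports Main "HOL-Library.FuncSet"
begin

unbundle cardinal_syntax

section \<open>Categories, functors, adjunctions\<close>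

text \<open>\<open>cmp C g f\<close> is "g after f".\<close>

record ('o, 'a) cat =
  ob  :: "'o set"
  ar  :: "'a set"
  src :: "'a \<Rightarrow> 'o"
  tgt :: "'a \<Rightarrow> 'o"
  idt :: "'o \<Rightarrow> 'a"
  cmp :: "'a \<Rightarrow> 'a \<Rightarrow> 'a"

definition hom :: "('o, 'a) cat \<Rightarrow> 'o \<Rightarrow> 'o \<Rightarrow> 'a set" where
  "hom C x y = {f \<in> ar C. src C f = x \<and> tgt C f = y}"

definition category :: "('o, 'a) cat \<Rightarrow> bool" where
  "category C \<longleftrightarrow>
     (\<forall>f\<in>ar C. src C f \<in> ob C \<and> tgt C f \<in> ob C) \<and>
     (\<forall>x\<in>ob C. idt C x \<in> hom C x x) \<and>
     (\<forall>f\<in>ar C. \<forall>g\<in>ar C. src C g = tgt C f \<longrightarrow> cmp C g f \<in> hom C (src C f) (tgt C g)) \<and>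
     (\<forall>f\<in>ar C. cmp C f (idt C (src C f)) = f \<and> cmp C (idt C (tgt C f)) f = f) \<and>
     (\<forall>f\<in>ar C. \<forall>g\<in>ar C. \<forall>h\<in>ar C. src C g = tgt C f \<longrightarrow> src C h = tgt C g \<longrightarrow>
        cmp C h (cmp C g f) = cmp C (cmp C h g) f)"

definition iso :: "('o, 'a) cat \<Rightarrow> 'a \<Rightarrow> bool" where
  "iso C f \<longleftrightarrow> f \<in> ar C \<and>
     (\<exists>g \<in> hom C (tgt C f) (src C f). cmp C g f = idt C (src C f) \<and> cmp C f g = idt C (tgt C f))"

definition op_cat :: "('o, 'a) cat \<Rightarrow> ('o, 'a) cat" where
  "op_cat C = \<lparr>ob = ob C, ar = ar C, src = tgt C, tgt = src C, idt = idt C,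
               cmp = (\<lambda>g f. cmp C f g)\<rparr>"

definition full_subcat :: "('o, 'a) cat \<Rightarrow> 'o set \<Rightarrow> ('o, 'a) cat" where
  "full_subcat C X = C\<lparr>ob := ob C \<inter> X, ar := {f \<in> ar C. src C f \<in> X \<and> tgt C f \<in> X}\<rparr>"

record ('o, 'a, 'p, 'b) ftor =
  fob :: "'o \<Rightarrow> 'p"
  far :: "'a \<Rightarrow> 'b"

definition is_functor :: "('o, 'a) cat \<Rightarrow> ('p, 'b) cat \<Rightarrow> ('o, 'a, 'p, 'b) ftor \<Rightarrow> bool" where
  "is_functor C D F \<longleftrightarrow>
     (\<forall>x\<in>ob C. fob F x \<in> ob D) \<and>
     (\<forall>f\<in>ar C. far F f \<in> hom D (fob F (src C f)) (fob F (tgt C f))) \<and>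
     (\<forall>x\<in>ob C. far F (idt C x) = idt D (fob F x)) \<and>
     (\<forall>f\<in>ar C. \<forall>g\<in>ar C. src C g = tgt C f \<longrightarrow> far F (cmp C g f) = cmp D (far F g) (far F f))"

definition id_ftor :: "('o, 'a, 'o, 'a) ftor" where
  "id_ftor = \<lparr>fob = (\<lambda>x. x), far = (\<lambda>f. f)\<rparr>"

definition comp_ftor ::
  "('p, 'b, 'q, 'c) ftor \<Rightarrow> ('o, 'a, 'p, 'b) ftor \<Rightarrow> ('o, 'a, 'q, 'c) ftor" where
  "comp_ftor G F = \<lparr>fob = (\<lambda>x. fob G (fob F x)), far = (\<lambda>f. far G (far F f))\<rparr>"

definition nat_trans ::
  "('o, 'a) cat \<Rightarrow> ('p, 'b) cat \<Rightarrow> ('o, 'a, 'p, 'b) ftor \<Rightarrow> ('o, 'a, 'p, 'b) ftor \<Rightarrow>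
   ('o \<Rightarrow> 'b) \<Rightarrow> bool" where
  "nat_trans C D F G \<tau> \<longleftrightarrow>
     (\<forall>x\<in>ob C. \<tau> x \<in> hom D (fob F x) (fob G x)) \<and>
     (\<forall>f\<in>ar C. cmp D (\<tau> (tgt C f)) (far F f) = cmp D (far G f) (\<tau> (src C f)))"

definition nat_iso ::
  "('o, 'a) cat \<Rightarrow> ('p, 'b) cat \<Rightarrow> ('o, 'a, 'p, 'b) ftor \<Rightarrow> ('o, 'a, 'p, 'b) ftor \<Rightarrow>
   ('o \<Rightarrow> 'b) \<Rightarrow> bool" where
  "nat_iso C D F G \<tau> \<longleftrightarrow> nat_trans C D F G \<tau> \<and> (\<forall>x\<in>ob C. iso D (\<tau> x))"

definition equivalent_cats :: "('o, 'a) cat \<Rightarrow> ('p, 'b) cat \<Rightarrow> bool" where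
  "equivalent_cats C D \<longleftrightarrow>
     (\<exists>F G. is_functor C D F \<and> is_functor D C G \<and>
        (\<exists>\<tau>. nat_iso C C id_ftor (comp_ftor G F) \<tau>) \<and>
        (\<exists>\<sigma>. nat_iso D D (comp_ftor F G) id_ftor \<sigma>))"

definition fully_faithful ::
  "('o, 'a) cat \<Rightarrow> ('p, 'b) cat \<Rightarrow> ('o, 'a, 'p, 'b) ftor \<Rightarrow> bool" where
  "fully_faithful C D F \<longleftrightarrow> is_functor C D F \<and>
     (\<forall>x\<in>ob C. \<forall>y\<in>ob C. bij_betw (far F) (hom C x y) (hom D (fob F x) (fob F y)))"

text \<open>\<open>L\<close> is left adjoint to \<open>R\<close>, with unit \<open>\<eta>\<close>.\<close>

definition adjunction ::
  "('o, 'a) cat \<Rightarrow> ('p, 'b) cat \<Rightarrow> ('o, 'a, 'p, 'b) ftor \<Rightarrow> ('p, 'b, 'o, 'a) ftor \<Rightarrow>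
   ('o \<Rightarrow> 'a) \<Rightarrow> bool" where
  "adjunction C D L R \<eta> \<longleftrightarrow>
     is_functor C D L \<and> is_functor D C R \<and>
     nat_trans C C id_ftor (comp_ftor R L) \<eta> \<and>
     (\<forall>x\<in>ob C. \<forall>y\<in>ob D. \<forall>f \<in> hom C x (fob R y).
        \<exists>!g. g \<in> hom D (fob L x) y \<and> cmp C (far R g) (\<eta> x) = f)"

section \<open>Limits and colimits\<close>

definition is_terminal :: "('o, 'a) cat \<Rightarrow> 'o \<Rightarrow> bool" where
  "is_terminal C t \<longleftrightarrow> t \<in> ob C \<and> (\<forall>x\<in>ob C. \<exists>!f. f \<in> hom C x t)"

definition is_initial :: "('o, 'a) cat \<Rightarrow> 'o \<Rightarrow> bool" where
  "is_initial C z \<longleftrightarrow> z \<in> ob C \<and> (\<forall>x\<in>ob C. \<exists>!f. f \<in> hom C z x)"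

definition is_product :: "('o, 'a) cat \<Rightarrow> 'o \<Rightarrow> 'o \<Rightarrow> 'a \<Rightarrow> 'a \<Rightarrow> bool" where
  "is_product C x y p q \<longleftrightarrow>
     p \<in> ar C \<and> q \<in> ar C \<and> src C p = src C q \<and> tgt C p = x \<and> tgt C q = y \<and>
     (\<forall>a\<in>ar C. \<forall>b\<in>ar C. src C a = src C b \<longrightarrow> tgt C a = x \<longrightarrow> tgt C b = y \<longrightarrow>
        (\<exists>!h. h \<in> hom C (src C a) (src C p) \<and> cmp C p h = a \<and> cmp C q h = b))"

definition is_pullback :: "('o, 'a) cat \<Rightarrow> 'a \<Rightarrow> 'a \<Rightarrow> 'a \<Rightarrow> 'a \<Rightarrow> bool" where
  "is_pullback C f g p q \<longleftrightarrow>
     f \<in> ar C \<and> g \<in> ar C \<and> tgt C f = tgt C g \<and>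
     p \<in> ar C \<and> q \<in> ar C \<and> src C p = src C q \<and> tgt C p = src C f \<and> tgt C q = src C g \<and>
     cmp C f p = cmp C g q \<and>
     (\<forall>a\<in>ar C. \<forall>b\<in>ar C. src C a = src C b \<longrightarrow> tgt C a = src C f \<longrightarrow> tgt C b = src C g \<longrightarrow>
        cmp C f a = cmp C g b \<longrightarrow>
        (\<exists>!h. h \<in> hom C (src C a) (src C p) \<and> cmp C p h = a \<and> cmp C q h = b))"

definition is_coproduct ::
  "('o, 'a) cat \<Rightarrow> 'i set \<Rightarrow> ('i \<Rightarrow> 'o) \<Rightarrow> 'o \<Rightarrow> ('i \<Rightarrow> 'a) \<Rightarrow> bool" where
  "is_coproduct C I X S inc \<longleftrightarrow>
     S \<in> ob C \<and> (\<forall>i\<in>I. X i \<in> ob C \<and> inc i \<in> hom C (X i) S) \<and>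
     (\<forall>y\<in>ob C. \<forall>a. (\<forall>i\<in>I. a i \<in> hom C (X i) y) \<longrightarrow>
        (\<exists>!h. h \<in> hom C S y \<and> (\<forall>i\<in>I. cmp C h (inc i) = a i)))"

text \<open>Chosen terminal object, products and pullbacks. They are meaningful in a category that
  has the limits in question.\<close>

definition terminal :: "('o, 'a) cat \<Rightarrow> 'o" where
  "terminal C = (SOME t. is_terminal C t)"

definition bang :: "('o, 'a) cat \<Rightarrow> 'o \<Rightarrow> 'a" where
  "bang C x = (THE f. f \<in> hom C x (terminal C))"

definition prod_cone :: "('o, 'a) cat \<Rightarrow> 'o \<Rightarrow> 'o \<Rightarrow> 'a \<times> 'a" where
  "prod_cone C x y = (SOME (p, q). is_product C x y p q)"

definition pr1 :: "('o, 'a) cat \<Rightarrow> 'o \<Rightarrow> 'o \<Rightarrow> 'a" where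
  "pr1 C x y = fst (prod_cone C x y)"

definition pr2 :: "('o, 'a) cat \<Rightarrow> 'o \<Rightarrow> 'o \<Rightarrow> 'a" where
  "pr2 C x y = snd (prod_cone C x y)"

definition prod_ob :: "('o, 'a) cat \<Rightarrow> 'o \<Rightarrow> 'o \<Rightarrow> 'o" where
  "prod_ob C x y = src C (pr1 C x y)"

definition pairing :: "('o, 'a) cat \<Rightarrow> 'a \<Rightarrow> 'a \<Rightarrow> 'a" where
  "pairing C a b = (THE h. h \<in> hom C (src C a) (prod_ob C (tgt C a) (tgt C b)) \<and>
     cmp C (pr1 C (tgt C a) (tgt C b)) h = a \<and> cmp C (pr2 C (tgt C a) (tgt C b)) h = b)"

definition prod_map :: "('o, 'a) cat \<Rightarrow> 'a \<Rightarrow> 'a \<Rightarrow> 'a" where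
  "prod_map C f g = pairing C (cmp C f (pr1 C (src C f) (src C g)))
                              (cmp C g (pr2 C (src C f) (src C g)))"

definition pb_cone :: "('o, 'a) cat \<Rightarrow> 'a \<Rightarrow> 'a \<Rightarrow> 'a \<times> 'a" where
  "pb_cone C f g = (SOME (p, q). is_pullback C f g p q)"

definition pb1 :: "('o, 'a) cat \<Rightarrow> 'a \<Rightarrow> 'a \<Rightarrow> 'a" where
  "pb1 C f g = fst (pb_cone C f g)"

definition pb2 :: "('o, 'a) cat \<Rightarrow> 'a \<Rightarrow> 'a \<Rightarrow> 'a" where
  "pb2 C f g = snd (pb_cone C f g)"

definition pb_ob :: "('o, 'a) cat \<Rightarrow> 'a \<Rightarrow> 'a \<Rightarrow> 'o" where
  "pb_ob C f g = src C (pb1 C f g)"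

text \<open>Preservation of finite limits is expressed by the terminal object and pullbacks, from
  which all finite limits are built.\<close>

definition left_exact ::
  "('o, 'a) cat \<Rightarrow> ('p, 'b) cat \<Rightarrow> ('o, 'a, 'p, 'b) ftor \<Rightarrow> bool" where
  "left_exact C D F \<longleftrightarrow>
     (\<forall>t. is_terminal C t \<longrightarrow> is_terminal D (fob F t)) \<and>
     (\<forall>f g p q. is_pullback C f g p q \<longrightarrow>
        is_pullback D (far F f) (far F g) (far F p) (far F q))"

definition geometric_morphism ::
  "('o, 'a) cat \<Rightarrow> ('p, 'b) cat \<Rightarrow> ('p, 'b, 'o, 'a) ftor \<Rightarrow> ('o, 'a, 'p, 'b) ftor \<Rightarrow> bool" where
  "geometric_morphism E F inverse_im direct_im \<longleftrightarrow>
     (\<exists>\<eta>. adjunction F E inverse_im direct_im \<eta>) \<and> left_exact F E inverse_im"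

section \<open>The category of sets\<close>

text \<open>Sets are relativised to a universe: they are the subsets of a type \<open>'s\<close> of cardinality
  less than a fixed regular strong limit cardinal \<open>\<kappa>\<close> on \<open>'s\<close>. For uncountable \<open>\<kappa>\<close> this is a
  Grothendieck universe. The case \<open>\<kappa> = \<aleph>\<^sub>0\<close>, where the sets are the finite ones, is not
  excluded, so that universes exist in HOL.\<close>

definition universe :: "'s rel \<Rightarrow> bool" where
  "universe \<kappa> \<longleftrightarrow> Card_order \<kappa> \<and> cinfinite \<kappa> \<and> regularCard \<kappa> \<and>
     (\<forall>X :: 's set. |X| <o \<kappa> \<longrightarrow> |Pow X| <o \<kappa>)"

definition small :: "'s rel \<Rightarrow> 'x set \<Rightarrow> bool" where
  "small \<kappa> X \<longleftrightarrow> |X| <o \<kappa>"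

text \<open>An arrow that carries its source and target along with its data.\<close>

datatype ('x, 'd) arrow = Arrow (asrc: 'x) (body: 'd) (atgt: 'x)

type_synonym 's sarrow = "('s set, 's \<Rightarrow> 's) arrow"

definition Sets :: "'s rel \<Rightarrow> ('s set, 's sarrow) cat" where
  "Sets \<kappa> = \<lparr>ob = {S. small \<kappa> S},
     ar = {Arrow S f T | S f T. small \<kappa> S \<and> small \<kappa> T \<and> f \<in> S \<rightarrow>\<^sub>E T},
     src = asrc, tgt = atgt,
     idt = (\<lambda>S. Arrow S (\<lambda>x\<in>S. x) S),
     cmp = (\<lambda>g f. Arrow (asrc f) (compose (asrc f) (body g) (body f)) (atgt g))\<rparr>"

section \<open>Grothendieck topoi\<close>

definition functor_cat ::
  "('o, 'a) cat \<Rightarrow> ('p, 'b) cat \<Rightarrow>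
   (('o, 'a, 'p, 'b) ftor, (('o, 'a, 'p, 'b) ftor, 'o \<Rightarrow> 'b) arrow) cat" where
  "functor_cat C D = \<lparr>ob = {F. is_functor C D F},
     ar = {Arrow F \<tau> G | F \<tau> G. is_functor C D F \<and> is_functor C D G \<and> nat_trans C D F G \<tau> \<and>
             \<tau> \<in> extensional (ob C)},
     src = asrc, tgt = atgt,
     idt = (\<lambda>F. Arrow F (\<lambda>x\<in>ob C. idt D (fob F x)) F),
     cmp = (\<lambda>t s. Arrow (asrc s) (\<lambda>x\<in>ob C. cmp D (body t x) (body s x)) (atgt t))\<rparr>"

definition sieve :: "('o, 'a) cat \<Rightarrow> 'o \<Rightarrow> 'a set \<Rightarrow> bool" where
  "sieve C c R \<longleftrightarrow> R \<subseteq> {f \<in> ar C. tgt C f = c} \<and>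
     (\<forall>f\<in>R. \<forall>g\<in>ar C. tgt C g = src C f \<longrightarrow> cmp C f g \<in> R)"

definition pull_sieve :: "('o, 'a) cat \<Rightarrow> 'a \<Rightarrow> 'a set \<Rightarrow> 'a set" where
  "pull_sieve C h R = {g \<in> ar C. tgt C g = src C h \<and> cmp C h g \<in> R}"

definition grothendieck_topology :: "('o, 'a) cat \<Rightarrow> ('o \<Rightarrow> 'a set set) \<Rightarrow> bool" where
  "grothendieck_topology C J \<longleftrightarrow>
     (\<forall>c\<in>ob C. \<forall>R\<in>J c. sieve C c R) \<and>
     (\<forall>c\<in>ob C. {f \<in> ar C. tgt C f = c} \<in> J c) \<and>
     (\<forall>h\<in>ar C. \<forall>R\<in>J (tgt C h). pull_sieve C h R \<in> J (src C h)) \<and>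
     (\<forall>c\<in>ob C. \<forall>R\<in>J c. \<forall>Q. sieve C c Q \<longrightarrow>
        (\<forall>h\<in>R. pull_sieve C h Q \<in> J (src C h)) \<longrightarrow> Q \<in> J c)"

definition is_sheaf ::
  "('o, 'a) cat \<Rightarrow> ('o \<Rightarrow> 'a set set) \<Rightarrow> ('o, 'a, 's set, 's sarrow) ftor \<Rightarrow> bool" where
  "is_sheaf C J P \<longleftrightarrow>
     (\<forall>c\<in>ob C. \<forall>R\<in>J c. \<forall>x.
        (\<forall>f\<in>R. x f \<in> fob P (src C f)) \<longrightarrow>
        (\<forall>f\<in>R. \<forall>g\<in>ar C. tgt C g = src C f \<longrightarrow> body (far P g) (x f) = x (cmp C f g)) \<longrightarrow>
        (\<exists>!y. y \<in> fob P c \<and> (\<forall>f\<in>R. body (far P f) y = x f)))"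

definition Sh ::
  "'s rel \<Rightarrow> ('o, 'a) cat \<Rightarrow> ('o \<Rightarrow> 'a set set) \<Rightarrow>
   (('o, 'a, 's set, 's sarrow) ftor,
    (('o, 'a, 's set, 's sarrow) ftor, 'o \<Rightarrow> 's sarrow) arrow) cat" where
  "Sh \<kappa> C J = full_subcat (functor_cat (op_cat C) (Sets \<kappa>)) {P. is_sheaf C J P}"

text \<open>As every small set embeds into \<open>'s\<close>, it is no restriction to take the objects and
  arrows of the site from \<open>'s\<close>.\<close>

definition grothendieck_topos :: "'s rel \<Rightarrow> ('o, 'a) cat \<Rightarrow> bool" where
  "grothendieck_topos \<kappa> E \<longleftrightarrow> category E \<and>
     (\<exists>(C :: ('s, 's) cat) J. category C \<and> small \<kappa> (ob C) \<and> small \<kappa> (ar C) \<and>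
        grothendieck_topology C J \<and> equivalent_cats E (Sh \<kappa> C J))"

section \<open>Covers, connected objects, Galois objects\<close>

definition is_cover :: "('o, 'a) cat \<Rightarrow> 'i set \<Rightarrow> ('i \<Rightarrow> 'o) \<Rightarrow> bool" where
  "is_cover E I U \<longleftrightarrow> (\<forall>i\<in>I. U i \<in> ob E) \<and>
     (\<forall>g\<in>ar E. \<forall>h\<in>ar E. src E g = terminal E \<longrightarrow> src E h = terminal E \<longrightarrow> tgt E g = tgt E h \<longrightarrow>
        (\<forall>i\<in>I. cmp E g (bang E (U i)) = cmp E h (bang E (U i))) \<longrightarrow> g = h)"

definition epi :: "('o, 'a) cat \<Rightarrow> 'a \<Rightarrow> bool" where
  "epi E f \<longleftrightarrow> f \<in> ar E \<and>
     (\<forall>g\<in>ar E. \<forall>h\<in>ar E. src E g = tgt E f \<longrightarrow> src E h = tgt E f \<longrightarrow> tgt E g = tgt E h \<longrightarrow>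
        cmp E g f = cmp E h f \<longrightarrow> g = h)"

definition connected_object :: "('o, 'a) cat \<Rightarrow> 'o \<Rightarrow> bool" where
  "connected_object E A \<longleftrightarrow> A \<in> ob E \<and>
     (\<forall>Y inc. is_coproduct E (UNIV :: bool set) Y A inc \<longrightarrow>
        is_initial E (Y True) \<or> is_initial E (Y False))"

definition Aut :: "('o, 'a) cat \<Rightarrow> 'o \<Rightarrow> 'a set" where
  "Aut E A = {f \<in> hom E A A. iso E f}"

text \<open>\<open>\<gamma>\<^sup>*\<close> is only defined on subsets of \<open>'s\<close>, so \<open>Aut E A\<close> enters through a copy \<open>G\<close> of it in
  \<open>Sets \<kappa>\<close>, via a bijection \<open>e\<close>. The canonical morphism \<open>m : A \<times> \<gamma>\<^sup>*G \<rightarrow> A \<times> A\<close>, informally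
  \<open>(a, g) \<mapsto> (a, e g a)\<close>, is the one whose restriction along \<open>A \<times> \<gamma>\<^sup>*{g} \<rightarrow> A \<times> \<gamma>\<^sup>*G\<close> is
  \<open>\<langle>pr1, e g \<circ> pr1\<rangle>\<close> for each \<open>g\<close>; here \<open>\<gamma>\<^sup>*{g}\<close> is terminal and \<open>\<gamma>\<^sup>*G\<close> is the coproduct of the
  \<open>\<gamma>\<^sup>*{g}\<close>, so there is exactly one such \<open>m\<close>.\<close>

definition canonical_action_map ::
  "('o, 'a) cat \<Rightarrow> ('s set, 's sarrow, 'o, 'a) ftor \<Rightarrow> 'o \<Rightarrow> 's set \<Rightarrow> ('s \<Rightarrow> 'a) \<Rightarrow> 'a \<Rightarrow> bool" where
  "canonical_action_map E gup A G e m \<longleftrightarrow>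
     m \<in> hom E (prod_ob E A (fob gup G)) (prod_ob E A A) \<and>
     (\<forall>g\<in>G. cmp E m (prod_map E (idt E A) (far gup (Arrow {g} (\<lambda>x\<in>{g}. x) G))) =
        pairing E (pr1 E A (fob gup {g})) (cmp E (e g) (pr1 E A (fob gup {g}))))"

definition galois_object ::
  "'s rel \<Rightarrow> ('o, 'a) cat \<Rightarrow> ('s set, 's sarrow, 'o, 'a) ftor \<Rightarrow> 'o \<Rightarrow> bool" where
  "galois_object \<kappa> E gup A \<longleftrightarrow>
     \<not> is_initial E A \<and> connected_object E A \<and> epi E (bang E A) \<and>
     (\<exists>G e m. small \<kappa> G \<and> bij_betw e G (Aut E A) \<and>
        canonical_action_map E gup A G e m \<and> iso E m)"

section \<open>Split objects and the push-out topos\<close>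

definition split_object ::
  "'s rel \<Rightarrow> ('o, 'a) cat \<Rightarrow> ('s set, 's sarrow, 'o, 'a) ftor \<Rightarrow> 'i set \<Rightarrow> ('i \<Rightarrow> 'o) \<Rightarrow> 'o \<Rightarrow> bool"
  where
  "split_object \<kappa> E gup I U X \<longleftrightarrow> X \<in> ob E \<and>
     (\<exists>S. \<forall>i\<in>I. small \<kappa> (S i) \<and>
        (\<exists>\<theta> \<in> hom E (prod_ob E (fob gup (S i)) (U i)) (prod_ob E X (U i)).
           iso E \<theta> \<and> cmp E (pr2 E X (U i)) \<theta> = pr2 E (fob gup (S i)) (U i)))"

definition Split ::
  "'s rel \<Rightarrow> ('o, 'a) cat \<Rightarrow> ('s set, 's sarrow, 'o, 'a) ftor \<Rightarrow> 'i set \<Rightarrow> ('i \<Rightarrow> 'o) \<Rightarrow>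
   ('o, 'a) cat" where
  "Split \<kappa> E gup I U = full_subcat E {X. split_object \<kappa> E gup I U X}"

text \<open>For \<open>p : S \<rightarrow> \<gamma>\<^sub>!W\<close> in sets, \<open>rho_ob\<close> is \<open>\<gamma>\<^sup>*S \<times>\<^bsub>\<gamma>\<^sup>*\<gamma>\<^sub>!W\<^esub> W\<close>, the pullback of \<open>\<gamma>\<^sup>*p\<close> along the
  unit \<open>W \<rightarrow> \<gamma>\<^sup>*\<gamma>\<^sub>!W\<close>; \<open>rho_pr\<close> is its projection to \<open>W\<close>, and \<open>rho_map\<close> is the action on a map
  \<open>h\<close> from \<open>p\<close> to \<open>p'\<close> over \<open>\<gamma>\<^sub>!W\<close>.\<close>

definition rho_ob ::
  "('o, 'a) cat \<Rightarrow> ('s set, 's sarrow, 'o, 'a) ftor \<Rightarrow> ('o \<Rightarrow> 'a) \<Rightarrow> 'o \<Rightarrow> 's sarrow \<Rightarrow> 'o" where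
  "rho_ob E gup \<eta> W p = pb_ob E (far gup p) (\<eta> W)"

definition rho_pr ::
  "('o, 'a) cat \<Rightarrow> ('s set, 's sarrow, 'o, 'a) ftor \<Rightarrow> ('o \<Rightarrow> 'a) \<Rightarrow> 'o \<Rightarrow> 's sarrow \<Rightarrow> 'a" where
  "rho_pr E gup \<eta> W p = pb2 E (far gup p) (\<eta> W)"

definition rho_map ::
  "('o, 'a) cat \<Rightarrow> ('s set, 's sarrow, 'o, 'a) ftor \<Rightarrow> ('o \<Rightarrow> 'a) \<Rightarrow> 'o \<Rightarrow>
   's sarrow \<Rightarrow> 's sarrow \<Rightarrow> 's sarrow \<Rightarrow> 'a" where
  "rho_map E gup \<eta> W p p' h =
     (THE k. k \<in> hom E (rho_ob E gup \<eta> W p) (rho_ob E gup \<eta> W p') \<and>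
        cmp E (pb1 E (far gup p') (\<eta> W)) k = cmp E (far gup h) (pb1 E (far gup p) (\<eta> W)) \<and>
        cmp E (rho_pr E gup \<eta> W p') k = rho_pr E gup \<eta> W p)"

text \<open>A triple \<open>\<langle>X, p : S \<rightarrow> \<gamma>\<^sub>!W, \<theta>\<rangle>\<close>; the set \<open>S\<close> is the source of \<open>p\<close>.\<close>

datatype ('o, 'a, 's) triple = Triple (tX: 'o) (tp: "'s sarrow") (tth: 'a)

definition pushout_ob ::
  "'s rel \<Rightarrow> ('o, 'a) cat \<Rightarrow> ('o, 'a, 's set, 's sarrow) ftor \<Rightarrow> ('s set, 's sarrow, 'o, 'a) ftor \<Rightarrow>
   ('o \<Rightarrow> 'a) \<Rightarrow> 'o \<Rightarrow> ('o, 'a, 's) triple set" where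
  "pushout_ob \<kappa> E gsh gup \<eta> W =
     {Triple X p \<theta> | X p \<theta>. X \<in> ob E \<and> p \<in> ar (Sets \<kappa>) \<and> atgt p = fob gsh W \<and>
        \<theta> \<in> hom E (prod_ob E X W) (rho_ob E gup \<eta> W p) \<and> iso E \<theta> \<and>
        cmp E (rho_pr E gup \<eta> W p) \<theta> = pr2 E X W}"

definition pushout_topos ::
  "'s rel \<Rightarrow> ('o, 'a) cat \<Rightarrow> ('o, 'a, 's set, 's sarrow) ftor \<Rightarrow> ('s set, 's sarrow, 'o, 'a) ftor \<Rightarrow>
   ('o \<Rightarrow> 'a) \<Rightarrow> 'o \<Rightarrow>
   (('o, 'a, 's) triple, (('o, 'a, 's) triple, 'a \<times> 's sarrow) arrow) cat" where
  "pushout_topos \<kappa> E gsh gup \<eta> W = \<lparr>ob = pushout_ob \<kappa> E gsh gup \<eta> W,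
     ar = {Arrow T (f, h) T' | T f h T'.
             T \<in> pushout_ob \<kappa> E gsh gup \<eta> W \<and> T' \<in> pushout_ob \<kappa> E gsh gup \<eta> W \<and>
             f \<in> hom E (tX T) (tX T') \<and>
             h \<in> hom (Sets \<kappa>) (asrc (tp T)) (asrc (tp T')) \<and>
             cmp (Sets \<kappa>) (tp T') h = tp T \<and>
             cmp E (tth T') (prod_map E f (idt E W)) =
               cmp E (rho_map E gup \<eta> W (tp T) (tp T') h) (tth T)},
     src = asrc, tgt = atgt,
     idt = (\<lambda>T. Arrow T (idt E (tX T), idt (Sets \<kappa>) (asrc (tp T))) T),
     cmp = (\<lambda>t s. Arrow (asrc s)
        (cmp E (fst (body t)) (fst (body s)), cmp (Sets \<kappa>) (snd (body t)) (snd (body s)))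
        (atgt t))\<rparr>"

text \<open>The inverse image functor \<open>f\<^sub>i\<^sup>*\<close> of the point at \<open>i \<in> \<gamma>\<^sub>!W\<close>.\<close>

definition fibre :: "'s sarrow \<Rightarrow> 's \<Rightarrow> 's set" where
  "fibre p i = {s \<in> asrc p. body p s = i}"

definition fibre_ftor ::
  "'s \<Rightarrow> (('o, 'a, 's) triple, (('o, 'a, 's) triple, 'a \<times> 's sarrow) arrow, 's set, 's sarrow) ftor"
  where
  "fibre_ftor i = \<lparr>fob = (\<lambda>T. fibre (tp T) i),
     far = (\<lambda>t. Arrow (fibre (tp (asrc t)) i)
                      (restrict (body (snd (body t))) (fibre (tp (asrc t)) i))
                      (fibre (tp (atgt t)) i))\<rparr>"

text \<open>\<open>\<phi>\<close> is a natural isomorphism from \<open>[A,-]\<close> to \<open>F\<close>. The hom-sets of \<open>C\<close> need not be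
  subsets of \<open>'s\<close>, hence \<open>[A,-]\<close> is not turned into a functor to \<open>Sets \<kappa>\<close>.\<close>

definition represents ::
  "('o, 'a) cat \<Rightarrow> ('o, 'a, 's set, 's sarrow) ftor \<Rightarrow> 'o \<Rightarrow> bool" where
  "represents C F A \<longleftrightarrow> A \<in> ob C \<and>
     (\<exists>\<phi>. (\<forall>Y\<in>ob C. bij_betw (\<phi> Y) (hom C A Y) (fob F Y)) \<and>
          (\<forall>k\<in>ar C. \<forall>h \<in> hom C A (src C k).
             \<phi> (tgt C k) (cmp C k h) = body (far F k) (\<phi> (src C k) h)))"

end

theory Submission
  imports Defs
begin

text \<open>
  Call \<open>V\<close> connected if \<open>\<gamma>\<^sub>!V\<close> is a point, and let \<open>W\<close> be the coproduct of the cover. The connected objects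
  that map to \<open>W\<close> form a dense subcategory \<open>CC W\<close>, so morphisms of \<open>E\<close> are natural families on it,
  and \<open>X\<close> is split by the cover iff \<open>[-,X]\<close> inverts all morphisms of \<open>CC W\<close>. For such \<open>X\<close> the set \<open>f\<^sub>i\<^sup>*X\<close> is
  \<open>[V\<^sub>0,X]\<close>, where \<open>V\<^sub>0\<close> is the component of \<open>W\<close> at \<open>i\<close>, hence \<open>A\<close> represents \<open>f\<^sub>i\<^sup>*\<close> via some \<open>a : V\<^sub>0 \<rightarrow> A\<close>. Being
  universal in this sense is a property of maps \<open>b : V \<rightarrow> A\<close> that is invariant under \<open>CC W\<close>, so it is
  classified by a map from \<open>A\<close> to the split object \<open>\<gamma>\<^sup>*2\<close>; as \<open>[A,\<gamma>\<^sup>*2] = 2\<close>, this map is constant and every \<open>b\<close> is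
  universal. Consequently every endomorphism of \<open>A\<close> is invertible, \<open>[A,X] \<times> [V,A] = [V,X] \<times> [V,A]\<close> for split
  \<open>X\<close> (with \<open>X = A\<close> the Galois condition, in general splitting by \<open>A\<close>), and since \<open>E\<close> is connected
  every \<open>V\<close> maps to \<open>A\<close>, so that \<open>A\<close> covers and splits no more than \<open>W\<close> does.

  Density needs that joint epimorphisms in \<open>E\<close> are stable and effective; this is checked on sheaves
  and transported to \<open>E\<close>.
\<close>

section \<open>Small sets\<close>

text \<open>The functor \<open>gup\<close> is only defined on small subsets of \<open>'s\<close>,
  and the small sets may be just the finite ones, so large coproducts cannot be taken for granted.
  Hence no coproduct is ever constructed: maps out of an object are glued along jointly epic sets of
  arrows, and effectiveness of such a set produces an arrow, not an object. Representability of the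
  fibre functor says something about maps from \<open>A\<close> to split objects only, so a
  universal map can be cancelled only against split targets. This dictates the two-element constant
  object as classifier: it is split by every cover, and the property it classifies must therefore be
  invariant in both directions. Connectedness of \<open>E\<close> enters through
  \<open>conn_one\<close>; it makes properties that are invariant along maps of \<open>CC W\<close>
  hold for all of \<open>CC W\<close> as soon as they hold once.\<close>

locale univ =
  fixes \<kappa> :: "'s rel"
  assumes univ: "universe \<kappa>"
begin

lemma card_kappa: "Card_order \<kappa>" "cinfinite \<kappa>" "regularCard \<kappa>"
  using univ unfolding universe_def by auto

lemma kappa_le_UNIV: "\<kappa> \<le>o |UNIV :: 's set|"
proof -
  have "\<kappa> =o |Field \<kappa>|" using card_kappa(1) card_of_Field_ordIso ordIso_symmetric by blast
  moreover have "|Field \<kappa>| \<le>o |UNIV :: 's set|" by (rule card_of_mono1) simp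
  ultimately show ?thesis by (rule ordIso_ordLeq_trans)
qed

lemma small_finite:
  assumes "finite X" shows "small \<kappa> X"
  unfolding small_def
proof (rule finite_ordLess_infinite)
  show "Well_order |X|" by (rule card_of_Well_order)
  show "Well_order \<kappa>" using card_kappa(1) by (rule card_order_on_well_order_on)
  show "finite (Field |X| )" using assms by (simp only: Field_card_of)
  show "infinite (Field \<kappa>)" using card_kappa(2) by (simp add: cinfinite_def)
qed

lemma small_inj:
  assumes "small \<kappa> Y" "inj_on f X" "f ` X \<subseteq> Y" shows "small \<kappa> X"
proof -
  have "|X| \<le>o |Y|" using card_of_ordLeq assms(2,3) by blast
  then show ?thesis using assms(1) unfolding small_def by (rule ordLeq_ordLess_trans)
qed

lemma small_subset: "small \<kappa> Y \<Longrightarrow> X \<subseteq> Y \<Longrightarrow> small \<kappa> X"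
  using small_inj[of Y id X] by auto

lemma small_image: "small \<kappa> X \<Longrightarrow> small \<kappa> (f ` X)"
  unfolding small_def using card_of_image ordLeq_ordLess_trans by blast

lemma small_bij: "bij_betw f X Y \<Longrightarrow> small \<kappa> X \<longleftrightarrow> small \<kappa> Y"
  using small_image[of X f] small_inj[of Y f X] unfolding bij_betw_def by auto

lemma small_UN: "small \<kappa> X \<Longrightarrow> (\<And>x. x \<in> X \<Longrightarrow> small \<kappa> (F x)) \<Longrightarrow> small \<kappa> (\<Union>x\<in>X. F x)"
  unfolding small_def using card_kappa
  by (intro card_of_UNION_ordLess_infinite_Field_regularCard) auto

lemma small_Times: 
  assumes "small \<kappa> X" "small \<kappa> Y" shows "small \<kappa> (X \<times> Y)"
proof -
  have "X \<times> Y = (\<Union>x\<in>X. Pair x ` Y)" by auto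
  then show ?thesis using small_UN[OF assms(1)] small_image[OF assms(2)] by metis
qed

lemma small_embed:
  assumes "small \<kappa> X" shows "\<exists>f :: 'x \<Rightarrow> 's. inj_on f X"
proof -
  have "|X| \<le>o |UNIV :: 's set|"
    using assms ordLeq_transitive[OF ordLess_imp_ordLeq kappa_le_UNIV] unfolding small_def by blast
  then show ?thesis using card_of_ordLeq[of X "UNIV :: 's set"] by blast
qed

text \<open>Hom sets of \<open>E\<close> consist of arrows, while \<open>gup\<close> accepts subsets
  of \<open>'s\<close>; the copy \<open>G\<close> is what \<open>gup\<close> is applied to.\<close>

lemma small_copy:
  assumes "small \<kappa> X" shows "\<exists>(G :: 's set) e. small \<kappa> G \<and> bij_betw e G X"
proof -
  obtain f :: "_ \<Rightarrow> 's" where f: "inj_on f X" using small_embed[OF assms] by auto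
  then have "bij_betw (inv_into X f) (f ` X) X" by (simp add: bij_betw_inv_into inj_on_imp_bij_betw)
  then show ?thesis using small_image[OF assms] by blast
qed

text \<open>\<open>universe\<close> bounds the power sets of subsets of \<open>'s\<close> only, so
  \<open>X\<close> is first moved into \<open>'s\<close>.\<close>

lemma small_Pow:
  assumes "small \<kappa> X" shows "small \<kappa> (Pow X)"
proof -
  obtain f :: "_ \<Rightarrow> 's" where f: "inj_on f X" using small_embed[OF assms] by auto
  have "small \<kappa> (Pow (f ` X))"
    using univ small_image[OF assms, of f] unfolding universe_def small_def by auto
  moreover have "inj_on ((`) f) (Pow X)" "((`) f) ` Pow X \<subseteq> Pow (f ` X)"
    using inj_on_image_Pow[OF f] by blast+
  ultimately show ?thesis using small_inj by blast
qed

lemma infinite_UNIV: "infinite (UNIV :: 's set)"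
  using card_kappa(2) finite_subset[OF subset_UNIV] unfolding cinfinite_def by auto

text \<open>The two elements serve as labels: maps to the constant object on \<open>{a, b}\<close>
  separate two alternatives.\<close>

lemma ex_two: "\<exists>a b :: 's. a \<noteq> b"
  using ex_new_if_finite[OF infinite_UNIV, of "{undefined}"] by auto

end

section \<open>Categories\<close>

locale cat =
  fixes E :: "('o, 'a) cat"
  assumes category: "category E"
begin

abbreviation comp (infixr "\<cdot>" 70) where "g \<cdot> f \<equiv> cmp E g f"

lemma ar_ob [simp]: "f \<in> ar E \<Longrightarrow> src E f \<in> ob E" "f \<in> ar E \<Longrightarrow> tgt E f \<in> ob E"
  using category unfolding category_def by auto

lemma idt_simps [simp]:
  "x \<in> ob E \<Longrightarrow> idt E x \<in> ar E" "x \<in> ob E \<Longrightarrow> src E (idt E x) = x" "x \<in> ob E \<Longrightarrow> tgt E (idt E x) = x"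
  using category unfolding category_def hom_def by auto

lemma comp_simps [simp]:
  assumes "f \<in> ar E" "g \<in> ar E" "src E g = tgt E f"
  shows "g \<cdot> f \<in> ar E" "src E (g \<cdot> f) = src E f" "tgt E (g \<cdot> f) = tgt E g"
  using category assms unfolding category_def hom_def by auto

lemma comp_id [simp]:
  "f \<in> ar E \<Longrightarrow> src E f = x \<Longrightarrow> f \<cdot> idt E x = f"
  "f \<in> ar E \<Longrightarrow> tgt E f = x \<Longrightarrow> idt E x \<cdot> f = f"
  using category unfolding category_def by auto

lemma assoc [simp]:
  "f \<in> ar E \<Longrightarrow> g \<in> ar E \<Longrightarrow> h \<in> ar E \<Longrightarrow> src E g = tgt E f \<Longrightarrow> src E h = tgt E g \<Longrightarrow>
     (h \<cdot> g) \<cdot> f = h \<cdot> (g \<cdot> f)"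
  using category unfolding category_def by auto

lemma homD: "f \<in> hom E x y \<Longrightarrow> f \<in> ar E" "f \<in> hom E x y \<Longrightarrow> src E f = x" "f \<in> hom E x y \<Longrightarrow> tgt E f = y"
    "f \<in> hom E x y \<Longrightarrow> x \<in> ob E" "f \<in> hom E x y \<Longrightarrow> y \<in> ob E"
  unfolding hom_def by auto

lemma id_hom: "x \<in> ob E \<Longrightarrow> idt E x \<in> hom E x x"
  unfolding hom_def by auto

lemma comp_hom: "f \<in> hom E x y \<Longrightarrow> g \<in> hom E y z \<Longrightarrow> g \<cdot> f \<in> hom E x z"
  unfolding hom_def by auto

lemma comp_assoc:
  "f \<in> hom E x y \<Longrightarrow> g \<in> hom E y z \<Longrightarrow> h \<in> hom E z w \<Longrightarrow> (h \<cdot> g) \<cdot> f = h \<cdot> (g \<cdot> f)"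
  unfolding hom_def by auto

lemma id_left: "f \<in> hom E x y \<Longrightarrow> idt E y \<cdot> f = f" and id_right: "f \<in> hom E x y \<Longrightarrow> f \<cdot> idt E x = f"
  unfolding hom_def by auto

lemma iso_inverse:
  assumes "iso E f" "f \<in> hom E x y"
  obtains g where "g \<in> hom E y x" "g \<cdot> f = idt E x" "f \<cdot> g = idt E y"
  using assms unfolding iso_def hom_def by auto

lemma isoI: "f \<in> hom E x y \<Longrightarrow> g \<in> hom E y x \<Longrightarrow> g \<cdot> f = idt E x \<Longrightarrow> f \<cdot> g = idt E y \<Longrightarrow> iso E f"
  unfolding iso_def hom_def by auto

lemma iso_epi:
  assumes "iso E f" "f \<in> hom E x y" "g \<in> hom E y z" "h \<in> hom E y z" "g \<cdot> f = h \<cdot> f"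
  shows "g = h"
proof -
  obtain k where k: "k \<in> hom E y x" "k \<cdot> f = idt E x" "f \<cdot> k = idt E y"
    using iso_inverse assms by metis
  have "g = (g \<cdot> f) \<cdot> k" using k assms(2,3) by (simp add: homD)
  also have "\<dots> = h" unfolding assms(5) using k assms(2,4) by (simp add: homD)
  finally show ?thesis .
qed

lemma iso_mono:
  assumes "iso E f" "f \<in> hom E x y" "g \<in> hom E z x" "h \<in> hom E z x" "f \<cdot> g = f \<cdot> h"
  shows "g = h"
proof -
  obtain k where k: "k \<in> hom E y x" "k \<cdot> f = idt E x" "f \<cdot> k = idt E y"
    using iso_inverse assms by metis
  have "g = (k \<cdot> f) \<cdot> g" unfolding k using assms by (simp add: homD)
  also have "\<dots> = k \<cdot> (f \<cdot> h)" using k(1) assms by (simp add: homD)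
  also have "\<dots> = (k \<cdot> f) \<cdot> h" using k(1) assms by (simp add: homD)
  also have "\<dots> = h" unfolding k using assms by (simp add: homD)
  finally show ?thesis .
qed

lemma pullbackI:
  assumes f: "f \<in> hom E x z" and g: "g \<in> hom E y z" and p: "p \<in> hom E P x" and q: "q \<in> hom E P y"
    and comm: "f \<cdot> p = g \<cdot> q"
    and univ: "\<And>V a b. a \<in> hom E V x \<Longrightarrow> b \<in> hom E V y \<Longrightarrow> f \<cdot> a = g \<cdot> b \<Longrightarrow>
       \<exists>!h. h \<in> hom E V P \<and> p \<cdot> h = a \<and> q \<cdot> h = b"
  shows "is_pullback E f g p q"
  unfolding is_pullback_def
proof (intro conjI ballI impI)
  fix a b assume "a \<in> ar E" "b \<in> ar E" "src E a = src E b" "tgt E a = src E f" "tgt E b = src E g" "f \<cdot> a = g \<cdot> b"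
  then show "\<exists>!h. h \<in> hom E (src E a) (src E p) \<and> p \<cdot> h = a \<and> q \<cdot> h = b"
    using univ[of a "src E a" b] f g p by (simp add: hom_def)
qed (use f g p q comm in \<open>simp_all add: hom_def\<close>)

lemma pullbackD:
  assumes pb: "is_pullback E f g p q" and f: "f \<in> hom E x z" and g: "g \<in> hom E y z"
  shows "p \<in> hom E (src E p) x" and "q \<in> hom E (src E p) y" and "f \<cdot> p = g \<cdot> q"
    and "a \<in> hom E V x \<Longrightarrow> b \<in> hom E V y \<Longrightarrow> f \<cdot> a = g \<cdot> b \<Longrightarrow>
       \<exists>!h. h \<in> hom E V (src E p) \<and> p \<cdot> h = a \<and> q \<cdot> h = b"
proof -
  note P = pb[unfolded is_pullback_def]
  show "p \<in> hom E (src E p) x" "q \<in> hom E (src E p) y" "f \<cdot> p = g \<cdot> q"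
    using P f g by (simp_all add: hom_def)
  have "\<forall>a\<in>ar E. \<forall>b\<in>ar E. src E a = src E b \<longrightarrow> tgt E a = src E f \<longrightarrow> tgt E b = src E g \<longrightarrow>
        f \<cdot> a = g \<cdot> b \<longrightarrow> (\<exists>!h. h \<in> hom E (src E a) (src E p) \<and> p \<cdot> h = a \<and> q \<cdot> h = b)"
    using P by (elim conjE) assumption
  from this[rule_format, of a b] show "a \<in> hom E V x \<Longrightarrow> b \<in> hom E V y \<Longrightarrow> f \<cdot> a = g \<cdot> b \<Longrightarrow>
       \<exists>!h. h \<in> hom E V (src E p) \<and> p \<cdot> h = a \<and> q \<cdot> h = b"
    using f g by (simp add: hom_def)
qed

text \<open>\<open>K\<close> is a bare set of arrows without a bound on its size, so it may consist
  of all arrows with some property, such as all maps from connected objects.\<close>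

definition jepi :: "'a set \<Rightarrow> 'o \<Rightarrow> bool" where
  "jepi K X \<longleftrightarrow> X \<in> ob E \<and> (\<forall>k\<in>K. k \<in> ar E \<and> tgt E k = X) \<and>
     (\<forall>Y. \<forall>g\<in>hom E X Y. \<forall>h\<in>hom E X Y. (\<forall>k\<in>K. g \<cdot> k = h \<cdot> k) \<longrightarrow> g = h)"

lemma jepiD:
  "jepi K X \<Longrightarrow> g \<in> hom E X Y \<Longrightarrow> h \<in> hom E X Y \<Longrightarrow> (\<And>k. k \<in> K \<Longrightarrow> g \<cdot> k = h \<cdot> k) \<Longrightarrow> g = h"
  unfolding jepi_def by blast

lemma jepi_ar: "jepi K X \<Longrightarrow> k \<in> K \<Longrightarrow> k \<in> hom E (src E k) X"
  unfolding jepi_def hom_def by auto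

text \<open>This sieve replaces the pullback of the family \<open>K\<close> along \<open>f\<close>.
  It involves no chosen limits and is therefore easy to compare across an equivalence of
  categories.\<close>

definition factoring :: "'a set \<Rightarrow> 'a \<Rightarrow> 'a set" where
  "factoring K f = {g \<in> ar E. tgt E g = src E f \<and> (\<exists>k\<in>K. \<exists>m\<in>hom E (src E g) (src E k). f \<cdot> g = k \<cdot> m)}"

end

text \<open>The properties of a category of sheaves on which the argument rests. Joint epimorphisms are
  stable and effective, both stated without pullbacks or coproducts; the last condition stands in
  for partial map classifiers and makes coproduct injections monic.\<close>

definition topos_like :: "('o, 'a) cat \<Rightarrow> bool" where
  "topos_like E \<longleftrightarrow> category E \<and>
     (\<exists>t. is_terminal E t) \<and>
     (\<forall>f\<in>ar E. \<forall>g\<in>ar E. tgt E f = tgt E g \<longrightarrow> (\<exists>p q. is_pullback E f g p q)) \<and>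
     (\<forall>K X. \<forall>f\<in>ar E. tgt E f = X \<longrightarrow> cat.jepi E K X \<longrightarrow> cat.jepi E (cat.factoring E K f) (src E f)) \<and>
     (\<forall>R X Y. Y \<in> ob E \<longrightarrow> cat.jepi E (fst ` R) X \<longrightarrow>
        (\<forall>(k, y)\<in>R. y \<in> hom E (src E k) Y) \<longrightarrow>
        (\<forall>(k, y)\<in>R. \<forall>(k', y')\<in>R. \<forall>a\<in>ar E. \<forall>b\<in>ar E. tgt E a = src E k \<longrightarrow> tgt E b = src E k' \<longrightarrow>
           src E a = src E b \<longrightarrow> cmp E k a = cmp E k' b \<longrightarrow> cmp E y a = cmp E y' b) \<longrightarrow>
        (\<exists>h\<in>hom E X Y. \<forall>(k, y)\<in>R. cmp E h k = y)) \<and>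
     (\<forall>X\<in>ob E. \<exists>P s. s \<in> hom E X P \<and> (\<forall>t. is_terminal E t \<longrightarrow> hom E t P \<noteq> {}) \<and>
        (\<forall>a\<in>ar E. \<forall>b\<in>ar E. tgt E a = X \<longrightarrow> tgt E b = X \<longrightarrow> src E a = src E b \<longrightarrow>
           cmp E s a = cmp E s b \<longrightarrow> a = b))"

section \<open>The category of sets\<close>

lemma hom_Sets: "t \<in> hom (Sets \<kappa>) S T \<longleftrightarrow> small \<kappa> S \<and> small \<kappa> T \<and> (\<exists>f\<in>S \<rightarrow>\<^sub>E T. t = Arrow S f T)"
  unfolding hom_def Sets_def by auto

lemma ob_Sets [simp]: "S \<in> ob (Sets \<kappa>) \<longleftrightarrow> small \<kappa> S"
  unfolding Sets_def by auto

lemma Sets_sel [simp]: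
  "src (Sets \<kappa>) = asrc" "tgt (Sets \<kappa>) = atgt"
  "cmp (Sets \<kappa>) g f = Arrow (asrc f) (compose (asrc f) (body g) (body f)) (atgt g)"
  "idt (Sets \<kappa>) S = Arrow S (\<lambda>x\<in>S. x) S"
  unfolding Sets_def by auto

lemma ar_Sets: "t \<in> ar (Sets \<kappa>) \<longleftrightarrow> small \<kappa> (asrc t) \<and> small \<kappa> (atgt t) \<and> body t \<in> asrc t \<rightarrow>\<^sub>E atgt t"
  unfolding Sets_def by (cases t) auto

lemma category_Sets: "category (Sets \<kappa>)"
  unfolding category_def hom_def by (auto simp: ar_Sets compose_def PiE_iff restrict_def extensional_def fun_eq_iff
      intro!: arrow.expand split: if_splits)

section \<open>Sheaves, elementwise\<close>

definition res :: "('o, 'a, 's set, 's sarrow) ftor \<Rightarrow> 'a \<Rightarrow> 's \<Rightarrow> 's" where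
  "res P f = body (far P f)"

definition app :: "('x, 'o \<Rightarrow> 's sarrow) arrow \<Rightarrow> 'o \<Rightarrow> 's \<Rightarrow> 's" where
  "app t c = body (body t c)"

locale site = univ \<kappa> + C: cat C for \<kappa> :: "'s rel" and C :: "('s, 's) cat" +
  fixes J :: "'s \<Rightarrow> 's set set"
  assumes small_ob: "small \<kappa> (ob C)" and small_ar: "small \<kappa> (ar C)"
    and topology: "grothendieck_topology C J"
begin

abbreviation "D \<equiv> Sh \<kappa> C J"

lemma J_sieve:
  assumes "c \<in> ob C" "R \<in> J c" "f \<in> R"
  shows "f \<in> ar C" "tgt C f = c" "g \<in> ar C \<Longrightarrow> tgt C g = src C f \<Longrightarrow> cmp C f g \<in> R"
proof -
  have "sieve C c R" using topology assms unfolding grothendieck_topology_def by blast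
  then show "f \<in> ar C" "tgt C f = c" "g \<in> ar C \<Longrightarrow> tgt C g = src C f \<Longrightarrow> cmp C f g \<in> R"
    using assms unfolding sieve_def by auto
qed

lemma J_max: "c \<in> ob C \<Longrightarrow> {f \<in> ar C. tgt C f = c} \<in> J c"
  using topology unfolding grothendieck_topology_def by blast

lemma J_pull: "h \<in> ar C \<Longrightarrow> R \<in> J (tgt C h) \<Longrightarrow> pull_sieve C h R \<in> J (src C h)"
  using topology unfolding grothendieck_topology_def by blast

lemma J_trans: "c \<in> ob C \<Longrightarrow> R \<in> J c \<Longrightarrow> sieve C c Q \<Longrightarrow> (\<And>h. h \<in> R \<Longrightarrow> pull_sieve C h Q \<in> J (src C h)) \<Longrightarrow> Q \<in> J c"
  using topology unfolding grothendieck_topology_def by blast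

text \<open>Along a member of \<open>R\<close> the larger sieve pulls back to the maximal one, so
  the transitivity axiom applies.\<close>

lemma J_mono:
  assumes c: "c \<in> ob C" "R \<in> J c" "sieve C c Q" "R \<subseteq> Q" shows "Q \<in> J c"
proof (rule J_trans[OF c(1,2,3)])
  fix h assume h: "h \<in> R"
  then have hh: "h \<in> ar C" "tgt C h = c" using J_sieve c by blast+
  have "pull_sieve C h Q = {f \<in> ar C. tgt C f = src C h}"
    using h c(3,4) unfolding pull_sieve_def sieve_def by auto
  then show "pull_sieve C h Q \<in> J (src C h)" using J_max hh by auto
qed

text \<open>Sheaf data with values in any type; by \<open>shdata_ob\<close> below an injection into \<open>'s\<close> turns them into
  an object of \<open>Sh\<close>.\<close>

definition shdata :: "('s \<Rightarrow> 't set) \<Rightarrow> ('s \<Rightarrow> 't \<Rightarrow> 't) \<Rightarrow> bool" where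
  "shdata X \<rho> \<longleftrightarrow>
     (\<forall>f\<in>ar C. \<forall>x\<in>X (tgt C f). \<rho> f x \<in> X (src C f)) \<and>
     (\<forall>c\<in>ob C. \<forall>x\<in>X c. \<rho> (idt C c) x = x) \<and>
     (\<forall>f\<in>ar C. \<forall>g\<in>ar C. tgt C g = src C f \<longrightarrow> (\<forall>x\<in>X (tgt C f). \<rho> (cmp C f g) x = \<rho> g (\<rho> f x))) \<and>
     (\<forall>c\<in>ob C. \<forall>R\<in>J c. \<forall>x. (\<forall>f\<in>R. x f \<in> X (src C f)) \<longrightarrow>
        (\<forall>f\<in>R. \<forall>g\<in>ar C. tgt C g = src C f \<longrightarrow> \<rho> g (x f) = x (cmp C f g)) \<longrightarrow>
        (\<exists>!y. y \<in> X c \<and> (\<forall>f\<in>R. \<rho> f y = x f)))"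

lemma shdataD:
  assumes "shdata X \<rho>"
  shows "f \<in> ar C \<Longrightarrow> x \<in> X (tgt C f) \<Longrightarrow> \<rho> f x \<in> X (src C f)"
    and "c \<in> ob C \<Longrightarrow> x \<in> X c \<Longrightarrow> \<rho> (idt C c) x = x"
    and "f \<in> ar C \<Longrightarrow> g \<in> ar C \<Longrightarrow> tgt C g = src C f \<Longrightarrow> x \<in> X (tgt C f) \<Longrightarrow> \<rho> (cmp C f g) x = \<rho> g (\<rho> f x)"
    and "c \<in> ob C \<Longrightarrow> R \<in> J c \<Longrightarrow> \<forall>f\<in>R. x' f \<in> X (src C f) \<Longrightarrow>
        \<forall>f\<in>R. \<forall>g\<in>ar C. tgt C g = src C f \<longrightarrow> \<rho> g (x' f) = x' (cmp C f g) \<Longrightarrow>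
        \<exists>!y. y \<in> X c \<and> (\<forall>f\<in>R. \<rho> f y = x' f)"
  using assms unfolding shdata_def by simp_all

lemma ob_D: "P \<in> ob D \<longleftrightarrow> is_functor (op_cat C) (Sets \<kappa>) P \<and> is_sheaf C J P"
  unfolding Sh_def full_subcat_def functor_cat_def by auto

lemma ob_D_shdata:
  assumes "P \<in> ob D" shows "shdata (fob P) (res P)"
proof -
  have F: "is_functor (op_cat C) (Sets \<kappa>) P" and S: "is_sheaf C J P" using assms ob_D by auto
  have far: "\<And>f. f \<in> ar C \<Longrightarrow> far P f \<in> hom (Sets \<kappa>) (fob P (tgt C f)) (fob P (src C f))"
    using F unfolding is_functor_def op_cat_def by auto
  have idt: "\<And>c. c \<in> ob C \<Longrightarrow> far P (idt C c) = Arrow (fob P c) (\<lambda>x\<in>fob P c. x) (fob P c)"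
    using F unfolding is_functor_def op_cat_def by auto
  have cmp: "\<And>f g. f \<in> ar C \<Longrightarrow> g \<in> ar C \<Longrightarrow> tgt C g = src C f \<Longrightarrow> far P (cmp C f g) = cmp (Sets \<kappa>) (far P g) (far P f)"
    using F unfolding is_functor_def op_cat_def by auto
  show ?thesis unfolding shdata_def res_def
  proof (intro conjI ballI allI impI)
    fix f x assume "f \<in> ar C" "x \<in> fob P (tgt C f)"
    then show "body (far P f) x \<in> fob P (src C f)" using far unfolding hom_Sets by fastforce
  next
    fix c x assume "c \<in> ob C" "x \<in> fob P c"
    then show "body (far P (idt C c)) x = x" using idt by auto
  next
    fix f g x assume *: "f \<in> ar C" "g \<in> ar C" "tgt C g = src C f" "x \<in> fob P (tgt C f)"
    then have "asrc (far P f) = fob P (tgt C f)" using far unfolding hom_Sets by fastforce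
    then show "body (far P (cmp C f g)) x = body (far P g) (body (far P f) x)"
      using * cmp[OF *(1-3)] by (simp add: compose_def)
  next
    fix c R x assume "c \<in> ob C" "R \<in> J c" "\<forall>f\<in>R. x f \<in> fob P (src C f)"
      "\<forall>f\<in>R. \<forall>g\<in>ar C. tgt C g = src C f \<longrightarrow> body (far P g) (x f) = x (cmp C f g)"
    then show "\<exists>!y. y \<in> fob P c \<and> (\<forall>f\<in>R. body (far P f) y = x f)"
      using S unfolding is_sheaf_def by blast
  qed
qed

lemma res_in: "P \<in> ob D \<Longrightarrow> f \<in> ar C \<Longrightarrow> tgt C f = c \<Longrightarrow> src C f = d \<Longrightarrow> x \<in> fob P c \<Longrightarrow> res P f x \<in> fob P d"
  using shdataD(1)[OF ob_D_shdata] by blast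

lemma res_id: "P \<in> ob D \<Longrightarrow> c \<in> ob C \<Longrightarrow> x \<in> fob P c \<Longrightarrow> res P (idt C c) x = x"
  by (rule shdataD(2)[OF ob_D_shdata])

lemma res_comp: "P \<in> ob D \<Longrightarrow> f \<in> ar C \<Longrightarrow> g \<in> ar C \<Longrightarrow> tgt C g = src C f \<Longrightarrow> x \<in> fob P (tgt C f) \<Longrightarrow>
    res P (cmp C f g) x = res P g (res P f x)"
  by (rule shdataD(3)[OF ob_D_shdata])

lemma glue:
  assumes "P \<in> ob D" "c \<in> ob C" "R \<in> J c" "\<And>f. f \<in> R \<Longrightarrow> x f \<in> fob P (src C f)"
    "\<And>f g. f \<in> R \<Longrightarrow> g \<in> ar C \<Longrightarrow> tgt C g = src C f \<Longrightarrow> res P g (x f) = x (cmp C f g)"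
  shows "\<exists>!y. y \<in> fob P c \<and> (\<forall>f\<in>R. res P f y = x f)"
  by (rule shdataD(4)[OF ob_D_shdata[OF assms(1)] assms(2,3)]) (simp_all add: assms(4,5))

text \<open>The uniqueness half of the sheaf condition, for the matching family of restrictions of
  \<open>y\<close>.\<close>

lemma separated:
  assumes P: "P \<in> ob D" "c \<in> ob C" "R \<in> J c" "y \<in> fob P c" "z \<in> fob P c" and
    eq: "\<And>f. f \<in> R \<Longrightarrow> res P f y = res P f z"
  shows "y = z"
proof -
  have "\<exists>!y'. y' \<in> fob P c \<and> (\<forall>f\<in>R. res P f y' = res P f y)"
    by (rule glue) (use P J_sieve res_in res_comp in \<open>auto\<close>)
  then show ?thesis using P eq by metis
qed

lemma small_fob: "P \<in> ob D \<Longrightarrow> c \<in> ob C \<Longrightarrow> small \<kappa> (fob P c)"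
  unfolding ob_D is_functor_def op_cat_def by auto

lemma shdata_ob:
  assumes X: "shdata X \<rho>" and sm: "\<And>c. c \<in> ob C \<Longrightarrow> small \<kappa> (X c)" and enc: "inj_on enc (\<Union>c\<in>ob C. X c)"
  shows "\<exists>P\<in>ob D. (\<forall>c\<in>ob C. fob P c = enc ` X c) \<and>
     (\<forall>f\<in>ar C. \<forall>x\<in>X (tgt C f). res P f (enc x) = enc (\<rho> f x))"
proof -
  define dec where "dec = inv_into (\<Union>c\<in>ob C. X c) enc"
  have dec: "dec (enc x) = x" if "c \<in> ob C" "x \<in> X c" for c x
    unfolding dec_def by (rule inv_into_f_f[OF enc]) (use that in auto)
  have enc_eq: "enc x = enc y \<longleftrightarrow> x = y" if "c \<in> ob C" "x \<in> X c" "y \<in> X c" for c x y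
    using dec that by metis
  have X1: "\<And>f x. f\<in>ar C \<Longrightarrow> x\<in>X (tgt C f) \<Longrightarrow> \<rho> f x \<in> X (src C f)"
    and X2: "\<And>c x. c\<in>ob C \<Longrightarrow> x\<in>X c \<Longrightarrow> \<rho> (idt C c) x = x"
    and X3: "\<And>f g x. f\<in>ar C \<Longrightarrow> g\<in>ar C \<Longrightarrow> tgt C g = src C f \<Longrightarrow> x\<in>X (tgt C f) \<Longrightarrow> \<rho> (cmp C f g) x = \<rho> g (\<rho> f x)"
    by (fact shdataD(1)[OF X], fact shdataD(2)[OF X], fact shdataD(3)[OF X])
  define P :: "('s, 's, 's set, 's sarrow) ftor" where
    "P = \<lparr>fob = (\<lambda>c. enc ` X c), far = (\<lambda>f. Arrow (enc ` X (tgt C f)) (\<lambda>y\<in>enc ` X (tgt C f). enc (\<rho> f (dec y))) (enc ` X (src C f)))\<rparr>"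
  have fob: "fob P c = enc ` X c" for c unfolding P_def by simp
  have r: "body (far P f) (enc x) = enc (\<rho> f x)" if "f \<in> ar C" "x \<in> X (tgt C f)" for f x
    using that dec[of "tgt C f" x] unfolding P_def by auto
  have "is_functor (op_cat C) (Sets \<kappa>) P"
    unfolding is_functor_def
  proof (intro conjI ballI impI)
    fix c assume "c \<in> ob (op_cat C)"
    then show "fob P c \<in> ob (Sets \<kappa>)" using sm small_image unfolding op_cat_def P_def by auto
  next
    fix f assume "f \<in> ar (op_cat C)"
    then have f: "f \<in> ar C" by (simp add: op_cat_def)
    then show "far P f \<in> hom (Sets \<kappa>) (fob P (src (op_cat C) f)) (fob P (tgt (op_cat C) f))"
      using X1[OF f] dec[of "tgt C f"] by (auto simp: hom_Sets op_cat_def P_def intro!: small_image sm)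
  next
    fix c assume "c \<in> ob (op_cat C)"
    then have c: "c \<in> ob C" by (simp add: op_cat_def)
    then show "far P (idt (op_cat C) c) = idt (Sets \<kappa>) (fob P c)"
      unfolding op_cat_def P_def by (auto simp: dec X2 restrict_def fun_eq_iff)
  next
    fix f g assume *: "f \<in> ar (op_cat C)" "g \<in> ar (op_cat C)" "src (op_cat C) g = tgt (op_cat C) f"
    then have fg: "f \<in> ar C" "g \<in> ar C" "tgt C g = src C f" by (auto simp: op_cat_def)
    then show "far P (cmp (op_cat C) g f) = cmp (Sets \<kappa>) (far P g) (far P f)"
      unfolding op_cat_def P_def using dec[of "tgt C f"] dec[of "tgt C g"]
      by (auto simp: X1 X3 enc_eq[of "src C f"] compose_def restrict_def fun_eq_iff)
  qed
  moreover have "is_sheaf C J P"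
    unfolding is_sheaf_def
  proof (intro ballI allI impI)
    fix c R x assume c: "c \<in> ob C" "R \<in> J c" and x: "\<forall>f\<in>R. x f \<in> fob P (src C f)"
      "\<forall>f\<in>R. \<forall>g\<in>ar C. tgt C g = src C f \<longrightarrow> body (far P g) (x f) = x (cmp C f g)"
    have x': "dec (x f) \<in> X (src C f)" "enc (dec (x f)) = x f" if "f \<in> R" for f
      using x(1) that J_sieve[OF c that] dec unfolding fob by force+
    have "\<rho> g (dec (x f)) = dec (x (cmp C f g))" if "f \<in> R" "g \<in> ar C" "tgt C g = src C f" for f g
    proof -
      have "enc (\<rho> g (dec (x f))) = x (cmp C f g)" using r[of g "dec (x f)"] x' x that by auto
      then show ?thesis using dec[of "src C g" "\<rho> g (dec (x f))"] that x' X1 by auto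
    qed
    then have "\<exists>!y. y \<in> X c \<and> (\<forall>f\<in>R. \<rho> f y = dec (x f))"
      by (intro shdataD(4)[OF X c]) (use x' in auto)
    then obtain y where y: "y \<in> X c" "\<forall>f\<in>R. \<rho> f y = dec (x f)"
      and u: "\<And>z. z \<in> X c \<Longrightarrow> \<forall>f\<in>R. \<rho> f z = dec (x f) \<Longrightarrow> z = y" by blast
    show "\<exists>!y. y \<in> fob P c \<and> (\<forall>f\<in>R. body (far P f) y = x f)"
    proof (rule ex1I[of _ "enc y"])
      show "enc y \<in> fob P c \<and> (\<forall>f\<in>R. body (far P f) (enc y) = x f)"
        using y r x' J_sieve[OF c] fob by auto
      fix w assume w: "w \<in> fob P c \<and> (\<forall>f\<in>R. body (far P f) w = x f)"
      then obtain z where z: "z \<in> X c" "w = enc z" using fob by auto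
      have "\<rho> f z = dec (x f)" if "f \<in> R" for f
        using w that z r J_sieve[OF c that] dec[of "src C f" "\<rho> f z"] X1 by force
      then show "w = enc y" using u z by blast
    qed
  qed
  ultimately have "P \<in> ob D" using ob_D by blast
  then show ?thesis using fob r unfolding res_def by blast
qed

lemma hom_D: "t \<in> hom D P Q \<longleftrightarrow> P \<in> ob D \<and> Q \<in> ob D \<and>
    (\<exists>\<tau>. t = Arrow P \<tau> Q \<and> nat_trans (op_cat C) (Sets \<kappa>) P Q \<tau> \<and> \<tau> \<in> extensional (ob C))"
  unfolding hom_def ob_D unfolding Sh_def full_subcat_def functor_cat_def op_cat_def by auto

lemma sel_D [simp]: "src D = asrc" "tgt D = atgt"
  unfolding Sh_def full_subcat_def functor_cat_def by auto

lemma ar_D: "t \<in> ar D \<longleftrightarrow> t \<in> hom D (asrc t) (atgt t)"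
  unfolding hom_def by simp

lemma hom_D_comp:
  assumes "t \<in> hom D P Q" "c \<in> ob C"
  shows "body t c = Arrow (fob P c) (body (body t c)) (fob Q c)" "body (body t c) \<in> fob P c \<rightarrow>\<^sub>E fob Q c"
proof -
  have "body t c \<in> hom (Sets \<kappa>) (fob P c) (fob Q c)"
    using assms unfolding hom_D nat_trans_def op_cat_def by auto
  then show "body t c = Arrow (fob P c) (body (body t c)) (fob Q c)" "body (body t c) \<in> fob P c \<rightarrow>\<^sub>E fob Q c"
    unfolding hom_Sets by auto
qed

lemma app_in: "t \<in> hom D P Q \<Longrightarrow> c \<in> ob C \<Longrightarrow> x \<in> fob P c \<Longrightarrow> app t c x \<in> fob Q c"
  using hom_D_comp(2)[of t P Q c] unfolding app_def by auto

lemma app_nat: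
  assumes t: "t \<in> hom D P Q" and f: "f \<in> ar C" "src C f = d" "tgt C f = c" and x: "x \<in> fob P c"
  shows "app t d (res P f x) = res Q f (app t c x)"
proof -
  have N: "cmp (Sets \<kappa>) (body t (src C f)) (far P f) = cmp (Sets \<kappa>) (far Q f) (body t (tgt C f))"
    using t f unfolding hom_D nat_trans_def op_cat_def by auto
  have PQ: "P \<in> ob D" "Q \<in> ob D" using t hom_D by auto
  then have far: "asrc (far P f) = fob P (tgt C f)" "asrc (body t (tgt C f)) = fob P (tgt C f)"
    using f hom_D_comp(1)[OF t, of "tgt C f"] unfolding ob_D is_functor_def op_cat_def hom_Sets
    by (fastforce, metis C.ar_ob(2) arrow.sel(1))
  have "compose (fob P (tgt C f)) (body (body t (src C f))) (body (far P f)) x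
     = compose (fob P (tgt C f)) (body (far Q f)) (body (body t (tgt C f))) x"
    using N far by simp
  then show ?thesis using x f unfolding app_def res_def by (simp add: compose_def)
qed

lemma hom_D_ext:
  assumes "t \<in> hom D P Q" "t' \<in> hom D P Q" "\<And>c x. c \<in> ob C \<Longrightarrow> x \<in> fob P c \<Longrightarrow> app t c x = app t' c x"
  shows "t = t'"
proof -
  have "body t c = body t' c" for c
  proof (cases "c \<in> ob C")
    case True
    have "body (body t c) = body (body t' c)"
      using hom_D_comp(2)[OF assms(1) True] hom_D_comp(2)[OF assms(2) True] assms(3)[OF True]
      unfolding app_def by (auto intro: PiE_ext)
    then show ?thesis using hom_D_comp(1)[OF assms(1) True] hom_D_comp(1)[OF assms(2) True] by metis
  next
    case False
    then show ?thesis using assms unfolding hom_D by (auto simp: extensional_def)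
  qed
  then show ?thesis using assms unfolding hom_D by auto
qed

text \<open>Together with \<open>hom_D_ext\<close> this allows morphisms of sheaves to be treated as
  natural families of functions, accessed through \<open>app\<close>.\<close>

lemma mk_hom_D:
  assumes PQ: "P \<in> ob D" "Q \<in> ob D" and \<phi>: "\<And>c x. c \<in> ob C \<Longrightarrow> x \<in> fob P c \<Longrightarrow> \<phi> c x \<in> fob Q c"
    and nat: "\<And>f x. f \<in> ar C \<Longrightarrow> x \<in> fob P (tgt C f) \<Longrightarrow> \<phi> (src C f) (res P f x) = res Q f (\<phi> (tgt C f) x)"
  shows "\<exists>t\<in>hom D P Q. \<forall>c\<in>ob C. \<forall>x\<in>fob P c. app t c x = \<phi> c x"
proof -
  define t where "t = Arrow P (\<lambda>c\<in>ob C. Arrow (fob P c) (restrict (\<phi> c) (fob P c)) (fob Q c)) Q"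
  have far: "\<exists>p\<in>fob P (tgt C f) \<rightarrow>\<^sub>E fob P (src C f). far P f = Arrow (fob P (tgt C f)) p (fob P (src C f))"
    "\<exists>p\<in>fob Q (tgt C f) \<rightarrow>\<^sub>E fob Q (src C f). far Q f = Arrow (fob Q (tgt C f)) p (fob Q (src C f))"
    if "f \<in> ar C" for f
    using PQ that unfolding ob_D is_functor_def op_cat_def hom_Sets by auto
  have "t \<in> hom D P Q" unfolding hom_D nat_trans_def
  proof (intro conjI exI[of _ "body t"] ballI)
    show "P \<in> ob D" "Q \<in> ob D" by fact+
    show "t = Arrow P (body t) Q" "body t \<in> extensional (ob C)" unfolding t_def by auto
    fix c assume "c \<in> ob (op_cat C)"
    then show "body t c \<in> hom (Sets \<kappa>) (fob P c) (fob Q c)"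
      using small_fob PQ \<phi> unfolding t_def hom_Sets op_cat_def by auto
  next
    fix f assume "f \<in> ar (op_cat C)"
    then have f: "f \<in> ar C" unfolding op_cat_def by simp
    then show "cmp (Sets \<kappa>) (body t (tgt (op_cat C) f)) (far P f) =
         cmp (Sets \<kappa>) (far Q f) (body t (src (op_cat C) f))"
      using far[OF f] nat[OF f] \<phi>[of "tgt C f"] unfolding op_cat_def t_def res_def
      by (auto simp: compose_def fun_eq_iff restrict_def PiE_iff)
  qed
  then show ?thesis unfolding app_def t_def by (intro bexI) auto
qed

lemma cmp_D:
  assumes "s \<in> hom D P Q" "t \<in> hom D Q R"
  shows "cmp D t s \<in> hom D P R" "c \<in> ob C \<Longrightarrow> x \<in> fob P c \<Longrightarrow> app (cmp D t s) c x = app t c (app s c x)"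
proof -
  have PQ: "P \<in> ob D" "R \<in> ob D" using assms hom_D by auto
  \<comment> \<open>The composite is first built elementwise, where naturality is immediate, and is
    then identified with \<open>cmp D t s\<close> component by component.\<close>
  have "\<exists>u\<in>hom D P R. \<forall>c\<in>ob C. \<forall>x\<in>fob P c. app u c x = app t c (app s c x)"
    by (intro mk_hom_D PQ)
      (simp_all add: app_in[OF assms(1)] app_in[OF assms(2)] app_nat[OF assms(1)] app_nat[OF assms(2)])
  then obtain u where u: "u \<in> hom D P R" "\<And>c x. c\<in>ob C \<Longrightarrow> x\<in>fob P c \<Longrightarrow> app u c x = app t c (app s c x)" by blast
  have c: "cmp D t s = Arrow P (\<lambda>c\<in>ob C. cmp (Sets \<kappa>) (body t c) (body s c)) R"
    using assms unfolding hom_D unfolding Sh_def full_subcat_def functor_cat_def op_cat_def by auto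
  have "u = cmp D t s"
  proof -
    have "body u c = (\<lambda>c\<in>ob C. cmp (Sets \<kappa>) (body t c) (body s c)) c" for c
    proof (cases "c \<in> ob C")
      case True
      have "body u c = Arrow (fob P c) (body (body u c)) (fob R c)" using hom_D_comp(1)[OF u(1) True] .
      moreover have "body s c = Arrow (fob P c) (body (body s c)) (fob Q c)" using hom_D_comp(1)[OF assms(1) True] .
      moreover have "body t c = Arrow (fob Q c) (body (body t c)) (fob R c)" using hom_D_comp(1)[OF assms(2) True] .
      moreover have "body (body u c) = compose (fob P c) (body (body t c)) (body (body s c))"
        using hom_D_comp(2)[OF u(1) True] u(2)[OF True] unfolding app_def
        by (auto simp: compose_def fun_eq_iff restrict_def PiE_iff extensional_def)
      ultimately show ?thesis using True by (metis (no_types, lifting) Sets_sel(3) arrow.sel(1,3) restrict_apply')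
    next
      case False
      then show ?thesis using u(1) unfolding hom_D by (auto simp: extensional_def)
    qed
    then have "body u = (\<lambda>c\<in>ob C. cmp (Sets \<kappa>) (body t c) (body s c))" by blast
    then show ?thesis using c u(1) unfolding hom_D by auto
  qed
  then show "cmp D t s \<in> hom D P R" "c \<in> ob C \<Longrightarrow> x \<in> fob P c \<Longrightarrow> app (cmp D t s) c x = app t c (app s c x)"
    using u by auto
qed

lemma idt_D:
  assumes P: "P \<in> ob D"
  shows "idt D P \<in> hom D P P" "c \<in> ob C \<Longrightarrow> x \<in> fob P c \<Longrightarrow> app (idt D P) c x = x"
proof -
  have i: "idt D P = Arrow P (\<lambda>c\<in>ob C. Arrow (fob P c) (\<lambda>x\<in>fob P c. x) (fob P c)) P"
    unfolding Sh_def full_subcat_def functor_cat_def op_cat_def by auto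
  obtain u where u: "u \<in> hom D P P" "\<And>c x. c\<in>ob C \<Longrightarrow> x\<in>fob P c \<Longrightarrow> app u c x = x"
    using mk_hom_D[OF P P, of "\<lambda>c x. x"] by auto
  have "body u c = (\<lambda>c\<in>ob C. Arrow (fob P c) (\<lambda>x\<in>fob P c. x) (fob P c)) c" for c
  proof (cases "c \<in> ob C")
    case True
    have "body (body u c) = (\<lambda>x\<in>fob P c. x)"
      using hom_D_comp(2)[OF u(1) True] u(2)[OF True] unfolding app_def
      by (auto simp: fun_eq_iff restrict_def PiE_iff extensional_def)
    then show ?thesis using True hom_D_comp(1)[OF u(1) True] by simp
  next
    case False
    then show ?thesis using u(1) unfolding hom_D by (auto simp: extensional_def)
  qed
  then have "body u = (\<lambda>c\<in>ob C. Arrow (fob P c) (\<lambda>x\<in>fob P c. x) (fob P c))" by blast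
  then have "u = idt D P" using i u(1) unfolding hom_D by auto
  then show "idt D P \<in> hom D P P" "c \<in> ob C \<Longrightarrow> x \<in> fob P c \<Longrightarrow> app (idt D P) c x = x" using u by auto
qed

lemma category_D: "category D"
  unfolding category_def
proof (intro conjI ballI impI)
  fix f assume "f \<in> ar D"
  then have f: "f \<in> hom D (asrc f) (atgt f)" by (simp add: ar_D)
  then have o: "asrc f \<in> ob D" "atgt f \<in> ob D" using hom_D by auto
  then show "src D f \<in> ob D" "tgt D f \<in> ob D" by simp_all
  have "cmp D f (idt D (asrc f)) = f"
    by (rule hom_D_ext[OF cmp_D(1)[OF idt_D(1)[OF o(1)] f] f])
      (auto simp: cmp_D(2)[OF idt_D(1)[OF o(1)] f] idt_D(2) o)
  then show "cmp D f (idt D (src D f)) = f" by simp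
  have "cmp D (idt D (atgt f)) f = f"
    by (rule hom_D_ext[OF cmp_D(1)[OF f idt_D(1)[OF o(2)]] f])
      (auto simp: cmp_D(2)[OF f idt_D(1)[OF o(2)]] idt_D(2) o app_in[OF f])
  then show "cmp D (idt D (tgt D f)) f = f" by simp
next
  fix P assume "P \<in> ob D" then show "idt D P \<in> hom D P P" by (rule idt_D)
next
  fix f g assume "f \<in> ar D" "g \<in> ar D" "src D g = tgt D f"
  then show "cmp D g f \<in> hom D (src D f) (tgt D g)"
    using cmp_D(1)[of f "asrc f" "atgt f" g "atgt g"] by (auto simp: ar_D)
next
  fix f g h assume "f \<in> ar D" "g \<in> ar D" "h \<in> ar D" "src D g = tgt D f" "src D h = tgt D g"
  then have f: "f \<in> hom D (asrc f) (asrc g)" and g: "g \<in> hom D (asrc g) (asrc h)" and h: "h \<in> hom D (asrc h) (atgt h)"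
    by (auto simp: ar_D)
  note gf = cmp_D(1)[OF f g] note hg = cmp_D(1)[OF g h]
  show "cmp D h (cmp D g f) = cmp D (cmp D h g) f"
    by (rule hom_D_ext[OF cmp_D(1)[OF gf h] cmp_D(1)[OF f hg]])
     (simp add: cmp_D(2)[OF gf h] cmp_D(2)[OF f hg] cmp_D(2)[OF f g] cmp_D(2)[OF g h] app_in[OF f])
qed

end

section \<open>Sheaves form a topos-like category\<close>

context site begin

sublocale D: cat D by unfold_locales (rule category_D)

lemma hom_D_ob: "t \<in> hom D P Q \<Longrightarrow> P \<in> ob D" "t \<in> hom D P Q \<Longrightarrow> Q \<in> ob D"
  using hom_D by auto

lemma small_total: "P \<in> ob D \<Longrightarrow> small \<kappa> (\<Union>c\<in>ob C. fob P c)"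
  by (intro small_UN small_ob small_fob)

section \<open>Finite limits of sheaves\<close>

lemma terminal_D: "\<exists>t. is_terminal D t"
proof -
  obtain s :: 's where True by simp
  have "shdata (\<lambda>c. {s}) (\<lambda>f x. x)" unfolding shdata_def by auto
  then obtain P where P: "P \<in> ob D" "\<And>c. c \<in> ob C \<Longrightarrow> fob P c = {s}"
    using shdata_ob[of "\<lambda>c. {s}" "\<lambda>f x. x" id] small_finite[of "{s}"] by auto
  have r: "res P f s = s" if "f \<in> ar C" for f
    using that res_in[OF P(1) that refl refl, of s] P(2) by auto
  have "\<exists>!f. f \<in> hom D X P" if X: "X \<in> ob D" for X
  proof -
    have "\<exists>t\<in>hom D X P. \<forall>c\<in>ob C. \<forall>x\<in>fob X c. app t c x = s"
      by (intro mk_hom_D X P) (use P r in auto)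
    then obtain t where "t \<in> hom D X P" by auto
    moreover have "t = t'" if "t \<in> hom D X P" "t' \<in> hom D X P" for t t'
      using hom_D_ext[OF that] app_in[OF that(1)] app_in[OF that(2)] P(2) by auto
    ultimately show ?thesis by blast
  qed
  then show ?thesis using P unfolding is_terminal_def by blast
qed

text \<open>Pullbacks of sheaves are computed pointwise, as sets of pairs encoded in
  \<open>'s\<close>. The last clause keeps this description: the universal property speaks of
  arrows, while the later arguments have to produce elements of the pullback.\<close>

lemma ex_pullback_D:
  assumes f: "f \<in> hom D X Z" and g: "g \<in> hom D Y Z"
  shows "\<exists>P p q. p \<in> hom D P X \<and> q \<in> hom D P Y \<and> is_pullback D f g p q \<and>
    (\<forall>c\<in>ob C. \<forall>x\<in>fob X c. \<forall>y\<in>fob Y c. app f c x = app g c y \<longrightarrow>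
       (\<exists>e\<in>fob P c. app p c e = x \<and> app q c e = y))"
proof -
  note X = hom_D_ob(1)[OF f] note Z = hom_D_ob(2)[OF f] note Y = hom_D_ob(1)[OF g]
  define W where "W c = {w. fst w \<in> fob X c \<and> snd w \<in> fob Y c \<and> app f c (fst w) = app g c (snd w)}" for c
  define \<rho> where "\<rho> h w = (res X h (fst w), res Y h (snd w))" for h w
  have W: "shdata W \<rho>"
    unfolding shdata_def
  proof (intro conjI ballI allI impI)
    fix h x assume "h \<in> ar C" "x \<in> W (tgt C h)"
    then show "\<rho> h x \<in> W (src C h)" unfolding W_def \<rho>_def using X Y
      by (auto simp: app_nat[OF f] app_nat[OF g] intro: res_in)
  next
    fix c x assume "c \<in> ob C" "x \<in> W c"
    then show "\<rho> (idt C c) x = x" unfolding W_def \<rho>_def using X Y by (auto simp: res_id)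
  next
    fix h k x assume "h \<in> ar C" "k \<in> ar C" "tgt C k = src C h" "x \<in> W (tgt C h)"
    then show "\<rho> (C.comp h k) x = \<rho> k (\<rho> h x)" unfolding W_def \<rho>_def using X Y by (auto simp: res_comp)
  next
    fix c R x assume c: "c \<in> ob C" "R \<in> J c" and x: "\<forall>f\<in>R. x f \<in> W (src C f)"
      and cmp: "\<forall>f\<in>R. \<forall>g\<in>ar C. tgt C g = src C f \<longrightarrow> \<rho> g (x f) = x (C.comp f g)"
    have "\<exists>!u. u \<in> fob X c \<and> (\<forall>f\<in>R. res X f u = fst (x f))"
      by (intro glue X c) (use x in \<open>auto simp: W_def \<rho>_def cmp[rule_format, symmetric]\<close>)
    then obtain u where u: "u \<in> fob X c" "\<And>f. f \<in> R \<Longrightarrow> res X f u = fst (x f)" by blast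
    have "\<exists>!v. v \<in> fob Y c \<and> (\<forall>f\<in>R. res Y f v = snd (x f))"
      by (intro glue Y c) (use x in \<open>auto simp: W_def \<rho>_def cmp[rule_format, symmetric]\<close>)
    then obtain v where v: "v \<in> fob Y c" "\<And>f. f \<in> R \<Longrightarrow> res Y f v = snd (x f)" by blast
    \<comment> \<open>The glued elements \<open>u\<close> and \<open>v\<close> have equal images on
      the covering sieve \<open>R\<close>, hence everywhere, as \<open>Z\<close> is
      separated.\<close>
    have "app f c u = app g c v"
    proof (rule separated[OF Z c])
      show "app f c u \<in> fob Z c" "app g c v \<in> fob Z c" using u v c app_in f g by auto
      fix h assume h: "h \<in> R"
      then show "res Z h (app f c u) = res Z h (app g c v)"
        using app_nat[OF f, of h, symmetric] app_nat[OF g, of h, symmetric] J_sieve[OF c h] u v x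
        unfolding W_def by force
    qed
    then have uv: "(u, v) \<in> W c" unfolding W_def using u v by auto
    show "\<exists>!y. y \<in> W c \<and> (\<forall>f\<in>R. \<rho> f y = x f)"
    proof (rule ex1I[of _ "(u, v)"])
      show "(u, v) \<in> W c \<and> (\<forall>f\<in>R. \<rho> f (u, v) = x f)" using uv u v unfolding \<rho>_def by auto
      fix w assume w: "w \<in> W c \<and> (\<forall>f\<in>R. \<rho> f w = x f)"
      obtain u' v' where w': "w = (u', v')" by (cases w)
      have *: "res X f u' = fst (x f)" "res Y f v' = snd (x f)" if "f \<in> R" for f
        using w w' that unfolding \<rho>_def by (metis fst_conv snd_conv)+
      have "u' \<in> fob X c" "v' \<in> fob Y c" using w w' by (auto simp: W_def)
      then have "u' = u" "v' = v" using separated[OF X c _ u(1)] separated[OF Y c _ v(1)] u v * by auto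
      then show "w = (u, v)" using w' by simp
    qed
  qed
  have small: "small \<kappa> ((\<Union>c\<in>ob C. fob X c) \<times> (\<Union>c\<in>ob C. fob Y c))"
    by (intro small_Times small_total X Y)
  have sub: "(\<Union>c\<in>ob C. W c) \<subseteq> (\<Union>c\<in>ob C. fob X c) \<times> (\<Union>c\<in>ob C. fob Y c)"
    unfolding W_def by auto
  have sm: "small \<kappa> (W c)" if "c \<in> ob C" for c
    by (rule small_subset[OF small_subset[OF small sub]]) (use that in auto)
  obtain enc :: "'s \<times> 's \<Rightarrow> 's" where enc: "inj_on enc (\<Union>c\<in>ob C. W c)"
    using small_embed[OF small_subset[OF small sub]] by blast
  obtain P where P: "P \<in> ob D" and fob: "\<And>c. c \<in> ob C \<Longrightarrow> fob P c = enc ` W c"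
    and r: "\<And>h w. h \<in> ar C \<Longrightarrow> w \<in> W (tgt C h) \<Longrightarrow> res P h (enc w) = enc (\<rho> h w)"
    using shdata_ob[OF W sm enc] by auto
  define dec where "dec = inv_into (\<Union>c\<in>ob C. W c) enc"
  have dec: "dec (enc w) = w" if "c \<in> ob C" "w \<in> W c" for c w
    unfolding dec_def by (rule inv_into_f_f[OF enc]) (use that in auto)
  have W_res: "\<rho> h w \<in> W (src C h)" if "h \<in> ar C" "w \<in> W (tgt C h)" for h w
    using shdataD(1)[OF W] that by blast
  have "\<exists>p\<in>hom D P X. \<forall>c\<in>ob C. \<forall>e\<in>fob P c. app p c e = fst (dec e)"
  proof (intro mk_hom_D P X)
    fix c e assume c: "c \<in> ob C" "e \<in> fob P c"
    then obtain w where w: "w \<in> W c" "e = enc w" using fob by auto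
    then show "fst (dec e) \<in> fob X c" using dec[OF c(1) w(1)] unfolding W_def by auto
  next
    fix h e assume c: "h \<in> ar C" "e \<in> fob P (tgt C h)"
    then obtain w where w: "w \<in> W (tgt C h)" "e = enc w" using fob by auto
    then show "fst (dec (res P h e)) = res X h (fst (dec e))"
      using dec[OF _ w(1)] dec[OF _ W_res[OF c(1) w(1)]] c r[OF c(1) w(1)] unfolding \<rho>_def by auto
  qed
  then obtain p where p: "p \<in> hom D P X" "\<And>c e. c \<in> ob C \<Longrightarrow> e \<in> fob P c \<Longrightarrow> app p c e = fst (dec e)" by blast
  have "\<exists>q\<in>hom D P Y. \<forall>c\<in>ob C. \<forall>e\<in>fob P c. app q c e = snd (dec e)"
  proof (intro mk_hom_D P Y)
    fix c e assume c: "c \<in> ob C" "e \<in> fob P c"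
    then obtain w where w: "w \<in> W c" "e = enc w" using fob by auto
    then show "snd (dec e) \<in> fob Y c" using dec[OF c(1) w(1)] unfolding W_def by auto
  next
    fix h e assume c: "h \<in> ar C" "e \<in> fob P (tgt C h)"
    then obtain w where w: "w \<in> W (tgt C h)" "e = enc w" using fob by auto
    then show "snd (dec (res P h e)) = res Y h (snd (dec e))"
      using dec[OF _ w(1)] dec[OF _ W_res[OF c(1) w(1)]] c r[OF c(1) w(1)] unfolding \<rho>_def by auto
  qed
  then obtain q where q: "q \<in> hom D P Y" "\<And>c e. c \<in> ob C \<Longrightarrow> e \<in> fob P c \<Longrightarrow> app q c e = snd (dec e)" by blast
  have comm: "cmp D f p = cmp D g q"
    by (rule hom_D_ext[OF cmp_D(1)[OF p(1) f] cmp_D(1)[OF q(1) g]])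
      (auto simp: cmp_D(2)[OF p(1) f] cmp_D(2)[OF q(1) g] p q fob dec W_def)
  have ex: "\<exists>e\<in>fob P c. app p c e = x \<and> app q c e = y"
    if "c \<in> ob C" "x \<in> fob X c" "y \<in> fob Y c" "app f c x = app g c y" for c x y
  proof (rule bexI[of _ "enc (x, y)"])
    show *: "enc (x, y) \<in> fob P c" using that fob unfolding W_def by auto
    show "app p c (enc (x, y)) = x \<and> app q c (enc (x, y)) = y"
      using that p q * dec[of c "(x, y)"] unfolding W_def by auto
  qed
  have u: "e = e'" if "c \<in> ob C" "e \<in> fob P c" "e' \<in> fob P c" "app p c e = app p c e'" "app q c e = app q c e'" for c e e'
    using that p q fob dec by (auto simp: prod_eq_iff)
  have "is_pullback D f g p q"
    unfolding is_pullback_def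
  proof (intro conjI ballI impI)
    show "f \<in> ar D" "g \<in> ar D" "tgt D f = tgt D g" "p \<in> ar D" "q \<in> ar D" "src D p = src D q" 
       "tgt D p = src D f" "tgt D q = src D g"
      using f g p q unfolding hom_def by auto
    show "cmp D f p = cmp D g q" by fact
    fix a b assume ab: "a \<in> ar D" "b \<in> ar D" "src D a = src D b" "tgt D a = src D f" "tgt D b = src D g"
      and eq: "cmp D f a = cmp D g b"
    define V where "V = src D a"
    have a: "a \<in> hom D V X" and b: "b \<in> hom D V Y" using ab f g unfolding V_def hom_def by auto
    have ab_eq: "app f c (app a c x) = app g c (app b c x)" if "c \<in> ob C" "x \<in> fob V c" for c x
      using eq cmp_D(2)[OF a f that] cmp_D(2)[OF b g that] by simp
    have ab_W: "(app a c x, app b c x) \<in> W c" if "c \<in> ob C" "x \<in> fob V c" for c x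
      using ab_eq[OF that] app_in[OF a that] app_in[OF b that] unfolding W_def by auto
    have "\<exists>h\<in>hom D V P. \<forall>c\<in>ob C. \<forall>x\<in>fob V c. app h c x = enc (app a c x, app b c x)"
      by (rule mk_hom_D[OF hom_D_ob(1)[OF a] P])
        (auto simp: ab_W fob r app_nat[OF a] app_nat[OF b] \<rho>_def)
    then obtain h where h: "h \<in> hom D V P"
      "\<And>c x. c \<in> ob C \<Longrightarrow> x \<in> fob V c \<Longrightarrow> app h c x = enc (app a c x, app b c x)" by blast
    have h1: "cmp D p h = a"
      by (rule hom_D_ext[OF cmp_D(1)[OF h(1) p(1)] a])
       (auto simp: cmp_D(2)[OF h(1) p(1)] h p fob ab_W dec)
    have h2: "cmp D q h = b"
      by (rule hom_D_ext[OF cmp_D(1)[OF h(1) q(1)] b])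
       (auto simp: cmp_D(2)[OF h(1) q(1)] h q fob ab_W dec)
    have P_eq: "src D p = P" using p unfolding hom_def by auto
    show "\<exists>!h. h \<in> hom D (src D a) (src D p) \<and> cmp D p h = a \<and> cmp D q h = b"
      unfolding P_eq V_def[symmetric]
    proof (rule ex1I[of _ h])
      show "h \<in> hom D V P \<and> cmp D p h = a \<and> cmp D q h = b" using h h1 h2 by auto
      fix k assume k: "k \<in> hom D V P \<and> cmp D p k = a \<and> cmp D q k = b"
      then have k': "k \<in> hom D V P" by simp
      show "k = h"
      proof (rule hom_D_ext[OF k' h(1)])
        fix c x assume c: "c \<in> ob C" "x \<in> fob V c"
        show "app k c x = app h c x"
        proof (rule u[OF c(1) app_in[OF k' c] app_in[OF h(1) c]])
          show "app p c (app k c x) = app p c (app h c x)"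
            using k h1 cmp_D(2)[OF k' p(1) c] cmp_D(2)[OF h(1) p(1) c] by simp
          show "app q c (app k c x) = app q c (app h c x)"
            using k h2 cmp_D(2)[OF k' q(1) c] cmp_D(2)[OF h(1) q(1) c] by simp
        qed
      qed
    qed
  qed
  then show ?thesis using p q ex by blast
qed

section \<open>Images of families of sheaf maps, and power sheaves\<close>

definition Im :: "_ set \<Rightarrow> 's \<Rightarrow> 's \<Rightarrow> bool" where
  "Im K c x \<longleftrightarrow> (\<exists>k\<in>K. \<exists>e\<in>fob (asrc k) c. app k c e = x)"

text \<open>Membership in the sheaf image of \<open>K\<close>, i.e. in the closure of the presheaf
  image \<open>Im\<close> under the topology.\<close>

definition covered :: "_ set \<Rightarrow> _ \<Rightarrow> 's \<Rightarrow> 's \<Rightarrow> bool" where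
  "covered K X c x \<longleftrightarrow> {f \<in> ar C. tgt C f = c \<and> Im K (src C f) (res X f x)} \<in> J c"

definition arrows_to :: "_ set \<Rightarrow> _ \<Rightarrow> bool" where
  "arrows_to K X \<longleftrightarrow> (\<forall>k\<in>K. k \<in> hom D (asrc k) X)"

text \<open>The value at \<open>c\<close> of the power sheaf of \<open>X\<close>: subsheaves of the product of \<open>X\<close> with the presheaf
  represented by \<open>c\<close>, as sets of pairs.\<close>

definition power_ob :: "_ \<Rightarrow> 's \<Rightarrow> ('s \<times> 's) set set" where
  "power_ob X c = {T. T \<subseteq> {(f, z). f \<in> ar C \<and> tgt C f = c \<and> z \<in> fob X (src C f)} \<and>
     (\<forall>f z g. (f, z) \<in> T \<longrightarrow> g \<in> ar C \<longrightarrow> tgt C g = src C f \<longrightarrow> (C.comp f g, res X g z) \<in> T) \<and>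
     (\<forall>f z Q. f \<in> ar C \<longrightarrow> tgt C f = c \<longrightarrow> z \<in> fob X (src C f) \<longrightarrow> Q \<in> J (src C f) \<longrightarrow>
        (\<forall>g\<in>Q. (C.comp f g, res X g z) \<in> T) \<longrightarrow> (f, z) \<in> T)}"

text \<open>Inverse image of a subsheaf along the map that composes the representable coordinate
  with \<open>h\<close> and leaves \<open>X\<close> alone.\<close>

definition power_res :: "_ \<Rightarrow> 's \<Rightarrow> ('s \<times> 's) set \<Rightarrow> ('s \<times> 's) set" where
  "power_res X h T = {(f, z). f \<in> ar C \<and> tgt C f = src C h \<and> z \<in> fob X (src C f) \<and> (C.comp h f, z) \<in> T}"

lemma power_obD:
  assumes "T \<in> power_ob X c"
  shows "(f, z) \<in> T \<Longrightarrow> f \<in> ar C" "(f, z) \<in> T \<Longrightarrow> tgt C f = c" "(f, z) \<in> T \<Longrightarrow> z \<in> fob X (src C f)"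
    "(f, z) \<in> T \<Longrightarrow> g \<in> ar C \<Longrightarrow> tgt C g = src C f \<Longrightarrow> (C.comp f g, res X g z) \<in> T"
    "f \<in> ar C \<Longrightarrow> tgt C f = c \<Longrightarrow> z \<in> fob X (src C f) \<Longrightarrow> Q \<in> J (src C f) \<Longrightarrow>
        (\<And>g. g \<in> Q \<Longrightarrow> (C.comp f g, res X g z) \<in> T) \<Longrightarrow> (f, z) \<in> T"
  using assms unfolding power_ob_def by blast+

lemma power_shdata:
  assumes X: "X \<in> ob D" shows "shdata (power_ob X) (power_res X)"
  unfolding shdata_def
proof (intro conjI ballI allI impI)
  fix h T assume h: "h \<in> ar C" and T: "T \<in> power_ob X (tgt C h)"
  show "power_res X h T \<in> power_ob X (src C h)"
    unfolding power_ob_def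
  proof (intro CollectI conjI allI impI)
    show "power_res X h T \<subseteq> {(f, z). f \<in> ar C \<and> tgt C f = src C h \<and> z \<in> fob X (src C f)}"
      unfolding power_res_def by auto
  next
    fix f z g assume "(f, z) \<in> power_res X h T" "g \<in> ar C" "tgt C g = src C f"
    then show "(C.comp f g, res X g z) \<in> power_res X h T"
      using power_obD(4)[OF T, of "C.comp h f" z g] h X unfolding power_res_def by (auto intro: res_in)
  next
    fix f z Q assume f: "f \<in> ar C" "tgt C f = src C h" "z \<in> fob X (src C f)" and Q: "Q \<in> J (src C f)"
      "\<forall>g\<in>Q. (C.comp f g, res X g z) \<in> power_res X h T"
    have "(C.comp h f, z) \<in> T"
    proof (rule power_obD(5)[OF T])
      fix g assume "g \<in> Q"
      then show "(C.comp (C.comp h f) g, res X g z) \<in> T"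
        using Q J_sieve[of "src C f" Q g] f h unfolding power_res_def by auto
    qed (use f h Q in auto)
    then show "(f, z) \<in> power_res X h T" using f unfolding power_res_def by auto
  qed
next
  fix c T assume c: "c \<in> ob C" and T: "T \<in> power_ob X c"
  have "(f, z) \<in> power_res X (idt C c) T \<longleftrightarrow> (f, z) \<in> T" for f z
    using power_obD(1-3)[OF T, of f z] c by (cases "f \<in> ar C \<and> tgt C f = c") (auto simp: power_res_def)
  then show "power_res X (idt C c) T = T" by auto
next
  fix h k T assume "h \<in> ar C" "k \<in> ar C" "tgt C k = src C h" "T \<in> power_ob X (tgt C h)"
  then show "power_res X (C.comp h k) T = power_res X k (power_res X h T)"
    unfolding power_res_def by auto
next
  fix c R x assume c: "c \<in> ob C" "R \<in> J c" and x: "\<forall>f\<in>R. x f \<in> power_ob X (src C f)"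
    and cmp: "\<forall>f\<in>R. \<forall>g\<in>ar C. tgt C g = src C f \<longrightarrow> power_res X g (x f) = x (C.comp f g)"
  note R = J_sieve[OF c]
  \<comment> \<open>A pair belongs to the glued subsheaf when all its restrictions that lie over
    \<open>R\<close> belong to the given ones. Testing at the identity suffices, because
    compatibility of \<open>x\<close> shifts the first coordinate into the index
    (\<open>mem1\<close>).\<close>
  define T where "T = {(f, z). f \<in> ar C \<and> tgt C f = c \<and> z \<in> fob X (src C f) \<and>
     (\<forall>g\<in>ar C. tgt C g = src C f \<longrightarrow> C.comp f g \<in> R \<longrightarrow> (idt C (src C g), res X g z) \<in> x (C.comp f g))}"
  have mem: "(C.comp g g', z) \<in> x f \<longleftrightarrow> (g', z) \<in> x (C.comp f g)"
    if "f \<in> R" "g \<in> ar C" "tgt C g = src C f" "g' \<in> ar C" "tgt C g' = src C g" "z \<in> fob X (src C g')" for f g g' z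
    using cmp that unfolding power_res_def by (auto simp: cmp[rule_format, symmetric] power_res_def)
  have mem1: "(g, z) \<in> x f \<longleftrightarrow> (idt C (src C g), z) \<in> x (C.comp f g)"
    if "f \<in> R" "g \<in> ar C" "tgt C g = src C f" "z \<in> fob X (src C g)" for f g z
    using mem[OF that(1-3), of "idt C (src C g)" z] that by auto
  have T: "T \<in> power_ob X c"
    unfolding power_ob_def
  proof (intro CollectI conjI allI impI)
    show "T \<subseteq> {(f, z). f \<in> ar C \<and> tgt C f = c \<and> z \<in> fob X (src C f)}" unfolding T_def by auto
  next
    fix f z g assume *: "(f, z) \<in> T" "g \<in> ar C" "tgt C g = src C f"
    have **: "(idt C (src C g'), res X g' (res X g z)) \<in> x (C.comp f (C.comp g g'))"
      if g': "g' \<in> ar C" "tgt C g' = src C g" "C.comp f (C.comp g g') \<in> R" for g'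
    proof -
      have "res X g' (res X g z) = res X (C.comp g g') z"
        using * g' res_comp[OF X *(2) g'(1,2), of z] unfolding T_def by auto
      moreover have "(idt C (src C (C.comp g g')), res X (C.comp g g') z) \<in> x (C.comp f (C.comp g g'))"
        using * g' unfolding T_def by (auto simp del: C.comp_simps(2)) 
      ultimately show ?thesis using * g' by simp
    qed
    show "(C.comp f g, res X g z) \<in> T" 
      using * ** X unfolding T_def by (auto intro: res_in)
  next
    fix f z Q assume f: "f \<in> ar C" "tgt C f = c" "z \<in> fob X (src C f)" and Q: "Q \<in> J (src C f)"
      "\<forall>g\<in>Q. (C.comp f g, res X g z) \<in> T"
    have "(idt C (src C g), res X g z) \<in> x (C.comp f g)"
      if g: "g \<in> ar C" "tgt C g = src C f" "C.comp f g \<in> R" for g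
    proof (rule power_obD(5)[of "x (C.comp f g)" X "src C g"])
      show "x (C.comp f g) \<in> power_ob X (src C g)" using x g f by fastforce
      show "pull_sieve C g Q \<in> J (src C (idt C (src C g)))" using J_pull[OF g(1)] g Q by simp
      show "idt C (src C g) \<in> ar C" "tgt C (idt C (src C g)) = src C g" 
        "res X g z \<in> fob X (src C (idt C (src C g)))" using g f X by (auto intro: res_in)
      fix g' assume "g' \<in> pull_sieve C g Q"
      then have g': "g' \<in> ar C" "tgt C g' = src C g" "C.comp g g' \<in> Q" unfolding pull_sieve_def by auto
      have "(C.comp f (C.comp g g'), res X (C.comp g g') z) \<in> T" using Q g' by auto
      moreover have "C.comp (C.comp f g) g' \<in> R" using R(3)[OF g(3)] g' g f by auto
      moreover have z: "res X (C.comp g g') z = res X g' (res X g z)" using res_comp[OF X g(1) g'(1,2)] f g by auto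
      moreover have zz: "res X g' (res X g z) \<in> fob X (src C g')" using X f g g' by (auto intro!: res_in)
      ultimately have "(idt C (src C g'), res X g' (res X g z)) \<in> x (C.comp f (C.comp g g'))"
        using f g g' res_id[OF X] unfolding T_def by (auto dest!: bspec[of _ _ "idt C (src C g')"])
      then have "(g', res X g' (res X g z)) \<in> x (C.comp f g)"
        using mem1[OF g(3) g'(1)] f g g' zz by auto
      then show "(C.comp (idt C (src C g)) g', res X g' (res X g z)) \<in> x (C.comp f g)" using g g' by simp
    qed
    then show "(f, z) \<in> T" using f unfolding T_def by auto
  qed
  show "\<exists>!T. T \<in> power_ob X c \<and> (\<forall>f\<in>R. power_res X f T = x f)"
  proof (rule ex1I[of _ T])
    have "power_res X h T = x h" if h: "h \<in> R" for h
    proof -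
      have xh: "x h \<in> power_ob X (src C h)" using x h by auto
      have "(f, z) \<in> power_res X h T \<longleftrightarrow> (f, z) \<in> x h" 
        if f: "f \<in> ar C" "tgt C f = src C h" "z \<in> fob X (src C f)" for f z
      proof -
        have "(f, z) \<in> power_res X h T \<longleftrightarrow> (\<forall>g\<in>ar C. tgt C g = src C f \<longrightarrow>
            (idt C (src C g), res X g z) \<in> x (C.comp h (C.comp f g)))"
          using R[OF h] f unfolding power_res_def T_def by auto
        also have "\<dots> \<longleftrightarrow> (\<forall>g\<in>ar C. tgt C g = src C f \<longrightarrow> (C.comp f g, res X g z) \<in> x h)"
          using mem1[OF h] f R[OF h] X by (auto simp: res_in)
        also have "\<dots> \<longleftrightarrow> (f, z) \<in> x h"
        proof
          assume "\<forall>g\<in>ar C. tgt C g = src C f \<longrightarrow> (C.comp f g, res X g z) \<in> x h"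
          then have "(C.comp f (idt C (src C f)), res X (idt C (src C f)) z) \<in> x h"
            using f by (metis C.ar_ob(1) C.idt_simps)
          moreover have "res X (idt C (src C f)) z = z" by (rule res_id[OF X]) (use f in auto)
          ultimately show "(f, z) \<in> x h" using f by auto
        qed (use power_obD(4)[OF xh] in auto)
        finally show ?thesis .
      qed
      moreover have "(f, z) \<in> power_res X h T \<or> (f, z) \<in> x h \<Longrightarrow> f \<in> ar C \<and> tgt C f = src C h \<and> z \<in> fob X (src C f)" for f z
        using power_obD(1-3)[OF xh] unfolding power_res_def by blast
      ultimately show ?thesis by (intro set_eqI) (metis surj_pair)
    qed
    then show "T \<in> power_ob X c \<and> (\<forall>f\<in>R. power_res X f T = x f)" using T by auto
    fix T' assume T': "T' \<in> power_ob X c \<and> (\<forall>f\<in>R. power_res X f T' = x f)"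
    then have T'1: "T' \<in> power_ob X c" by auto
    have "(f, z) \<in> T' \<longleftrightarrow> (f, z) \<in> T" if f: "f \<in> ar C" "tgt C f = c" "z \<in> fob X (src C f)" for f z
    proof -
      have 1: "(C.comp f g, res X g z) \<in> T' \<longleftrightarrow> (idt C (src C g), res X g z) \<in> x (C.comp f g)"
        if g: "g \<in> ar C" "tgt C g = src C f" "C.comp f g \<in> R" for g
      proof -
        have "x (C.comp f g) = power_res X (C.comp f g) T'" using T' g by auto
        then show ?thesis using f g X unfolding power_res_def by (auto simp: res_in)
      qed
      \<comment> \<open>A subsheaf is closed under restriction and under covers, so membership at
        \<open>f\<close> is decided on the covering sieve \<open>pull_sieve C f R\<close>, where
        \<open>T'\<close> is prescribed.\<close>
      have "pull_sieve C f R \<in> J (src C f)" using J_pull f c by auto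
      then have "(f, z) \<in> T' \<longleftrightarrow> (\<forall>g\<in>pull_sieve C f R. (C.comp f g, res X g z) \<in> T')"
        using power_obD(4,5)[OF T'1] f unfolding pull_sieve_def by blast
      then show ?thesis using 1 f unfolding T_def pull_sieve_def by auto
    qed
    then show "T' = T" using power_obD(1-3)[OF T'1] power_obD(1-3)[OF T] by (intro set_eqI) (metis surj_pair)
  qed
qed

end

context site begin

text \<open>Records that natural families of subsheaves are classified by maps to \<open>P\<close>,
  with injective encoding. Both applications compare or construct such classifying maps and do not
  look inside \<open>P\<close>.\<close>

definition power_rep :: "_ \<Rightarrow> _ \<Rightarrow> (('s \<times> 's) set \<Rightarrow> 's) \<Rightarrow> bool" where
  "power_rep X P enc \<longleftrightarrow> P \<in> ob D \<and> inj_on enc (\<Union>c\<in>ob C. power_ob X c) \<and>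
    (\<forall>Y M. Y \<in> ob D \<longrightarrow> (\<forall>c y. c \<in> ob C \<longrightarrow> y \<in> fob Y c \<longrightarrow> M c y \<in> power_ob X c) \<longrightarrow>
      (\<forall>h y. h \<in> ar C \<longrightarrow> y \<in> fob Y (tgt C h) \<longrightarrow> power_res X h (M (tgt C h) y) = M (src C h) (res Y h y)) \<longrightarrow>
      (\<exists>t\<in>hom D Y P. \<forall>c\<in>ob C. \<forall>y\<in>fob Y c. app t c y = enc (M c y)))"

lemma power_repD:
  assumes "power_rep X P enc"
  shows "P \<in> ob D"
    and "c \<in> ob C \<Longrightarrow> T \<in> power_ob X c \<Longrightarrow> T' \<in> power_ob X c \<Longrightarrow> enc T = enc T' \<Longrightarrow> T = T'"
    and "Y \<in> ob D \<Longrightarrow> (\<And>c y. c \<in> ob C \<Longrightarrow> y \<in> fob Y c \<Longrightarrow> M c y \<in> power_ob X c) \<Longrightarrow>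
      (\<And>h y. h \<in> ar C \<Longrightarrow> y \<in> fob Y (tgt C h) \<Longrightarrow> power_res X h (M (tgt C h) y) = M (src C h) (res Y h y)) \<Longrightarrow>
      \<exists>t\<in>hom D Y P. \<forall>c\<in>ob C. \<forall>y\<in>fob Y c. app t c y = enc (M c y)"
  using assms unfolding power_rep_def by (simp, meson UN_I inj_onD, simp)

lemma power_D:
  assumes X: "X \<in> ob D"
  shows "\<exists>P enc. power_rep X P enc"
proof -
  have small: "small \<kappa> (Pow (ar C \<times> (\<Union>c\<in>ob C. fob X c)))"
    by (intro small_Pow small_Times small_ar small_total X)
  have sub: "(\<Union>c\<in>ob C. power_ob X c) \<subseteq> Pow (ar C \<times> (\<Union>c\<in>ob C. fob X c))"
    unfolding power_ob_def by fastforce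
  have sm: "small \<kappa> (power_ob X c)" if "c \<in> ob C" for c
    by (rule small_subset[OF small_subset[OF small sub]]) (use that in auto)
  obtain enc :: "('s \<times> 's) set \<Rightarrow> 's" where enc: "inj_on enc (\<Union>c\<in>ob C. power_ob X c)"
    using small_embed[OF small_subset[OF small sub]] by blast
  obtain P where P: "P \<in> ob D" and fob: "\<And>c. c \<in> ob C \<Longrightarrow> fob P c = enc ` power_ob X c"
    and r: "\<And>h T. h \<in> ar C \<Longrightarrow> T \<in> power_ob X (tgt C h) \<Longrightarrow> res P h (enc T) = enc (power_res X h T)"
    using shdata_ob[OF power_shdata[OF X] sm enc] by auto
  have "\<exists>t\<in>hom D Y P. \<forall>c\<in>ob C. \<forall>y\<in>fob Y c. app t c y = enc (M c y)"
    if Y: "Y \<in> ob D" and M: "\<And>c y. c \<in> ob C \<Longrightarrow> y \<in> fob Y c \<Longrightarrow> M c y \<in> power_ob X c"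
      and nat: "\<And>h y. h \<in> ar C \<Longrightarrow> y \<in> fob Y (tgt C h) \<Longrightarrow> power_res X h (M (tgt C h) y) = M (src C h) (res Y h y)"
    for Y M
    by (rule mk_hom_D[OF Y P]) (simp_all add: fob M r nat)
  then have "power_rep X P enc" using P enc unfolding power_rep_def by simp
  then show ?thesis by blast
qed

text \<open>The graph of the map from the presheaf represented by \<open>c\<close> to
  \<open>X\<close> that corresponds to \<open>x\<close> by Yoneda; as a function of \<open>x\<close>
  it is the singleton map into the power sheaf.\<close>

definition singl :: "_ \<Rightarrow> 's \<Rightarrow> 's \<Rightarrow> ('s \<times> 's) set" where
  "singl X c x = {(f, z). f \<in> ar C \<and> tgt C f = c \<and> z = res X f x}"

lemma singl_power:
  assumes X: "X \<in> ob D" and c: "c \<in> ob C" "x \<in> fob X c"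
  shows "singl X c x \<in> power_ob X c"
  unfolding power_ob_def
proof (intro CollectI conjI allI impI)
  show "singl X c x \<subseteq> {(f, z). f \<in> ar C \<and> tgt C f = c \<and> z \<in> fob X (src C f)}"
    using X c unfolding singl_def by (auto intro: res_in)
next
  fix f z g assume "(f, z) \<in> singl X c x" "g \<in> ar C" "tgt C g = src C f"
  then show "(C.comp f g, res X g z) \<in> singl X c x"
    using X c unfolding singl_def by (auto simp: res_comp)
next
  fix f z Q assume f: "f \<in> ar C" "tgt C f = c" "z \<in> fob X (src C f)" and Q: "Q \<in> J (src C f)"
      "\<forall>g\<in>Q. (C.comp f g, res X g z) \<in> singl X c x"
  have "z = res X f x"
  proof (rule separated[OF X _ Q(1)])
    fix g assume g: "g \<in> Q"
    then have "res X g z = res X (C.comp f g) x" using Q unfolding singl_def by auto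
    then show "res X g z = res X g (res X f x)" using f c J_sieve[OF _ Q(1) g] X by (auto simp: res_comp)
  qed (use f c X in \<open>auto intro: res_in\<close>)
  then show "(f, z) \<in> singl X c x" using f unfolding singl_def by auto
qed

lemma singl_nat:
  assumes X: "X \<in> ob D" and h: "h \<in> ar C" "x \<in> fob X (tgt C h)"
  shows "power_res X h (singl X (tgt C h) x) = singl X (src C h) (res X h x)"
proof -
  have "(f, z) \<in> power_res X h (singl X (tgt C h) x) \<longleftrightarrow> (f, z) \<in> singl X (src C h) (res X h x)" for f z
    using h X unfolding power_res_def singl_def by (auto simp: res_comp intro!: res_in)
  then show ?thesis by auto
qed

text \<open>The graph is evaluated at the identity of \<open>c\<close>.\<close>

lemma singl_inj:
  assumes "X \<in> ob D" "c \<in> ob C" "x \<in> fob X c" "y \<in> fob X c" "singl X c x = singl X c y"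
  shows "x = y"
proof -
  have "(idt C c, x) \<in> singl X c x" using assms(1-3) unfolding singl_def by (auto simp: res_id)
  then have "(idt C c, x) \<in> singl X c y" using assms by simp
  then have "x = res X (idt C c) y" unfolding singl_def by auto
  then show ?thesis using assms(1,2,4) by (simp add: res_id)
qed

text \<open>\<open>P\<close> is the power sheaf of \<open>X\<close>; its global element is the maximal subsheaf.\<close>

lemma embed_D:
  assumes X: "X \<in> ob D"
  shows "\<exists>P s. s \<in> hom D X P \<and> (\<forall>t. is_terminal D t \<longrightarrow> hom D t P \<noteq> {}) \<and>
     (\<forall>a\<in>ar D. \<forall>b\<in>ar D. tgt D a = X \<longrightarrow> tgt D b = X \<longrightarrow> src D a = src D b \<longrightarrow> cmp D s a = cmp D s b \<longrightarrow> a = b)"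
proof -
  obtain P enc where rep: "power_rep X P enc" using power_D[OF X] by blast
  note P = power_repD(1)[OF rep] and enc = power_repD(2)[OF rep] and mk = power_repD(3)[OF rep]
  obtain s where s: "s \<in> hom D X P" "\<And>c x. c \<in> ob C \<Longrightarrow> x \<in> fob X c \<Longrightarrow> app s c x = enc (singl X c x)"
    using mk[of X "singl X"] X by (auto simp: singl_power singl_nat)
  have s_inj: "x = y" if "c \<in> ob C" "x \<in> fob X c" "y \<in> fob X c" "app s c x = app s c y" for c x y
  proof -
    have "enc (singl X c x) = enc (singl X c y)" using that s by auto
    then have "singl X c x = singl X c y" using enc[OF that(1)] singl_power[OF X] that by auto
    then show ?thesis using singl_inj X that by blast
  qed
  have "hom D t P \<noteq> {}" if t: "is_terminal D t" for t
  proof -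
    define M where "M c (y :: 's) = {(f, z). f \<in> ar C \<and> tgt C f = c \<and> z \<in> fob X (src C f)}" for c y
    have "M c y \<in> power_ob X c" for c y unfolding power_ob_def M_def using X by (auto intro: res_in)
    moreover have "power_res X h (M (tgt C h) y) = M (src C h) y'" if "h \<in> ar C" for h y y'
      using that unfolding power_res_def M_def by auto
    moreover have "t \<in> ob D" using t unfolding is_terminal_def by auto
    ultimately show ?thesis using mk[of t M] by auto
  qed
  moreover have "a = b" if ab: "a \<in> ar D" "b \<in> ar D" "tgt D a = X" "tgt D b = X" "src D a = src D b" "cmp D s a = cmp D s b"
    for a b
  proof -
    have a: "a \<in> hom D (asrc a) X" and b: "b \<in> hom D (asrc a) X" using ab by (auto simp: hom_def)
    show ?thesis
    proof (rule hom_D_ext[OF a b])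
      fix c x assume c: "c \<in> ob C" "x \<in> fob (asrc a) c"
      have "app s c (app a c x) = app s c (app b c x)"
        using cmp_D(2)[OF a s(1) c] cmp_D(2)[OF b s(1) c] ab(6) by simp
      then show "app a c x = app b c x" using s_inj[OF c(1) app_in[OF a c] app_in[OF b c]] by blast
    qed
  qed
  ultimately show ?thesis using s(1) by blast
qed

section \<open>Joint epimorphisms of sheaves are the locally surjective families\<close>

lemma Im_res:
  assumes K: "arrows_to K X" and f: "f \<in> ar C" "tgt C f = c" and x: "Im K c x"
  shows "Im K (src C f) (res X f x)"
proof -
  obtain k e where k: "k \<in> K" "e \<in> fob (asrc k) c" "app k c e = x" using x unfolding Im_def by auto
  then have kh: "k \<in> hom D (asrc k) X" using K unfolding arrows_to_def by auto
  then have "res (asrc k) f e \<in> fob (asrc k) (src C f)" "app k (src C f) (res (asrc k) f e) = res X f x"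
    using k f app_nat[OF kh f(1) refl f(2) k(2)] hom_D_ob(1)[OF kh] by (auto intro: res_in)
  then show ?thesis unfolding Im_def using k by blast
qed

lemma Im_sieve:
  assumes K: "arrows_to K X" and X: "X \<in> ob D" and x: "c \<in> ob C" "x \<in> fob X c"
  shows "sieve C c {f \<in> ar C. tgt C f = c \<and> Im K (src C f) (res X f x)}"
  unfolding sieve_def using x by (auto simp: res_comp X intro!: Im_res[OF K])

lemma covered_res:
  assumes K: "arrows_to K X" and X: "X \<in> ob D" and x: "x \<in> fob X c" and c: "covered K X c x" and f: "f \<in> ar C" "tgt C f = c"
  shows "covered K X (src C f) (res X f x)"
proof -
  have "pull_sieve C f {f \<in> ar C. tgt C f = c \<and> Im K (src C f) (res X f x)} \<in> J (src C f)"
    using J_pull c f unfolding covered_def by auto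
  moreover have "pull_sieve C f {f \<in> ar C. tgt C f = c \<and> Im K (src C f) (res X f x)} =
     {g \<in> ar C. tgt C g = src C f \<and> Im K (src C g) (res X g (res X f x))}"
    unfolding pull_sieve_def using f x by (auto simp: res_comp X)
  ultimately show ?thesis unfolding covered_def by simp
qed

text \<open>The singleton map and its intersection with the sheaf image of \<open>K\<close> are two
  maps from \<open>X\<close> to the power sheaf that agree on \<open>K\<close>. A joint epimorphism
  makes them equal, so every singleton lies in the image.\<close>

lemma jepi_covered:
  assumes K: "D.jepi K X" and c: "c \<in> ob C" "x \<in> fob X c"
  shows "covered K X c x"
proof -
  have X: "X \<in> ob D" and A: "arrows_to K X"
    using K unfolding D.jepi_def arrows_to_def by (auto simp: hom_def)
  obtain P enc where rep: "power_rep X P enc" using power_D[OF X] by blast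
  note P = power_repD(1)[OF rep] and enc = power_repD(2)[OF rep] and mk = power_repD(3)[OF rep]
  \<comment> \<open>The singleton cut down to the sheaf image. It is again a subsheaf because being
    \<open>covered\<close> is stable under restriction and local.\<close>
  define M where "M c x = {(f, z) \<in> singl X c x. covered K X (src C f) z}" for c x
  have M: "M c x \<in> power_ob X c" if c: "c \<in> ob C" "x \<in> fob X c" for c x
  proof -
    note S = singl_power[OF X c]
    show ?thesis unfolding power_ob_def
    proof (intro CollectI conjI allI impI)
      show "M c x \<subseteq> {(f, z). f \<in> ar C \<and> tgt C f = c \<and> z \<in> fob X (src C f)}"
        using power_obD(1-3)[OF S] unfolding M_def by auto
    next
      fix f z g assume *: "(f, z) \<in> M c x" "g \<in> ar C" "tgt C g = src C f"
      then have f: "(f, z) \<in> singl X c x" and cov: "covered K X (src C f) z" unfolding M_def by auto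
      show "(C.comp f g, res X g z) \<in> M c x"
        using power_obD(4)[OF S f] covered_res[OF A X power_obD(3)[OF S f] cov] power_obD(1)[OF S f] *
        unfolding M_def by auto
    next
      fix f z Q assume f: "f \<in> ar C" "tgt C f = c" "z \<in> fob X (src C f)" and Q: "Q \<in> J (src C f)"
        "\<forall>g\<in>Q. (C.comp f g, res X g z) \<in> M c x"
      have 1: "(f, z) \<in> singl X c x"
        by (rule power_obD(5)[OF S f Q(1)]) (use Q in \<open>auto simp: M_def\<close>)
      have "covered K X (src C f) z"
        unfolding covered_def
      proof (rule J_trans[OF _ Q(1) Im_sieve[OF A X]])
        fix h assume h: "h \<in> Q"
        have h': "h \<in> ar C" "tgt C h = src C f" using J_sieve[OF _ Q(1) h] f by auto
        have "covered K X (src C h) (res X h z)" using Q h f h' unfolding M_def by auto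
        moreover have "pull_sieve C h {g \<in> ar C. tgt C g = src C f \<and> Im K (src C g) (res X g z)} =
           {g \<in> ar C. tgt C g = src C h \<and> Im K (src C g) (res X g (res X h z))}"
          unfolding pull_sieve_def using f h' by (auto simp: res_comp X)
        ultimately show "pull_sieve C h {g \<in> ar C. tgt C g = src C f \<and> Im K (src C g) (res X g z)} \<in> J (src C h)"
          unfolding covered_def by simp
      qed (use f in auto)
      then show "(f, z) \<in> M c x" using 1 unfolding M_def by auto
    qed
  qed
  have M_nat: "power_res X h (M (tgt C h) x) = M (src C h) (res X h x)" if h: "h \<in> ar C" "x \<in> fob X (tgt C h)" for h x
  proof -
    have "(f, z) \<in> power_res X h (M (tgt C h) x) \<longleftrightarrow> (f, z) \<in> power_res X h (singl X (tgt C h) x) \<and> covered K X (src C f) z" for f z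
      using h(1) unfolding power_res_def M_def by auto
    moreover have "(f, z) \<in> M (src C h) (res X h x) \<longleftrightarrow> (f, z) \<in> singl X (src C h) (res X h x) \<and> covered K X (src C f) z" for f z
      unfolding M_def by auto
    ultimately show ?thesis using singl_nat[OF X h] by auto
  qed
  obtain s where s: "s \<in> hom D X P" "\<And>c x. c \<in> ob C \<Longrightarrow> x \<in> fob X c \<Longrightarrow> app s c x = enc (singl X c x)"
    using mk[of X "singl X"] X by (auto simp: singl_power singl_nat)
  obtain m where m: "m \<in> hom D X P" "\<And>c x. c \<in> ob C \<Longrightarrow> x \<in> fob X c \<Longrightarrow> app m c x = enc (M c x)"
    using mk[of X M] X by (auto simp: M M_nat)
  have "s = m"
  proof (rule D.jepiD[OF K s(1) m(1)])
    fix k assume k: "k \<in> K"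
    then have kh: "k \<in> hom D (asrc k) X" using A unfolding arrows_to_def by auto
    show "cmp D s k = cmp D m k"
    proof (rule hom_D_ext[OF cmp_D(1)[OF kh s(1)] cmp_D(1)[OF kh m(1)]])
      fix c e assume c: "c \<in> ob C" "e \<in> fob (asrc k) c"
      let ?x = "app k c e"
      have x: "?x \<in> fob X c" using app_in[OF kh c] .
      have Imx: "Im K c ?x" unfolding Im_def using k c by auto
      \<comment> \<open>An element hit by \<open>k\<close> has all its restrictions in the image, so
        the cut removes nothing from its singleton.\<close>
      have "covered K X (src C f) z" if "(f, z) \<in> singl X c ?x" for f z
      proof -
        have f: "f \<in> ar C" "tgt C f = c" "z = res X f ?x" using that unfolding singl_def by auto
        have "Im K (src C f) z" using Im_res[OF A _ _ Imx] f by auto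
        then have "{g \<in> ar C. tgt C g = src C f \<and> Im K (src C g) (res X g z)} = {g \<in> ar C. tgt C g = src C f}"
          by (auto intro!: Im_res[OF A])
        then show ?thesis unfolding covered_def using J_max f by auto
      qed
      then have "M c ?x = singl X c ?x" unfolding M_def by auto
      then show "app (cmp D s k) c e = app (cmp D m k) c e"
        using cmp_D(2)[OF kh s(1) c] cmp_D(2)[OF kh m(1) c] s(2)[OF c(1) x] m(2)[OF c(1) x] by simp
    qed
  qed
  then have "enc (singl X c x) = enc (M c x)" using s m c by auto
  then have "singl X c x = M c x" using enc[OF c(1)] singl_power[OF X] M c by auto
  moreover have "(idt C c, x) \<in> singl X c x" unfolding singl_def using c X by (auto simp: res_id)
  ultimately have "(idt C c, x) \<in> M c x" by simp
  then show ?thesis unfolding M_def using c by auto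
qed

text \<open>Two maps that agree on \<open>K\<close> agree locally at every element, and their target
  is separated.\<close>

lemma covered_jepi:
  assumes X: "X \<in> ob D" and K: "arrows_to K X" and cov: "\<And>c x. c \<in> ob C \<Longrightarrow> x \<in> fob X c \<Longrightarrow> covered K X c x"
  shows "D.jepi K X"
  unfolding D.jepi_def
proof (intro conjI ballI allI impI X)
  fix k assume "k \<in> K"
  then show "k \<in> ar D" "tgt D k = X" using K unfolding arrows_to_def hom_def by auto
next
  fix Y g h assume g: "g \<in> hom D X Y" and h: "h \<in> hom D X Y" and eq: "\<forall>k\<in>K. cmp D g k = cmp D h k"
  show "g = h"
  proof (rule hom_D_ext[OF g h])
    fix c x assume c: "c \<in> ob C" "x \<in> fob X c"
    show "app g c x = app h c x"
    proof (rule separated[OF hom_D_ob(2)[OF g] c(1) cov[OF c, unfolded covered_def] app_in[OF g c] app_in[OF h c]])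
      fix f assume "f \<in> {f \<in> ar C. tgt C f = c \<and> Im K (src C f) (res X f x)}"
      then obtain k e where f: "f \<in> ar C" "tgt C f = c" and k: "k \<in> K" "e \<in> fob (asrc k) (src C f)" "app k (src C f) e = res X f x"
        unfolding Im_def by auto
      have kh: "k \<in> hom D (asrc k) X" using K k unfolding arrows_to_def by auto
      have "app g (src C f) (app k (src C f) e) = app h (src C f) (app k (src C f) e)"
        using eq k(1) cmp_D(2)[OF kh g _ k(2)] cmp_D(2)[OF kh h _ k(2)] f by auto
      then show "res Y f (app g c x) = res Y f (app h c x)"
        using app_nat[OF g f(1) refl f(2) c(2)] app_nat[OF h f(1) refl f(2) c(2)] k by simp
    qed
  qed
qed

text \<open>Stability is checked on elements: wherever the image of \<open>y\<close> under
  \<open>f\<close> lifts along some \<open>k\<close>, the restriction of \<open>y\<close> lifts to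
  the pullback of \<open>f\<close> and \<open>k\<close>, whose projection to \<open>Y\<close>
  belongs to \<open>factoring\<close>.\<close>

lemma jepi_factoring_D:
  assumes K: "D.jepi K X" and f: "f \<in> hom D Y X"
  shows "D.jepi (D.factoring K f) Y"
proof (rule covered_jepi)
  show Y: "Y \<in> ob D" using f hom_D by auto
  show A': "arrows_to (D.factoring K f) Y" unfolding arrows_to_def D.factoring_def using f by (auto simp: hom_def)
  have X: "X \<in> ob D" and A: "arrows_to K X"
    using K unfolding D.jepi_def arrows_to_def by (auto simp: hom_def)
  fix c y assume c: "c \<in> ob C" "y \<in> fob Y c"
  show "covered (D.factoring K f) Y c y"
    unfolding covered_def
  proof (rule J_mono[OF c(1) jepi_covered[OF K c(1) app_in[OF f c], unfolded covered_def] Im_sieve[OF A' Y c]], clarify)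
    fix h assume h: "h \<in> ar C" "c = tgt C h" and "Im K (src C h) (res X h (app f (tgt C h) y))"
    then obtain k e where k: "k \<in> K" "e \<in> fob (asrc k) (src C h)" "app k (src C h) e = app f (src C h) (res Y h y)"
      unfolding Im_def using app_nat[OF f h(1) refl refl, of y] c by auto
    have kh: "k \<in> hom D (asrc k) X" using A k unfolding arrows_to_def by auto
    \<comment> \<open>A single arrow of \<open>factoring\<close> is needed through which the element
      lifts; the pullback projection \<open>p\<close> is one.\<close>
    obtain P p q where P: "p \<in> hom D P Y" "q \<in> hom D P (asrc k)" "is_pullback D f k p q" and
      ex: "\<And>c x y. c\<in>ob C \<Longrightarrow> x\<in>fob Y c \<Longrightarrow> y\<in>fob (asrc k) c \<Longrightarrow> app f c x = app k c y \<Longrightarrow>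
       (\<exists>e\<in>fob P c. app p c e = x \<and> app q c e = y)" 
      using ex_pullback_D[OF f kh] by blast
    have y': "res Y h y \<in> fob Y (src C h)" using h c Y by (auto intro: res_in)
    obtain u where u: "u \<in> fob P (src C h)" "app p (src C h) u = res Y h y"
      using ex[OF _ y' k(2)] k h by auto
    have "p \<in> D.factoring K f"
      using P k f kh unfolding D.factoring_def is_pullback_def by (auto simp: hom_def)
    moreover have "asrc p = P" using P by (auto simp: hom_def)
    ultimately have "Im (D.factoring K f) (src C h) (res Y h y)"
      unfolding Im_def using u by auto
    then show "tgt C h = tgt C h \<and> Im (D.factoring K f) (src C h) (res Y h y)" by simp
  qed
qed

text \<open>The value at \<open>x\<close> is glued from the values on the covering sieve of arrows
  along which \<open>x\<close> lifts to the source of some member of \<open>R\<close>.\<close>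

lemma jepi_effective_D:
  assumes Y: "Y \<in> ob D" and K: "D.jepi (fst ` R) X"
    and R: "\<And>k y. (k, y) \<in> R \<Longrightarrow> y \<in> hom D (src D k) Y"
    and compat: "\<And>k y k' y' a b. (k, y) \<in> R \<Longrightarrow> (k', y') \<in> R \<Longrightarrow> a \<in> ar D \<Longrightarrow> b \<in> ar D \<Longrightarrow> tgt D a = src D k \<Longrightarrow>
        tgt D b = src D k' \<Longrightarrow> src D a = src D b \<Longrightarrow> cmp D k a = cmp D k' b \<Longrightarrow> cmp D y a = cmp D y' b"
  shows "\<exists>h\<in>hom D X Y. \<forall>(k, y)\<in>R. cmp D h k = y"
proof -
  have X: "X \<in> ob D" and A: "arrows_to (fst ` R) X"
    using K unfolding D.jepi_def arrows_to_def by (auto simp: hom_def)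
  have RX: "k \<in> hom D (asrc k) X" "y \<in> hom D (asrc k) Y" if "(k, y) \<in> R" for k y
    using A R[OF that] that unfolding arrows_to_def by force+
  \<comment> \<open>Compatibility is assumed for arrows. Applied to the two projections of the
    pullback of \<open>k\<close> and \<open>k'\<close>, it yields independence of the chosen
    lift.\<close>
  have wd: "app y c e = app y' c e'"
    if r: "(k, y) \<in> R" "(k', y') \<in> R" and c: "c \<in> ob C" and e: "e \<in> fob (asrc k) c" "e' \<in> fob (asrc k') c" "app k c e = app k' c e'"
    for k y k' y' c e e'
  proof -
    obtain P p q where P: "p \<in> hom D P (asrc k)" "q \<in> hom D P (asrc k')" "is_pullback D k k' p q" and
      ex: "\<And>c x y. c\<in>ob C \<Longrightarrow> x\<in>fob (asrc k) c \<Longrightarrow> y\<in>fob (asrc k') c \<Longrightarrow> app k c x = app k' c y \<Longrightarrow>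
       (\<exists>e\<in>fob P c. app p c e = x \<and> app q c e = y)" 
      using ex_pullback_D[OF RX(1)[OF r(1)] RX(1)[OF r(2)]] by blast
    obtain u where u: "u \<in> fob P c" "app p c u = e" "app q c u = e'" using ex[OF c e] by auto
    have "cmp D y p = cmp D y' q"
      by (rule compat[OF r]) (use P in \<open>auto simp: hom_def is_pullback_def\<close>)
    then show ?thesis
      using cmp_D(2)[OF P(1) RX(2)[OF r(1)] c u(1)] cmp_D(2)[OF P(2) RX(2)[OF r(2)] c u(1)] u by simp
  qed
  \<comment> \<open>The graph of the desired map on the presheaf image of the family. It is
    functional by \<open>wd\<close> and stable under restriction.\<close>
  define V where "V c x v \<longleftrightarrow> (\<exists>(k, y)\<in>R. \<exists>e\<in>fob (asrc k) c. app k c e = x \<and> app y c e = v)" for c x v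
  have V_fun: "v = v'" if "V c x v" "V c x v'" "c \<in> ob C" for c x v v'
  proof -
    note a = that
    obtain k y e k' y' e' where "(k, y) \<in> R" "e \<in> fob (asrc k) c" "app k c e = x" "app y c e = v"
      "(k', y') \<in> R" "e' \<in> fob (asrc k') c" "app k' c e' = x" "app y' c e' = v'"
      using a(1,2) unfolding V_def by auto
    then show ?thesis using wd[of k y k' y' c e e'] a(3) by simp
  qed
  have V_in: "v \<in> fob Y c" if "V c x v" "c \<in> ob C" for c x v
    using that app_in[OF RX(2)] unfolding V_def by auto
  have V_res: "V (src C f) (res X f x) (res Y f v)" if V: "V (tgt C f) x v" and f: "f \<in> ar C" for f x v
  proof -
    obtain k y e where k: "(k, y) \<in> R" "e \<in> fob (asrc k) (tgt C f)" "app k (tgt C f) e = x" "app y (tgt C f) e = v"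
      using V unfolding V_def by auto
    have "res (asrc k) f e \<in> fob (asrc k) (src C f)" using k f hom_D_ob(1)[OF RX(1)[OF k(1)]] by (auto intro: res_in)
    moreover have "app k (src C f) (res (asrc k) f e) = res X f x" using app_nat[OF RX(1)[OF k(1)] f refl refl k(2)] k by simp
    moreover have "app y (src C f) (res (asrc k) f e) = res Y f v" using app_nat[OF RX(2)[OF k(1)] f refl refl k(2)] k by simp
    ultimately show ?thesis unfolding V_def using k(1) by blast
  qed
  have V_Im: "Im (fst ` R) c x \<longleftrightarrow> (\<exists>v. V c x v)" for c x
    unfolding Im_def V_def by force
  define S where "S c x = {f \<in> ar C. tgt C f = c \<and> Im (fst ` R) (src C f) (res X f x)}" for c x
  have S: "S c x \<in> J c" if "c \<in> ob C" "x \<in> fob X c" for c x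
    using jepi_covered[OF K that] unfolding covered_def S_def by auto
  \<comment> \<open>The choice is harmless since \<open>V_fun\<close> leaves at most one value; the
    same fact makes the family matching.\<close>
  define val where "val c x f = (SOME v. V (src C f) (res X f x) v)" for c :: 's and x f
  have val: "V (src C f) (res X f x) (val c x f)" if "f \<in> S c x" for c x f
    using that unfolding S_def val_def V_Im by (auto intro: someI)
  have glued: "\<exists>!y. y \<in> fob Y c \<and> (\<forall>f\<in>S c x. res Y f y = val c x f)" if c: "c \<in> ob C" "x \<in> fob X c" for c x
  proof (rule glue[OF Y c(1) S[OF c]])
    fix f assume f: "f \<in> S c x"
    then show "val c x f \<in> fob Y (src C f)" using V_in[OF val[OF f]] unfolding S_def by auto
    fix g assume g: "g \<in> ar C" "tgt C g = src C f"
    have f': "f \<in> ar C" "tgt C f = c" using f unfolding S_def by auto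
    have fg: "C.comp f g \<in> S c x" using J_sieve(3)[OF c(1) S[OF c] f g] .
    have "V (src C g) (res X g (res X f x)) (res Y g (val c x f))" using V_res[of g] val[OF f] g by auto
    moreover have "V (src C g) (res X g (res X f x)) (val c x (C.comp f g))" 
      using val[OF fg] f' g c by (auto simp: res_comp[OF X])
    ultimately show "res Y g (val c x f) = val c x (C.comp f g)" using V_fun g by auto
  qed
  define \<phi> where "\<phi> c x = (THE y. y \<in> fob Y c \<and> (\<forall>f\<in>S c x. res Y f y = val c x f))" for c x
  have \<phi>: "\<phi> c x \<in> fob Y c" "f \<in> S c x \<Longrightarrow> res Y f (\<phi> c x) = val c x f" if "c \<in> ob C" "x \<in> fob X c" for c x f
    using theI'[OF glued[OF that]] unfolding \<phi>_def by auto
  have \<phi>_eq: "\<phi> c x = y" if c: "c \<in> ob C" "x \<in> fob X c" "y \<in> fob Y c" 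
      and y: "\<And>f. f \<in> S c x \<Longrightarrow> V (src C f) (res X f x) (res Y f y)" for c x y
  proof (rule separated[OF Y c(1) S[OF c(1,2)] \<phi>(1)[OF c(1,2)] c(3)])
    fix f assume f: "f \<in> S c x"
    then have "src C f \<in> ob C" unfolding S_def by auto
    then show "res Y f (\<phi> c x) = res Y f y" using \<phi>(2)[OF c(1,2) f] V_fun[OF val[OF f] y[OF f]] by simp
  qed
  have "\<exists>h\<in>hom D X Y. \<forall>c\<in>ob C. \<forall>x\<in>fob X c. app h c x = \<phi> c x"
  proof (rule mk_hom_D[OF X Y \<phi>(1)])
    fix f x assume f: "f \<in> ar C" "x \<in> fob X (tgt C f)"
    show "\<phi> (src C f) (res X f x) = res Y f (\<phi> (tgt C f) x)"
    proof (rule \<phi>_eq)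
      show "src C f \<in> ob C" "res X f x \<in> fob X (src C f)" "res Y f (\<phi> (tgt C f) x) \<in> fob Y (src C f)"
        using f \<phi>(1)[of "tgt C f" x] by (auto intro: res_in X Y)
      fix g assume g: "g \<in> S (src C f) (res X f x)"
      then have g': "g \<in> ar C" "tgt C g = src C f" "C.comp f g \<in> S (tgt C f) x"
        using f unfolding S_def by (auto simp: res_comp[OF X])
      have "V (src C g) (res X g (res X f x)) (res Y (C.comp f g) (\<phi> (tgt C f) x))"
        using val[OF g'(3)] \<phi>(2)[OF _ f(2) g'(3)] f g' by (auto simp: res_comp[OF X])
      then show "V (src C g) (res X g (res X f x)) (res Y g (res Y f (\<phi> (tgt C f) x)))"
        using f g' \<phi>(1)[of "tgt C f" x] by (auto simp: res_comp[OF Y])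
    qed
  qed
  then obtain h where h: "h \<in> hom D X Y" "\<And>c x. c\<in>ob C \<Longrightarrow> x\<in>fob X c \<Longrightarrow> app h c x = \<phi> c x" by blast
  have "cmp D h k = y" if r: "(k, y) \<in> R" for k y
  proof (rule hom_D_ext[OF cmp_D(1)[OF RX(1)[OF r] h(1)] RX(2)[OF r]])
    fix c e assume c: "c \<in> ob C" "e \<in> fob (asrc k) c"
    have V: "V c (app k c e) (app y c e)" unfolding V_def using r c by auto
    have "\<phi> c (app k c e) = app y c e"
    proof (rule \<phi>_eq[OF c(1) app_in[OF RX(1)[OF r] c] app_in[OF RX(2)[OF r] c]])
      fix f assume "f \<in> S c (app k c e)"
      then show "V (src C f) (res X f (app k c e)) (res Y f (app y c e))" using V_res V unfolding S_def by auto
    qed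
    then show "app (cmp D h k) c e = app y c e"
      using cmp_D(2)[OF RX(1)[OF r] h(1) c] h(2)[OF c(1) app_in[OF RX(1)[OF r] c]] by simp
  qed
  then show ?thesis using h(1) by blast
qed

theorem topos_like_D: "topos_like D"
  unfolding topos_like_def
proof (intro conjI)
  show "\<forall>f\<in>ar D. \<forall>g\<in>ar D. tgt D f = tgt D g \<longrightarrow> (\<exists>p q. is_pullback D f g p q)"
  proof (intro ballI impI)
    fix f g assume "f \<in> ar D" "g \<in> ar D" "tgt D f = tgt D g"
    then have "f \<in> hom D (src D f) (tgt D g)" "g \<in> hom D (src D g) (tgt D g)" by (auto simp: hom_def)
    then show "\<exists>p q. is_pullback D f g p q" using ex_pullback_D by blast
  qed
  show "\<forall>K X. \<forall>f\<in>ar D. tgt D f = X \<longrightarrow> D.jepi K X \<longrightarrow> D.jepi (D.factoring K f) (src D f)"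
    using jepi_factoring_D by (auto simp: hom_def)
  show "\<forall>R X Y. Y \<in> ob D \<longrightarrow> D.jepi (fst ` R) X \<longrightarrow>
        (\<forall>(k, y)\<in>R. y \<in> hom D (src D k) Y) \<longrightarrow>
        (\<forall>(k, y)\<in>R. \<forall>(k', y')\<in>R. \<forall>a\<in>ar D. \<forall>b\<in>ar D. tgt D a = src D k \<longrightarrow> tgt D b = src D k' \<longrightarrow>
           src D a = src D b \<longrightarrow> cmp D k a = cmp D k' b \<longrightarrow> cmp D y a = cmp D y' b) \<longrightarrow>
        (\<exists>h\<in>hom D X Y. \<forall>(k, y)\<in>R. cmp D h k = y)"
  proof (intro allI impI)
    fix R X Y assume *: "Y \<in> ob D" "D.jepi (fst ` R) X" "\<forall>(k, y)\<in>R. y \<in> hom D (src D k) Y"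
      "\<forall>(k, y)\<in>R. \<forall>(k', y')\<in>R. \<forall>a\<in>ar D. \<forall>b\<in>ar D. tgt D a = src D k \<longrightarrow> tgt D b = src D k' \<longrightarrow>
           src D a = src D b \<longrightarrow> cmp D k a = cmp D k' b \<longrightarrow> cmp D y a = cmp D y' b"
    show "\<exists>h\<in>hom D X Y. \<forall>(k, y)\<in>R. cmp D h k = y"
      by (rule jepi_effective_D[OF *(1,2)]) (use *(3,4) in \<open>fast\<close>)+
  qed
  show "\<forall>X\<in>ob D. \<exists>P s. s \<in> hom D X P \<and> (\<forall>t. is_terminal D t \<longrightarrow> hom D t P \<noteq> {}) \<and>
        (\<forall>a\<in>ar D. \<forall>b\<in>ar D. tgt D a = X \<longrightarrow> tgt D b = X \<longrightarrow> src D a = src D b \<longrightarrow>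
           cmp D s a = cmp D s b \<longrightarrow> a = b)"
    using embed_D by blast
qed (fact category_D terminal_D)+

end

section \<open>Transport along an equivalence\<close>

text \<open>What the transport uses of an equivalence: any arrow of \<open>D\<close> becomes the
  image of a unique arrow of \<open>E\<close> after its ends are replaced by isomorphic objects in
  the image of \<open>F\<close>.\<close>

locale ff_es = E: cat E + D: cat D for E :: "('o, 'a) cat" and D :: "('p, 'b) cat" +
  fixes F :: "('o, 'a, 'p, 'b) ftor"
  assumes ff: "fully_faithful E D F"
    and es: "Y \<in> ob D \<Longrightarrow> \<exists>X\<in>ob E. \<exists>u\<in>hom D (fob F X) Y. iso D u"
begin

lemma F_functor: "is_functor E D F" using ff unfolding fully_faithful_def by auto

lemma F_ob: "x \<in> ob E \<Longrightarrow> fob F x \<in> ob D" using F_functor unfolding is_functor_def by auto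

lemma F_hom: "f \<in> hom E x y \<Longrightarrow> far F f \<in> hom D (fob F x) (fob F y)"
  using F_functor unfolding is_functor_def hom_def by auto

lemma F_comp: "f \<in> hom E x y \<Longrightarrow> g \<in> hom E y z \<Longrightarrow> far F (cmp E g f) = cmp D (far F g) (far F f)"
  using F_functor unfolding is_functor_def hom_def by auto

lemma F_faithful: "f \<in> hom E x y \<Longrightarrow> g \<in> hom E x y \<Longrightarrow> far F f = far F g \<Longrightarrow> f = g"
  using ff E.homD unfolding fully_faithful_def bij_betw_def inj_on_def by metis

lemma F_full: 
  assumes "x \<in> ob E" "y \<in> ob E" "h \<in> hom D (fob F x) (fob F y)"
  obtains f where "f \<in> hom E x y" "far F f = h"
proof -
  have "far F ` hom E x y = hom D (fob F x) (fob F y)"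
    using ff assms(1,2) unfolding fully_faithful_def bij_betw_def by blast
  then show thesis using assms(3) that by (metis imageE)
qed

lemma lift:
  assumes "Y \<in> ob D"
  obtains X u where "X \<in> ob E" "u \<in> hom D (fob F X) Y" "iso D u"
  using es[OF assms] by blast

text \<open>Serves \<open>embed_E\<close>, where the points of \<open>P\<close> are indexed by the
  terminal objects of \<open>E\<close>.\<close>

lemma F_terminal:
  assumes t: "is_terminal E t" shows "is_terminal D (fob F t)"
  unfolding is_terminal_def
proof (intro conjI ballI)
  have t': "t \<in> ob E" using t unfolding is_terminal_def by auto
  then show "fob F t \<in> ob D" by (rule F_ob)
  fix Y assume "Y \<in> ob D"
  then obtain X u where X: "X \<in> ob E" and u: "u \<in> hom D (fob F X) Y" "iso D u" by (rule lift)
  obtain v where v: "v \<in> hom D Y (fob F X)" using D.iso_inverse[OF u(2,1)] by metis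
  obtain f where f: "f \<in> hom E X t" using t X unfolding is_terminal_def by auto
  show "\<exists>!f. f \<in> hom D Y (fob F t)"
  proof (rule ex1I)
    show "cmp D (far F f) v \<in> hom D Y (fob F t)" using D.comp_hom[OF v F_hom[OF f]] .
    fix g assume g: "g \<in> hom D Y (fob F t)"
    show "g = cmp D (far F f) v"
    proof (rule D.iso_epi[OF u(2,1) g D.comp_hom[OF v F_hom[OF f]]])
      let ?a = "cmp D g u" and ?b = "cmp D (cmp D (far F f) v) u"
      have a: "?a \<in> hom D (fob F X) (fob F t)" "?b \<in> hom D (fob F X) (fob F t)"
        using D.comp_hom[OF u(1) g] D.comp_hom[OF u(1) D.comp_hom[OF v F_hom[OF f]]] by auto
      obtain a' where a': "a' \<in> hom E X t" "far F a' = ?a" using F_full[OF X t' a(1)] .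
      obtain b' where b': "b' \<in> hom E X t" "far F b' = ?b" using F_full[OF X t' a(2)] .
      have "a' = b'" using t X a' b' unfolding is_terminal_def by blast
      then show "?a = ?b" using a' b' by simp
    qed
  qed
qed

lemma F_terminal_reflect:
  assumes t: "is_terminal D t" shows "\<exists>t. is_terminal E t"
proof -
  have "t \<in> ob D" using t unfolding is_terminal_def by auto
  then obtain T u where T: "T \<in> ob E" and u: "u \<in> hom D (fob F T) t" "iso D u" by (rule lift)
  obtain v where v: "v \<in> hom D t (fob F T)" "cmp D v u = idt D (fob F T)" using D.iso_inverse[OF u(2,1)] by metis
  have "\<exists>!f. f \<in> hom E x T" if x: "x \<in> ob E" for x
  proof -
    obtain h where h: "h \<in> hom D (fob F x) t" and un: "\<And>k. k \<in> hom D (fob F x) t \<Longrightarrow> k = h"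
      using t F_ob[OF x] unfolding is_terminal_def by blast
    obtain f where f: "f \<in> hom E x T" using F_full[OF x T D.comp_hom[OF h v(1)]] by metis
    have "g = f" if g: "g \<in> hom E x T" for g
      using F_faithful[OF g f D.iso_mono[OF u(2,1) F_hom[OF g] F_hom[OF f]]] un D.comp_hom[OF F_hom[OF g] u(1)]
        D.comp_hom[OF F_hom[OF f] u(1)] by metis
    then show ?thesis using f by blast
  qed
  then show ?thesis using T unfolding is_terminal_def by blast
qed

text \<open>The vertex of the pullback in \<open>D\<close> is replaced by an isomorphic object
  \<open>fob F P\<close>; then the projections and the mediating arrows lift along
  \<open>F\<close>.\<close>

lemma pullback_reflect:
  assumes f: "f \<in> hom E x z" and g: "g \<in> hom E y z" and pb: "is_pullback D (far F f) (far F g) p' q'"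
  shows "\<exists>p q. is_pullback E f g p q"
proof -
  note Ff = F_hom[OF f] note Fg = F_hom[OF g]
  define P' where "P' = src D p'"
  have p': "p' \<in> hom D P' (fob F x)" and q': "q' \<in> hom D P' (fob F y)" and comm': "cmp D (far F f) p' = cmp D (far F g) q'"
    using D.pullbackD(1-3)[OF pb Ff Fg] unfolding P'_def by auto
  note univ = D.pullbackD(4)[OF pb Ff Fg, folded P'_def]
  have xy: "x \<in> ob E" "y \<in> ob E" using f g E.homD by auto
  obtain P u where P: "P \<in> ob E" and u: "u \<in> hom D (fob F P) P'" "iso D u" using lift[of P'] p' D.homD by metis
  obtain v where v: "v \<in> hom D P' (fob F P)" "cmp D u v = idt D P'" using D.iso_inverse[OF u(2,1)] by metis
  obtain p where p: "p \<in> hom E P x" "far F p = cmp D p' u" using F_full[OF P xy(1) D.comp_hom[OF u(1) p']] by metis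
  obtain q where q: "q \<in> hom E P y" "far F q = cmp D q' u" using F_full[OF P xy(2) D.comp_hom[OF u(1) q']] by metis
  have comm: "cmp E f p = cmp E g q"
  proof (rule F_faithful[OF E.comp_hom[OF p(1) f] E.comp_hom[OF q(1) g]])
    show "far F (cmp E f p) = far F (cmp E g q)"
      using F_comp[OF p(1) f] F_comp[OF q(1) g] p q D.comp_assoc[OF u(1) p' Ff] D.comp_assoc[OF u(1) q' Fg] comm'
      by metis
  qed
  have "\<exists>!h. h \<in> hom E V P \<and> cmp E p h = a \<and> cmp E q h = b"
    if a: "a \<in> hom E V x" and b: "b \<in> hom E V y" and ab: "cmp E f a = cmp E g b" for V a b
  proof -
    have V: "V \<in> ob E" using a E.homD by auto
    have "cmp D (far F f) (far F a) = cmp D (far F g) (far F b)"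
      using F_comp[OF a f] F_comp[OF b g] ab by simp
    then obtain h' where h': "h' \<in> hom D (fob F V) P'" "cmp D p' h' = far F a" "cmp D q' h' = far F b"
      and un: "\<And>k. k \<in> hom D (fob F V) P' \<Longrightarrow> cmp D p' k = far F a \<Longrightarrow> cmp D q' k = far F b \<Longrightarrow> k = h'"
      using univ[OF F_hom[OF a] F_hom[OF b]] by blast
    obtain h where h: "h \<in> hom E V P" "far F h = cmp D v h'" using F_full[OF V P D.comp_hom[OF h'(1) v(1)]] by metis
    have uh: "cmp D u (far F h) = h'"
      unfolding h using D.comp_assoc[OF h'(1) v(1) u(1)] v(2) D.id_left[OF h'(1)] by simp
    show ?thesis
    proof (rule ex1I[of _ h])
      have "far F (cmp E p h) = far F a"
        using F_comp[OF h(1) p(1)] p(2) D.comp_assoc[OF F_hom[OF h(1)] u(1) p'] uh h'(2) by simp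
      moreover have "far F (cmp E q h) = far F b"
        using F_comp[OF h(1) q(1)] q(2) D.comp_assoc[OF F_hom[OF h(1)] u(1) q'] uh h'(3) by simp
      ultimately show "h \<in> hom E V P \<and> cmp E p h = a \<and> cmp E q h = b"
        using F_faithful[OF E.comp_hom[OF h(1) p(1)] a] F_faithful[OF E.comp_hom[OF h(1) q(1)] b] h(1) by blast
      fix k assume k: "k \<in> hom E V P \<and> cmp E p k = a \<and> cmp E q k = b"
      then have k1: "k \<in> hom E V P" by simp
      have "cmp D u (far F k) = h'"
      proof (rule un[OF D.comp_hom[OF F_hom[OF k1] u(1)]])
        show "cmp D p' (cmp D u (far F k)) = far F a"
          using D.comp_assoc[OF F_hom[OF k1] u(1) p'] p F_comp[OF k1 p(1)] k by simp
        show "cmp D q' (cmp D u (far F k)) = far F b"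
          using D.comp_assoc[OF F_hom[OF k1] u(1) q'] q F_comp[OF k1 q(1)] k by simp
      qed
      then show "k = h" using D.iso_mono[OF u(2,1) F_hom[OF k1] F_hom[OF h(1)]] uh F_faithful[OF k1 h(1)] by simp
    qed
  qed
  then have "is_pullback E f g p q" by (rule E.pullbackI[OF f g p(1) q(1) comm])
  then show ?thesis by blast
qed

text \<open>A test pair in \<open>D\<close> may have any target \<open>Y\<close>; composing with an
  isomorphism from \<open>Y\<close> to an object of the image makes it come from
  \<open>E\<close>.\<close>

lemma jepi_F:
  assumes K: "E.jepi K X" shows "D.jepi (far F ` K) (fob F X)"
  unfolding D.jepi_def
proof (intro conjI ballI allI impI)
  have X: "X \<in> ob E" using K unfolding E.jepi_def by auto
  then show "fob F X \<in> ob D" by (rule F_ob)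
  fix Y g h assume g: "g \<in> hom D (fob F X) Y" and h: "h \<in> hom D (fob F X) Y"
    and eq: "\<forall>k\<in>far F ` K. cmp D g k = cmp D h k"
  obtain Y0 u where Y0: "Y0 \<in> ob E" and u: "u \<in> hom D (fob F Y0) Y" "iso D u" using lift[of Y] D.homD[OF g] by metis
  obtain v where v: "v \<in> hom D Y (fob F Y0)" "cmp D u v = idt D Y" "cmp D v u = idt D (fob F Y0)"
    using D.iso_inverse[OF u(2,1)] by metis
  have vi: "iso D v" using D.isoI[OF v(1) u(1)] v by simp
  obtain g0 where g0: "g0 \<in> hom E X Y0" "far F g0 = cmp D v g" using F_full[OF X Y0 D.comp_hom[OF g v(1)]] by metis
  obtain h0 where h0: "h0 \<in> hom E X Y0" "far F h0 = cmp D v h" using F_full[OF X Y0 D.comp_hom[OF h v(1)]] by metis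
  have "g0 = h0"
  proof (rule E.jepiD[OF K g0(1) h0(1)])
    fix k assume k: "k \<in> K"
    note kh = E.jepi_ar[OF K k]
    show "cmp E g0 k = cmp E h0 k"
    proof (rule F_faithful[OF E.comp_hom[OF kh g0(1)] E.comp_hom[OF kh h0(1)]])
      show "far F (cmp E g0 k) = far F (cmp E h0 k)"
        using F_comp[OF kh g0(1)] F_comp[OF kh h0(1)] g0 h0 D.comp_assoc[OF F_hom[OF kh] g v(1)]
          D.comp_assoc[OF F_hom[OF kh] h v(1)] eq k by simp
    qed
  qed
  then show "g = h" using D.iso_mono[OF vi v(1) g h] g0 h0 by simp
next
  fix k assume "k \<in> far F ` K"
  then show "k \<in> ar D" "tgt D k = fob F X" using E.jepi_ar[OF K] F_hom unfolding hom_def by force+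
qed

lemma jepi_factoring_E:
  assumes D: "\<And>K X f Y. D.jepi K X \<Longrightarrow> f \<in> hom D Y X \<Longrightarrow> D.jepi (D.factoring K f) Y"
    and K: "E.jepi K X" and f: "f \<in> hom E Y X"
  shows "E.jepi (E.factoring K f) Y"
  unfolding E.jepi_def
proof (intro conjI ballI allI impI)
  show Y: "Y \<in> ob E" using f E.homD by auto
  fix k assume "k \<in> E.factoring K f"
  then show "k \<in> ar E" "tgt E k = Y" unfolding E.factoring_def using f by (auto simp: hom_def)
next
  have Y: "Y \<in> ob E" using f E.homD by auto
  fix Z g h assume g: "g \<in> hom E Y Z" and h: "h \<in> hom E Y Z" and eq: "\<forall>k\<in>E.factoring K f. cmp E g k = cmp E h k"
  have J: "D.jepi (D.factoring (far F ` K) (far F f)) (fob F Y)" by (rule D[OF jepi_F[OF K] F_hom[OF f]])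
  have "far F g = far F h"
  proof (rule D.jepiD[OF J F_hom[OF g] F_hom[OF h]])
    fix l assume l: "l \<in> D.factoring (far F ` K) (far F f)"
    then obtain k m where k: "k \<in> K" and m: "m \<in> hom D (src D l) (src D (far F k))" and lk: "cmp D (far F f) l = cmp D (far F k) m"
      unfolding D.factoring_def by auto
    have l': "l \<in> hom D (src D l) (fob F Y)" using l F_hom[OF f] unfolding D.factoring_def hom_def by auto
    note kh = E.jepi_ar[OF K k]
    have m': "m \<in> hom D (src D l) (fob F (src E k))" using m F_hom[OF kh] unfolding hom_def by auto
    \<comment> \<open>The source of \<open>l\<close> need not lie in the image of \<open>F\<close>.
      Precomposed with the isomorphism \<open>v\<close>, both \<open>l\<close> and its factor
      \<open>m\<close> come from \<open>E\<close>, and \<open>v\<close> is cancelled at the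
      end.\<close>
    obtain A v where A: "A \<in> ob E" and v: "v \<in> hom D (fob F A) (src D l)" "iso D v" using lift[of "src D l"] D.homD[OF l'] by metis
    obtain l0 where l0: "l0 \<in> hom E A Y" "far F l0 = cmp D l v" using F_full[OF A Y D.comp_hom[OF v(1) l']] by metis
    obtain m0 where m0: "m0 \<in> hom E A (src E k)" "far F m0 = cmp D m v" using F_full[OF A _ D.comp_hom[OF v(1) m']] E.homD[OF kh] by metis
    have "cmp E f l0 = cmp E k m0"
    proof (rule F_faithful[OF E.comp_hom[OF l0(1) f] E.comp_hom[OF m0(1) kh]])
      show "far F (cmp E f l0) = far F (cmp E k m0)"
        using F_comp[OF l0(1) f] F_comp[OF m0(1) kh] l0 m0 D.comp_assoc[OF v(1) l' F_hom[OF f]]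
          D.comp_assoc[OF v(1) m' F_hom[OF kh]] lk by simp
    qed
    then have "l0 \<in> E.factoring K f" unfolding E.factoring_def using l0 m0 k f by (auto simp: hom_def)
    then have "cmp E g l0 = cmp E h l0" using eq by auto
    then have "cmp D (cmp D (far F g) l) v = cmp D (cmp D (far F h) l) v"
      using F_comp[OF l0(1) g] F_comp[OF l0(1) h] l0(2) D.comp_assoc[OF v(1) l' F_hom[OF g]]
         D.comp_assoc[OF v(1) l' F_hom[OF h]] by simp
    then show "cmp D (far F g) l = cmp D (far F h) l"
      using D.iso_epi[OF v(2,1) D.comp_hom[OF l' F_hom[OF g]] D.comp_hom[OF l' F_hom[OF h]]] by simp
  qed
  then show "g = h" using F_faithful g h by blast
qed

lemma jepi_effective_E:
  assumes D: "\<And>R X Y. Y \<in> ob D \<Longrightarrow> D.jepi (fst ` R) X \<Longrightarrow> (\<And>k y. (k, y) \<in> R \<Longrightarrow> y \<in> hom D (src D k) Y) \<Longrightarrow>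
      (\<And>k y k' y' a b V. (k, y) \<in> R \<Longrightarrow> (k', y') \<in> R \<Longrightarrow> a \<in> hom D V (src D k) \<Longrightarrow> b \<in> hom D V (src D k') \<Longrightarrow>
         cmp D k a = cmp D k' b \<Longrightarrow> cmp D y a = cmp D y' b) \<Longrightarrow>
      \<exists>h\<in>hom D X Y. \<forall>(k, y)\<in>R. cmp D h k = y"
    and Y: "Y \<in> ob E" and K: "E.jepi (fst ` R) X"
    and R: "\<And>k y. (k, y) \<in> R \<Longrightarrow> y \<in> hom E (src E k) Y"
    and compat: "\<And>k y k' y' a b V. (k, y) \<in> R \<Longrightarrow> (k', y') \<in> R \<Longrightarrow> a \<in> hom E V (src E k) \<Longrightarrow> b \<in> hom E V (src E k') \<Longrightarrow>
         cmp E k a = cmp E k' b \<Longrightarrow> cmp E y a = cmp E y' b"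
  shows "\<exists>h\<in>hom E X Y. \<forall>(k, y)\<in>R. cmp E h k = y"
proof -
  have X: "X \<in> ob E" using K unfolding E.jepi_def by auto
  define S where "S = (\<lambda>(k, y). (far F k, far F y)) ` R"
  have kh: "k \<in> hom E (src E k) X" if "(k, y) \<in> R" for k y using E.jepi_ar[OF K] that by force
  have Fk: "far F k \<in> hom D (fob F (src E k)) (fob F X)" "src D (far F k) = fob F (src E k)"
    "far F y \<in> hom D (fob F (src E k)) (fob F Y)" if "(k, y) \<in> R" for k y
    using F_hom[OF kh[OF that]] F_hom[OF R[OF that]] unfolding hom_def by auto
  have "\<exists>h\<in>hom D (fob F X) (fob F Y). \<forall>(k, y)\<in>S. cmp D h k = y"
  proof (rule D)
    show "fob F Y \<in> ob D" using F_ob Y .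
    have "fst ` S = far F ` fst ` R" unfolding S_def by force
    then show "D.jepi (fst ` S) (fob F X)" using jepi_F[OF K] by simp
    fix k y assume "(k, y) \<in> S"
    then show "y \<in> hom D (src D k) (fob F Y)" using Fk unfolding S_def by auto
  next
    fix k y k' y' a b V assume s: "(k, y) \<in> S" "(k', y') \<in> S" and a: "a \<in> hom D V (src D k)" and b: "b \<in> hom D V (src D k')"
      and eq: "cmp D k a = cmp D k' b"
    obtain k0 y0 where r: "(k0, y0) \<in> R" "k = far F k0" "y = far F y0" using s(1) unfolding S_def by auto
    obtain k1 y1 where r': "(k1, y1) \<in> R" "k' = far F k1" "y' = far F y1" using s(2) unfolding S_def by auto
    have a: "a \<in> hom D V (fob F (src E k0))" and b: "b \<in> hom D V (fob F (src E k1))" using a b r r' Fk by auto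
    obtain A v where A: "A \<in> ob E" and v: "v \<in> hom D (fob F A) V" "iso D v" using lift[of V] D.homD[OF a] by metis
    obtain a0 where a0: "a0 \<in> hom E A (src E k0)" "far F a0 = cmp D a v"
      using F_full[OF A _ D.comp_hom[OF v(1) a]] E.homD[OF kh[OF r(1)]] by metis
    obtain b0 where b0: "b0 \<in> hom E A (src E k1)" "far F b0 = cmp D b v"
      using F_full[OF A _ D.comp_hom[OF v(1) b]] E.homD[OF kh[OF r'(1)]] by metis
    have "cmp E k0 a0 = cmp E k1 b0"
    proof (rule F_faithful[OF E.comp_hom[OF a0(1) kh[OF r(1)]] E.comp_hom[OF b0(1) kh[OF r'(1)]]])
      show "far F (cmp E k0 a0) = far F (cmp E k1 b0)"
        using F_comp[OF a0(1) kh[OF r(1)]] F_comp[OF b0(1) kh[OF r'(1)]] a0 b0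
          D.comp_assoc[OF v(1) a Fk(1)[OF r(1)]] D.comp_assoc[OF v(1) b Fk(1)[OF r'(1)]] eq r r' by simp
    qed
    then have "cmp E y0 a0 = cmp E y1 b0" using compat[OF r(1) r'(1) a0(1) b0(1)] by simp
    then have "cmp D (cmp D y a) v = cmp D (cmp D y' b) v"
      using F_comp[OF a0(1) R[OF r(1)]] F_comp[OF b0(1) R[OF r'(1)]] a0 b0
          D.comp_assoc[OF v(1) a Fk(3)[OF r(1)]] D.comp_assoc[OF v(1) b Fk(3)[OF r'(1)]] r r' by simp
    then show "cmp D y a = cmp D y' b"
      using D.iso_epi[OF v(2,1) D.comp_hom[OF a Fk(3)[OF r(1)]] D.comp_hom[OF b Fk(3)[OF r'(1)]]] r r' by simp
  qed
  then obtain h where h: "h \<in> hom D (fob F X) (fob F Y)" "\<forall>(k, y)\<in>S. cmp D h k = y" by blast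
  obtain h0 where h0: "h0 \<in> hom E X Y" "far F h0 = h" using F_full[OF X Y h(1)] .
  have "cmp E h0 k = y" if r: "(k, y) \<in> R" for k y
  proof (rule F_faithful[OF E.comp_hom[OF kh[OF r] h0(1)] R[OF r]])
    have "(far F k, far F y) \<in> S" unfolding S_def using r by force
    then show "far F (cmp E h0 k) = far F y" using F_comp[OF kh[OF r] h0(1)] h0(2) h(2) by fastforce
  qed
  then show ?thesis using h0 by blast
qed

lemma embed_E:
  assumes D: "\<And>X. X \<in> ob D \<Longrightarrow> \<exists>P s. s \<in> hom D X P \<and> (\<forall>t. is_terminal D t \<longrightarrow> hom D t P \<noteq> {}) \<and>
     (\<forall>V. \<forall>a\<in>hom D V X. \<forall>b\<in>hom D V X. cmp D s a = cmp D s b \<longrightarrow> a = b)" 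
    and X: "X \<in> ob E"
  shows "\<exists>P s. s \<in> hom E X P \<and> (\<forall>t. is_terminal E t \<longrightarrow> hom E t P \<noteq> {}) \<and>
     (\<forall>V. \<forall>a\<in>hom E V X. \<forall>b\<in>hom E V X. cmp E s a = cmp E s b \<longrightarrow> a = b)"
proof -
  obtain P' s' where s': "s' \<in> hom D (fob F X) P'" and t': "\<And>t. is_terminal D t \<Longrightarrow> hom D t P' \<noteq> {}"
    and inj: "\<And>V a b. a \<in> hom D V (fob F X) \<Longrightarrow> b \<in> hom D V (fob F X) \<Longrightarrow> cmp D s' a = cmp D s' b \<Longrightarrow> a = b"
    using D[OF F_ob[OF X]] by blast
  obtain P u where P: "P \<in> ob E" and u: "u \<in> hom D (fob F P) P'" "iso D u" using lift[of P'] D.homD[OF s'] by metis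
  obtain v where v: "v \<in> hom D P' (fob F P)" "cmp D u v = idt D P'" "cmp D v u = idt D (fob F P)"
    using D.iso_inverse[OF u(2,1)] by metis
  have vi: "iso D v" using D.isoI[OF v(1) u(1)] v by simp
  obtain s where s: "s \<in> hom E X P" "far F s = cmp D v s'" using F_full[OF X P D.comp_hom[OF s' v(1)]] by metis
  have "hom E t P \<noteq> {}" if t: "is_terminal E t" for t
  proof -
    obtain x where "x \<in> hom D (fob F t) P'" using t'[OF F_terminal[OF t]] by blast
    then have "cmp D v x \<in> hom D (fob F t) (fob F P)" using v D.comp_hom by blast
    moreover have "t \<in> ob E" using t unfolding is_terminal_def by auto
    ultimately show ?thesis using F_full[OF _ P] by blast
  qed
  moreover have "a = b" if a: "a \<in> hom E V X" and b: "b \<in> hom E V X" and eq: "cmp E s a = cmp E s b" for V a b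
  proof (rule F_faithful[OF a b inj[OF F_hom[OF a] F_hom[OF b]]])
    have "cmp D v (cmp D s' (far F a)) = cmp D v (cmp D s' (far F b))"
      using eq F_comp[OF a s(1)] F_comp[OF b s(1)] s(2) D.comp_assoc[OF F_hom[OF a] s' v(1)]
        D.comp_assoc[OF F_hom[OF b] s' v(1)] by simp
    then show "cmp D s' (far F a) = cmp D s' (far F b)"
      using D.iso_mono[OF vi v(1) D.comp_hom[OF F_hom[OF a] s'] D.comp_hom[OF F_hom[OF b] s']] by simp
  qed
  ultimately show ?thesis using s(1) by blast
qed

end

lemma equivalent_cats_ff:
  assumes E: "category E" and D: "category D" and eq: "equivalent_cats E D"
  obtains F where "ff_es E D F"
proof -
  interpret E: cat E using E by unfold_locales
  interpret D: cat D using D by unfold_locales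
  obtain F G \<tau> \<sigma> where F: "is_functor E D F" and G: "is_functor D E G"
    and \<tau>: "nat_iso E E id_ftor (comp_ftor G F) \<tau>" and \<sigma>: "nat_iso D D (comp_ftor F G) id_ftor \<sigma>"
    using eq unfolding equivalent_cats_def by blast
  have F_ob: "fob F x \<in> ob D" if "x \<in> ob E" for x using F that unfolding is_functor_def by auto
  have F_hom: "far F f \<in> hom D (fob F x) (fob F y)" if "f \<in> hom E x y" for f x y
    using F that unfolding is_functor_def hom_def by auto
  have G_ob: "fob G x \<in> ob E" if "x \<in> ob D" for x using G that unfolding is_functor_def by auto
  have G_hom: "far G f \<in> hom E (fob G x) (fob G y)" if "f \<in> hom D x y" for f x y
    using G that unfolding is_functor_def hom_def by auto
  have \<tau>: "\<tau> x \<in> hom E x (fob G (fob F x))" "iso E (\<tau> x)" if "x \<in> ob E" for x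
    using \<tau> that unfolding nat_iso_def nat_trans_def id_ftor_def comp_ftor_def by auto
  have \<tau>_nat: "cmp E (\<tau> y) f = cmp E (far G (far F f)) (\<tau> x)" if "f \<in> hom E x y" for f x y
    using \<open>nat_iso E E id_ftor (comp_ftor G F) \<tau>\<close> that unfolding nat_iso_def nat_trans_def id_ftor_def comp_ftor_def hom_def by auto
  have \<sigma>: "\<sigma> x \<in> hom D (fob F (fob G x)) x" "iso D (\<sigma> x)" if "x \<in> ob D" for x
    using \<sigma> that unfolding nat_iso_def nat_trans_def id_ftor_def comp_ftor_def by auto
  have \<sigma>_nat: "cmp D (\<sigma> y) (far F (far G f)) = cmp D f (\<sigma> x)" if "f \<in> hom D x y" for f x y
    using \<open>nat_iso D D (comp_ftor F G) id_ftor \<sigma>\<close> that unfolding nat_iso_def nat_trans_def id_ftor_def comp_ftor_def hom_def by auto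
  have F_faithful: "f = g" if f: "f \<in> hom E x y" and g: "g \<in> hom E x y" and eq: "far F f = far F g" for f g x y
    using \<tau>_nat[OF f] \<tau>_nat[OF g] eq E.iso_mono[OF \<tau>(2,1) f g] E.homD[OF f] by simp
  have G_faithful: "f = g" if f: "f \<in> hom D x y" and g: "g \<in> hom D x y" and eq: "far G f = far G g" for f g x y
    using \<sigma>_nat[OF f] \<sigma>_nat[OF g] eq D.iso_epi[OF \<sigma>(2,1) f g] D.homD[OF f] by simp
  have full: "\<exists>f\<in>hom E x y. far F f = h" if x: "x \<in> ob E" and y: "y \<in> ob E" and h: "h \<in> hom D (fob F x) (fob F y)" for x y h
  proof -
    obtain t where t: "t \<in> hom E (fob G (fob F y)) y" "cmp E (\<tau> y) t = idt E (fob G (fob F y))"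
      using E.iso_inverse[OF \<tau>(2,1)[OF y]] by metis
    \<comment> \<open>The conjugate of \<open>far G h\<close> by \<tau>, with \<open>t\<close> the
      inverse of \<open>\<tau> y\<close>. Naturality gives \<open>far G (far F f) = far G h\<close>,
      and faithfulness of \<open>G\<close> finishes.\<close>
    define f where "f = cmp E t (cmp E (far G h) (\<tau> x))"
    note Gh\<tau> = E.comp_hom[OF \<tau>(1)[OF x] G_hom[OF h]]
    have f: "f \<in> hom E x y" unfolding f_def using E.comp_hom[OF Gh\<tau> t(1)] .
    have "cmp E (far G (far F f)) (\<tau> x) = cmp E (far G h) (\<tau> x)"
      using \<tau>_nat[OF f] E.comp_assoc[OF Gh\<tau> t(1) \<tau>(1)[OF y]] t(2) E.id_left[OF Gh\<tau>] unfolding f_def by simp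
    then have "far G (far F f) = far G h"
      using E.iso_epi[OF \<tau>(2,1)[OF x] G_hom[OF F_hom[OF f]] G_hom[OF h]] by simp
    then show ?thesis using G_faithful[OF F_hom[OF f] h] f by blast
  qed
  have "ff_es E D F"
  proof
    show "fully_faithful E D F" unfolding fully_faithful_def
    proof (intro conjI ballI F)
      fix x y assume "x \<in> ob E" "y \<in> ob E"
      then show "bij_betw (far F) (hom E x y) (hom D (fob F x) (fob F y))"
        unfolding bij_betw_def using F_faithful F_hom full by (fastforce simp: inj_on_def)
    qed
    show "\<exists>X\<in>ob E. \<exists>u\<in>hom D (fob F X) Y. iso D u" if "Y \<in> ob D" for Y
      using \<sigma>[OF that] G_ob[OF that] by blast
  qed
  then show thesis using that by blast
qed

context cat begin

lemma topos_likeD: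
  assumes "topos_like E"
  shows "\<exists>t. is_terminal E t"
    and "f \<in> hom E x z \<Longrightarrow> g \<in> hom E y z \<Longrightarrow> \<exists>p q. is_pullback E f g p q"
    and "jepi K X \<Longrightarrow> f \<in> hom E Y X \<Longrightarrow> jepi (factoring K f) Y"
    and "Y \<in> ob E \<Longrightarrow> jepi (fst ` R) X \<Longrightarrow> (\<And>k y. (k, y) \<in> R \<Longrightarrow> y \<in> hom E (src E k) Y) \<Longrightarrow>
      (\<And>k y k' y' a b V. (k, y) \<in> R \<Longrightarrow> (k', y') \<in> R \<Longrightarrow> a \<in> hom E V (src E k) \<Longrightarrow> b \<in> hom E V (src E k') \<Longrightarrow>
         cmp E k a = cmp E k' b \<Longrightarrow> cmp E y a = cmp E y' b) \<Longrightarrow>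
      \<exists>h\<in>hom E X Y. \<forall>(k, y)\<in>R. cmp E h k = y"
    and "X \<in> ob E \<Longrightarrow> \<exists>P s. s \<in> hom E X P \<and> (\<forall>t. is_terminal E t \<longrightarrow> hom E t P \<noteq> {}) \<and>
     (\<forall>V. \<forall>a\<in>hom E V X. \<forall>b\<in>hom E V X. cmp E s a = cmp E s b \<longrightarrow> a = b)"
proof -
  note T = assms[unfolded topos_like_def]
  show "\<exists>t. is_terminal E t" using T[THEN conjunct2, THEN conjunct1] .
  show "f \<in> hom E x z \<Longrightarrow> g \<in> hom E y z \<Longrightarrow> \<exists>p q. is_pullback E f g p q"
    using T[THEN conjunct2, THEN conjunct2, THEN conjunct1] by (auto simp: hom_def)
  show "jepi K X \<Longrightarrow> f \<in> hom E Y X \<Longrightarrow> jepi (factoring K f) Y"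
    using T[THEN conjunct2, THEN conjunct2, THEN conjunct2, THEN conjunct1] by (auto simp: hom_def)
  show "\<exists>h\<in>hom E X Y. \<forall>(k, y)\<in>R. cmp E h k = y"
    if a: "Y \<in> ob E" "jepi (fst ` R) X" and b: "\<And>k y. (k, y) \<in> R \<Longrightarrow> y \<in> hom E (src E k) Y"
      and c: "\<And>k y k' y' a b V. (k, y) \<in> R \<Longrightarrow> (k', y') \<in> R \<Longrightarrow> a \<in> hom E V (src E k) \<Longrightarrow> b \<in> hom E V (src E k') \<Longrightarrow>
         cmp E k a = cmp E k' b \<Longrightarrow> cmp E y a = cmp E y' b"
  proof (rule T[THEN conjunct2, THEN conjunct2, THEN conjunct2, THEN conjunct2, THEN conjunct1, rule_format, OF a])
    show "case x of (k, y) \<Rightarrow> y \<in> hom E (src E k) Y" if "x \<in> R" for x using b that by auto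
    show "case x of (k, y) \<Rightarrow> \<forall>(k', y')\<in>R. \<forall>a\<in>ar E. \<forall>b\<in>ar E. tgt E a = src E k \<longrightarrow> tgt E b = src E k' \<longrightarrow>
           src E a = src E b \<longrightarrow> cmp E k a = cmp E k' b \<longrightarrow> cmp E y a = cmp E y' b" if "x \<in> R" for x
    proof (cases x)
      case (Pair k y)
      have "y \<cdot> a = y' \<cdot> b" if "(k', y') \<in> R" "a \<in> ar E" "b \<in> ar E" "tgt E a = src E k" "tgt E b = src E k'"
        "src E a = src E b" "k \<cdot> a = k' \<cdot> b" for k' y' a b
        by (rule c[of k y k' y' a "src E a" b]) (use that \<open>x \<in> R\<close> Pair in \<open>simp_all add: hom_def\<close>)
      then show ?thesis unfolding Pair prod.case by blast
    qed
  qed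
  show "X \<in> ob E \<Longrightarrow> \<exists>P s. s \<in> hom E X P \<and> (\<forall>t. is_terminal E t \<longrightarrow> hom E t P \<noteq> {}) \<and>
     (\<forall>V. \<forall>a\<in>hom E V X. \<forall>b\<in>hom E V X. cmp E s a = cmp E s b \<longrightarrow> a = b)"
  proof -
    assume "X \<in> ob E"
    then obtain P s where "s \<in> hom E X P" "\<forall>t. is_terminal E t \<longrightarrow> hom E t P \<noteq> {}"
        "\<forall>a\<in>ar E. \<forall>b\<in>ar E. tgt E a = X \<longrightarrow> tgt E b = X \<longrightarrow> src E a = src E b \<longrightarrow> cmp E s a = cmp E s b \<longrightarrow> a = b"
      using T[THEN conjunct2, THEN conjunct2, THEN conjunct2, THEN conjunct2, THEN conjunct2] by blast
    then show ?thesis by (intro exI[of _ P] exI[of _ s]) (auto simp: hom_def)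
  qed
qed

end

theorem topos_like_topos:
  assumes "universe \<kappa>" and "grothendieck_topos \<kappa> E"
  shows "topos_like E"
proof -
  obtain C :: "('a, 'a) cat" and J where E: "category E" and C: "category C" "small \<kappa> (ob C)" "small \<kappa> (ar C)"
     "grothendieck_topology C J" "equivalent_cats E (Sh \<kappa> C J)"
    using assms(2) unfolding grothendieck_topos_def by blast
  interpret site \<kappa> C J by unfold_locales (use assms(1) C in auto)
  obtain F where "ff_es E D F" using equivalent_cats_ff[OF E category_D C(5)] .
  then interpret F: ff_es E D F .
  note TD = D.topos_likeD[OF topos_like_D]
  show ?thesis unfolding topos_like_def
  proof (intro conjI)
    show "\<exists>t. is_terminal E t" using F.F_terminal_reflect TD(1) by blast
    show "\<forall>f\<in>ar E. \<forall>g\<in>ar E. tgt E f = tgt E g \<longrightarrow> (\<exists>p q. is_pullback E f g p q)"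
    proof (intro ballI impI)
      fix f g assume fg: "f \<in> ar E" "g \<in> ar E" "tgt E f = tgt E g"
      then have "f \<in> hom E (src E f) (tgt E g)" "g \<in> hom E (src E g) (tgt E g)" by (auto simp: hom_def)
      then show "\<exists>p q. is_pullback E f g p q" using F.pullback_reflect TD(2) F.F_hom by meson
    qed
    show "\<forall>K X. \<forall>f\<in>ar E. tgt E f = X \<longrightarrow> F.E.jepi K X \<longrightarrow> F.E.jepi (F.E.factoring K f) (src E f)"
    proof (intro allI ballI impI)
      fix K X f assume "f \<in> ar E" "tgt E f = X" and K: "F.E.jepi K X"
      then have f: "f \<in> hom E (src E f) X" by (auto simp: hom_def)
      show "F.E.jepi (F.E.factoring K f) (src E f)"
        by (rule F.jepi_factoring_E[OF _ K f]) (rule TD(3))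
    qed
    show "\<forall>R X Y. Y \<in> ob E \<longrightarrow> F.E.jepi (fst ` R) X \<longrightarrow> (\<forall>(k, y)\<in>R. y \<in> hom E (src E k) Y) \<longrightarrow>
        (\<forall>(k, y)\<in>R. \<forall>(k', y')\<in>R. \<forall>a\<in>ar E. \<forall>b\<in>ar E. tgt E a = src E k \<longrightarrow> tgt E b = src E k' \<longrightarrow>
           src E a = src E b \<longrightarrow> cmp E k a = cmp E k' b \<longrightarrow> cmp E y a = cmp E y' b) \<longrightarrow>
        (\<exists>h\<in>hom E X Y. \<forall>(k, y)\<in>R. cmp E h k = y)"
    proof (intro allI impI)
      fix R X Y assume *: "Y \<in> ob E" "F.E.jepi (fst ` R) X" "\<forall>(k, y)\<in>R. y \<in> hom E (src E k) Y"
        "\<forall>(k, y)\<in>R. \<forall>(k', y')\<in>R. \<forall>a\<in>ar E. \<forall>b\<in>ar E. tgt E a = src E k \<longrightarrow> tgt E b = src E k' \<longrightarrow>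
           src E a = src E b \<longrightarrow> cmp E k a = cmp E k' b \<longrightarrow> cmp E y a = cmp E y' b"
      show "\<exists>h\<in>hom E X Y. \<forall>(k, y)\<in>R. cmp E h k = y"
      proof (rule F.jepi_effective_E[OF _ *(1,2)])
        show "\<exists>h\<in>hom D X Y. \<forall>(k, y)\<in>R. cmp D h k = y"
          if "Y \<in> ob D" "D.jepi (fst ` R) X" "\<And>k y. (k, y) \<in> R \<Longrightarrow> y \<in> hom D (src D k) Y"
            "\<And>k y k' y' a b V. (k, y) \<in> R \<Longrightarrow> (k', y') \<in> R \<Longrightarrow> a \<in> hom D V (src D k) \<Longrightarrow> b \<in> hom D V (src D k') \<Longrightarrow>
              cmp D k a = cmp D k' b \<Longrightarrow> cmp D y a = cmp D y' b" for R X Y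
          using that by (rule TD(4))
        show "y \<in> hom E (src E k) Y" if "(k, y) \<in> R" for k y using *(3) that by auto
      next
        fix k y k' y' a b V assume r: "(k, y) \<in> R" "(k', y') \<in> R" and "a \<in> hom E V (src E k)" "b \<in> hom E V (src E k')"
           "cmp E k a = cmp E k' b"
        moreover have "\<forall>(k', y')\<in>R. \<forall>a\<in>ar E. \<forall>b\<in>ar E. tgt E a = src E k \<longrightarrow> tgt E b = src E k' \<longrightarrow>
           src E a = src E b \<longrightarrow> cmp E k a = cmp E k' b \<longrightarrow> cmp E y a = cmp E y' b"
          using bspec[OF *(4) r(1)] by simp
        from bspec[OF this r(2)] have "\<forall>a\<in>ar E. \<forall>b\<in>ar E. tgt E a = src E k \<longrightarrow> tgt E b = src E k' \<longrightarrow>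
           src E a = src E b \<longrightarrow> cmp E k a = cmp E k' b \<longrightarrow> cmp E y a = cmp E y' b" by simp
        ultimately show "cmp E y a = cmp E y' b" by (simp add: hom_def)
      qed
    qed
    show "\<forall>X\<in>ob E. \<exists>P s. s \<in> hom E X P \<and> (\<forall>t. is_terminal E t \<longrightarrow> hom E t P \<noteq> {}) \<and>
        (\<forall>a\<in>ar E. \<forall>b\<in>ar E. tgt E a = X \<longrightarrow> tgt E b = X \<longrightarrow> src E a = src E b \<longrightarrow>
           cmp E s a = cmp E s b \<longrightarrow> a = b)"
    proof
      fix X assume X: "X \<in> ob E"
      obtain P s where s: "s \<in> hom E X P" "\<forall>t. is_terminal E t \<longrightarrow> hom E t P \<noteq> {}"
        and i: "\<forall>V. \<forall>a\<in>hom E V X. \<forall>b\<in>hom E V X. cmp E s a = cmp E s b \<longrightarrow> a = b"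
        using F.embed_E[OF TD(5) X] by blast
      show "\<exists>P s. s \<in> hom E X P \<and> (\<forall>t. is_terminal E t \<longrightarrow> hom E t P \<noteq> {}) \<and>
        (\<forall>a\<in>ar E. \<forall>b\<in>ar E. tgt E a = X \<longrightarrow> tgt E b = X \<longrightarrow> src E a = src E b \<longrightarrow>
           cmp E s a = cmp E s b \<longrightarrow> a = b)"
        using s i by (intro exI[of _ P] exI[of _ s]) (auto simp: hom_def)
    qed
  qed (fact E)
qed

section \<open>Connected objects generate\<close>

definition fn :: "'s set \<Rightarrow> ('s \<Rightarrow> 's) \<Rightarrow> 's set \<Rightarrow> 's sarrow" where
  "fn S f T = Arrow S (restrict f S) T"

lemma fn_hom: "small \<kappa> S \<Longrightarrow> small \<kappa> T \<Longrightarrow> (\<And>x. x \<in> S \<Longrightarrow> f x \<in> T) \<Longrightarrow> fn S f T \<in> hom (Sets \<kappa>) S T"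
  unfolding fn_def hom_Sets by auto

lemma hom_Sets_in: "t \<in> hom (Sets \<kappa>) S T \<Longrightarrow> x \<in> S \<Longrightarrow> body t x \<in> T"
  unfolding hom_Sets by auto

lemma hom_Sets_eqI:
  assumes "t \<in> hom (Sets \<kappa>) S T" "t' \<in> hom (Sets \<kappa>) S T" "\<And>x. x \<in> S \<Longrightarrow> body t x = body t' x"
  shows "t = t'"
proof -
  obtain f f' where f: "f \<in> S \<rightarrow>\<^sub>E T" "t = Arrow S f T" "f' \<in> S \<rightarrow>\<^sub>E T" "t' = Arrow S f' T"
    using assms(1,2) unfolding hom_Sets by blast
  have "f = f'" by (rule PiE_ext[OF f(1,3)]) (use assms(3) f in simp)
  then show ?thesis using f by simp
qed

lemma fn_app [simp]: "x \<in> S \<Longrightarrow> body (fn S f T) x = f x"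
  unfolding fn_def by simp

lemma cmp_Sets_app: "s \<in> hom (Sets \<kappa>) S T \<Longrightarrow> x \<in> S \<Longrightarrow> body (cmp (Sets \<kappa>) t s) x = body t (body s x)"
  unfolding hom_Sets by (auto simp: compose_def)

text \<open>From here on no site occurs: of the topos hypothesis only \<open>topos_like\<close> is
  kept.\<close>

locale lc_topos = univ \<kappa> + cat E for \<kappa> :: "'s rel" and E :: "('o, 'a) cat" +
  fixes gup :: "('s set, 's sarrow, 'o, 'a) ftor"
    and gdn gsh :: "('o, 'a, 's set, 's sarrow) ftor"
    and \<eta> :: "'o \<Rightarrow> 'a"
  assumes topos_like: "topos_like E"
    and structure_morphism: "geometric_morphism E (Sets \<kappa>) gup gdn"
    and locally_connected: "adjunction E (Sets \<kappa>) gsh gup \<eta>"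
    and connected: "fully_faithful (Sets \<kappa>) E gup"
begin

sublocale Set: cat "Sets \<kappa>" by unfold_locales (rule category_Sets)

abbreviation g\<gamma> ("\<gamma>") where "\<gamma> S \<equiv> fob gup S"
abbreviation g\<pi> ("\<pi>") where "\<pi> X \<equiv> fob gsh X"
abbreviation one where "one \<equiv> terminal E"

lemmas jepi_factoring = topos_likeD(3)[OF topos_like]

lemma terminal_one: "is_terminal E one"
  unfolding terminal_def by (rule someI_ex[OF topos_likeD(1)[OF topos_like]])

lemma one_ob: "one \<in> ob E" using terminal_one unfolding is_terminal_def by auto

lemma bang_hom: "X \<in> ob E \<Longrightarrow> bang E X \<in> hom E X one"
  using terminal_one theI'[of "\<lambda>f. f \<in> hom E X one"] unfolding is_terminal_def bang_def by auto

lemma one_eq: "f \<in> hom E X one \<Longrightarrow> g \<in> hom E X one \<Longrightarrow> f = g"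
  using terminal_one homD unfolding is_terminal_def by metis

section \<open>Calculus of the chosen pullbacks and products\<close>

lemma pb_pullback:
  assumes "f \<in> hom E x z" "g \<in> hom E y z" shows "is_pullback E f g (pb1 E f g) (pb2 E f g)"
proof -
  have "\<exists>pq. case pq of (p, q) \<Rightarrow> is_pullback E f g p q" using topos_likeD(2)[OF topos_like assms] by auto
  then have "case pb_cone E f g of (p, q) \<Rightarrow> is_pullback E f g p q" unfolding pb_cone_def by (rule someI_ex)
  then show ?thesis unfolding pb1_def pb2_def by (simp add: case_prod_beta)
qed

text \<open>A product is a pullback over \<open>one\<close>, where the commutation condition holds
  automatically.\<close>

lemma is_product_pr:
  assumes x: "x \<in> ob E" and y: "y \<in> ob E" shows "is_product E x y (pr1 E x y) (pr2 E x y)"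
proof -
  note b = bang_hom[OF x] bang_hom[OF y]
  obtain p q where pb: "is_pullback E (bang E x) (bang E y) p q" using topos_likeD(2)[OF topos_like b] by blast
  note P = pullbackD[OF pb b]
  have "is_product E x y p q" unfolding is_product_def
  proof (intro conjI ballI impI)
    fix a b assume "a \<in> ar E" "b \<in> ar E" "src E a = src E b" "tgt E a = x" "tgt E b = y"
    then have a: "a \<in> hom E (src E a) x" and b': "b \<in> hom E (src E a) y" by (auto simp: hom_def)
    show "\<exists>!h. h \<in> hom E (src E a) (src E p) \<and> p \<cdot> h = a \<and> q \<cdot> h = b"
      by (rule P(4)[OF a b' one_eq[OF comp_hom[OF a b(1)] comp_hom[OF b' b(2)]]])
  qed (use P(1,2) in \<open>auto simp: hom_def\<close>)
  then have "\<exists>pq. case pq of (p, q) \<Rightarrow> is_product E x y p q" by auto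
  then have "case prod_cone E x y of (p, q) \<Rightarrow> is_product E x y p q" unfolding prod_cone_def by (rule someI_ex)
  then show ?thesis unfolding pr1_def pr2_def by (simp add: case_prod_beta)
qed

lemma pr_hom:
  assumes "x \<in> ob E" "y \<in> ob E"
  shows "pr1 E x y \<in> hom E (prod_ob E x y) x" "pr2 E x y \<in> hom E (prod_ob E x y) y"
  using is_product_pr[OF assms] unfolding is_product_def prod_ob_def by (auto simp: hom_def)

lemma prod_ob_ob: "x \<in> ob E \<Longrightarrow> y \<in> ob E \<Longrightarrow> prod_ob E x y \<in> ob E"
  using pr_hom homD by blast

lemma prod_univ:
  assumes "a \<in> hom E V x" "b \<in> hom E V y"
  shows "\<exists>!h. h \<in> hom E V (prod_ob E x y) \<and> pr1 E x y \<cdot> h = a \<and> pr2 E x y \<cdot> h = b"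
proof -
  have "x \<in> ob E" "y \<in> ob E" using assms homD by auto
  note P = is_product_pr[OF this, unfolded is_product_def]
  have "\<forall>a\<in>ar E. \<forall>b\<in>ar E. src E a = src E b \<longrightarrow> tgt E a = x \<longrightarrow> tgt E b = y \<longrightarrow>
        (\<exists>!h. h \<in> hom E (src E a) (src E (pr1 E x y)) \<and> pr1 E x y \<cdot> h = a \<and> pr2 E x y \<cdot> h = b)"
    using P by (elim conjE) assumption
  from this[rule_format, of a b] show ?thesis using assms by (simp add: hom_def prod_ob_def)
qed

lemma pairing:
  assumes a: "a \<in> hom E V x" and b: "b \<in> hom E V y"
  shows "pairing E a b \<in> hom E V (prod_ob E x y)" "pr1 E x y \<cdot> pairing E a b = a" "pr2 E x y \<cdot> pairing E a b = b"
proof -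
  have "src E a = V" "tgt E a = x" "tgt E b = y" using a b homD by auto
  then have "pairing E a b \<in> hom E V (prod_ob E x y) \<and> pr1 E x y \<cdot> pairing E a b = a \<and> pr2 E x y \<cdot> pairing E a b = b"
    using theI'[OF prod_univ[OF a b]] unfolding pairing_def by simp
  then show "pairing E a b \<in> hom E V (prod_ob E x y)" "pr1 E x y \<cdot> pairing E a b = a" "pr2 E x y \<cdot> pairing E a b = b"
    by auto
qed

lemma prod_eqI:
  assumes h: "h \<in> hom E V (prod_ob E x y)" and k: "k \<in> hom E V (prod_ob E x y)" and xy: "x \<in> ob E" "y \<in> ob E"
    and e: "pr1 E x y \<cdot> h = pr1 E x y \<cdot> k" "pr2 E x y \<cdot> h = pr2 E x y \<cdot> k"
  shows "h = k"
  using prod_univ[OF comp_hom[OF k pr_hom(1)[OF xy]] comp_hom[OF k pr_hom(2)[OF xy]]] h k e by blast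

lemma pairing_comp:
  assumes a: "a \<in> hom E V x" and b: "b \<in> hom E V y" and v: "v \<in> hom E V' V"
  shows "pairing E a b \<cdot> v = pairing E (a \<cdot> v) (b \<cdot> v)"
proof -
  have xy: "x \<in> ob E" "y \<in> ob E" using a b homD by auto
  note p = pairing[OF a b] and q = pairing[OF comp_hom[OF v a] comp_hom[OF v b]]
  show ?thesis
    by (rule prod_eqI[OF comp_hom[OF v p(1)] q(1) xy])
      (simp_all add: q comp_assoc[OF v p(1) pr_hom(1)[OF xy], symmetric] comp_assoc[OF v p(1) pr_hom(2)[OF xy], symmetric] p)
qed

lemma prod_map:
  assumes f: "f \<in> hom E x x'" and g: "g \<in> hom E y y'"
  shows "prod_map E f g \<in> hom E (prod_ob E x y) (prod_ob E x' y')"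
    and "a \<in> hom E V x \<Longrightarrow> b \<in> hom E V y \<Longrightarrow> prod_map E f g \<cdot> pairing E a b = pairing E (f \<cdot> a) (g \<cdot> b)"
proof -
  have xy: "x \<in> ob E" "y \<in> ob E" "src E f = x" "src E g = y" using f g homD by auto
  have pm: "prod_map E f g = pairing E (f \<cdot> pr1 E x y) (g \<cdot> pr2 E x y)" unfolding prod_map_def using xy by simp
  note p = comp_hom[OF pr_hom(1)[OF xy(1,2)] f] comp_hom[OF pr_hom(2)[OF xy(1,2)] g]
  show "prod_map E f g \<in> hom E (prod_ob E x y) (prod_ob E x' y')" unfolding pm using pairing(1)[OF p] .
  assume a: "a \<in> hom E V x" and b: "b \<in> hom E V y"
  note ab = pairing[OF a b]
  show "prod_map E f g \<cdot> pairing E a b = pairing E (f \<cdot> a) (g \<cdot> b)"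
    unfolding pm pairing_comp[OF p ab(1)]
    using comp_assoc[OF ab(1) pr_hom(1)[OF xy(1,2)] f] comp_assoc[OF ab(1) pr_hom(2)[OF xy(1,2)] g] ab by simp
qed

lemma pairing_eta:
  assumes h: "h \<in> hom E V (prod_ob E x y)" and xy: "x \<in> ob E" "y \<in> ob E"
  shows "h = pairing E (pr1 E x y \<cdot> h) (pr2 E x y \<cdot> h)"
  using prod_eqI[OF h pairing(1)[OF comp_hom[OF h pr_hom(1)[OF xy]] comp_hom[OF h pr_hom(2)[OF xy]]] xy]
    pairing(2,3)[OF comp_hom[OF h pr_hom(1)[OF xy]] comp_hom[OF h pr_hom(2)[OF xy]]] by simp

section \<open>Constant maps, connected objects and components\<close>

lemma gup_functor: "is_functor (Sets \<kappa>) E gup" and gsh_functor: "is_functor E (Sets \<kappa>) gsh"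
  using locally_connected unfolding adjunction_def by auto

lemma \<gamma>_ob: "small \<kappa> S \<Longrightarrow> \<gamma> S \<in> ob E" using gup_functor unfolding is_functor_def by auto

lemma \<gamma>_hom: "t \<in> hom (Sets \<kappa>) S T \<Longrightarrow> far gup t \<in> hom E (\<gamma> S) (\<gamma> T)"
  using gup_functor unfolding is_functor_def hom_def by blast

lemma \<gamma>_comp: "s \<in> hom (Sets \<kappa>) S T \<Longrightarrow> t \<in> hom (Sets \<kappa>) T R \<Longrightarrow> far gup (cmp (Sets \<kappa>) t s) = far gup t \<cdot> far gup s"
  using gup_functor unfolding is_functor_def hom_def by blast

lemma \<pi>_small: "X \<in> ob E \<Longrightarrow> small \<kappa> (\<pi> X)" using gsh_functor unfolding is_functor_def by auto

lemma \<pi>_hom: "f \<in> hom E X Y \<Longrightarrow> far gsh f \<in> hom (Sets \<kappa>) (\<pi> X) (\<pi> Y)"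
  using gsh_functor unfolding is_functor_def hom_def by blast

lemma \<eta>_hom: "X \<in> ob E \<Longrightarrow> \<eta> X \<in> hom E X (\<gamma> (\<pi> X))"
  using locally_connected unfolding adjunction_def nat_trans_def id_ftor_def comp_ftor_def by auto

lemma \<eta>_nat: "f \<in> hom E X Y \<Longrightarrow> \<eta> Y \<cdot> f = far gup (far gsh f) \<cdot> \<eta> X"
  using locally_connected unfolding adjunction_def nat_trans_def id_ftor_def comp_ftor_def by (auto simp: hom_def)

lemma transpose:
  assumes "X \<in> ob E" "small \<kappa> S" "f \<in> hom E X (\<gamma> S)"
  shows "\<exists>!t. t \<in> hom (Sets \<kappa>) (\<pi> X) S \<and> far gup t \<cdot> \<eta> X = f"
  using locally_connected assms unfolding adjunction_def by auto

lemma transpose_eq: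
  assumes "X \<in> ob E" "small \<kappa> S" "f \<in> hom E X (\<gamma> S)" "t \<in> hom (Sets \<kappa>) (\<pi> X) S" "far gup t \<cdot> \<eta> X = f"
    "t' \<in> hom (Sets \<kappa>) (\<pi> X) S" "far gup t' \<cdot> \<eta> X = f"
  shows "t = t'"
  using transpose[OF assms(1-3)] assms(4-7) by blast

text \<open>The map from \<open>V\<close> to \<open>\<gamma> S\<close> with value \<open>s\<close>,
  as the transpose of a constant function. In this form naturality in \<open>V\<close> and in
  \<open>S\<close> follows from that of \<eta>.\<close>

definition const :: "'o \<Rightarrow> 's set \<Rightarrow> 's \<Rightarrow> 'a" where
  "const V S s = far gup (fn (\<pi> V) (\<lambda>_. s) S) \<cdot> \<eta> V"

lemma cfn_hom: "V \<in> ob E \<Longrightarrow> small \<kappa> S \<Longrightarrow> s \<in> S \<Longrightarrow> fn (\<pi> V) (\<lambda>_. s) S \<in> hom (Sets \<kappa>) (\<pi> V) S"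
  by (intro fn_hom \<pi>_small) auto

lemma const_hom: "V \<in> ob E \<Longrightarrow> small \<kappa> S \<Longrightarrow> s \<in> S \<Longrightarrow> const V S s \<in> hom E V (\<gamma> S)"
  unfolding const_def by (rule comp_hom[OF \<eta>_hom \<gamma>_hom[OF cfn_hom]])

lemma const_comp:
  assumes v: "v \<in> hom E V' V" and S: "small \<kappa> S" "s \<in> S"
  shows "const V S s \<cdot> v = const V' S s"
proof -
  have V: "V \<in> ob E" "V' \<in> ob E" using v homD by auto
  note h = \<gamma>_hom[OF cfn_hom[OF V(1) S]] and gv = \<pi>_hom[OF v]
  have e: "cmp (Sets \<kappa>) (fn (\<pi> V) (\<lambda>_. s) S) (far gsh v) = fn (\<pi> V') (\<lambda>_. s) S"
    by (rule hom_Sets_eqI[OF Set.comp_hom[OF gv cfn_hom[OF V(1) S]] cfn_hom[OF V(2) S]])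
      (simp add: cmp_Sets_app[OF gv] hom_Sets_in[OF gv] del: Sets_sel)
  have "const V S s \<cdot> v = far gup (fn (\<pi> V) (\<lambda>_. s) S) \<cdot> (\<eta> V \<cdot> v)"
    unfolding const_def by (rule comp_assoc[OF v \<eta>_hom[OF V(1)] h])
  also have "\<dots> = (far gup (fn (\<pi> V) (\<lambda>_. s) S) \<cdot> far gup (far gsh v)) \<cdot> \<eta> V'"
    unfolding \<eta>_nat[OF v] using comp_assoc[OF \<eta>_hom[OF V(2)] \<gamma>_hom[OF gv] h] by simp
  also have "\<dots> = const V' S s"
    unfolding const_def e[symmetric] \<gamma>_comp[OF gv cfn_hom[OF V(1) S]] ..
  finally show ?thesis .
qed

lemma const_map:
  assumes V: "V \<in> ob E" and S: "small \<kappa> S" "s \<in> S" and t: "t \<in> hom (Sets \<kappa>) S T"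
  shows "far gup t \<cdot> const V S s = const V T (body t s)"
proof -
  have T: "small \<kappa> T" using t hom_Sets by auto
  note c = cfn_hom[OF V S]
  have e: "cmp (Sets \<kappa>) t (fn (\<pi> V) (\<lambda>_. s) S) = fn (\<pi> V) (\<lambda>_. body t s) T"
    by (rule hom_Sets_eqI[OF Set.comp_hom[OF c t] cfn_hom[OF V T hom_Sets_in[OF t S(2)]]])
      (simp add: cmp_Sets_app[OF c] del: Sets_sel)
  show ?thesis unfolding const_def e[symmetric] \<gamma>_comp[OF c t]
    using comp_assoc[OF \<eta>_hom[OF V] \<gamma>_hom[OF c] \<gamma>_hom[OF t]] by simp
qed

lemma const_inj:
  assumes V: "V \<in> ob E" and S: "small \<kappa> S" "s \<in> S" "s' \<in> S" and e: "const V S s = const V S s'" and ne: "\<pi> V \<noteq> {}"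
  shows "s = s'"
proof -
  have "fn (\<pi> V) (\<lambda>_. s) S = fn (\<pi> V) (\<lambda>_. s') S"
    using transpose[OF V S(1) const_hom[OF V S(1,3)]] cfn_hom[OF V S(1,2)] cfn_hom[OF V S(1,3)] e
    unfolding const_def by blast
  then show ?thesis using ne by (metis ex_in_conv fn_app)
qed

text \<open>The transposes are functions on the empty set.\<close>

lemma empty_eq:
  assumes V: "V \<in> ob E" and S: "small \<kappa> S" and e: "\<pi> V = {}" and g: "g \<in> hom E V (\<gamma> S)" and h: "h \<in> hom E V (\<gamma> S)"
  shows "g = h"
proof -
  obtain t t' where t: "t \<in> hom (Sets \<kappa>) (\<pi> V) S" "far gup t \<cdot> \<eta> V = g" "t' \<in> hom (Sets \<kappa>) (\<pi> V) S" "far gup t' \<cdot> \<eta> V = h"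
    using transpose[OF V S g] transpose[OF V S h] by blast
  have "t = t'" by (rule hom_Sets_eqI[OF t(1,3)]) (simp add: e)
  then show ?thesis using t by simp
qed

text \<open>Unlike \<open>connected_object\<close>, which speaks of binary coproduct decompositions,
  this form immediately turns maps from \<open>V\<close> to \<open>\<gamma> S\<close> into elements
  of \<open>S\<close>.\<close>

definition conn :: "'o \<Rightarrow> bool" where "conn V \<longleftrightarrow> V \<in> ob E \<and> (\<exists>x. \<pi> V = {x})"

text \<open>Both the identity of \<open>\<pi> V\<close> and the constant function at
  \<open>j\<close> have transpose \<open>\<eta> V\<close>, so they are equal.\<close>

lemma connI:
  assumes V: "V \<in> ob E" and j: "j \<in> \<pi> V" and e: "\<eta> V = const V (\<pi> V) j"
  shows "conn V"
proof -
  note sm = \<pi>_small[OF V]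
  have id: "idt (Sets \<kappa>) (\<pi> V) \<in> hom (Sets \<kappa>) (\<pi> V) (\<pi> V)" using Set.id_hom sm by auto
  have "far gup (idt (Sets \<kappa>) (\<pi> V)) \<cdot> \<eta> V = \<eta> V"
    using gup_functor sm id_left[OF \<eta>_hom[OF V]] unfolding is_functor_def by auto
  then have eq: "idt (Sets \<kappa>) (\<pi> V) = fn (\<pi> V) (\<lambda>_. j) (\<pi> V)"
    by (intro transpose_eq[OF V sm \<eta>_hom[OF V] id _ cfn_hom[OF V sm j] e[symmetric, unfolded const_def]])
  have "x = j" if x: "x \<in> \<pi> V" for x
  proof -
    have "body (idt (Sets \<kappa>) (\<pi> V)) x = j" unfolding eq using x by simp
    then show ?thesis using x by simp
  qed
  then have "\<pi> V = {j}" using j by blast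
  then show ?thesis unfolding conn_def using V by auto
qed

lemma conn_ob: "conn V \<Longrightarrow> V \<in> ob E" unfolding conn_def by auto

lemma conn_const:
  assumes V: "conn V" and S: "small \<kappa> S" and g: "g \<in> hom E V (\<gamma> S)"
  shows "\<exists>!s. s \<in> S \<and> g = const V S s"
proof -
  obtain x where x: "\<pi> V = {x}" and V': "V \<in> ob E" using V unfolding conn_def by auto
  obtain t where t: "t \<in> hom (Sets \<kappa>) (\<pi> V) S" "far gup t \<cdot> \<eta> V = g" using transpose[OF V' S g] by blast
  have s: "body t x \<in> S" using hom_Sets_in[OF t(1), of x] x by auto
  have "t = fn (\<pi> V) (\<lambda>_. body t x) S"
    by (rule hom_Sets_eqI[OF t(1) cfn_hom[OF V' S s]]) (simp add: x)
  then have "g = const V S (body t x)" unfolding const_def using t by simp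
  then show ?thesis using const_inj[OF V' S] s x by (metis insert_not_empty)
qed

definition val :: "'o \<Rightarrow> 's set \<Rightarrow> 'a \<Rightarrow> 's" where
  "val V S g = (THE s. s \<in> S \<and> g = const V S s)"

lemma val:
  assumes "conn V" "small \<kappa> S" "g \<in> hom E V (\<gamma> S)"
  shows "val V S g \<in> S" "g = const V S (val V S g)"
  using theI'[OF conn_const[OF assms]] unfolding val_def by auto

lemma const_eq_iff:
  assumes "conn V" "small \<kappa> S" "s \<in> S" "s' \<in> S" shows "const V S s = const V S s' \<longleftrightarrow> s = s'"
  using const_inj[of V S s s'] assms unfolding conn_def by auto

lemma val_const: "conn V \<Longrightarrow> small \<kappa> S \<Longrightarrow> s \<in> S \<Longrightarrow> val V S (const V S s) = s"
  using val[of V S "const V S s"] const_hom[OF conn_ob] const_eq_iff by metis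

lemma val_comp:
  assumes "conn V" "conn V'" "small \<kappa> S" "g \<in> hom E V (\<gamma> S)" "v \<in> hom E V' V"
  shows "val V' S (g \<cdot> v) = val V S g"
proof -
  have "g \<cdot> v = const V' S (val V S g)" using val[OF assms(1,3,4)] const_comp[OF assms(5,3)] by metis
  then show ?thesis using val_const[OF assms(2,3) val(1)[OF assms(1,3,4)]] by simp
qed

text \<open>The component of \<open>Y\<close> in which \<open>z : V \<rightarrow> Y\<close> lands.\<close>

definition cpt :: "'a \<Rightarrow> 's" where
  "cpt z = val (src E z) (\<pi> (tgt E z)) (\<eta> (tgt E z) \<cdot> z)"

lemma cpt:
  assumes V: "conn V" and z: "z \<in> hom E V Y"
  shows "cpt z \<in> \<pi> Y" "\<eta> Y \<cdot> z = const V (\<pi> Y) (cpt z)"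
proof -
  have Y: "Y \<in> ob E" using z homD by auto
  show "cpt z \<in> \<pi> Y" "\<eta> Y \<cdot> z = const V (\<pi> Y) (cpt z)"
    using val[OF V \<pi>_small[OF Y] comp_hom[OF z \<eta>_hom[OF Y]]] homD[OF z] unfolding cpt_def by auto
qed

lemma cpt_unique:
  assumes V: "conn V" and z: "z \<in> hom E V Y" and j: "j \<in> \<pi> Y" "\<eta> Y \<cdot> z = const V (\<pi> Y) j"
  shows "cpt z = j"
  using cpt[OF V z] j const_eq_iff[OF V \<pi>_small] homD[OF z] by metis

lemma cpt_comp:
  assumes V: "conn V" "conn V'" and z: "z \<in> hom E V Y" and v: "v \<in> hom E V' V"
  shows "cpt (z \<cdot> v) = cpt z"
proof -
  have Y: "Y \<in> ob E" using z homD by auto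
  have "\<eta> Y \<cdot> (z \<cdot> v) = const V' (\<pi> Y) (cpt z)"
    using comp_assoc[OF v z \<eta>_hom[OF Y]] cpt[OF V(1) z] const_comp[OF v \<pi>_small[OF Y]] by metis
  then show ?thesis using cpt_unique[OF V(2) comp_hom[OF v z] cpt(1)[OF V(1) z]] by simp
qed

lemma cpt_map:
  assumes V: "conn V" and z: "z \<in> hom E V Y" and f: "f \<in> hom E Y Z"
  shows "cpt (f \<cdot> z) = body (far gsh f) (cpt z)"
proof (rule cpt_unique[OF V comp_hom[OF z f]])
  have Y: "Y \<in> ob E" "Z \<in> ob E" using f homD by auto
  note c = cpt[OF V z]
  show "body (far gsh f) (cpt z) \<in> \<pi> Z" using hom_Sets_in[OF \<pi>_hom[OF f] c(1)] .
  show "\<eta> Z \<cdot> (f \<cdot> z) = const V (\<pi> Z) (body (far gsh f) (cpt z))"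
    using comp_assoc[OF z f \<eta>_hom[OF Y(2)]] \<eta>_nat[OF f] comp_assoc[OF z \<eta>_hom[OF Y(1)] \<gamma>_hom[OF \<pi>_hom[OF f]]] c(2)
      const_map[OF conn_ob[OF V] \<pi>_small[OF Y(1)] c(1) \<pi>_hom[OF f]] by metis
qed

definition pt :: "'s \<Rightarrow> 's set \<Rightarrow> 's sarrow" where "pt s S = fn {s} (\<lambda>x. x) S"

lemma pt_hom: "small \<kappa> S \<Longrightarrow> s \<in> S \<Longrightarrow> pt s S \<in> hom (Sets \<kappa>) {s} S"
  unfolding pt_def by (rule fn_hom[OF small_finite]) auto

lemma to_point:
  assumes g: "g \<in> hom E V (\<gamma> {s})" shows "g = const V {s} s"
proof -
  have V: "V \<in> ob E" using g homD by auto
  obtain t where t: "t \<in> hom (Sets \<kappa>) (\<pi> V) {s}" "far gup t \<cdot> \<eta> V = g"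
    using transpose[OF V _ g] small_finite by blast
  have "t = fn (\<pi> V) (\<lambda>_. s) {s}"
    by (rule hom_Sets_eqI[OF t(1) cfn_hom[OF V small_finite]]) (use hom_Sets_in[OF t(1)] in auto)
  then show ?thesis unfolding const_def using t by simp
qed

lemma pt_const:
  assumes S: "small \<kappa> S" "s \<in> S" and g: "g \<in> hom E V (\<gamma> {s})"
  shows "far gup (pt s S) \<cdot> g = const V S s"
  using const_map[OF _ small_finite _ pt_hom[OF S], of V s] to_point[OF g] homD[OF g] unfolding pt_def by simp

text \<open>\<open>gup\<close> is left adjoint to \<open>gdn\<close>, so a map from
  \<open>\<gamma> S\<close> amounts to a function on \<open>S\<close>, and its value at
  \<open>s\<close> depends only on the restriction to the point \<open>s\<close>.\<close>

lemma pt_jepi: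
  assumes S: "small \<kappa> S"
  shows "jepi ((\<lambda>s. far gup (pt s S)) ` S) (\<gamma> S)"
  unfolding jepi_def
proof (intro conjI ballI allI impI)
  show "\<gamma> S \<in> ob E" using \<gamma>_ob S .
  fix k assume "k \<in> (\<lambda>s. far gup (pt s S)) ` S"
  then show "k \<in> ar E" "tgt E k = \<gamma> S" using \<gamma>_hom[OF pt_hom[OF S]] by (auto simp: hom_def)
next
  fix Y g h assume g: "g \<in> hom E (\<gamma> S) Y" and h: "h \<in> hom E (\<gamma> S) Y"
    and eq: "\<forall>k\<in>(\<lambda>s. far gup (pt s S)) ` S. g \<cdot> k = h \<cdot> k"
  have Y: "Y \<in> ob E" using g homD by auto
  obtain \<epsilon> where adj: "adjunction (Sets \<kappa>) E gup gdn \<epsilon>"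
    using structure_morphism unfolding geometric_morphism_def by blast
  have gdn: "is_functor E (Sets \<kappa>) gdn" using adj unfolding adjunction_def by auto
  have gdn_hom: "far gdn f \<in> hom (Sets \<kappa>) (fob gdn x) (fob gdn y)" if "f \<in> hom E x y" for f x y
    using gdn that unfolding is_functor_def hom_def by blast
  have gdn_comp: "far gdn (f' \<cdot> f) = cmp (Sets \<kappa>) (far gdn f') (far gdn f)" if "f \<in> hom E x y" "f' \<in> hom E y z" for f f' x y z
    using gdn that unfolding is_functor_def hom_def by blast
  have \<epsilon>: "\<epsilon> R \<in> hom (Sets \<kappa>) R (fob gdn (\<gamma> R))" if "small \<kappa> R" for R
    using adj that unfolding adjunction_def nat_trans_def id_ftor_def comp_ftor_def by auto
  have \<epsilon>_nat: "cmp (Sets \<kappa>) (\<epsilon> T) t = cmp (Sets \<kappa>) (far gdn (far gup t)) (\<epsilon> R)" if "t \<in> hom (Sets \<kappa>) R T" for t R T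
    using adj that unfolding adjunction_def nat_trans_def id_ftor_def comp_ftor_def by (auto simp: hom_def simp del: Sets_sel(3))
  have un: "\<exists>!g. g \<in> hom E (\<gamma> S) Y \<and> cmp (Sets \<kappa>) (far gdn g) (\<epsilon> S) = f" if "f \<in> hom (Sets \<kappa>) S (fob gdn Y)" for f
    using adj S Y that unfolding adjunction_def by (auto simp del: Sets_sel(3))
  \<comment> \<open>Naturality of the unit \<epsilon> at \<open>pt s S\<close> expresses the
    transpose of \<open>f\<close> at \<open>s\<close> through the restriction of
    \<open>f\<close>.\<close>
  have a: "body (cmp (Sets \<kappa>) (far gdn f) (\<epsilon> S)) s = body (far gdn (f \<cdot> far gup (pt s S))) (body (\<epsilon> {s}) s)"
    if f: "f \<in> hom E (\<gamma> S) Y" and s: "s \<in> S" for f s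
  proof -
    note p = pt_hom[OF S s] and e1 = \<epsilon>[OF small_finite, of "{s}"]
    have "body (\<epsilon> S) s = body (cmp (Sets \<kappa>) (\<epsilon> S) (pt s S)) s"
      using cmp_Sets_app[OF p, of s "\<epsilon> S"] by (simp add: pt_def del: Sets_sel)
    also have "\<dots> = body (far gdn (far gup (pt s S))) (body (\<epsilon> {s}) s)"
      unfolding \<epsilon>_nat[OF p] using cmp_Sets_app[OF e1, of s] by (simp del: Sets_sel)
    finally have "body (\<epsilon> S) s = body (far gdn (far gup (pt s S))) (body (\<epsilon> {s}) s)" .
    moreover have "body (far gdn (f \<cdot> far gup (pt s S))) (body (\<epsilon> {s}) s)
       = body (far gdn f) (body (far gdn (far gup (pt s S))) (body (\<epsilon> {s}) s))"
      unfolding gdn_comp[OF \<gamma>_hom[OF p] f]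
      by (rule cmp_Sets_app[OF gdn_hom[OF \<gamma>_hom[OF p]]]) (use hom_Sets_in[OF e1] in auto)
    ultimately show ?thesis using cmp_Sets_app[OF \<epsilon>[OF S] s] by (simp del: Sets_sel)
  qed
  note ge = Set.comp_hom[OF \<epsilon>[OF S] gdn_hom[OF g]] note he = Set.comp_hom[OF \<epsilon>[OF S] gdn_hom[OF h]]
  have "cmp (Sets \<kappa>) (far gdn g) (\<epsilon> S) = cmp (Sets \<kappa>) (far gdn h) (\<epsilon> S)"
    by (rule hom_Sets_eqI[OF ge he]) (use a[OF g] a[OF h] eq in \<open>simp del: Sets_sel\<close>)
  then show "g = h" using un[OF he] g h by blast
qed

text \<open>The inclusion into \<open>Y\<close> of its component at \<open>j\<close>, namely of the
  pullback of \<open>\<eta> Y\<close> along the point \<open>j\<close>; \<open>cob Y j\<close> is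
  the component itself.\<close>

definition cin :: "'o \<Rightarrow> 's \<Rightarrow> 'a" where "cin Y j = pb2 E (far gup (pt j (\<pi> Y))) (\<eta> Y)"
definition cob :: "'o \<Rightarrow> 's \<Rightarrow> 'o" where "cob Y j = src E (cin Y j)"

lemma cin:
  assumes Y: "Y \<in> ob E" and j: "j \<in> \<pi> Y"
  shows "cin Y j \<in> hom E (cob Y j) Y" "\<eta> Y \<cdot> cin Y j = const (cob Y j) (\<pi> Y) j"
    and "z \<in> hom E Z Y \<Longrightarrow> \<eta> Y \<cdot> z = const Z (\<pi> Y) j \<Longrightarrow> \<exists>!h. h \<in> hom E Z (cob Y j) \<and> cin Y j \<cdot> h = z"
proof -
  note p = \<gamma>_hom[OF pt_hom[OF \<pi>_small[OF Y] j]]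
  note pb = pb_pullback[OF p \<eta>_hom[OF Y]]
  note P = pullbackD[OF pb p \<eta>_hom[OF Y], folded cin_def]
  have s: "src E (pb1 E (far gup (pt j (\<pi> Y))) (\<eta> Y)) = cob Y j" unfolding cob_def using P(2) homD by metis
  note P = P[unfolded s]
  show "cin Y j \<in> hom E (cob Y j) Y" by (rule P(2))
  show "\<eta> Y \<cdot> cin Y j = const (cob Y j) (\<pi> Y) j" using P(3) pt_const[OF \<pi>_small[OF Y] j P(1)] by simp
  assume z: "z \<in> hom E Z Y" and e: "\<eta> Y \<cdot> z = const Z (\<pi> Y) j"
  have Z: "Z \<in> ob E" using z homD by auto
  have c: "const Z {j} j \<in> hom E Z (\<gamma> {j})" by (intro const_hom Z small_finite) auto
  have "far gup (pt j (\<pi> Y)) \<cdot> const Z {j} j = \<eta> Y \<cdot> z" using pt_const[OF \<pi>_small[OF Y] j c] e by simp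
  then obtain h where h: "h \<in> hom E Z (cob Y j)" "cin Y j \<cdot> h = z"
    and un: "\<And>k. k \<in> hom E Z (cob Y j) \<Longrightarrow> pb1 E (far gup (pt j (\<pi> Y))) (\<eta> Y) \<cdot> k = const Z {j} j \<Longrightarrow> cin Y j \<cdot> k = z \<Longrightarrow> k = h"
    using P(4)[OF c z] by blast
  \<comment> \<open>An object has at most one map to \<open>\<gamma> {j}\<close>, so the condition
    on the first projection holds for every \<open>k\<close>, and \<open>cin Y j\<close> alone
    determines the factorisation.\<close>
  have "pb1 E (far gup (pt j (\<pi> Y))) (\<eta> Y) \<cdot> k = const Z {j} j" if "k \<in> hom E Z (cob Y j)" for k
    using to_point comp_hom[OF that P(1)] .
  then show "\<exists>!h. h \<in> hom E Z (cob Y j) \<and> cin Y j \<cdot> h = z" using h un by blast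
qed

lemma cin_mono:
  assumes Y: "Y \<in> ob E" and j: "j \<in> \<pi> Y" and h: "h \<in> hom E Z (cob Y j)" and k: "k \<in> hom E Z (cob Y j)"
    and e: "cin Y j \<cdot> h = cin Y j \<cdot> k"
  shows "h = k"
proof -
  note c = cin[OF Y j]
  have "\<eta> Y \<cdot> (cin Y j \<cdot> k) = const Z (\<pi> Y) j"
    using comp_assoc[OF k c(1) \<eta>_hom[OF Y]] c(2) const_comp[OF k \<pi>_small[OF Y] j] by simp
  then show ?thesis using c(3)[OF comp_hom[OF k c(1)]] h k e by blast
qed

text \<open>The points of \<open>\<gamma> (\<pi> Y)\<close> are jointly epic, and so is their
  inverse image along \<open>\<eta> Y\<close>. Every arrow of the latter factors through a
  component.\<close>

lemma cin_jepi:
  assumes Y: "Y \<in> ob E" shows "jepi (cin Y ` \<pi> Y) Y"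
proof -
  have K: "jepi (factoring ((\<lambda>s. far gup (pt s (\<pi> Y))) ` \<pi> Y) (\<eta> Y)) Y"
    by (rule jepi_factoring[OF pt_jepi[OF \<pi>_small[OF Y]] \<eta>_hom[OF Y]])
  show ?thesis unfolding jepi_def
  proof (intro conjI ballI allI impI Y)
    fix k assume "k \<in> cin Y ` \<pi> Y"
    then show "k \<in> ar E" "tgt E k = Y" using cin(1)[OF Y] by (auto simp: hom_def)
  next
    fix Z g h assume g: "g \<in> hom E Y Z" and h: "h \<in> hom E Y Z" and eq: "\<forall>k\<in>cin Y ` \<pi> Y. g \<cdot> k = h \<cdot> k"
    show "g = h"
    proof (rule jepiD[OF K g h])
      fix l assume l: "l \<in> factoring ((\<lambda>s. far gup (pt s (\<pi> Y))) ` \<pi> Y) (\<eta> Y)"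
      then have l': "l \<in> hom E (src E l) Y" using \<eta>_hom[OF Y] unfolding factoring_def by (auto simp: hom_def)
      obtain j m where j: "j \<in> \<pi> Y" and m: "m \<in> hom E (src E l) (src E (far gup (pt j (\<pi> Y))))"
        and lm: "\<eta> Y \<cdot> l = far gup (pt j (\<pi> Y)) \<cdot> m" using l unfolding factoring_def by auto
      have "m \<in> hom E (src E l) (\<gamma> {j})" using m homD(2)[OF \<gamma>_hom[OF pt_hom[OF \<pi>_small[OF Y] j]]] by simp
      then have "\<eta> Y \<cdot> l = const (src E l) (\<pi> Y) j" using lm pt_const[OF \<pi>_small[OF Y] j] by simp
      then obtain n where n: "n \<in> hom E (src E l) (cob Y j)" "cin Y j \<cdot> n = l" using cin(3)[OF Y j l'] by blast
      have "(g \<cdot> cin Y j) \<cdot> n = (h \<cdot> cin Y j) \<cdot> n" using eq j by simp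
      then show "g \<cdot> l = h \<cdot> l"
        using comp_assoc[OF n(1) cin(1)[OF Y j] g] comp_assoc[OF n(1) cin(1)[OF Y j] h] n(2) by simp
    qed
  qed
qed

text \<open>The set of components of \<open>cob Y j\<close> is inhabited, since otherwise
  \<open>j\<close> would be invisible to maps from \<open>Y\<close> to constant objects; and
  \<open>\<eta>\<close> is constant on \<open>cob Y j\<close>, since it extends to
  \<open>Y\<close>.\<close>

lemma conn_cob:
  assumes Y: "Y \<in> ob E" and j: "j \<in> \<pi> Y" shows "conn (cob Y j)"
proof -
  have cobs: "cob Y k \<in> ob E" if "k \<in> \<pi> Y" for k using cin(1)[OF Y that] homD by auto
  \<comment> \<open>Two functions on \<open>\<pi> Y\<close> that differ only at \<open>j\<close>
    would have transposes that agree on every component, by \<open>empty_eq\<close> also on the one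
    at \<open>j\<close>.\<close>
  have ne: "\<pi> (cob Y j) \<noteq> {}"
  proof
    assume e: "\<pi> (cob Y j) = {}"
    obtain a b :: 's where ab: "a \<noteq> b" using ex_two by blast
    have sm: "small \<kappa> {a, b}" by (simp add: small_finite)
    define t where "t = fn (\<pi> Y) (\<lambda>x. a) {a, b}"
    define t' where "t' = fn (\<pi> Y) (\<lambda>x. if x = j then b else a) {a, b}"
    have t: "t \<in> hom (Sets \<kappa>) (\<pi> Y) {a, b}" "t' \<in> hom (Sets \<kappa>) (\<pi> Y) {a, b}"
      unfolding t_def t'_def by (auto intro!: fn_hom \<pi>_small Y sm)
    note gt = \<gamma>_hom[OF t(1)] \<gamma>_hom[OF t(2)]
    have "far gup t \<cdot> \<eta> Y = far gup t' \<cdot> \<eta> Y"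
    proof (rule jepiD[OF cin_jepi[OF Y] comp_hom[OF \<eta>_hom[OF Y] gt(1)] comp_hom[OF \<eta>_hom[OF Y] gt(2)]])
      fix k assume "k \<in> cin Y ` \<pi> Y"
      then obtain i where i: "i \<in> \<pi> Y" "k = cin Y i" by auto
      note ci = cin[OF Y i(1)]
      have *: "(far gup u \<cdot> \<eta> Y) \<cdot> k = const (cob Y i) {a, b} (body u i)" if "u \<in> hom (Sets \<kappa>) (\<pi> Y) {a, b}" for u
        using comp_assoc[OF ci(1) \<eta>_hom[OF Y] \<gamma>_hom[OF that]] ci(2) const_map[OF cobs[OF i(1)] \<pi>_small[OF Y] i(1) that] i(2) by simp
      show "(far gup t \<cdot> \<eta> Y) \<cdot> k = (far gup t' \<cdot> \<eta> Y) \<cdot> k"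
      proof (cases "i = j")
        case True
        then show ?thesis using empty_eq[OF cobs[OF j] sm e] *[OF t(1)] *[OF t(2)]
            const_hom[OF cobs[OF j] sm hom_Sets_in[OF t(1) j]] const_hom[OF cobs[OF j] sm hom_Sets_in[OF t(2) j]] by metis
      next
        case False
        then show ?thesis using *[OF t(1)] *[OF t(2)] i(1) unfolding t_def t'_def by simp
      qed
    qed
    then have "t = t'" using transpose[OF Y sm comp_hom[OF \<eta>_hom[OF Y] gt(1)]] t by metis
    then have "body t j = body t' j" by simp
    then show False using ab j unfolding t_def t'_def by simp
  qed
  note cj = cin[OF Y j] note Vob = cobs[OF j]
  define V where "V = cob Y j"
  obtain s0 where s0: "s0 \<in> \<pi> V" using ne V_def by auto
  have smV: "small \<kappa> (\<pi> V)" using \<pi>_small[OF Vob] V_def by simp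
  \<comment> \<open>\<open>\<eta> V\<close> is extended to all of \<open>Y\<close> by an arbitrary
    constant on the other components; \<open>s0\<close> is available because \<open>\<pi> V\<close>
    is inhabited.\<close>
  define \<phi> where "\<phi> i = (if i = j then \<eta> V else const (cob Y i) (\<pi> V) s0)" for i
  have \<phi>: "\<phi> i \<in> hom E (cob Y i) (\<gamma> (\<pi> V))" if "i \<in> \<pi> Y" for i
    unfolding \<phi>_def using \<eta>_hom[OF Vob] const_hom[OF cobs[OF that] smV s0] V_def by auto
  have "\<exists>h\<in>hom E Y (\<gamma> (\<pi> V)). \<forall>(k, y)\<in>(\<lambda>i. (cin Y i, \<phi> i)) ` \<pi> Y. h \<cdot> k = y"
  proof (rule topos_likeD(4)[OF topos_like])
    show "\<gamma> (\<pi> V) \<in> ob E" using \<gamma>_ob smV .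
    have "fst ` (\<lambda>i. (cin Y i, \<phi> i)) ` \<pi> Y = cin Y ` \<pi> Y" by force
    then show "jepi (fst ` (\<lambda>i. (cin Y i, \<phi> i)) ` \<pi> Y) Y" using cin_jepi[OF Y] by simp
    fix k y assume "(k, y) \<in> (\<lambda>i. (cin Y i, \<phi> i)) ` \<pi> Y"
    then show "y \<in> hom E (src E k) (\<gamma> (\<pi> V))" using \<phi> homD(2)[OF cin(1)[OF Y]] by auto
  next
    fix k y k' y' a b Z
    assume "(k, y) \<in> (\<lambda>i. (cin Y i, \<phi> i)) ` \<pi> Y" "(k', y') \<in> (\<lambda>i. (cin Y i, \<phi> i)) ` \<pi> Y"
    then obtain i i' where i: "i \<in> \<pi> Y" "k = cin Y i" "y = \<phi> i" and i': "i' \<in> \<pi> Y" "k' = cin Y i'" "y' = \<phi> i'" by auto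
    assume "a \<in> hom E Z (src E k)" "b \<in> hom E Z (src E k')" and eq: "k \<cdot> a = k' \<cdot> b"
    then have a: "a \<in> hom E Z (cob Y i)" and b: "b \<in> hom E Z (cob Y i')" using i i' homD(2)[OF cin(1)[OF Y]] by auto
    have Z: "Z \<in> ob E" using a homD by auto
    show "y \<cdot> a = y' \<cdot> b"
    \<comment> \<open>An overlap \<open>Z\<close> with a component forces \<open>i = i'\<close>,
      because \<open>\<eta> Y\<close> has the constant value \<open>i\<close> and also
      \<open>i'\<close> on it. On an overlap without components all maps to a constant object
      agree.\<close>
    proof (cases "\<pi> Z = {}")
      case True
      then show ?thesis using empty_eq[OF Z smV True] comp_hom[OF a \<phi>[OF i(1)]] comp_hom[OF b \<phi>[OF i'(1)]] i i' by simp
    next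
      case False
      have "const Z (\<pi> Y) i = const Z (\<pi> Y) i'"
        using comp_assoc[OF a cin(1)[OF Y i(1)] \<eta>_hom[OF Y]] comp_assoc[OF b cin(1)[OF Y i'(1)] \<eta>_hom[OF Y]] eq i(2) i'(2)
          cin(2)[OF Y i(1)] cin(2)[OF Y i'(1)] const_comp[OF a \<pi>_small[OF Y] i(1)] const_comp[OF b \<pi>_small[OF Y] i'(1)] by metis
      then have ii: "i = i'" using const_inj[OF Z \<pi>_small[OF Y] i(1) i'(1)] False by simp
      then have "a = b" using cin_mono[OF Y i(1) a] b eq i i' by simp
      then show ?thesis using ii i i' by simp
    qed
  qed
  then obtain h where h: "h \<in> hom E Y (\<gamma> (\<pi> V))" "h \<cdot> cin Y j = \<eta> V" using j unfolding \<phi>_def by fastforce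
  obtain t where t: "t \<in> hom (Sets \<kappa>) (\<pi> Y) (\<pi> V)" "far gup t \<cdot> \<eta> Y = h" using transpose[OF Y smV h(1)] by blast
  \<comment> \<open>The extension \<open>h\<close> factors through \<open>\<eta> Y\<close>, which is
    constant on the component at \<open>j\<close>.\<close>
  have "\<eta> V = const V (\<pi> V) (body t j)"
    using comp_assoc[OF cj(1) \<eta>_hom[OF Y] \<gamma>_hom[OF t(1)]] cj(2) const_map[OF Vob \<pi>_small[OF Y] j t(1)] t(2) h(2) V_def by metis
  then show ?thesis using connI[OF Vob[folded V_def]] hom_Sets_in[OF t(1) j] V_def by simp
qed

lemma conn_factor:
  assumes V: "conn V" and z: "z \<in> hom E V Y"
  shows "\<exists>!h. h \<in> hom E V (cob Y (cpt z)) \<and> cin Y (cpt z) \<cdot> h = z"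
  using cin(3)[OF _ cpt(1)[OF V z] z cpt(2)[OF V z]] homD[OF z] by blast

lemma cpt_cin: "Y \<in> ob E \<Longrightarrow> j \<in> \<pi> Y \<Longrightarrow> cpt (cin Y j) = j"
  using cpt_unique[OF conn_cob] cin(1,2) by blast

section \<open>Density of the connected objects over a cover\<close>

definition cov :: "'o \<Rightarrow> bool" where "cov W \<longleftrightarrow> W \<in> ob E \<and> jepi {bang E W} one"

definition CC :: "'o \<Rightarrow> 'o set" where "CC W = {V. conn V \<and> hom E V W \<noteq> {}}"

lemma CC_conn: "V \<in> CC W \<Longrightarrow> conn V" unfolding CC_def by auto

lemma CC_ob: "V \<in> CC W \<Longrightarrow> V \<in> ob E" using CC_conn conn_ob by auto

lemma CC_cob: "Y \<in> ob E \<Longrightarrow> hom E Y W \<noteq> {} \<Longrightarrow> j \<in> \<pi> Y \<Longrightarrow> cob Y j \<in> CC W"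
  unfolding CC_def using conn_cob cin(1) comp_hom by blast

text \<open>Pulled back to \<open>X\<close>, the cover \<open>W\<close> of \<open>one\<close> gives
  a jointly epic set of arrows from objects \<open>Z\<close> that map to \<open>W\<close>; each
  \<open>Z\<close> is in turn covered by its components.\<close>

lemma generating:
  assumes W: "cov W" and X: "X \<in> ob E"
  shows "jepi {v. src E v \<in> CC W \<and> v \<in> hom E (src E v) X} X"
  unfolding jepi_def
proof (intro conjI ballI allI impI X)
  fix Y g h assume g: "g \<in> hom E X Y" and h: "h \<in> hom E X Y" and eq: "\<forall>k\<in>{v. src E v \<in> CC W \<and> v \<in> hom E (src E v) X}. g \<cdot> k = h \<cdot> k"
  have WW: "W \<in> ob E" "jepi {bang E W} one" using W unfolding cov_def by auto
  show "g = h"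
  proof (rule jepiD[OF jepi_factoring[OF WW(2) bang_hom[OF X]] g h])
    fix l assume l: "l \<in> factoring {bang E W} (bang E X)"
    define Z where "Z = src E l"
    have lh: "l \<in> hom E Z X" and ne: "hom E Z W \<noteq> {}" using l homD[OF bang_hom[OF X]] homD[OF bang_hom[OF WW(1)]]
      unfolding factoring_def Z_def by (auto simp: hom_def)
    have Z: "Z \<in> ob E" using lh homD by auto
    show "g \<cdot> l = h \<cdot> l"
    proof (rule jepiD[OF cin_jepi[OF Z] comp_hom[OF lh g] comp_hom[OF lh h]])
      fix k assume "k \<in> cin Z ` \<pi> Z"
      then obtain j where j: "j \<in> \<pi> Z" "k = cin Z j" by auto
      have k: "k \<in> hom E (cob Z j) Z" using cin(1)[OF Z j(1)] j by simp
      have "g \<cdot> (l \<cdot> k) = h \<cdot> (l \<cdot> k)" using eq comp_hom[OF k lh] CC_cob[OF Z ne j(1)] homD by auto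
      then show "(g \<cdot> l) \<cdot> k = (h \<cdot> l) \<cdot> k" using comp_assoc[OF k lh g] comp_assoc[OF k lh h] by simp
    qed
  qed
qed (auto simp: hom_def)

lemma CC_ext:
  assumes W: "cov W" and f: "f \<in> hom E X Y" and g: "g \<in> hom E X Y" and eq: "\<And>V v. V \<in> CC W \<Longrightarrow> v \<in> hom E V X \<Longrightarrow> f \<cdot> v = g \<cdot> v"
  shows "f = g"
  using jepiD[OF generating[OF W] f g] eq homD[OF f] by blast

text \<open>The maps from \<open>CC W\<close> form an effective family. Compatibility on an
  arbitrary overlap is tested on the maps from \<open>CC W\<close> into that overlap, where it
  follows from naturality.\<close>

lemma CC_dense:
  assumes W: "cov W" and XY: "X \<in> ob E" "Y \<in> ob E"
    and \<alpha>: "\<And>V v. V \<in> CC W \<Longrightarrow> v \<in> hom E V X \<Longrightarrow> \<alpha> v \<in> hom E V Y"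
    and nat: "\<And>V V' v u. V \<in> CC W \<Longrightarrow> V' \<in> CC W \<Longrightarrow> v \<in> hom E V X \<Longrightarrow> u \<in> hom E V' V \<Longrightarrow> \<alpha> (v \<cdot> u) = \<alpha> v \<cdot> u"
  shows "\<exists>f\<in>hom E X Y. \<forall>V\<in>CC W. \<forall>v\<in>hom E V X. f \<cdot> v = \<alpha> v"
proof -
  let ?K = "{v. src E v \<in> CC W \<and> v \<in> hom E (src E v) X}"
  have "\<exists>h\<in>hom E X Y. \<forall>(k, y)\<in>(\<lambda>v. (v, \<alpha> v)) ` ?K. h \<cdot> k = y"
  proof (rule topos_likeD(4)[OF topos_like XY(2)])
    have "fst ` (\<lambda>v. (v, \<alpha> v)) ` ?K = ?K" by force
    then show "jepi (fst ` (\<lambda>v. (v, \<alpha> v)) ` ?K) X" using generating[OF W XY(1)] by simp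
    fix k y assume "(k, y) \<in> (\<lambda>v. (v, \<alpha> v)) ` ?K"
    then show "y \<in> hom E (src E k) Y" using \<alpha> by auto
  next
    fix k y k' y' a b Z
    assume "(k, y) \<in> (\<lambda>v. (v, \<alpha> v)) ` ?K" "(k', y') \<in> (\<lambda>v. (v, \<alpha> v)) ` ?K"
    then have k: "src E k \<in> CC W" "k \<in> hom E (src E k) X" "y = \<alpha> k" and k': "src E k' \<in> CC W" "k' \<in> hom E (src E k') X" "y' = \<alpha> k'"
      by auto
    assume a: "a \<in> hom E Z (src E k)" and b: "b \<in> hom E Z (src E k')" and eq: "k \<cdot> a = k' \<cdot> b"
    note y = \<alpha>[OF k(1,2)] \<alpha>[OF k'(1,2)]
    have "\<alpha> k \<cdot> a = \<alpha> k' \<cdot> b"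
    proof (rule CC_ext[OF W comp_hom[OF a y(1)] comp_hom[OF b y(2)]])
      fix V v assume V: "V \<in> CC W" and v: "v \<in> hom E V Z"
      have "\<alpha> k \<cdot> (a \<cdot> v) = \<alpha> k' \<cdot> (b \<cdot> v)"
        using nat[OF k(1) V k(2) comp_hom[OF v a]] nat[OF k'(1) V k'(2) comp_hom[OF v b]]
          comp_assoc[OF v a k(2)] comp_assoc[OF v b k'(2)] eq by simp
      then show "(\<alpha> k \<cdot> a) \<cdot> v = (\<alpha> k' \<cdot> b) \<cdot> v" using comp_assoc[OF v a y(1)] comp_assoc[OF v b y(2)] by simp
    qed
    then show "y \<cdot> a = y' \<cdot> b" using k k' by simp
  qed
  then obtain h where h: "h \<in> hom E X Y" "\<forall>(k, y)\<in>(\<lambda>v. (v, \<alpha> v)) ` ?K. h \<cdot> k = y" by blast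
  have "h \<cdot> v = \<alpha> v" if "V \<in> CC W" "v \<in> hom E V X" for V v using h(2) that homD(2)[OF that(2)] by fastforce
  then show ?thesis using h(1) by blast
qed

text \<open>The unique preimages under \<open>f\<close> form a natural family, which density turns
  into the inverse.\<close>

lemma CC_iso:
  assumes W: "cov W" and f: "f \<in> hom E X Y" and bij: "\<And>V. V \<in> CC W \<Longrightarrow> bij_betw (\<lambda>v. f \<cdot> v) (hom E V X) (hom E V Y)"
  shows "iso E f"
proof -
  have XY: "X \<in> ob E" "Y \<in> ob E" using f homD by auto
  define \<alpha> where "\<alpha> y = (THE x. x \<in> hom E (src E y) X \<and> f \<cdot> x = y)" for y
  have un: "\<exists>!x. x \<in> hom E V X \<and> f \<cdot> x = y" if "V \<in> CC W" "y \<in> hom E V Y" for V y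
  proof -
    note b = bij[OF that(1)] and y = that(2)
    have "y \<in> (\<lambda>v. f \<cdot> v) ` hom E V X" using b y by (simp only: bij_betw_def)
    then obtain x where "x \<in> hom E V X" "f \<cdot> x = y" by auto
    then show ?thesis using inj_onD[OF bij_betw_imp_inj_on[OF b]] by (intro ex1I[of _ x]) auto
  qed
  have \<alpha>: "\<alpha> y \<in> hom E V X" "f \<cdot> \<alpha> y = y" if "V \<in> CC W" "y \<in> hom E V Y" for V y
    using theI'[OF un[OF that]] homD(2)[OF that(2)] unfolding \<alpha>_def by auto
  have "\<alpha> (y \<cdot> u) = \<alpha> y \<cdot> u" if V: "V \<in> CC W" "V' \<in> CC W" and y: "y \<in> hom E V Y" and u: "u \<in> hom E V' V" for V V' y u
    using un[OF V(2) comp_hom[OF u y]] \<alpha>[OF V(2) comp_hom[OF u y]] comp_hom[OF u \<alpha>(1)[OF V(1) y]]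
       comp_assoc[OF u \<alpha>(1)[OF V(1) y] f] \<alpha>(2)[OF V(1) y] by metis
  then obtain g where g: "g \<in> hom E Y X" "\<And>V v. V \<in> CC W \<Longrightarrow> v \<in> hom E V Y \<Longrightarrow> g \<cdot> v = \<alpha> v"
    using CC_dense[OF W XY(2,1), of \<alpha>] \<alpha>(1) by blast
  have "f \<cdot> g = idt E Y"
    by (rule CC_ext[OF W comp_hom[OF g(1) f] id_hom[OF XY(2)]])
      (simp add: comp_assoc[OF _ g(1) f] g(2) \<alpha>(2) id_left)
  moreover have "g \<cdot> f = idt E X"
  proof (rule CC_ext[OF W comp_hom[OF f g(1)] id_hom[OF XY(1)]])
    fix V v assume V: "V \<in> CC W" and v: "v \<in> hom E V X"
    have "\<alpha> (f \<cdot> v) = v" using un[OF V comp_hom[OF v f]] \<alpha>[OF V comp_hom[OF v f]] v by blast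
    then show "(g \<cdot> f) \<cdot> v = idt E X \<cdot> v" using comp_assoc[OF v f g(1)] g(2)[OF V comp_hom[OF v f]] id_left[OF v] by simp
  qed
  ultimately show ?thesis using isoI[OF f g(1)] by blast
qed

text \<open>Replaces a subobject classifier for complemented subobjects: invariance of
  \<open>T\<close> in both directions is what makes the two labels a natural family.\<close>

lemma CC_indicator:
  assumes W: "cov W" and X: "X \<in> ob E" and S: "small \<kappa> S" "a \<in> S" "b \<in> S"
    and T: "\<And>V V' v u. V \<in> CC W \<Longrightarrow> V' \<in> CC W \<Longrightarrow> v \<in> hom E V X \<Longrightarrow> u \<in> hom E V' V \<Longrightarrow> T (v \<cdot> u) \<longleftrightarrow> T v"
  shows "\<exists>f\<in>hom E X (\<gamma> S). \<forall>V\<in>CC W. \<forall>v\<in>hom E V X. f \<cdot> v = const V S (if T v then a else b)"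
proof -
  define \<alpha> where "\<alpha> v = const (src E v) S (if T v then a else b)" for v
  have "\<exists>f\<in>hom E X (\<gamma> S). \<forall>V\<in>CC W. \<forall>v\<in>hom E V X. f \<cdot> v = \<alpha> v"
  proof (rule CC_dense[OF W X \<gamma>_ob[OF S(1)]])
    fix V v assume "V \<in> CC W" "v \<in> hom E V X"
    then show "\<alpha> v \<in> hom E V (\<gamma> S)" unfolding \<alpha>_def using S const_hom[OF CC_ob] homD(2) by auto
  next
    fix V V' v u assume h: "V \<in> CC W" "V' \<in> CC W" "v \<in> hom E V X" "u \<in> hom E V' V"
    then show "\<alpha> (v \<cdot> u) = \<alpha> v \<cdot> u"
      unfolding \<alpha>_def using T[OF h] const_comp[OF h(4) S(1)] S(2,3) homD(2)[OF h(3)] homD(2)[OF comp_hom[OF h(4,3)]] by auto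
  qed
  then obtain f where f: "f \<in> hom E X (\<gamma> S)" "\<forall>V\<in>CC W. \<forall>v\<in>hom E V X. f \<cdot> v = \<alpha> v" by blast
  have "f \<cdot> v = const V S (if T v then a else b)" if "V \<in> CC W" "v \<in> hom E V X" for V v
    using f(2) that homD(2)[OF that(2)] unfolding \<alpha>_def by auto
  then show ?thesis using f(1) by blast
qed

text \<open>\<open>gup\<close> preserves the terminal object, so a map from \<open>one\<close> to
  \<open>\<gamma> (\<pi> one)\<close> is a map between constant objects; by fullness it comes from a
  point of \<open>\<pi> one\<close>, and \<open>connI\<close> applies to
  \<open>\<eta> one\<close>.\<close>

lemma conn_one: "conn one"
proof -
  obtain s0 :: 's where True by simp
  have tm: "is_terminal (Sets \<kappa>) {s0}"
    unfolding is_terminal_def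
  proof (intro conjI ballI)
    show "{s0} \<in> ob (Sets \<kappa>)" by (simp add: small_finite)
    fix S :: "'s set" assume "S \<in> ob (Sets \<kappa>)"
    then have S: "small \<kappa> S" by simp
    have f: "fn S (\<lambda>_. s0) {s0} \<in> hom (Sets \<kappa>) S {s0}" by (intro fn_hom S small_finite) auto
    show "\<exists>!f. f \<in> hom (Sets \<kappa>) S {s0}"
    proof (rule ex1I[of _ "fn S (\<lambda>_. s0) {s0}"], rule f)
      fix g assume g: "g \<in> hom (Sets \<kappa>) S {s0}"
      show "g = fn S (\<lambda>_. s0) {s0}" by (rule hom_Sets_eqI[OF g f]) (use hom_Sets_in[OF g] hom_Sets_in[OF f] in auto)
    qed
  qed
  have t: "is_terminal E (\<gamma> {s0})"
    using structure_morphism tm unfolding geometric_morphism_def left_exact_def by blast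
  have s0: "small \<kappa> {s0}" by (simp add: small_finite)
  obtain u where u: "u \<in> hom E one (\<gamma> {s0})" using t one_ob unfolding is_terminal_def by blast
  note b = bang_hom[OF \<gamma>_ob[OF s0]]
  have bu: "bang E (\<gamma> {s0}) \<cdot> u = idt E one" by (rule one_eq[OF comp_hom[OF u b] id_hom[OF one_ob]])
  note sm = \<pi>_small[OF one_ob]
  note e1 = comp_hom[OF b \<eta>_hom[OF one_ob]]
  \<comment> \<open>This uses that \<open>gup\<close> is full.\<close>
  obtain t where t: "t \<in> hom (Sets \<kappa>) {s0} (\<pi> one)" "far gup t = \<eta> one \<cdot> bang E (\<gamma> {s0})"
    using connected e1 s0 sm unfolding fully_faithful_def bij_betw_def by (metis (no_types, lifting) imageE ob_Sets)
  define j where "j = body t s0"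
  have j: "j \<in> \<pi> one" unfolding j_def using hom_Sets_in[OF t(1)] by auto
  have "\<eta> one = (\<eta> one \<cdot> bang E (\<gamma> {s0})) \<cdot> u"
    using comp_assoc[OF u b \<eta>_hom[OF one_ob]] bu id_right[OF \<eta>_hom[OF one_ob]] by simp
  also have "\<dots> = const one (\<pi> one) j"
    unfolding t(2)[symmetric] to_point[OF u] j_def using const_map[OF one_ob s0 _ t(1)] by simp
  finally have e: "\<eta> one = const one (\<pi> one) j" .
  show ?thesis by (rule connI[OF one_ob j e])
qed

text \<open>The indicator of \<open>T\<close> is a map from \<open>one\<close> to a constant object,
  hence constant because \<open>one\<close> is connected. This takes the place of joining objects of
  \<open>CC W\<close> by zigzags.\<close>

lemma CC_connected:
  assumes W: "cov W" and T: "\<And>V V' u. V \<in> CC W \<Longrightarrow> V' \<in> CC W \<Longrightarrow> u \<in> hom E V' V \<Longrightarrow> T V' \<longleftrightarrow> T V"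
    and V0: "V0 \<in> CC W" "T V0" and V: "V \<in> CC W"
  shows "T V"
proof -
  obtain a b :: 's where ab: "a \<noteq> b" using ex_two by blast
  have sm: "small \<kappa> {a, b}" by (simp add: small_finite)
  obtain f where f: "f \<in> hom E one (\<gamma> {a, b})"
    "\<And>V v. V \<in> CC W \<Longrightarrow> v \<in> hom E V one \<Longrightarrow> f \<cdot> v = const V {a, b} (if T (src E v) then a else b)"
  proof -
    have "\<exists>f\<in>hom E one (\<gamma> {a, b}). \<forall>V\<in>CC W. \<forall>v\<in>hom E V one. f \<cdot> v = const V {a, b} (if T (src E v) then a else b)"
    proof (rule CC_indicator[OF W one_ob sm])
      fix V V' v u assume h: "V \<in> CC W" "V' \<in> CC W" "v \<in> hom E V one" "u \<in> hom E V' V"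
      show "T (src E (v \<cdot> u)) \<longleftrightarrow> T (src E v)"
        using T[OF h(1,2,4)] homD(2)[OF h(3)] homD(2)[OF comp_hom[OF h(4,3)]] by simp
    qed auto
    then show thesis using that by blast
  qed
  define s where "s = val one {a, b} f"
  have s: "f = const one {a, b} s" "s \<in> {a, b}" using val[OF conn_one sm f(1)] s_def by auto
  have "s = (if T V then a else b)" if V: "V \<in> CC W" for V
  proof -
    note v = bang_hom[OF CC_ob[OF V]]
    have "const V {a, b} s = const V {a, b} (if T V then a else b)"
      using f(2)[OF V v] const_comp[OF v sm s(2)] s(1) homD(2)[OF v] by simp
    then show ?thesis using const_eq_iff[OF CC_conn[OF V] sm s(2)] by simp
  qed
  then show ?thesis using V0 V ab by metis
qed

text \<open>Without connected objects over \<open>W\<close>, any two parallel maps would agree, in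
  particular two different constants on \<open>one\<close>.\<close>

lemma CC_nonempty:
  assumes W: "cov W" shows "\<exists>V. V \<in> CC W"
proof (rule ccontr)
  assume n: "\<nexists>V. V \<in> CC W"
  obtain a b :: 's where ab: "a \<noteq> b" using ex_two by blast
  have sm: "small \<kappa> {a, b}" by (simp add: small_finite)
  have "const one {a, b} a = const one {a, b} b"
    by (rule CC_ext[OF W const_hom[OF one_ob sm] const_hom[OF one_ob sm]]) (use n in auto)
  then show False using const_eq_iff[OF conn_one sm] ab by auto
qed

text \<open>The empty family of components is jointly epic; effectiveness for it gives existence,
  joint epimorphy gives uniqueness.\<close>

lemma empty_initial:
  assumes X: "X \<in> ob E" and e: "\<pi> X = {}" shows "is_initial E X"
  unfolding is_initial_def
proof (intro conjI ballI X)
  fix Y assume Y: "Y \<in> ob E"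
  have J: "jepi {} X" using cin_jepi[OF X] e by simp
  have "\<exists>h\<in>hom E X Y. \<forall>(k, y)\<in>{}. h \<cdot> k = y"
    by (rule topos_likeD(4)[OF topos_like Y]) (use J in auto)
  then show "\<exists>!f. f \<in> hom E X Y" using jepiD[OF J] by blast
qed

end

section \<open>Split objects invert connected objects over the cover\<close>

context lc_topos begin

definition spl :: "'o \<Rightarrow> 'o \<Rightarrow> bool" where
  "spl W X \<longleftrightarrow> X \<in> ob E \<and> (\<forall>V\<in>CC W. small \<kappa> (hom E V X)) \<and>
     (\<forall>V\<in>CC W. \<forall>V'\<in>CC W. \<forall>u\<in>hom E V' V. bij_betw (\<lambda>x. x \<cdot> u) (hom E V X) (hom E V' X))"

lemma spl_lift:
  assumes "spl W X" "V \<in> CC W" "V' \<in> CC W" "u \<in> hom E V' V" "y \<in> hom E V' X"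
  shows "\<exists>!x. x \<in> hom E V X \<and> x \<cdot> u = y"
proof -
  have b: "bij_betw (\<lambda>x. x \<cdot> u) (hom E V X) (hom E V' X)" using assms unfolding spl_def by blast
  then have "y \<in> (\<lambda>x. x \<cdot> u) ` hom E V X" using assms(5) by (simp only: bij_betw_def)
  then obtain x where "x \<in> hom E V X" "x \<cdot> u = y" by auto
  then show ?thesis using inj_onD[OF bij_betw_imp_inj_on[OF b]] by (intro ex1I[of _ x]) auto
qed

text \<open>\<open>X\<close> is trivialised over each \<open>V\<close> by a set \<open>S\<close>,
  naturally in the objects over \<open>V\<close>. Comparing the bijections at \<open>idt E V\<close>
  and at \<open>u\<close> shows that precomposition with \<open>u\<close> is bijective.\<close>

lemma splI:
  assumes X: "X \<in> ob E"
    and \<beta>: "\<And>V. V \<in> CC W \<Longrightarrow> \<exists>(S :: 's set) \<beta>. small \<kappa> S \<and>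
      (\<forall>V'\<in>CC W. \<forall>v\<in>hom E V' V. bij_betw (\<beta> v) S (hom E V' X) \<and> (\<forall>s\<in>S. \<beta> v s = \<beta> (idt E V) s \<cdot> v))"
  shows "spl W X"
  unfolding spl_def
proof (intro conjI ballI X)
  fix V assume V: "V \<in> CC W"
  obtain S :: "'s set" and \<beta> where S: "small \<kappa> S" and
    b: "\<And>V' v. V' \<in> CC W \<Longrightarrow> v \<in> hom E V' V \<Longrightarrow> bij_betw (\<beta> v) S (hom E V' X)"
    and n: "\<And>V' v s. V' \<in> CC W \<Longrightarrow> v \<in> hom E V' V \<Longrightarrow> s \<in> S \<Longrightarrow> \<beta> v s = \<beta> (idt E V) s \<cdot> v"
    using \<beta>[OF V] by blast
  have id: "idt E V \<in> hom E V V" using id_hom CC_ob V by auto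
  show "small \<kappa> (hom E V X)" using small_bij[OF b[OF V id]] S by simp
  fix V' u assume V': "V' \<in> CC W" "u \<in> hom E V' V"
  have "bij_betw ((\<lambda>x. x \<cdot> u) \<circ> \<beta> (idt E V)) S (hom E V' X)"
    using b[OF V'] bij_betw_cong[of S "\<beta> u" "(\<lambda>x. x \<cdot> u) \<circ> \<beta> (idt E V)"] n[OF V'] by simp
  then show "bij_betw (\<lambda>x. x \<cdot> u) (hom E V X) (hom E V' X)"
    using bij_betw_comp_iff[OF b[OF V id]] by blast
qed

text \<open>Over a connected \<open>V\<close> with a map to some \<open>U i\<close>, the isomorphism
  \<theta> identifies the maps from \<open>V\<close> to \<open>X\<close> with those to
  \<open>\<gamma> S\<close>, which are the elements of \<open>S\<close>.\<close>

lemma split_object_spl: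
  assumes U: "\<And>i. i \<in> I \<Longrightarrow> U i \<in> ob E" and H: "\<And>V. V \<in> CC W \<Longrightarrow> \<exists>i\<in>I. hom E V (U i) \<noteq> {}"
    and X: "split_object \<kappa> E gup I U X"
  shows "spl W X"
proof (rule splI)
  show Xo: "X \<in> ob E" using X unfolding split_object_def by auto
  fix V assume V: "V \<in> CC W"
  obtain i u where i: "i \<in> I" and u: "u \<in> hom E V (U i)" using H[OF V] by blast
  obtain S \<theta> where S: "small \<kappa> S" and \<theta>: "\<theta> \<in> hom E (prod_ob E (\<gamma> S) (U i)) (prod_ob E X (U i))"
     "iso E \<theta>" "pr2 E X (U i) \<cdot> \<theta> = pr2 E (\<gamma> S) (U i)"
    using X i unfolding split_object_def by blast
  note Ui = U[OF i] and gS = \<gamma>_ob[OF S]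
  note p1 = pr_hom(1)[OF Xo Ui] and p2 = pr_hom(2)[OF Xo Ui] and q1 = pr_hom(1)[OF gS Ui] and q2 = pr_hom(2)[OF gS Ui]
  \<comment> \<open>The \<open>X\<close>-coordinate of \<theta> at the point \<open>s\<close> over
    \<open>u \<cdot> v\<close>.\<close>
  define \<beta> where "\<beta> v s = pr1 E X (U i) \<cdot> (\<theta> \<cdot> pairing E (const (src E v) S s) (u \<cdot> v))" for v s
  have pair: "pairing E (const V' S s) (u \<cdot> v) \<in> hom E V' (prod_ob E (\<gamma> S) (U i))"
    "\<theta> \<cdot> pairing E (const V' S s) (u \<cdot> v) = pairing E (\<beta> v s) (u \<cdot> v)" "\<beta> v s \<in> hom E V' X"
    if V': "V' \<in> CC W" and v: "v \<in> hom E V' V" and s: "s \<in> S" for V' v s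
  proof -
    note P = pairing[OF const_hom[OF CC_ob[OF V'] S s] comp_hom[OF v u]]
    show "pairing E (const V' S s) (u \<cdot> v) \<in> hom E V' (prod_ob E (\<gamma> S) (U i))" by (rule P)
    note tP = comp_hom[OF P(1) \<theta>(1)]
    have b: "\<beta> v s = pr1 E X (U i) \<cdot> (\<theta> \<cdot> pairing E (const V' S s) (u \<cdot> v))" unfolding \<beta>_def using homD(2)[OF v] by simp
    show "\<beta> v s \<in> hom E V' X" unfolding b by (rule comp_hom[OF tP p1])
    have "pr2 E X (U i) \<cdot> (\<theta> \<cdot> pairing E (const V' S s) (u \<cdot> v)) = u \<cdot> v"
      using comp_assoc[OF P(1) \<theta>(1) p2] \<theta>(3) P(3) by simp
    then show "\<theta> \<cdot> pairing E (const V' S s) (u \<cdot> v) = pairing E (\<beta> v s) (u \<cdot> v)"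
      using pairing_eta[OF tP Xo Ui] b by simp
  qed
  show "\<exists>(S :: 's set) \<beta>. small \<kappa> S \<and>
      (\<forall>V'\<in>CC W. \<forall>v\<in>hom E V' V. bij_betw (\<beta> v) S (hom E V' X) \<and> (\<forall>s\<in>S. \<beta> v s = \<beta> (idt E V) s \<cdot> v))"
  proof (intro exI conjI ballI)
    show "small \<kappa> S" by fact
    fix V' v assume V': "V' \<in> CC W" and v: "v \<in> hom E V' V"
    show "bij_betw (\<beta> v) S (hom E V' X)"
      unfolding bij_betw_def
    proof (intro conjI inj_onI set_eqI iffI)
      fix s s' assume s: "s \<in> S" "s' \<in> S" and e: "\<beta> v s = \<beta> v s'"
      have "pairing E (const V' S s) (u \<cdot> v) = pairing E (const V' S s') (u \<cdot> v)"
        using iso_mono[OF \<theta>(2,1) pair(1)[OF V' v s(1)] pair(1)[OF V' v s(2)]] pair(2)[OF V' v s(1)] pair(2)[OF V' v s(2)] e by simp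
      then have "const V' S s = const V' S s'"
        using pairing(2)[OF const_hom[OF CC_ob[OF V'] S s(1)] comp_hom[OF v u]]
          pairing(2)[OF const_hom[OF CC_ob[OF V'] S s(2)] comp_hom[OF v u]] by metis
      then show "s = s'" using const_eq_iff[OF CC_conn[OF V'] S s] by simp
    next
      fix x assume "x \<in> \<beta> v ` S" then show "x \<in> hom E V' X" using pair(3)[OF V' v] by auto
    next
      fix x assume x: "x \<in> hom E V' X"
      note xu = pairing[OF x comp_hom[OF v u]]
      obtain t where t: "t \<in> hom E (prod_ob E X (U i)) (prod_ob E (\<gamma> S) (U i))" "\<theta> \<cdot> t = idt E (prod_ob E X (U i))"
        using iso_inverse[OF \<theta>(2,1)] by metis
      define y where "y = t \<cdot> pairing E x (u \<cdot> v)"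
      have y: "y \<in> hom E V' (prod_ob E (\<gamma> S) (U i))" unfolding y_def by (rule comp_hom[OF xu(1) t(1)])
      have ty: "\<theta> \<cdot> y = pairing E x (u \<cdot> v)"
        unfolding y_def using comp_assoc[OF xu(1) t(1) \<theta>(1)] t(2) id_left[OF xu(1)] by simp
      define s where "s = val V' S (pr1 E (\<gamma> S) (U i) \<cdot> y)"
      have s: "s \<in> S" "pr1 E (\<gamma> S) (U i) \<cdot> y = const V' S s"
        using val[OF CC_conn[OF V'] S comp_hom[OF y q1]] s_def by auto
      have "pr2 E (\<gamma> S) (U i) \<cdot> y = u \<cdot> v" using comp_assoc[OF y \<theta>(1) p2] \<theta>(3) ty xu(3) by simp
      then have "y = pairing E (const V' S s) (u \<cdot> v)" using pairing_eta[OF y gS Ui] s(2) by simp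
      then have "pairing E x (u \<cdot> v) = pairing E (\<beta> v s) (u \<cdot> v)" using pair(2)[OF V' v s(1)] ty by simp
      then have "x = \<beta> v s" using xu(2) pairing(2)[OF pair(3)[OF V' v s(1)] comp_hom[OF v u]] by metis
      then show "x \<in> \<beta> v ` S" using s(1) by auto
    qed
    fix s assume s: "s \<in> S"
    have V'': "idt E V \<in> hom E V V" using id_hom CC_ob[OF V] by auto
    note P = pairing[OF const_hom[OF CC_ob[OF V] S s] u]
    have "\<beta> (idt E V) s \<cdot> v = (pr1 E X (U i) \<cdot> (\<theta> \<cdot> pairing E (const V S s) u)) \<cdot> v"
      unfolding \<beta>_def using homD(2)[OF V''] id_right[OF u] by simp
    also have "\<dots> = pr1 E X (U i) \<cdot> (\<theta> \<cdot> (pairing E (const V S s) u \<cdot> v))"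
      using comp_assoc[OF v comp_hom[OF P(1) \<theta>(1)] p1] comp_assoc[OF v P(1) \<theta>(1)] by simp
    also have "\<dots> = \<beta> v s"
      unfolding \<beta>_def pairing_comp[OF const_hom[OF CC_ob[OF V] S s] u v] const_comp[OF v S s] homD(2)[OF v] ..
    finally show "\<beta> v s = \<beta> (idt E V) s \<cdot> v" ..
  qed
qed

text \<open>Converse to the passage from \<theta> to bijections: a natural family of bijections over
  the maps from \<open>CC W\<close> to \<open>B\<close> glues to a map \<theta> by density, and
  \<open>CC_iso\<close> makes it an isomorphism.\<close>

lemma trivialize:
  assumes W: "cov W" and X: "X \<in> ob E" and B: "B \<in> ob E" and S: "small \<kappa> S"
    and bij: "\<And>V b. V \<in> CC W \<Longrightarrow> b \<in> hom E V B \<Longrightarrow> bij_betw (\<beta> b) S (hom E V X)"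
    and nat: "\<And>V V' b u s. V \<in> CC W \<Longrightarrow> V' \<in> CC W \<Longrightarrow> b \<in> hom E V B \<Longrightarrow> u \<in> hom E V' V \<Longrightarrow> s \<in> S \<Longrightarrow> \<beta> (b \<cdot> u) s = \<beta> b s \<cdot> u"
  shows "\<exists>\<theta>\<in>hom E (prod_ob E (\<gamma> S) B) (prod_ob E X B). iso E \<theta> \<and> pr2 E X B \<cdot> \<theta> = pr2 E (\<gamma> S) B"
proof -
  note gS = \<gamma>_ob[OF S]
  note p1 = pr_hom(1)[OF X B] and p2 = pr_hom(2)[OF X B] and q1 = pr_hom(1)[OF gS B] and q2 = pr_hom(2)[OF gS B]
  \<comment> \<open>A map \<open>z\<close> from a connected object is a pair of an element
    \<open>s\<close> and a map \<open>b\<close> to \<open>B\<close>; it is sent to the pair of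
    \<open>\<beta> b s\<close> and \<open>b\<close>.\<close>
  define \<alpha> where "\<alpha> z = pairing E (\<beta> (pr2 E (\<gamma> S) B \<cdot> z) (val (src E z) S (pr1 E (\<gamma> S) B \<cdot> z))) (pr2 E (\<gamma> S) B \<cdot> z)" for z
  have \<beta>h: "\<beta> b s \<in> hom E V X" if "V \<in> CC W" "b \<in> hom E V B" "s \<in> S" for V b s
    using bij[OF that(1,2)] that(3) unfolding bij_betw_def by auto
  have z: "val V S (pr1 E (\<gamma> S) B \<cdot> z) \<in> S" "pr1 E (\<gamma> S) B \<cdot> z = const V S (val V S (pr1 E (\<gamma> S) B \<cdot> z))"
     "pr2 E (\<gamma> S) B \<cdot> z \<in> hom E V B" 
     "\<beta> (pr2 E (\<gamma> S) B \<cdot> z) (val V S (pr1 E (\<gamma> S) B \<cdot> z)) \<in> hom E V X"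
     "\<alpha> z = pairing E (\<beta> (pr2 E (\<gamma> S) B \<cdot> z) (val V S (pr1 E (\<gamma> S) B \<cdot> z))) (pr2 E (\<gamma> S) B \<cdot> z)"
     "\<alpha> z \<in> hom E V (prod_ob E X B)"
    if V: "V \<in> CC W" and z: "z \<in> hom E V (prod_ob E (\<gamma> S) B)" for V z
  proof -
    note v = val[OF CC_conn[OF V] S comp_hom[OF z q1]]
    show 1: "val V S (pr1 E (\<gamma> S) B \<cdot> z) \<in> S" "pr1 E (\<gamma> S) B \<cdot> z = const V S (val V S (pr1 E (\<gamma> S) B \<cdot> z))" by (rule v)+
    show 2: "pr2 E (\<gamma> S) B \<cdot> z \<in> hom E V B" by (rule comp_hom[OF z q2])
    show 3: "\<beta> (pr2 E (\<gamma> S) B \<cdot> z) (val V S (pr1 E (\<gamma> S) B \<cdot> z)) \<in> hom E V X" by (rule \<beta>h[OF V 2 1(1)])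
    show 4: "\<alpha> z = pairing E (\<beta> (pr2 E (\<gamma> S) B \<cdot> z) (val V S (pr1 E (\<gamma> S) B \<cdot> z))) (pr2 E (\<gamma> S) B \<cdot> z)"
      unfolding \<alpha>_def homD(2)[OF z] ..
    show "\<alpha> z \<in> hom E V (prod_ob E X B)" unfolding 4 by (rule pairing(1)[OF 3 2])
  qed
  have "\<exists>f\<in>hom E (prod_ob E (\<gamma> S) B) (prod_ob E X B). \<forall>V\<in>CC W. \<forall>v\<in>hom E V (prod_ob E (\<gamma> S) B). f \<cdot> v = \<alpha> v"
  proof (rule CC_dense[OF W prod_ob_ob[OF gS B] prod_ob_ob[OF X B] z(6)])
    fix V V' v u assume V: "V \<in> CC W" and V': "V' \<in> CC W" and v: "v \<in> hom E V (prod_ob E (\<gamma> S) B)" and u: "u \<in> hom E V' V"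
    note zv = z[OF V v] and zu = z[OF V' comp_hom[OF u v]]
    have 1: "pr1 E (\<gamma> S) B \<cdot> (v \<cdot> u) = (pr1 E (\<gamma> S) B \<cdot> v) \<cdot> u" "pr2 E (\<gamma> S) B \<cdot> (v \<cdot> u) = (pr2 E (\<gamma> S) B \<cdot> v) \<cdot> u"
      using comp_assoc[OF u v q1] comp_assoc[OF u v q2] by auto
    have 2: "val V' S (pr1 E (\<gamma> S) B \<cdot> (v \<cdot> u)) = val V S (pr1 E (\<gamma> S) B \<cdot> v)"
      unfolding 1 by (rule val_comp[OF CC_conn[OF V] CC_conn[OF V'] S comp_hom[OF v q1] u])
    show "\<alpha> (v \<cdot> u) = \<alpha> v \<cdot> u"
      unfolding zu(5) 2 unfolding 1 zv(5) pairing_comp[OF zv(4,3) u] nat[OF V V' zv(3) u zv(1)] ..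
  qed
  then obtain \<theta> where \<theta>: "\<theta> \<in> hom E (prod_ob E (\<gamma> S) B) (prod_ob E X B)"
    "\<And>V v. V \<in> CC W \<Longrightarrow> v \<in> hom E V (prod_ob E (\<gamma> S) B) \<Longrightarrow> \<theta> \<cdot> v = \<alpha> v" by blast
  have "pr2 E X B \<cdot> \<theta> = pr2 E (\<gamma> S) B"
  proof (rule CC_ext[OF W comp_hom[OF \<theta>(1) p2] q2])
    fix V v assume V: "V \<in> CC W" and v: "v \<in> hom E V (prod_ob E (\<gamma> S) B)"
    show "(pr2 E X B \<cdot> \<theta>) \<cdot> v = pr2 E (\<gamma> S) B \<cdot> v"
      using comp_assoc[OF v \<theta>(1) p2] \<theta>(2)[OF V v] z(5)[OF V v] pairing(3)[OF z(4)[OF V v] z(3)[OF V v]] by simp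
  qed
  moreover have "iso E \<theta>"
  proof (rule CC_iso[OF W \<theta>(1)])
    fix V assume V: "V \<in> CC W"
    show "bij_betw (\<lambda>v. \<theta> \<cdot> v) (hom E V (prod_ob E (\<gamma> S) B)) (hom E V (prod_ob E X B))"
      unfolding bij_betw_def
    proof (intro conjI inj_onI set_eqI iffI)
      fix v v' assume v: "v \<in> hom E V (prod_ob E (\<gamma> S) B)" and v': "v' \<in> hom E V (prod_ob E (\<gamma> S) B)"
        and e: "\<theta> \<cdot> v = \<theta> \<cdot> v'"
      note zv = z[OF V v] and zv' = z[OF V v']
      have e': "\<alpha> v = \<alpha> v'" using e \<theta>(2)[OF V v] \<theta>(2)[OF V v'] by simp
      have 2: "pr2 E (\<gamma> S) B \<cdot> v = pr2 E (\<gamma> S) B \<cdot> v'"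
        using e' zv(5) zv'(5) pairing(3)[OF zv(4,3)] pairing(3)[OF zv'(4,3)] by metis
      have "\<beta> (pr2 E (\<gamma> S) B \<cdot> v) (val V S (pr1 E (\<gamma> S) B \<cdot> v)) = \<beta> (pr2 E (\<gamma> S) B \<cdot> v) (val V S (pr1 E (\<gamma> S) B \<cdot> v'))"
        using e' zv(5) zv'(5) pairing(2)[OF zv(4,3)] pairing(2)[OF zv'(4,3)] 2 by metis
      then have "val V S (pr1 E (\<gamma> S) B \<cdot> v) = val V S (pr1 E (\<gamma> S) B \<cdot> v')"
        using inj_onD[OF bij_betw_imp_inj_on[OF bij[OF V zv(3)]]] zv(1) zv'(1) by blast
      then have "pr1 E (\<gamma> S) B \<cdot> v = pr1 E (\<gamma> S) B \<cdot> v'" using zv(2) zv'(2) by metis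
      then show "v = v'" using prod_eqI[OF v v' gS B] 2 by blast
    next
      fix y assume "y \<in> (\<lambda>v. \<theta> \<cdot> v) ` hom E V (prod_ob E (\<gamma> S) B)"
      then show "y \<in> hom E V (prod_ob E X B)" using comp_hom[OF _ \<theta>(1)] by auto
    next
      fix y assume y: "y \<in> hom E V (prod_ob E X B)"
      define b where "b = pr2 E X B \<cdot> y"
      have b: "b \<in> hom E V B" unfolding b_def by (rule comp_hom[OF y p2])
      have "pr1 E X B \<cdot> y \<in> \<beta> b ` S" using bij[OF V b] comp_hom[OF y p1] by (simp only: bij_betw_def)
      then obtain s where s: "s \<in> S" "pr1 E X B \<cdot> y = \<beta> b s" by auto
      define v where "v = pairing E (const V S s) b"
      note P = pairing[OF const_hom[OF CC_ob[OF V] S s(1)] b, folded v_def]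
      have "\<alpha> v = pairing E (\<beta> b s) b"
        using z(5)[OF V P(1)] P val_const[OF CC_conn[OF V] S s(1)] by simp
      also have "\<dots> = y" using pairing_eta[OF y X B] s(2) b_def by simp
      finally have "y = \<theta> \<cdot> v" using \<theta>(2)[OF V P(1)] by simp
      then show "y \<in> (\<lambda>v. \<theta> \<cdot> v) ` hom E V (prod_ob E (\<gamma> S) B)" using P(1) by (rule image_eqI)
    qed
  qed
  ultimately show ?thesis using \<theta>(1) by blast
qed

text \<open>Since \<open>E\<close> is connected, all fibres \<open>hom E V X\<close> are in
  bijection with one set \<open>S\<close>. On each component of \<open>B\<close> one such bijection
  is chosen and transported along maps into the component; naturality over \<open>B\<close> is then
  built in.\<close>

lemma spl_split_object:
  assumes W: "cov W" and X: "spl W X" and U: "\<And>i. i \<in> I \<Longrightarrow> U i \<in> ob E" "\<And>i. i \<in> I \<Longrightarrow> hom E (U i) W \<noteq> {}"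
  shows "split_object \<kappa> E gup I U X"
proof -
  have Xo: "X \<in> ob E" and Xs: "\<And>V. V \<in> CC W \<Longrightarrow> small \<kappa> (hom E V X)" 
    and Xb: "\<And>V V' u. V \<in> CC W \<Longrightarrow> V' \<in> CC W \<Longrightarrow> u \<in> hom E V' V \<Longrightarrow> bij_betw (\<lambda>x. x \<cdot> u) (hom E V X) (hom E V' X)"
    using X unfolding spl_def by auto
  obtain V0 where V0: "V0 \<in> CC W" using CC_nonempty[OF W] by auto
  obtain S :: "'s set" and e where S: "small \<kappa> S" and e: "bij_betw e S (hom E V0 X)" using small_copy[OF Xs[OF V0]] by blast
  \<comment> \<open>Having a fibre in bijection with \<open>S\<close> is invariant because the maps
    of \<open>CC W\<close> are inverted, so it spreads from \<open>V0\<close>.\<close>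
  have fib: "\<exists>f. bij_betw f S (hom E V X)" if V: "V \<in> CC W" for V
  proof (rule CC_connected[OF W _ V0 _ V])
    show "\<exists>f. bij_betw f S (hom E V0 X)" using e by blast
    fix V V' u assume V: "V \<in> CC W" "V' \<in> CC W" "u \<in> hom E V' V"
    note b = Xb[OF V]
    show "(\<exists>f. bij_betw f S (hom E V' X)) \<longleftrightarrow> (\<exists>f. bij_betw f S (hom E V X))"
      using bij_betw_trans[OF _ b] bij_betw_trans[OF _ bij_betw_inv_into[OF b]] by blast
  qed
  have "\<exists>\<theta>\<in>hom E (prod_ob E (\<gamma> S) B) (prod_ob E X B). iso E \<theta> \<and> pr2 E X B \<cdot> \<theta> = pr2 E (\<gamma> S) B"
    if B: "B \<in> ob E" "hom E B W \<noteq> {}" for B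
  proof -
    have "\<exists>f. \<forall>j\<in>\<pi> B. bij_betw (f j) S (hom E (cob B j) X)"
      using fib[OF CC_cob[OF B]] by (intro bchoice) auto
    then obtain f where f: "\<And>j. j \<in> \<pi> B \<Longrightarrow> bij_betw (f j) S (hom E (cob B j) X)" by blast
    \<comment> \<open>The factorisation of \<open>b\<close> through the component of
      \<open>B\<close> in which it lands.\<close>
    define bar where "bar b = (THE h. h \<in> hom E (src E b) (cob B (cpt b)) \<and> cin B (cpt b) \<cdot> h = b)" for b
    have bar: "bar b \<in> hom E V (cob B (cpt b))" "cin B (cpt b) \<cdot> bar b = b" if "V \<in> CC W" "b \<in> hom E V B" for V b
      using theI'[OF conn_factor[OF CC_conn[OF that(1)] that(2)]] homD(2)[OF that(2)] unfolding bar_def by auto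
    show ?thesis
    proof (rule trivialize[OF W Xo B(1) S, of "\<lambda>b s. f (cpt b) s \<cdot> bar b"])
      fix V b assume V: "V \<in> CC W" and b: "b \<in> hom E V B"
      note j = cpt(1)[OF CC_conn[OF V] b]
      show "bij_betw (\<lambda>s. f (cpt b) s \<cdot> bar b) S (hom E V X)"
        using bij_betw_trans[OF f[OF j] Xb[OF CC_cob[OF B j] V bar(1)[OF V b]]] by (simp add: comp_def)
    next
      fix V V' b u s assume V: "V \<in> CC W" and V': "V' \<in> CC W" and b: "b \<in> hom E V B" and u: "u \<in> hom E V' V" and s: "s \<in> S"
      note j = cpt(1)[OF CC_conn[OF V] b]
      have c: "cpt (b \<cdot> u) = cpt b" by (rule cpt_comp[OF CC_conn[OF V] CC_conn[OF V'] b u])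
      note bu = bar[OF V' comp_hom[OF u b], unfolded c] and bb = bar[OF V b]
      have "bar (b \<cdot> u) = bar b \<cdot> u"
        by (rule cin_mono[OF B(1) j bu(1) comp_hom[OF u bb(1)]])
          (use bu(2) comp_assoc[OF u bb(1) cin(1)[OF B(1) j]] bb(2) in simp)
      moreover have "f (cpt b) s \<in> hom E (cob B (cpt b)) X" using f[OF j] s unfolding bij_betw_def by auto
      ultimately show "f (cpt (b \<cdot> u)) s \<cdot> bar (b \<cdot> u) = (f (cpt b) s \<cdot> bar b) \<cdot> u"
        unfolding c using comp_assoc[OF u bb(1)] by simp
    qed
  qed
  then show ?thesis unfolding split_object_def using Xo S U by (intro conjI exI[of _ "\<lambda>_. S"]) auto
qed

section \<open>The push-out topos\<close>

abbreviation ptriple where "ptriple W \<equiv> pushout_ob \<kappa> E gsh gup \<eta> W"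

lemma ptripleD:
  assumes "T \<in> ptriple W"
  shows "tX T \<in> ob E" "tp T \<in> hom (Sets \<kappa>) (asrc (tp T)) (\<pi> W)" "small \<kappa> (asrc (tp T))"
    "tth T \<in> hom E (prod_ob E (tX T) W) (rho_ob E gup \<eta> W (tp T))" "iso E (tth T)"
    "rho_pr E gup \<eta> W (tp T) \<cdot> tth T = pr2 E (tX T) W"
  using assms unfolding pushout_ob_def by (auto simp: hom_def ar_Sets)

lemma rho:
  assumes W: "W \<in> ob E" and p: "p \<in> hom (Sets \<kappa>) S (\<pi> W)"
  shows "pb1 E (far gup p) (\<eta> W) \<in> hom E (rho_ob E gup \<eta> W p) (\<gamma> S)"
    "rho_pr E gup \<eta> W p \<in> hom E (rho_ob E gup \<eta> W p) W"
    "far gup p \<cdot> pb1 E (far gup p) (\<eta> W) = \<eta> W \<cdot> rho_pr E gup \<eta> W p"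
    "a \<in> hom E V (\<gamma> S) \<Longrightarrow> b \<in> hom E V W \<Longrightarrow> far gup p \<cdot> a = \<eta> W \<cdot> b \<Longrightarrow>
      \<exists>!h. h \<in> hom E V (rho_ob E gup \<eta> W p) \<and> pb1 E (far gup p) (\<eta> W) \<cdot> h = a \<and> rho_pr E gup \<eta> W p \<cdot> h = b"
proof -
  note h = \<gamma>_hom[OF p] \<eta>_hom[OF W]
  note P = pullbackD[OF pb_pullback[OF h] h]
  show "pb1 E (far gup p) (\<eta> W) \<in> hom E (rho_ob E gup \<eta> W p) (\<gamma> S)"
    "rho_pr E gup \<eta> W p \<in> hom E (rho_ob E gup \<eta> W p) W"
    "far gup p \<cdot> pb1 E (far gup p) (\<eta> W) = \<eta> W \<cdot> rho_pr E gup \<eta> W p"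
    "a \<in> hom E V (\<gamma> S) \<Longrightarrow> b \<in> hom E V W \<Longrightarrow> far gup p \<cdot> a = \<eta> W \<cdot> b \<Longrightarrow>
      \<exists>!h. h \<in> hom E V (rho_ob E gup \<eta> W p) \<and> pb1 E (far gup p) (\<eta> W) \<cdot> h = a \<and> rho_pr E gup \<eta> W p \<cdot> h = b"
    using P unfolding rho_ob_def rho_pr_def pb_ob_def by blast+
qed

lemma rho_eqI:
  assumes W: "W \<in> ob E" and p: "p \<in> hom (Sets \<kappa>) S (\<pi> W)"
    and h: "h \<in> hom E V (rho_ob E gup \<eta> W p)" and k: "k \<in> hom E V (rho_ob E gup \<eta> W p)"
    and e: "pb1 E (far gup p) (\<eta> W) \<cdot> h = pb1 E (far gup p) (\<eta> W) \<cdot> k" "rho_pr E gup \<eta> W p \<cdot> h = rho_pr E gup \<eta> W p \<cdot> k"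
  shows "h = k"
proof -
  note r = rho[OF W p]
  have "far gup p \<cdot> (pb1 E (far gup p) (\<eta> W) \<cdot> k) = \<eta> W \<cdot> (rho_pr E gup \<eta> W p \<cdot> k)"
    using comp_assoc[OF k r(1) \<gamma>_hom[OF p]] comp_assoc[OF k r(2) \<eta>_hom[OF W]] r(3) by simp
  then show ?thesis using r(4)[OF comp_hom[OF k r(1)] comp_hom[OF k r(2)]] h k e by blast
qed

text \<open>The coordinate in \<open>S\<close> of \<open>\<langle>x, w\<rangle> : V \<rightarrow> X \<times> W\<close> under \<open>\<theta>\<close>; for fixed \<open>w\<close> it identifies
  \<open>[V, X]\<close> with a fibre of \<open>p\<close>.\<close>

definition coord :: "'o \<Rightarrow> ('o, 'a, 's) triple \<Rightarrow> 'a \<Rightarrow> 'a \<Rightarrow> 's" where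
  "coord W T w x = val (src E w) (asrc (tp T)) (pb1 E (far gup (tp T)) (\<eta> W) \<cdot> (tth T \<cdot> pairing E x w))"

lemma coord:
  assumes W: "W \<in> ob E" and T: "T \<in> ptriple W" and V: "conn V" and w: "w \<in> hom E V W" and x: "x \<in> hom E V (tX T)"
  shows "tth T \<cdot> pairing E x w \<in> hom E V (rho_ob E gup \<eta> W (tp T))"
    "coord W T w x \<in> asrc (tp T)"
    "pb1 E (far gup (tp T)) (\<eta> W) \<cdot> (tth T \<cdot> pairing E x w) = const V (asrc (tp T)) (coord W T w x)"
    "rho_pr E gup \<eta> W (tp T) \<cdot> (tth T \<cdot> pairing E x w) = w"
    "body (tp T) (coord W T w x) = cpt w"
proof -
  note D = ptripleD[OF T] note r = rho[OF W D(2)] note P = pairing[OF x w]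
  show t: "tth T \<cdot> pairing E x w \<in> hom E V (rho_ob E gup \<eta> W (tp T))" by (rule comp_hom[OF P(1) D(4)])
  show c: "coord W T w x \<in> asrc (tp T)"
    "pb1 E (far gup (tp T)) (\<eta> W) \<cdot> (tth T \<cdot> pairing E x w) = const V (asrc (tp T)) (coord W T w x)"
    using val[OF V D(3) comp_hom[OF t r(1)]] homD(2)[OF w] unfolding coord_def by auto
  show q: "rho_pr E gup \<eta> W (tp T) \<cdot> (tth T \<cdot> pairing E x w) = w"
    using comp_assoc[OF P(1) D(4) r(2)] D(6) P(3) by simp
  have "\<eta> W \<cdot> w = far gup (tp T) \<cdot> const V (asrc (tp T)) (coord W T w x)"
    using comp_assoc[OF t r(1) \<gamma>_hom[OF D(2)]] comp_assoc[OF t r(2) \<eta>_hom[OF W]] r(3) c(2) q by simp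
  then have "\<eta> W \<cdot> w = const V (\<pi> W) (body (tp T) (coord W T w x))"
    using const_map[OF conn_ob[OF V] D(3) c(1) D(2)] by simp
  then show "body (tp T) (coord W T w x) = cpt w"
    using cpt_unique[OF V w hom_Sets_in[OF D(2) c(1)]] by simp
qed

lemma coord_comp:
  assumes W: "W \<in> ob E" and T: "T \<in> ptriple W" and V: "conn V" "conn V'" and w: "w \<in> hom E V W" and x: "x \<in> hom E V (tX T)"
    and u: "u \<in> hom E V' V"
  shows "coord W T (w \<cdot> u) (x \<cdot> u) = coord W T w x"
proof -
  note D = ptripleD[OF T] note r = rho[OF W D(2)] note P = pairing[OF x w] note c = coord[OF W T V(1) w x]
  have "tth T \<cdot> pairing E (x \<cdot> u) (w \<cdot> u) = (tth T \<cdot> pairing E x w) \<cdot> u"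
    using pairing_comp[OF x w u] comp_assoc[OF u P(1) D(4)] by simp
  then have "coord W T (w \<cdot> u) (x \<cdot> u) = val V' (asrc (tp T)) ((pb1 E (far gup (tp T)) (\<eta> W) \<cdot> (tth T \<cdot> pairing E x w)) \<cdot> u)"
    unfolding coord_def using comp_assoc[OF u c(1) r(1)] homD(2)[OF comp_hom[OF u w]] by simp
  also have "\<dots> = coord W T w x"
    unfolding coord_def using val_comp[OF V D(3) comp_hom[OF c(1) r(1)] u] homD(2)[OF w] by simp
  finally show ?thesis .
qed

lemma coord_bij:
  assumes W: "W \<in> ob E" and T: "T \<in> ptriple W" and V: "conn V" and w: "w \<in> hom E V W"
  shows "bij_betw (coord W T w) (hom E V (tX T)) (fibre (tp T) (cpt w))"
  unfolding bij_betw_def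
proof (intro conjI inj_onI set_eqI iffI)
  note D = ptripleD[OF T] note r = rho[OF W D(2)]
  {
    fix x x' assume x: "x \<in> hom E V (tX T)" and x': "x' \<in> hom E V (tX T)" and e: "coord W T w x = coord W T w x'"
    note c = coord[OF W T V w x] and c' = coord[OF W T V w x']
    have "tth T \<cdot> pairing E x w = tth T \<cdot> pairing E x' w"
      by (rule rho_eqI[OF W D(2) c(1) c'(1)]) (use c c' e in simp_all)
    then have "pairing E x w = pairing E x' w" using iso_mono[OF D(5,4)] pairing(1)[OF x w] pairing(1)[OF x' w] by blast
    then show "x = x'" using pairing(2)[OF x w] pairing(2)[OF x' w] by metis
  next
    fix s assume "s \<in> coord W T w ` hom E V (tX T)"
    then show "s \<in> fibre (tp T) (cpt w)" using coord[OF W T V w] unfolding fibre_def by auto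
  next
    fix s assume "s \<in> fibre (tp T) (cpt w)"
    then have s: "s \<in> asrc (tp T)" "body (tp T) s = cpt w" unfolding fibre_def by auto
    note k = const_hom[OF conn_ob[OF V] D(3) s(1)]
    \<comment> \<open>As \<open>s\<close> lies over the component of \<open>w\<close>, the two form
      a map to the pullback \<open>rho_ob\<close>; the inverse of \<theta> turns it into the
      required \<open>x\<close>.\<close>
    have "far gup (tp T) \<cdot> const V (asrc (tp T)) s = \<eta> W \<cdot> w"
      using const_map[OF conn_ob[OF V] D(3) s(1) D(2)] cpt(2)[OF V w] s(2) by simp
    then obtain h where h: "h \<in> hom E V (rho_ob E gup \<eta> W (tp T))" "pb1 E (far gup (tp T)) (\<eta> W) \<cdot> h = const V (asrc (tp T)) s"
        "rho_pr E gup \<eta> W (tp T) \<cdot> h = w" using r(4)[OF k w] by blast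
    obtain t where t: "t \<in> hom E (rho_ob E gup \<eta> W (tp T)) (prod_ob E (tX T) W)" "tth T \<cdot> t = idt E (rho_ob E gup \<eta> W (tp T))"
      using iso_inverse[OF D(5,4)] by metis
    note z = comp_hom[OF h(1) t(1)]
    have tz: "tth T \<cdot> (t \<cdot> h) = h" using comp_assoc[OF h(1) t(1) D(4)] t(2) id_left[OF h(1)] by simp
    have z2: "pr2 E (tX T) W \<cdot> (t \<cdot> h) = w" using comp_assoc[OF z D(4) r(2)] D(6) tz h(3) by simp
    define x where "x = pr1 E (tX T) W \<cdot> (t \<cdot> h)"
    have x: "x \<in> hom E V (tX T)" unfolding x_def by (rule comp_hom[OF z pr_hom(1)[OF D(1) W]])
    have "t \<cdot> h = pairing E x w" using pairing_eta[OF z D(1) W] z2 x_def by simp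
    then have "const V (asrc (tp T)) (coord W T w x) = const V (asrc (tp T)) s" using coord(3)[OF W T V w x] tz h(2) by simp
    then have "coord W T w x = s" using const_eq_iff[OF V D(3) coord(2)[OF W T V w x] s(1)] by simp
    then show "s \<in> coord W T w ` hom E V (tX T)" using x by blast
  }
qed

lemma coord_inj:
  assumes "W \<in> ob E" "T \<in> ptriple W" "conn V" "w \<in> hom E V W" "x \<in> hom E V (tX T)" "x' \<in> hom E V (tX T)" "coord W T w x = coord W T w x'"
  shows "x = x'"
  using inj_onD[OF bij_betw_imp_inj_on[OF coord_bij[OF assms(1-4)]] assms(7,5,6)] .

lemma coord_surj:
  assumes "W \<in> ob E" "T \<in> ptriple W" "conn V" "w \<in> hom E V W" "s \<in> asrc (tp T)" "body (tp T) s = cpt w"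
  obtains x where "x \<in> hom E V (tX T)" "coord W T w x = s"
proof -
  have "s \<in> coord W T w ` hom E V (tX T)" using coord_bij[OF assms(1-4)] assms(5,6) unfolding bij_betw_def fibre_def by auto
  then show thesis using that by auto
qed

text \<open>For \<open>w : V \<rightarrow> W\<close> the coordinate identifies
  \<open>hom E V' X\<close> with the fibre of \<open>p\<close> at the component of \<open>w\<close>,
  and this fibre is the same for all \<open>V'\<close> over \<open>V\<close>.\<close>

lemma ptriple_spl:
  assumes W: "W \<in> ob E" and T: "T \<in> ptriple W" shows "spl W (tX T)"
proof (rule splI)
  note D = ptripleD[OF T]
  show "tX T \<in> ob E" by (rule D)
  fix V assume V: "V \<in> CC W"
  then obtain w where w: "w \<in> hom E V W" unfolding CC_def by auto
  define \<beta> where "\<beta> v = inv_into (hom E (src E v) (tX T)) (coord W T (w \<cdot> v))" for v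
  show "\<exists>(S :: 's set) \<beta>. small \<kappa> S \<and> (\<forall>V'\<in>CC W. \<forall>v\<in>hom E V' V. bij_betw (\<beta> v) S (hom E V' (tX T)) \<and>
      (\<forall>s\<in>S. \<beta> v s = \<beta> (idt E V) s \<cdot> v))"
  proof (intro exI conjI ballI)
    show "small \<kappa> (fibre (tp T) (cpt w))" by (rule small_subset[OF D(3)]) (auto simp: fibre_def)
    have b: "bij_betw (coord W T (w \<cdot> v)) (hom E V' (tX T)) (fibre (tp T) (cpt w))" if "V' \<in> CC W" "v \<in> hom E V' V" for V' v
      using coord_bij[OF W T CC_conn[OF that(1)] comp_hom[OF that(2) w]]
        cpt_comp[OF CC_conn[OF V] CC_conn[OF that(1)] w that(2)] by simp
    fix V' v assume V': "V' \<in> CC W" and v: "v \<in> hom E V' V"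
    show "bij_betw (\<beta> v) (fibre (tp T) (cpt w)) (hom E V' (tX T))"
      unfolding \<beta>_def homD(2)[OF v] by (rule bij_betw_inv_into[OF b[OF V' v]])
    fix s assume s: "s \<in> fibre (tp T) (cpt w)"
    note i = id_hom[OF CC_ob[OF V]]
    define x where "x = \<beta> (idt E V) s"
    have "x \<in> hom E V (tX T)" "coord W T (w \<cdot> idt E V) x = s"
      unfolding x_def \<beta>_def homD(2)[OF i] using b[OF V i] s
      by (auto simp: bij_betw_inv_into_right intro: bij_betwE[OF bij_betw_inv_into[OF b[OF V i]], rule_format])
    then have x: "x \<in> hom E V (tX T)" "coord W T w x = s" using id_right[OF w] by auto
    have "coord W T (w \<cdot> v) (x \<cdot> v) = s" using coord_comp[OF W T CC_conn[OF V] CC_conn[OF V'] w x(1) v] x(2) by simp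
    then have "\<beta> v s = x \<cdot> v"
      unfolding \<beta>_def homD(2)[OF v] using bij_betw_inv_into_left[OF b[OF V' v] comp_hom[OF v x(1)]] by simp
    then show "\<beta> v s = \<beta> (idt E V) s \<cdot> v" unfolding x_def .
  qed
qed

text \<open>The set over \<open>\<pi> W\<close> is the set of components of the product of
  \<open>X\<close> and \<open>W\<close>, and \<theta> is the canonical map to the pullback. It is
  invertible because each component of the product is a copy of a component of
  \<open>W\<close>.\<close>

lemma spl_ptriple:
  assumes W: "cov W" and X: "spl W X"
  shows "\<exists>T\<in>ptriple W. tX T = X"
proof -
  have Wo: "W \<in> ob E" using W unfolding cov_def by auto
  have Xo: "X \<in> ob E" using X unfolding spl_def by auto
  define Y where "Y = prod_ob E X W"
  have Y: "Y \<in> ob E" unfolding Y_def by (rule prod_ob_ob[OF Xo Wo])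
  note q1 = pr_hom(1)[OF Xo Wo, folded Y_def] and q2 = pr_hom(2)[OF Xo Wo, folded Y_def]
  define p where "p = far gsh (pr2 E X W)"
  have p: "p \<in> hom (Sets \<kappa>) (\<pi> Y) (\<pi> W)" unfolding p_def by (rule \<pi>_hom[OF q2])
  note r = rho[OF Wo p] note sY = \<pi>_small[OF Y]
  obtain \<theta> where \<theta>: "\<theta> \<in> hom E Y (rho_ob E gup \<eta> W p)" "pb1 E (far gup p) (\<eta> W) \<cdot> \<theta> = \<eta> Y" "rho_pr E gup \<eta> W p \<cdot> \<theta> = pr2 E X W"
    using r(4)[OF \<eta>_hom[OF Y] q2] \<eta>_nat[OF q2] unfolding p_def by metis
  have \<theta>z: "pb1 E (far gup p) (\<eta> W) \<cdot> (\<theta> \<cdot> z) = const V (\<pi> Y) (cpt z)" "rho_pr E gup \<eta> W p \<cdot> (\<theta> \<cdot> z) = pr2 E X W \<cdot> z"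
    if V: "V \<in> CC W" and z: "z \<in> hom E V Y" for V z
    using comp_assoc[OF z \<theta>(1) r(1)] comp_assoc[OF z \<theta>(1) r(2)] \<theta>(2,3) cpt(2)[OF CC_conn[OF V] z] by auto
  \<comment> \<open>The component \<open>k\<close> projects by \<open>r\<close> to a component of
    \<open>W\<close>. As \<open>X\<close> inverts \<open>r\<close>, the coordinate in
    \<open>X\<close> descends along \<open>r\<close> to \<open>x0\<close>.\<close>
  have comp: "\<exists>r x0. r \<in> hom E (cob Y k) (cob W (body p k)) \<and> body p k \<in> \<pi> W \<and> cob W (body p k) \<in> CC W \<and> cin W (body p k) \<cdot> r = pr2 E X W \<cdot> cin Y k \<and>
      x0 \<in> hom E (cob W (body p k)) X \<and> x0 \<cdot> r = pr1 E X W \<cdot> cin Y k" if k: "k \<in> \<pi> Y" for k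
  proof -
    have Yk: "cob Y k \<in> CC W" using CC_cob[OF Y _ k] q2 by blast
    note c = cin(1)[OF Y k] note qc = comp_hom[OF c q2]
    have cp: "cpt (pr2 E X W \<cdot> cin Y k) = body p k"
      using cpt_map[OF CC_conn[OF Yk] c q2] cpt_cin[OF Y k] unfolding p_def by simp
    obtain r where rr: "r \<in> hom E (cob Y k) (cob W (body p k))" "cin W (body p k) \<cdot> r = pr2 E X W \<cdot> cin Y k"
      using conn_factor[OF CC_conn[OF Yk] qc] unfolding cp by blast
    have j: "body p k \<in> \<pi> W" using hom_Sets_in[OF p k] .
    have Wj: "cob W (body p k) \<in> CC W" using CC_cob[OF Wo _ j] id_hom[OF Wo] by blast
    obtain x0 where "x0 \<in> hom E (cob W (body p k)) X" "x0 \<cdot> r = pr1 E X W \<cdot> cin Y k"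
      using spl_lift[OF X Wj Yk rr(1) comp_hom[OF c q1]] by blast
    then show ?thesis using rr j Wj by blast
  qed
  have "iso E \<theta>"
  proof (rule CC_iso[OF W \<theta>(1)])
    fix V assume V: "V \<in> CC W"
    show "bij_betw (\<lambda>v. \<theta> \<cdot> v) (hom E V Y) (hom E V (rho_ob E gup \<eta> W p))"
      unfolding bij_betw_def
    proof (intro conjI inj_onI set_eqI iffI)
      fix z z' assume z: "z \<in> hom E V Y" and z': "z' \<in> hom E V Y" and e: "\<theta> \<cdot> z = \<theta> \<cdot> z'"
      define k where "k = cpt z"
      have k: "k \<in> \<pi> Y" unfolding k_def by (rule cpt(1)[OF CC_conn[OF V] z])
      have "const V (\<pi> Y) k = const V (\<pi> Y) (cpt z')" using \<theta>z[OF V z] \<theta>z[OF V z'] e k_def by simp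
      then have k': "cpt z' = k" using const_eq_iff[OF CC_conn[OF V] sY k cpt(1)[OF CC_conn[OF V] z']] by simp
      have e2: "pr2 E X W \<cdot> z = pr2 E X W \<cdot> z'" using \<theta>z[OF V z] \<theta>z[OF V z'] e by simp
      obtain r x0 where r: "r \<in> hom E (cob Y k) (cob W (body p k))" "body p k \<in> \<pi> W" "cin W (body p k) \<cdot> r = pr2 E X W \<cdot> cin Y k"
        and x0: "x0 \<in> hom E (cob W (body p k)) X" "x0 \<cdot> r = pr1 E X W \<cdot> cin Y k" using comp[OF k] by blast
      obtain y where y: "y \<in> hom E V (cob Y k)" "cin Y k \<cdot> y = z" using conn_factor[OF CC_conn[OF V] z] k_def by blast
      obtain y' where y': "y' \<in> hom E V (cob Y k)" "cin Y k \<cdot> y' = z'" using conn_factor[OF CC_conn[OF V] z'] k' by blast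
      note c = cin(1)[OF Y k]
      \<comment> \<open>Both coordinates of a map into the component \<open>k\<close> can be read
        off after \<open>r\<close>: the one in \<open>W\<close> through \<open>cin\<close>, the one
        in \<open>X\<close> through \<open>x0\<close>.\<close>
      have "r \<cdot> y = r \<cdot> y'"
      proof (rule cin_mono[OF Wo r(2) comp_hom[OF y(1) r(1)] comp_hom[OF y'(1) r(1)]])
        show "cin W (body p k) \<cdot> (r \<cdot> y) = cin W (body p k) \<cdot> (r \<cdot> y')"
          using comp_assoc[OF y(1) r(1) cin(1)[OF Wo r(2)]] comp_assoc[OF y'(1) r(1) cin(1)[OF Wo r(2)]] r(3)
            comp_assoc[OF y(1) c q2] comp_assoc[OF y'(1) c q2] y(2) y'(2) e2 by simp
      qed
      then have "pr1 E X W \<cdot> z = pr1 E X W \<cdot> z'"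
        using comp_assoc[OF y(1) r(1) x0(1)] comp_assoc[OF y'(1) r(1) x0(1)] x0(2)
          comp_assoc[OF y(1) c q1] comp_assoc[OF y'(1) c q1] y(2) y'(2) by simp
      then show "z = z'" using prod_eqI[OF z[unfolded Y_def] z'[unfolded Y_def] Xo Wo] e2 by blast
    next
      fix y assume "y \<in> (\<lambda>v. \<theta> \<cdot> v) ` hom E V Y"
      then show "y \<in> hom E V (rho_ob E gup \<eta> W p)" using comp_hom[OF _ \<theta>(1)] by auto
    next
      fix y assume y: "y \<in> hom E V (rho_ob E gup \<eta> W p)"
      define k where "k = val V (\<pi> Y) (pb1 E (far gup p) (\<eta> W) \<cdot> y)"
      have k: "k \<in> \<pi> Y" "pb1 E (far gup p) (\<eta> W) \<cdot> y = const V (\<pi> Y) k"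
        unfolding k_def using val[OF CC_conn[OF V] sY comp_hom[OF y r(1)]] by auto
      define w where "w = rho_pr E gup \<eta> W p \<cdot> y"
      have w: "w \<in> hom E V W" unfolding w_def by (rule comp_hom[OF y r(2)])
      define j where "j = body p k"
      have "\<eta> W \<cdot> w = const V (\<pi> W) j"
        using comp_assoc[OF y r(1) \<gamma>_hom[OF p]] comp_assoc[OF y r(2) \<eta>_hom[OF Wo]] r(3) k(2) 
          const_map[OF CC_ob[OF V] sY k(1) p] unfolding w_def j_def by simp
      then have cw: "cpt w = j" using cpt_unique[OF CC_conn[OF V] w] hom_Sets_in[OF p k(1)] unfolding j_def by simp
      obtain r' x0 where r': "r' \<in> hom E (cob Y k) (cob W j)" "j \<in> \<pi> W" "cob W j \<in> CC W" "cin W j \<cdot> r' = pr2 E X W \<cdot> cin Y k"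
        and x0: "x0 \<in> hom E (cob W j) X" "x0 \<cdot> r' = pr1 E X W \<cdot> cin Y k" using comp[OF k(1)] unfolding j_def by blast
      obtain u where u: "u \<in> hom E V (cob W j)" "cin W j \<cdot> u = w" using conn_factor[OF CC_conn[OF V] w] cw by blast
      note cW = cin(1)[OF Wo r'(2)] note c = cin(1)[OF Y k(1)]
      \<comment> \<open>The map from the component of \<open>W\<close> back to the product. It lands
        in the component \<open>k\<close> because its composite with \<open>r'\<close> is
        \<open>cin Y k\<close>.\<close>
      define z0 where "z0 = pairing E x0 (cin W j)"
      note z0 = pairing[OF x0(1) cW, folded z0_def Y_def]
      have Yk: "cob Y k \<in> CC W" using CC_cob[OF Y _ k(1)] q2 by blast
      have "z0 \<cdot> r' = cin Y k"
        unfolding z0_def pairing_comp[OF x0(1) cW r'(1)] using x0(2) r'(4) pairing_eta[OF c[unfolded Y_def] Xo Wo] Y_def by simp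
      then have cz0: "cpt z0 = k" using cpt_comp[OF CC_conn[OF r'(3)] CC_conn[OF Yk] z0(1) r'(1)] cpt_cin[OF Y k(1)] by simp
      note z = comp_hom[OF u(1) z0(1)]
      have cz: "cpt (z0 \<cdot> u) = k" using cpt_comp[OF CC_conn[OF r'(3)] CC_conn[OF V] z0(1) u(1)] cz0 by simp
      have "\<theta> \<cdot> (z0 \<cdot> u) = y"
      proof (rule rho_eqI[OF Wo p comp_hom[OF z \<theta>(1)] y])
        show "pb1 E (far gup p) (\<eta> W) \<cdot> (\<theta> \<cdot> (z0 \<cdot> u)) = pb1 E (far gup p) (\<eta> W) \<cdot> y" using \<theta>z(1)[OF V z] cz k(2) by simp
        show "rho_pr E gup \<eta> W p \<cdot> (\<theta> \<cdot> (z0 \<cdot> u)) = rho_pr E gup \<eta> W p \<cdot> y"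
          using \<theta>z(2)[OF V z] comp_assoc[OF u(1) z0(1) q2] z0(3) u(2) w_def by simp
      qed
      then show "y \<in> (\<lambda>v. \<theta> \<cdot> v) ` hom E V Y" using z by blast
    qed
  qed
  then have "Triple X p \<theta> \<in> ptriple W"
    unfolding pushout_ob_def using Xo p \<theta> unfolding Y_def by (auto simp: hom_def)
  then show ?thesis by (metis triple.sel(1))
qed

section \<open>Morphisms of the push-out topos in coordinates\<close>

definition pmor :: "'o \<Rightarrow> ('o, 'a, 's) triple \<Rightarrow> ('o, 'a, 's) triple \<Rightarrow> 'a \<Rightarrow> 's sarrow \<Rightarrow> bool" where
  "pmor W T T' f h \<longleftrightarrow> f \<in> hom E (tX T) (tX T') \<and> h \<in> hom (Sets \<kappa>) (asrc (tp T)) (asrc (tp T')) \<and>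
     cmp (Sets \<kappa>) (tp T') h = tp T \<and>
     tth T' \<cdot> prod_map E f (idt E W) = rho_map E gup \<eta> W (tp T) (tp T') h \<cdot> tth T"

lemma hom_pushout:
  "t \<in> hom (pushout_topos \<kappa> E gsh gup \<eta> W) T T' \<longleftrightarrow>
     T \<in> ptriple W \<and> T' \<in> ptriple W \<and> (\<exists>f h. t = Arrow T (f, h) T' \<and> pmor W T T' f h)"
  unfolding hom_def pushout_topos_def pmor_def by (auto simp: hom_def)

lemma sel_pushout [simp]:
  "ob (pushout_topos \<kappa> E gsh gup \<eta> W) = ptriple W"
  "src (pushout_topos \<kappa> E gsh gup \<eta> W) = asrc" "tgt (pushout_topos \<kappa> E gsh gup \<eta> W) = atgt"
  "idt (pushout_topos \<kappa> E gsh gup \<eta> W) T = Arrow T (idt E (tX T), idt (Sets \<kappa>) (asrc (tp T))) T"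
  "cmp (pushout_topos \<kappa> E gsh gup \<eta> W) t s = Arrow (asrc s)
        (fst (body t) \<cdot> fst (body s), cmp (Sets \<kappa>) (snd (body t)) (snd (body s))) (atgt t)"
  unfolding pushout_topos_def by auto

text \<open>The compatibility square is an equation between maps out of a product with
  \<open>W\<close>, so it can be tested on pairs \<open>x\<close>, \<open>w\<close> of maps from
  \<open>CC W\<close>; both sides lie over \<open>w\<close>, and only their coordinates remain to be
  compared.\<close>

lemma pmor_coord:
  assumes W: "cov W" and T: "T \<in> ptriple W" and T': "T' \<in> ptriple W"
  shows "pmor W T T' f h \<longleftrightarrow> f \<in> hom E (tX T) (tX T') \<and> h \<in> hom (Sets \<kappa>) (asrc (tp T)) (asrc (tp T')) \<and>
     cmp (Sets \<kappa>) (tp T') h = tp T \<and>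
     (\<forall>V\<in>CC W. \<forall>w\<in>hom E V W. \<forall>x\<in>hom E V (tX T). coord W T' w (f \<cdot> x) = body h (coord W T w x))"
proof (cases "f \<in> hom E (tX T) (tX T') \<and> h \<in> hom (Sets \<kappa>) (asrc (tp T)) (asrc (tp T')) \<and> cmp (Sets \<kappa>) (tp T') h = tp T")
  case False
  then show ?thesis unfolding pmor_def by blast
next
  case True
  then have f: "f \<in> hom E (tX T) (tX T')" and h: "h \<in> hom (Sets \<kappa>) (asrc (tp T)) (asrc (tp T'))"
    and ph: "cmp (Sets \<kappa>) (tp T') h = tp T" by auto
  have Wo: "W \<in> ob E" using W unfolding cov_def by auto
  note D = ptripleD[OF T] and D' = ptripleD[OF T']
  note r = rho[OF Wo D(2)] and r' = rho[OF Wo D'(2)]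
  note gh = \<gamma>_hom[OF h]
  have "far gup (tp T') \<cdot> (far gup h \<cdot> pb1 E (far gup (tp T)) (\<eta> W)) = \<eta> W \<cdot> rho_pr E gup \<eta> W (tp T)"
    using comp_assoc[OF r(1) gh \<gamma>_hom[OF D'(2)]] \<gamma>_comp[OF h D'(2)] ph r(3) by simp
  note ex = r'(4)[OF comp_hom[OF r(1) gh] r(2) this]
  define k where "k = rho_map E gup \<eta> W (tp T) (tp T') h"
  have k: "k \<in> hom E (rho_ob E gup \<eta> W (tp T)) (rho_ob E gup \<eta> W (tp T'))"
    "pb1 E (far gup (tp T')) (\<eta> W) \<cdot> k = far gup h \<cdot> pb1 E (far gup (tp T)) (\<eta> W)"
    "rho_pr E gup \<eta> W (tp T') \<cdot> k = rho_pr E gup \<eta> W (tp T)"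
    using theI'[OF ex] unfolding k_def rho_map_def by auto
  note iW = id_hom[OF Wo]
  note pm = prod_map[OF f iW]
  note L = comp_hom[OF pm(1) D'(4)] and R = comp_hom[OF D(4) k(1)]
  have pt: "(tth T' \<cdot> prod_map E f (idt E W)) \<cdot> pairing E x w = (k \<cdot> tth T) \<cdot> pairing E x w \<longleftrightarrow>
      coord W T' w (f \<cdot> x) = body h (coord W T w x)"
    if V: "V \<in> CC W" and w: "w \<in> hom E V W" and x: "x \<in> hom E V (tX T)" for V w x
  proof -
    note Vc = CC_conn[OF V]
    note P = pairing[OF x w] note c = coord[OF Wo T Vc w x] and c' = coord[OF Wo T' Vc w comp_hom[OF x f]]
    have l: "(tth T' \<cdot> prod_map E f (idt E W)) \<cdot> pairing E x w = tth T' \<cdot> pairing E (f \<cdot> x) w"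
      using comp_assoc[OF P(1) pm(1) D'(4)] pm(2)[OF x w] id_left[OF w] by simp
    have rr: "(k \<cdot> tth T) \<cdot> pairing E x w = k \<cdot> (tth T \<cdot> pairing E x w)" using comp_assoc[OF P(1) D(4) k(1)] .
    note kk = comp_hom[OF c(1) k(1)]
    have k1: "pb1 E (far gup (tp T')) (\<eta> W) \<cdot> (k \<cdot> (tth T \<cdot> pairing E x w)) = const V (asrc (tp T')) (body h (coord W T w x))"
      using comp_assoc[OF c(1) k(1) r'(1)] k(2) comp_assoc[OF c(1) r(1) gh] c(3) const_map[OF CC_ob[OF V] D(3) c(2) h] by simp
    have k2: "rho_pr E gup \<eta> W (tp T') \<cdot> (k \<cdot> (tth T \<cdot> pairing E x w)) = w"
      using comp_assoc[OF c(1) k(1) r'(2)] k(3) c(4) by simp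
    show ?thesis unfolding l rr
    proof
      assume "tth T' \<cdot> pairing E (f \<cdot> x) w = k \<cdot> (tth T \<cdot> pairing E x w)"
      then have "const V (asrc (tp T')) (coord W T' w (f \<cdot> x)) = const V (asrc (tp T')) (body h (coord W T w x))"
        using c'(3) k1 by simp
      then show "coord W T' w (f \<cdot> x) = body h (coord W T w x)"
        using const_eq_iff[OF Vc D'(3) c'(2) hom_Sets_in[OF h c(2)]] by simp
    next
      assume e: "coord W T' w (f \<cdot> x) = body h (coord W T w x)"
      show "tth T' \<cdot> pairing E (f \<cdot> x) w = k \<cdot> (tth T \<cdot> pairing E x w)"
        by (rule rho_eqI[OF Wo D'(2) c'(1) kk]) (use c' k1 k2 e in simp_all)
    qed
  qed
  have "tth T' \<cdot> prod_map E f (idt E W) = k \<cdot> tth T \<longleftrightarrow>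
    (\<forall>V\<in>CC W. \<forall>w\<in>hom E V W. \<forall>x\<in>hom E V (tX T). coord W T' w (f \<cdot> x) = body h (coord W T w x))"
  proof
    assume "tth T' \<cdot> prod_map E f (idt E W) = k \<cdot> tth T"
    then show "\<forall>V\<in>CC W. \<forall>w\<in>hom E V W. \<forall>x\<in>hom E V (tX T). coord W T' w (f \<cdot> x) = body h (coord W T w x)"
      using pt by simp
  next
    assume a: "\<forall>V\<in>CC W. \<forall>w\<in>hom E V W. \<forall>x\<in>hom E V (tX T). coord W T' w (f \<cdot> x) = body h (coord W T w x)"
    show "tth T' \<cdot> prod_map E f (idt E W) = k \<cdot> tth T"
    proof (rule CC_ext[OF W L R])
      fix V z assume V: "V \<in> CC W" and z: "z \<in> hom E V (prod_ob E (tX T) W)"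
      note z1 = comp_hom[OF z pr_hom(1)[OF D(1) Wo]] and z2 = comp_hom[OF z pr_hom(2)[OF D(1) Wo]]
      show "(tth T' \<cdot> prod_map E f (idt E W)) \<cdot> z = (k \<cdot> tth T) \<cdot> z"
        using pt[OF V z2 z1] a V z1 z2 pairing_eta[OF z D(1) Wo] by simp
    qed
  qed
  then show ?thesis using True unfolding pmor_def k_def by blast
qed

lemma pmorD:
  assumes W: "cov W" and T: "T \<in> ptriple W" "T' \<in> ptriple W" and m: "pmor W T T' f h"
  shows "f \<in> hom E (tX T) (tX T')" "h \<in> hom (Sets \<kappa>) (asrc (tp T)) (asrc (tp T'))"
    "s \<in> asrc (tp T) \<Longrightarrow> body (tp T') (body h s) = body (tp T) s"
    "V \<in> CC W \<Longrightarrow> w \<in> hom E V W \<Longrightarrow> x \<in> hom E V (tX T) \<Longrightarrow> coord W T' w (f \<cdot> x) = body h (coord W T w x)"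
proof -
  note M = m[unfolded pmor_coord[OF W T]]
  show 1: "f \<in> hom E (tX T) (tX T')" "h \<in> hom (Sets \<kappa>) (asrc (tp T)) (asrc (tp T'))" using M by auto
  show "s \<in> asrc (tp T) \<Longrightarrow> body (tp T') (body h s) = body (tp T) s"
    using M cmp_Sets_app[OF 1(2), of s "tp T'"] by (simp del: Sets_sel)
  show "V \<in> CC W \<Longrightarrow> w \<in> hom E V W \<Longrightarrow> x \<in> hom E V (tX T) \<Longrightarrow> coord W T' w (f \<cdot> x) = body h (coord W T w x)"
    using M by blast
qed

lemma pmorI:
  assumes W: "cov W" and T: "T \<in> ptriple W" "T' \<in> ptriple W"
    and f: "f \<in> hom E (tX T) (tX T')" and h: "h \<in> hom (Sets \<kappa>) (asrc (tp T)) (asrc (tp T'))"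
    and p: "\<And>s. s \<in> asrc (tp T) \<Longrightarrow> body (tp T') (body h s) = body (tp T) s"
    and c: "\<And>V w x. V \<in> CC W \<Longrightarrow> w \<in> hom E V W \<Longrightarrow> x \<in> hom E V (tX T) \<Longrightarrow> coord W T' w (f \<cdot> x) = body h (coord W T w x)"
  shows "pmor W T T' f h"
proof -
  note D = ptripleD[OF T(1)] and D' = ptripleD[OF T(2)]
  have "cmp (Sets \<kappa>) (tp T') h = tp T"
    by (rule hom_Sets_eqI[OF Set.comp_hom[OF h D'(2)] D(2)])
      (use p cmp_Sets_app[OF h, of _ "tp T'"] in \<open>simp del: Sets_sel\<close>)
  then show ?thesis unfolding pmor_coord[OF W T] using f h c by blast
qed

text \<open>Every \<open>s\<close> is the coordinate of a map from the component of \<open>W\<close>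
  over which it lies, and \<open>h s\<close> has to be the coordinate of the image of that map under
  \<open>f\<close>. So \<open>f\<close> alone determines a morphism of triples.\<close>

lemma pmor_unique:
  assumes W: "cov W" and T: "T \<in> ptriple W" "T' \<in> ptriple W" and f: "f \<in> hom E (tX T) (tX T')"
  shows "\<exists>!h. pmor W T T' f h"
proof -
  have Wo: "W \<in> ob E" using W unfolding cov_def by auto
  note D = ptripleD[OF T(1)] and D' = ptripleD[OF T(2)]
  have Wj: "cob W j \<in> CC W" if "j \<in> \<pi> W" for j using CC_cob[OF Wo _ that] id_hom[OF Wo] by blast
  note ci = cin(1)[OF Wo]
  \<comment> \<open>The inclusion of the component serves as the standard \<open>w\<close> over
    it.\<close>
  have "\<exists>x. \<forall>s\<in>asrc (tp T). x s \<in> hom E (cob W (body (tp T) s)) (tX T) \<and> coord W T (cin W (body (tp T) s)) (x s) = s"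
  proof (intro bchoice ballI)
    fix s assume s: "s \<in> asrc (tp T)"
    have j: "body (tp T) s \<in> \<pi> W" using hom_Sets_in[OF D(2) s] .
    show "\<exists>x. x \<in> hom E (cob W (body (tp T) s)) (tX T) \<and> coord W T (cin W (body (tp T) s)) x = s"
      using coord_surj[OF Wo T(1) CC_conn[OF Wj[OF j]] ci[OF j] s] cpt_cin[OF Wo j] by metis
  qed
  then obtain x where x: "\<And>s. s \<in> asrc (tp T) \<Longrightarrow> x s \<in> hom E (cob W (body (tp T) s)) (tX T)"
    "\<And>s. s \<in> asrc (tp T) \<Longrightarrow> coord W T (cin W (body (tp T) s)) (x s) = s" by blast
  define h where "h = fn (asrc (tp T)) (\<lambda>s. coord W T' (cin W (body (tp T) s)) (f \<cdot> x s)) (asrc (tp T'))"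
  have c': "coord W T' (cin W (body (tp T) s)) (f \<cdot> x s) \<in> asrc (tp T')" 
     "body (tp T') (coord W T' (cin W (body (tp T) s)) (f \<cdot> x s)) = body (tp T) s" if s: "s \<in> asrc (tp T)" for s
  proof -
    have j: "body (tp T) s \<in> \<pi> W" using hom_Sets_in[OF D(2) s] .
    note c = coord[OF Wo T(2) CC_conn[OF Wj[OF j]] ci[OF j] comp_hom[OF x(1)[OF s] f]]
    show "coord W T' (cin W (body (tp T) s)) (f \<cdot> x s) \<in> asrc (tp T')" 
     "body (tp T') (coord W T' (cin W (body (tp T) s)) (f \<cdot> x s)) = body (tp T) s" using c(2,5) cpt_cin[OF Wo j] by auto
  qed
  have h: "h \<in> hom (Sets \<kappa>) (asrc (tp T)) (asrc (tp T'))" unfolding h_def by (rule fn_hom[OF D(3) D'(3) c'(1)])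
  have "pmor W T T' f h"
  proof (rule pmorI[OF W T f h])
    fix s assume s: "s \<in> asrc (tp T)"
    then show "body (tp T') (body h s) = body (tp T) s" using c'(2) unfolding h_def by simp
  next
    fix V w y assume V: "V \<in> CC W" and w: "w \<in> hom E V W" and y: "y \<in> hom E V (tX T)"
    note Vc = CC_conn[OF V]
    define s where "s = coord W T w y"
    have s: "s \<in> asrc (tp T)" "body (tp T) s = cpt w" using coord(2,5)[OF Wo T(1) Vc w y] s_def by auto
    have j: "cpt w \<in> \<pi> W" by (rule cpt(1)[OF Vc w])
    obtain u where u: "u \<in> hom E V (cob W (cpt w))" "cin W (cpt w) \<cdot> u = w" using conn_factor[OF Vc w] by blast
    note xs = x(1)[OF s(1), unfolded s(2)] and Wc = CC_conn[OF Wj[OF j]]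
    have "coord W T w (x s \<cdot> u) = s"
      using coord_comp[OF Wo T(1) Wc Vc ci[OF j] xs u(1)] u(2) x(2)[OF s(1)] s(2) by simp
    then have "x s \<cdot> u = y" using coord_inj[OF Wo T(1) Vc w comp_hom[OF u(1) xs] y] s_def by simp
    then have "coord W T' w (f \<cdot> y) = coord W T' (cin W (cpt w)) (f \<cdot> x s)"
      using coord_comp[OF Wo T(2) Wc Vc ci[OF j] comp_hom[OF xs f] u(1)] u(2) comp_assoc[OF u(1) xs f] by simp
    then show "coord W T' w (f \<cdot> y) = body h (coord W T w y)"
      unfolding s_def[symmetric] h_def using s by simp
  qed
  moreover have "k = h" if k: "pmor W T T' f k" for k
  proof (rule hom_Sets_eqI[OF pmorD(2)[OF W T k] h])
    fix s assume s: "s \<in> asrc (tp T)"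
    have j: "body (tp T) s \<in> \<pi> W" using hom_Sets_in[OF D(2) s] .
    show "body k s = body h s"
      using pmorD(4)[OF W T k Wj[OF j] ci[OF j] x(1)[OF s]] x(2)[OF s] s unfolding h_def by simp
  qed
  ultimately show ?thesis by blast
qed

lemma pmor_id:
  assumes W: "cov W" and T: "T \<in> ptriple W"
  shows "pmor W T T (idt E (tX T)) (idt (Sets \<kappa>) (asrc (tp T)))"
proof (rule pmorI[OF W T T])
  note D = ptripleD[OF T] have Wo: "W \<in> ob E" using W unfolding cov_def by auto
  show "idt E (tX T) \<in> hom E (tX T) (tX T)" by (rule id_hom[OF D(1)])
  show "idt (Sets \<kappa>) (asrc (tp T)) \<in> hom (Sets \<kappa>) (asrc (tp T)) (asrc (tp T))" using Set.id_hom D(3) by auto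
  fix V w x assume "V \<in> CC W" "w \<in> hom E V W" "x \<in> hom E V (tX T)"
  then show "coord W T w (idt E (tX T) \<cdot> x) = body (idt (Sets \<kappa>) (asrc (tp T))) (coord W T w x)"
    using coord(2)[OF Wo T CC_conn] id_left by simp
qed simp

lemma pmor_comp:
  assumes W: "cov W" and T: "T \<in> ptriple W" "T' \<in> ptriple W" "T'' \<in> ptriple W"
    and f: "pmor W T T' f h" and g: "pmor W T' T'' g k"
  shows "pmor W T T'' (g \<cdot> f) (cmp (Sets \<kappa>) k h)"
proof (rule pmorI[OF W T(1,3)])
  note F = pmorD[OF W T(1,2) f] and G = pmorD[OF W T(2,3) g]
  have Wo: "W \<in> ob E" using W unfolding cov_def by auto
  show "g \<cdot> f \<in> hom E (tX T) (tX T'')" by (rule comp_hom[OF F(1) G(1)])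
  show "cmp (Sets \<kappa>) k h \<in> hom (Sets \<kappa>) (asrc (tp T)) (asrc (tp T''))" by (rule Set.comp_hom[OF F(2) G(2)])
  fix s assume s: "s \<in> asrc (tp T)"
  show "body (tp T'') (body (cmp (Sets \<kappa>) k h) s) = body (tp T) s"
    unfolding cmp_Sets_app[OF F(2) s] using G(3)[OF hom_Sets_in[OF F(2) s]] F(3)[OF s] by simp
next
  note F = pmorD[OF W T(1,2) f] and G = pmorD[OF W T(2,3) g]
  have Wo: "W \<in> ob E" using W unfolding cov_def by auto
  fix V w x assume V: "V \<in> CC W" and w: "w \<in> hom E V W" and x: "x \<in> hom E V (tX T)"
  show "coord W T'' w ((g \<cdot> f) \<cdot> x) = body (cmp (Sets \<kappa>) k h) (coord W T w x)"
    unfolding cmp_Sets_app[OF F(2) coord(2)[OF Wo T(1) CC_conn[OF V] w x]]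
    using comp_assoc[OF x F(1) G(1)] G(4)[OF V w comp_hom[OF x F(1)]] F(4)[OF V w x] by simp
qed

end

section \<open>Fully faithful functors with the same objects\<close>

lemma ff_lift:
  assumes "fully_faithful C E P" "x \<in> ob C" "y \<in> ob C" "e \<in> hom E (fob P x) (fob P y)"
  shows "\<exists>!f. f \<in> hom C x y \<and> far P f = e"
proof -
  have b: "bij_betw (far P) (hom C x y) (hom E (fob P x) (fob P y))"
    using assms unfolding fully_faithful_def by blast
  have "e \<in> far P ` hom C x y" using b assms(4) by (simp only: bij_betw_def)
  then obtain f where "f \<in> hom C x y" "far P f = e" by auto
  then show ?thesis using inj_onD[OF bij_betw_imp_inj_on[OF b]] by (intro ex1I[of _ f]) auto
qed

lemma ff_eqI:
  assumes "fully_faithful C E P" "x \<in> ob C" "y \<in> ob C" "f \<in> hom C x y" "g \<in> hom C x y" "far P f = far P g"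
  shows "f = g"
  using assms inj_onD[of "far P" "hom C x y"] unfolding fully_faithful_def bij_betw_def by blast

text \<open>Any choice of objects of \<open>D\<close> over the objects of \<open>C\<close> extends
  to arrows by full faithfulness of \<open>Q\<close>, and functoriality is checked after applying
  the faithful \<open>Q\<close>.\<close>

lemma ff_same_objects:
  assumes C: "category C" and D: "category D" and E: "category E"
    and P: "fully_faithful C E P" and Q: "fully_faithful D E Q"
    and sub: "fob P ` ob C \<subseteq> fob Q ` ob D"
  obtains F where "is_functor C D F" "\<And>x. x \<in> ob C \<Longrightarrow> fob Q (fob F x) = fob P x"
    "\<And>f. f \<in> ar C \<Longrightarrow> far Q (far F f) = far P f"
proof -
  interpret C: cat C using C by unfold_locales
  interpret D: cat D using D by unfold_locales
  interpret E: cat E using E by unfold_locales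
  have PF: "is_functor C E P" and QF: "is_functor D E Q" using P Q unfolding fully_faithful_def by auto
  have P_hom: "far P f \<in> hom E (fob P x) (fob P y)" if "f \<in> hom C x y" for f x y
    using PF that unfolding is_functor_def hom_def by auto
  have Q_comp: "far Q (cmp D g f) = cmp E (far Q g) (far Q f)" if "f \<in> hom D x y" "g \<in> hom D y z" for f g x y z
    using QF that unfolding is_functor_def hom_def by auto
  have P_comp: "far P (cmp C g f) = cmp E (far P g) (far P f)" if "f \<in> hom C x y" "g \<in> hom C y z" for f g x y z
    using PF that unfolding is_functor_def hom_def by auto
  have "\<exists>\<phi>. \<forall>x\<in>ob C. \<phi> x \<in> ob D \<and> fob Q (\<phi> x) = fob P x" by (intro bchoice) (use sub in force)
  then obtain \<phi> where \<phi>: "\<And>x. x \<in> ob C \<Longrightarrow> \<phi> x \<in> ob D" "\<And>x. x \<in> ob C \<Longrightarrow> fob Q (\<phi> x) = fob P x" by blast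
  define F where "F = \<lparr>fob = \<phi>, far = (\<lambda>f. THE g. g \<in> hom D (\<phi> (src C f)) (\<phi> (tgt C f)) \<and> far Q g = far P f)\<rparr>"
  have F: "far F f \<in> hom D (\<phi> x) (\<phi> y)" "far Q (far F f) = far P f" if f: "f \<in> hom C x y" for f x y
  proof -
    have xy: "x \<in> ob C" "y \<in> ob C" "src C f = x" "tgt C f = y" using f C.homD by auto
    have "far P f \<in> hom E (fob Q (\<phi> x)) (fob Q (\<phi> y))" using P_hom[OF f] \<phi> xy by simp
    from theI'[OF ff_lift[OF Q \<phi>(1)[OF xy(1)] \<phi>(1)[OF xy(2)] this]]
    show "far F f \<in> hom D (\<phi> x) (\<phi> y)" "far Q (far F f) = far P f" unfolding F_def using xy by auto
  qed
  have "is_functor C D F" unfolding is_functor_def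
  proof (intro conjI ballI impI)
    fix x assume x: "x \<in> ob C"
    then show "fob F x \<in> ob D" using \<phi> F_def by simp
    have "far F (idt C x) = idt D (\<phi> x)"
    proof (rule ff_eqI[OF Q \<phi>(1)[OF x] \<phi>(1)[OF x] F(1)[OF C.id_hom[OF x]] D.id_hom[OF \<phi>(1)[OF x]]])
      show "far Q (far F (idt C x)) = far Q (idt D (\<phi> x))"
        using F(2)[OF C.id_hom[OF x]] PF QF x \<phi>[OF x] unfolding is_functor_def by simp
    qed
    then show "far F (idt C x) = idt D (fob F x)" unfolding F_def by simp
  next
    fix f assume "f \<in> ar C"
    then show "far F f \<in> hom D (fob F (src C f)) (fob F (tgt C f))" using F(1)[of f "src C f" "tgt C f"] F_def by (simp add: hom_def)
  next
    fix f g assume "f \<in> ar C" "g \<in> ar C" "src C g = tgt C f"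
    then have f: "f \<in> hom C (src C f) (tgt C f)" and g: "g \<in> hom C (tgt C f) (tgt C g)" by (auto simp: hom_def)
    note o = \<phi>(1)[OF C.homD(4)[OF f]] \<phi>(1)[OF C.homD(5)[OF g]]
    show "far F (cmp C g f) = cmp D (far F g) (far F f)"
    proof (rule ff_eqI[OF Q o F(1)[OF C.comp_hom[OF f g]] D.comp_hom[OF F(1)[OF f] F(1)[OF g]]])
      show "far Q (far F (cmp C g f)) = far Q (cmp D (far F g) (far F f))"
        using F(2)[OF C.comp_hom[OF f g]] P_comp[OF f g] Q_comp[OF F(1)[OF f] F(1)[OF g]] F(2)[OF f] F(2)[OF g] by simp
    qed
  qed
  moreover have "fob Q (fob F x) = fob P x" if "x \<in> ob C" for x using \<phi> that F_def by simp
  moreover have "far Q (far F f) = far P f" if "f \<in> ar C" for f using F(2)[of f "src C f" "tgt C f"] that by (simp add: hom_def)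
  ultimately show thesis by (rule that)
qed

text \<open>\<open>H\<close> leaves the image under \<open>P\<close> unchanged, so identities of
  \<open>E\<close> lift to mutually inverse arrows between \<open>x\<close> and
  \<open>fob H x\<close>; all equations are checked after applying \<open>P\<close>.\<close>

lemma ff_id_iso:
  assumes C: "category C" and E: "category E" and P: "fully_faithful C E P" and H: "is_functor C C H"
    and H1: "\<And>x. x \<in> ob C \<Longrightarrow> fob P (fob H x) = fob P x" and H2: "\<And>f. f \<in> ar C \<Longrightarrow> far P (far H f) = far P f"
  shows "\<exists>\<tau>. nat_iso C C id_ftor H \<tau>" and "\<exists>\<tau>. nat_iso C C H id_ftor \<tau>"
proof -
  interpret C: cat C using C by unfold_locales
  interpret E: cat E using E by unfold_locales
  have PF: "is_functor C E P" using P unfolding fully_faithful_def by auto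
  have P_ob: "fob P x \<in> ob E" if "x \<in> ob C" for x using PF that unfolding is_functor_def by auto
  have P_hom: "far P f \<in> hom E (fob P x) (fob P y)" if "f \<in> hom C x y" for f x y
    using PF that unfolding is_functor_def hom_def by auto
  have P_id: "far P (idt C x) = idt E (fob P x)" if "x \<in> ob C" for x using PF that unfolding is_functor_def by auto
  have P_comp: "far P (cmp C g f) = cmp E (far P g) (far P f)" if "f \<in> hom C x y" "g \<in> hom C y z" for f g x y z
    using PF that unfolding is_functor_def hom_def by auto
  have H_ob: "fob H x \<in> ob C" if "x \<in> ob C" for x using H that unfolding is_functor_def by auto
  have H_hom: "far H f \<in> hom C (fob H x) (fob H y)" if "f \<in> hom C x y" for f x y
    using H that unfolding is_functor_def hom_def by auto
  have PH: "far P (far H f) = far P f" if "f \<in> hom C x y" for f x y using H2 that unfolding hom_def by auto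
  define \<tau> where "\<tau> x = (THE f. f \<in> hom C x (fob H x) \<and> far P f = idt E (fob P x))" for x
  define \<sigma> where "\<sigma> x = (THE f. f \<in> hom C (fob H x) x \<and> far P f = idt E (fob P x))" for x
  have \<tau>: "\<tau> x \<in> hom C x (fob H x)" "far P (\<tau> x) = idt E (fob P x)"
    and \<sigma>: "\<sigma> x \<in> hom C (fob H x) x" "far P (\<sigma> x) = idt E (fob P x)" if x: "x \<in> ob C" for x
  proof -
    note i = E.id_hom[OF P_ob[OF x]]
    show "\<tau> x \<in> hom C x (fob H x)" "far P (\<tau> x) = idt E (fob P x)"
      using theI'[OF ff_lift[OF P x H_ob[OF x]]] i H1[OF x] unfolding \<tau>_def by auto
    show "\<sigma> x \<in> hom C (fob H x) x" "far P (\<sigma> x) = idt E (fob P x)"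
      using theI'[OF ff_lift[OF P H_ob[OF x] x]] i H1[OF x] unfolding \<sigma>_def by auto
  qed
  have st: "cmp C (\<sigma> x) (\<tau> x) = idt C x" and ts: "cmp C (\<tau> x) (\<sigma> x) = idt C (fob H x)" if x: "x \<in> ob C" for x
  proof -
    note i = E.id_hom[OF P_ob[OF x]]
    show "cmp C (\<sigma> x) (\<tau> x) = idt C x"
      by (rule ff_eqI[OF P x x C.comp_hom[OF \<tau>(1)[OF x] \<sigma>(1)[OF x]] C.id_hom[OF x]])
        (simp add: P_comp[OF \<tau>(1)[OF x] \<sigma>(1)[OF x]] \<tau>(2)[OF x] \<sigma>(2)[OF x] P_id[OF x] E.id_left[OF i])
    show "cmp C (\<tau> x) (\<sigma> x) = idt C (fob H x)"
      by (rule ff_eqI[OF P H_ob[OF x] H_ob[OF x] C.comp_hom[OF \<sigma>(1)[OF x] \<tau>(1)[OF x]] C.id_hom[OF H_ob[OF x]]])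
        (simp add: P_comp[OF \<sigma>(1)[OF x] \<tau>(1)[OF x]] \<tau>(2)[OF x] \<sigma>(2)[OF x] P_id[OF H_ob[OF x]] H1[OF x] E.id_left[OF i])
  qed
  have n: "cmp C (\<tau> y) f = cmp C (far H f) (\<tau> x)" "cmp C (\<sigma> y) (far H f) = cmp C f (\<sigma> x)" if f: "f \<in> hom C x y" for f x y
  proof -
    have xy: "x \<in> ob C" "y \<in> ob C" using f C.homD by auto
    note Pf = P_hom[OF f]
    show "cmp C (\<tau> y) f = cmp C (far H f) (\<tau> x)"
      by (rule ff_eqI[OF P xy(1) H_ob[OF xy(2)] C.comp_hom[OF f \<tau>(1)[OF xy(2)]] C.comp_hom[OF \<tau>(1)[OF xy(1)] H_hom[OF f]]])
       (simp add: P_comp[OF f \<tau>(1)[OF xy(2)]] P_comp[OF \<tau>(1)[OF xy(1)] H_hom[OF f]] \<tau>(2)[OF xy(1)] \<tau>(2)[OF xy(2)] PH[OF f]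
         E.id_left[OF Pf] E.id_right[OF Pf])
    show "cmp C (\<sigma> y) (far H f) = cmp C f (\<sigma> x)"
      by (rule ff_eqI[OF P H_ob[OF xy(1)] xy(2) C.comp_hom[OF H_hom[OF f] \<sigma>(1)[OF xy(2)]] C.comp_hom[OF \<sigma>(1)[OF xy(1)] f]])
       (simp add: P_comp[OF H_hom[OF f] \<sigma>(1)[OF xy(2)]] P_comp[OF \<sigma>(1)[OF xy(1)] f] \<sigma>(2)[OF xy(1)] \<sigma>(2)[OF xy(2)] PH[OF f]
         E.id_left[OF Pf] E.id_right[OF Pf])
  qed
  have "nat_iso C C id_ftor H \<tau>"
    unfolding nat_iso_def nat_trans_def id_ftor_def
    using \<tau>(1) n(1) C.isoI[OF \<tau>(1) \<sigma>(1) st ts] by (auto simp: hom_def)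
  moreover have "nat_iso C C H id_ftor \<sigma>"
    unfolding nat_iso_def nat_trans_def id_ftor_def
    using \<sigma>(1) n(2) C.isoI[OF \<sigma>(1) \<tau>(1) ts st] by (auto simp: hom_def)
  ultimately show "\<exists>\<tau>. nat_iso C C id_ftor H \<tau>" "\<exists>\<tau>. nat_iso C C H id_ftor \<tau>" by blast+
qed

lemma is_functor_comp:
  assumes "is_functor C D F" "is_functor D E G" shows "is_functor C E (comp_ftor G F)"
  using assms unfolding is_functor_def comp_ftor_def by (auto simp: hom_def)

text \<open>Avoids comparing the two push-out topoi with \<open>Split\<close>: it suffices that
  their projections to \<open>E\<close> hit the same objects on the nose.\<close>

lemma equivalent_same_objects:
  assumes C: "category C" and D: "category D" and E: "category E"
    and P: "fully_faithful C E P" and Q: "fully_faithful D E Q"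
    and same: "fob P ` ob C = fob Q ` ob D"
  shows "equivalent_cats C D"
proof -
  obtain F where F: "is_functor C D F" "\<And>x. x \<in> ob C \<Longrightarrow> fob Q (fob F x) = fob P x" "\<And>f. f \<in> ar C \<Longrightarrow> far Q (far F f) = far P f"
    using ff_same_objects[OF C D E P Q] same by blast
  obtain G where G: "is_functor D C G" "\<And>x. x \<in> ob D \<Longrightarrow> fob P (fob G x) = fob Q x" "\<And>f. f \<in> ar D \<Longrightarrow> far P (far G f) = far Q f"
    using ff_same_objects[OF D C E Q P] same by blast
  have Fm: "fob F x \<in> ob D" if "x \<in> ob C" for x using F(1) that unfolding is_functor_def by auto
  have Fa: "far F f \<in> ar D" if "f \<in> ar C" for f using F(1) that unfolding is_functor_def hom_def by auto
  have Gm: "fob G x \<in> ob C" if "x \<in> ob D" for x using G(1) that unfolding is_functor_def by auto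
  have Ga: "far G f \<in> ar C" if "f \<in> ar D" for f using G(1) that unfolding is_functor_def hom_def by auto
  have "\<exists>\<tau>. nat_iso C C id_ftor (comp_ftor G F) \<tau>"
    by (rule ff_id_iso(1)[OF C E P is_functor_comp[OF F(1) G(1)]]) (simp_all add: comp_ftor_def F G Fm Fa)
  moreover have "\<exists>\<sigma>. nat_iso D D (comp_ftor F G) id_ftor \<sigma>"
    by (rule ff_id_iso(2)[OF D E Q is_functor_comp[OF G(1) F(1)]]) (simp_all add: comp_ftor_def F G Gm Ga)
  ultimately show ?thesis unfolding equivalent_cats_def using F(1) G(1) by blast
qed

context lc_topos begin

section \<open>The push-out topos and its fully faithful projection to \<open>E\<close>\<close>

abbreviation PP where "PP W \<equiv> pushout_topos \<kappa> E gsh gup \<eta> W"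

lemma ar_pushout: "t \<in> ar (PP W) \<longleftrightarrow> t \<in> hom (PP W) (asrc t) (atgt t)"
  unfolding hom_def by simp

lemma category_pushout:
  assumes W: "cov W" shows "category (PP W)"
  unfolding category_def
proof (intro conjI ballI impI)
  fix t assume t: "t \<in> ar (PP W)"
  then have t': "t \<in> hom (PP W) (asrc t) (atgt t)" by (simp add: ar_pushout)
  then obtain f h where T: "asrc t \<in> ptriple W" "atgt t \<in> ptriple W" and t_eq: "t = Arrow (asrc t) (f, h) (atgt t)" and m: "pmor W (asrc t) (atgt t) f h"
    unfolding hom_pushout by blast
  then show "src (PP W) t \<in> ob (PP W)" "tgt (PP W) t \<in> ob (PP W)" by auto
  note M = pmorD[OF W T m]
  have b: "body t = (f, h)" using t_eq by (metis arrow.sel(2))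
  have hi: "cmp (Sets \<kappa>) h (idt (Sets \<kappa>) (asrc (tp (asrc t)))) = h" by (rule Set.id_right[OF M(2)])
  have ih: "cmp (Sets \<kappa>) (idt (Sets \<kappa>) (asrc (tp (atgt t)))) h = h" by (rule Set.id_left[OF M(2)])
  show "cmp (PP W) t (idt (PP W) (src (PP W) t)) = t"
    using t_eq b hi id_right[OF M(1)] by (simp del: Sets_sel)
  show "cmp (PP W) (idt (PP W) (tgt (PP W) t)) t = t"
    using t_eq b ih id_left[OF M(1)] by (simp del: Sets_sel)
next
  fix T assume "T \<in> ob (PP W)"
  then show "idt (PP W) T \<in> hom (PP W) T T" using pmor_id[OF W] by (auto simp: hom_pushout simp del: Sets_sel)
next
  fix s t assume "s \<in> ar (PP W)" "t \<in> ar (PP W)" "src (PP W) t = tgt (PP W) s"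
  then have s: "s \<in> hom (PP W) (asrc s) (atgt s)" and t: "t \<in> hom (PP W) (atgt s) (atgt t)" by (auto simp: ar_pushout)
  obtain f h where S: "asrc s \<in> ptriple W" "atgt s \<in> ptriple W" "s = Arrow (asrc s) (f, h) (atgt s)" "pmor W (asrc s) (atgt s) f h"
    using s unfolding hom_pushout by blast
  obtain g k where T: "atgt t \<in> ptriple W" "t = Arrow (atgt s) (g, k) (atgt t)" "pmor W (atgt s) (atgt t) g k"
    using t unfolding hom_pushout by blast
  have b: "body s = (f, h)" "body t = (g, k)" using S(3) T(2) by (metis arrow.sel(2))+
  show "cmp (PP W) t s \<in> hom (PP W) (src (PP W) s) (tgt (PP W) t)"
    using pmor_comp[OF W S(1,2) T(1) S(4) T(3)] S(1) T(1) b by (simp add: hom_pushout del: Sets_sel)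
next
  fix r s t assume "r \<in> ar (PP W)" "s \<in> ar (PP W)" "t \<in> ar (PP W)" "src (PP W) s = tgt (PP W) r" "src (PP W) t = tgt (PP W) s"
  then have r: "r \<in> hom (PP W) (asrc r) (atgt r)" and s: "s \<in> hom (PP W) (atgt r) (atgt s)" and t: "t \<in> hom (PP W) (atgt s) (atgt t)"
    by (auto simp: ar_pushout)
  obtain f h where R: "asrc r \<in> ptriple W" "atgt r \<in> ptriple W" "r = Arrow (asrc r) (f, h) (atgt r)" "pmor W (asrc r) (atgt r) f h"
    using r unfolding hom_pushout by blast
  obtain f' h' where S: "atgt s \<in> ptriple W" "s = Arrow (atgt r) (f', h') (atgt s)" "pmor W (atgt r) (atgt s) f' h'"
    using s unfolding hom_pushout by blast
  obtain f'' h'' where T: "atgt t \<in> ptriple W" "t = Arrow (atgt s) (f'', h'') (atgt t)" "pmor W (atgt s) (atgt t) f'' h''"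
    using t unfolding hom_pushout by blast
  have b: "body r = (f, h)" "body s = (f', h')" "body t = (f'', h'')" using R(3) S(2) T(2) by (metis arrow.sel(2))+
  note m = pmorD[OF W R(1,2,4)] pmorD[OF W R(2) S(1,3)] pmorD[OF W S(1) T(1,3)]
  show "cmp (PP W) t (cmp (PP W) s r) = cmp (PP W) (cmp (PP W) t s) r"
    using b comp_assoc[OF m(1) m(5) m(9)] Set.comp_assoc[OF m(2) m(6) m(10)] by (simp del: Sets_sel)
qed

definition forget :: "(('o, 'a, 's) triple, (('o, 'a, 's) triple, 'a \<times> 's sarrow) arrow, 'o, 'a) ftor" where
  "forget = \<lparr>fob = tX, far = (\<lambda>t. fst (body t))\<rparr>"

text \<open>Full faithfulness restates \<open>pmor_unique\<close>.\<close>

lemma forget_ff: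
  assumes W: "cov W" shows "fully_faithful (PP W) E forget"
  unfolding fully_faithful_def is_functor_def
proof (intro conjI ballI impI)
  fix T assume "T \<in> ob (PP W)"
  then show "fob forget T \<in> ob E" "far forget (idt (PP W) T) = idt E (fob forget T)"
    using ptripleD(1) by (auto simp: forget_def)
next
  fix t assume "t \<in> ar (PP W)"
  then have t': "t \<in> hom (PP W) (asrc t) (atgt t)" by (simp add: ar_pushout)
  then obtain f h where T: "asrc t \<in> ptriple W" "atgt t \<in> ptriple W" and t_eq: "t = Arrow (asrc t) (f, h) (atgt t)" and m: "pmor W (asrc t) (atgt t) f h"
    unfolding hom_pushout by blast
  have b: "body t = (f, h)" using t_eq by (metis arrow.sel(2))
  show "far forget t \<in> hom E (fob forget (src (PP W) t)) (fob forget (tgt (PP W) t))"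
    using pmorD(1)[OF W T m] b by (simp add: forget_def)
next
  fix s t show "far forget (cmp (PP W) t s) = cmp E (far forget t) (far forget s)" by (simp add: forget_def)
next
  fix T T' assume "T \<in> ob (PP W)" "T' \<in> ob (PP W)"
  then have T: "T \<in> ptriple W" "T' \<in> ptriple W" by auto
  show "bij_betw (far forget) (hom (PP W) T T') (hom E (fob forget T) (fob forget T'))"
    unfolding bij_betw_def
  proof (intro conjI inj_onI set_eqI iffI)
    fix s t assume "s \<in> hom (PP W) T T'" "t \<in> hom (PP W) T T'" and e: "far forget s = far forget t"
    then obtain f h g k where st: "s = Arrow T (f, h) T'" "pmor W T T' f h" "t = Arrow T (g, k) T'" "pmor W T T' g k"
      unfolding hom_pushout by blast
    then have "f = g" using e by (simp add: forget_def)
    then have "h = k" using pmor_unique[OF W T pmorD(1)[OF W T st(2)]] st(2,4) by blast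
    then show "s = t" using st \<open>f = g\<close> by simp
  next
    fix f assume "f \<in> far forget ` hom (PP W) T T'"
    then obtain t where t: "t \<in> hom (PP W) T T'" "f = far forget t" by blast
    then obtain g k where "t = Arrow T (g, k) T'" "pmor W T T' g k" unfolding hom_pushout by blast
    then show "f \<in> hom E (fob forget T) (fob forget T')"
      using pmorD(1)[OF W T] t(2) by (simp add: forget_def)
  next
    fix f assume "f \<in> hom E (fob forget T) (fob forget T')"
    then have "f \<in> hom E (tX T) (tX T')" by (simp add: forget_def)
    then obtain h where "pmor W T T' f h" using pmor_unique[OF W T] by blast
    then have "Arrow T (f, h) T' \<in> hom (PP W) T T'" using T by (auto simp: hom_pushout)
    moreover have "f = far forget (Arrow T (f, h) T')" by (simp add: forget_def)
    ultimately show "f \<in> far forget ` hom (PP W) T T'" by blast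
  qed
qed

text \<open>The objects in the image of the projection are those satisfying \<open>spl\<close>, by
  \<open>ptriple_spl\<close> and \<open>spl_ptriple\<close>.\<close>

lemma pushout_equivalent:
  assumes W: "cov W" "cov W'" and same: "\<And>X. spl W X \<longleftrightarrow> spl W' X"
  shows "equivalent_cats (PP W) (PP W')"
proof (rule equivalent_same_objects[OF category_pushout[OF W(1)] category_pushout[OF W(2)] category forget_ff[OF W(1)] forget_ff[OF W(2)]])
  have "fob forget ` ob (PP W) = {X. spl W X}" if W: "cov W" for W
    using ptriple_spl[of W] spl_ptriple[OF W] W unfolding cov_def by (fastforce simp: forget_def)
  then show "fob forget ` ob (PP W) = fob forget ` ob (PP W')" using W same by simp
qed

section \<open>Coproducts and covers\<close>

lemma coproduct_inc:
  assumes "is_coproduct E I U UU inc" "i \<in> I" shows "inc i \<in> hom E (U i) UU" "U i \<in> ob E"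
  using assms unfolding is_coproduct_def by auto

lemma coproduct_map:
  assumes "is_coproduct E I U UU inc" "\<And>i. i \<in> I \<Longrightarrow> a i \<in> hom E (U i) Y" "Y \<in> ob E"
  shows "\<exists>!h. h \<in> hom E UU Y \<and> (\<forall>i\<in>I. h \<cdot> inc i = a i)"
  using assms unfolding is_coproduct_def by blast

lemma coproduct_jepi:
  assumes cop: "is_coproduct E I U UU inc" shows "jepi (inc ` I) UU"
  unfolding jepi_def
proof (intro conjI ballI allI impI)
  show "UU \<in> ob E" using cop unfolding is_coproduct_def by auto
  fix k assume "k \<in> inc ` I"
  then show "k \<in> ar E" "tgt E k = UU" using coproduct_inc(1)[OF cop] by (auto simp: hom_def)
next
  fix Y g h assume g: "g \<in> hom E UU Y" and h: "h \<in> hom E UU Y" and e: "\<forall>k\<in>inc ` I. g \<cdot> k = h \<cdot> k"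
  have "\<exists>!k. k \<in> hom E UU Y \<and> (\<forall>i\<in>I. k \<cdot> inc i = h \<cdot> inc i)"
    by (rule coproduct_map[OF cop comp_hom[OF coproduct_inc(1)[OF cop] h]]) (use homD(5)[OF g] in auto)
  then show "g = h" using g h e by blast
qed

text \<open>A monic \<open>s\<close> from the summand into an object with a global point extends to
  the whole coproduct, so \<open>inc i\<close> is monic as well.\<close>

lemma coproduct_mono:
  assumes cop: "is_coproduct E I U UU inc" and i: "i \<in> I" and x: "x \<in> hom E V (U i)" and y: "y \<in> hom E V (U i)"
    and e: "inc i \<cdot> x = inc i \<cdot> y"
  shows "x = y"
proof -
  obtain P s where s: "s \<in> hom E (U i) P" "hom E one P \<noteq> {}"
    and inj: "\<And>V a b. a \<in> hom E V (U i) \<Longrightarrow> b \<in> hom E V (U i) \<Longrightarrow> s \<cdot> a = s \<cdot> b \<Longrightarrow> a = b"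
    using topos_likeD(5)[OF topos_like coproduct_inc(2)[OF cop i]] terminal_one by blast
  obtain q where q: "q \<in> hom E one P" using s by blast
  \<comment> \<open>The other summands are sent to the point \<open>q\<close>.\<close>
  have "\<exists>!h. h \<in> hom E UU P \<and> (\<forall>k\<in>I. h \<cdot> inc k = (if k = i then s else q \<cdot> bang E (U k)))"
    by (rule coproduct_map[OF cop]) (use s comp_hom[OF bang_hom[OF coproduct_inc(2)[OF cop]] q] homD[OF q] in auto)
  then obtain h where h: "h \<in> hom E UU P" and "\<forall>k\<in>I. h \<cdot> inc k = (if k = i then s else q \<cdot> bang E (U k))"
    by (elim ex1E conjE)
  from bspec[OF this(2) i] have hs: "h \<cdot> inc i = s" by simp
  note c = coproduct_inc(1)[OF cop i]
  have "s \<cdot> x = s \<cdot> y" using comp_assoc[OF x c h] comp_assoc[OF y c h] e hs by simp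
  then show ?thesis using inj x y by blast
qed

text \<open>Labelling the summands gives a map to a two-element constant object, constant on
  \<open>V\<close>, so \<open>V\<close> meets one summand only; the local factorisations through it
  glue because \<open>inc i\<close> is monic.\<close>

lemma coproduct_conn:
  assumes cop: "is_coproduct E I U UU inc" and V: "conn V" and w: "w \<in> hom E V UU"
  shows "\<exists>i\<in>I. hom E V (U i) \<noteq> {}"
proof -
  obtain a b :: 's where ab: "a \<noteq> b" using ex_two by blast
  have sm: "small \<kappa> {a, b}" by (simp add: small_finite)
  have Vo: "V \<in> ob E" using conn_ob[OF V] .
  note J = jepi_factoring[OF coproduct_jepi[OF cop] w]
  note Us = coproduct_inc(2)[OF cop] and ci = coproduct_inc(1)[OF cop]
  have fac: "\<exists>i\<in>I. \<exists>u\<in>hom E (src E l) (U i). w \<cdot> l = inc i \<cdot> u" if "l \<in> factoring (inc ` I) w" for l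
    using that homD(2)[OF ci] unfolding factoring_def by auto
  have lh: "l \<in> hom E (src E l) V" if "l \<in> factoring (inc ` I) w" for l using jepi_ar[OF J that] .
  \<comment> \<open>Otherwise the family covering \<open>V\<close> could not distinguish two
    constants on \<open>V\<close>. The summand \<open>i\<close> is read off from such an
    \<open>l\<close>.\<close>
  have "\<exists>l\<in>factoring (inc ` I) w. \<pi> (src E l) \<noteq> {}"
  proof (rule ccontr)
    assume n: "\<not> ?thesis"
    note c = const_hom[OF Vo sm, of a] const_hom[OF Vo sm, of b]
    have "const V {a, b} a = const V {a, b} b"
    proof (rule jepiD[OF J c])
      fix l assume l: "l \<in> factoring (inc ` I) w"
      show "const V {a, b} a \<cdot> l = const V {a, b} b \<cdot> l"
        by (rule empty_eq[OF homD(4)[OF lh[OF l]] sm _ comp_hom[OF lh[OF l] c(1)] comp_hom[OF lh[OF l] c(2)]]) (use n l in auto)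
    qed auto
    then show False using const_eq_iff[OF V sm] ab by auto
  qed
  then obtain l0 where l0: "l0 \<in> factoring (inc ` I) w" "\<pi> (src E l0) \<noteq> {}" by blast
  obtain i u0 where i: "i \<in> I" and u0: "u0 \<in> hom E (src E l0) (U i)" "w \<cdot> l0 = inc i \<cdot> u0" using fac[OF l0(1)] by blast
  have "\<exists>!h. h \<in> hom E UU (\<gamma> {a, b}) \<and> (\<forall>k\<in>I. h \<cdot> inc k = const (U k) {a, b} (if k = i then a else b))"
    by (rule coproduct_map[OF cop const_hom[OF Us sm] \<gamma>_ob[OF sm]]) auto
  then obtain \<chi> where \<chi>: "\<chi> \<in> hom E UU (\<gamma> {a, b})" "\<And>k. k \<in> I \<Longrightarrow> \<chi> \<cdot> inc k = const (U k) {a, b} (if k = i then a else b)" by blast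
  define s where "s = val V {a, b} (\<chi> \<cdot> w)"
  have s: "s \<in> {a, b}" "\<chi> \<cdot> w = const V {a, b} s" using val[OF V sm comp_hom[OF w \<chi>(1)]] s_def by auto
  have key: "s = (if k = i then a else b)"
    if l: "l \<in> hom E Z V" "\<pi> Z \<noteq> {}" and k: "k \<in> I" and u: "u \<in> hom E Z (U k)" "w \<cdot> l = inc k \<cdot> u" for l Z k u
  proof -
    have "const Z {a, b} s = const Z {a, b} (if k = i then a else b)"
      using const_comp[OF l(1) sm s(1)] s(2) comp_assoc[OF l(1) w \<chi>(1)] u(2) comp_assoc[OF u(1) ci[OF k] \<chi>(1)] \<chi>(2)[OF k]
        const_comp[OF u(1) sm, of "if k = i then a else b"] by simp
    then show ?thesis using const_inj[OF homD(4)[OF l(1)] sm s(1) _ _ l(2)] by auto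
  qed
  have sa: "s = a" using key[OF lh[OF l0(1)] l0(2) i u0] by simp
  \<comment> \<open>All local lifts to the summand \<open>i\<close>. Sources without components are
    initial and hence lift trivially; the others lie over \<open>i\<close> by
    \<open>key\<close>.\<close>
  define R where "R = {(l, u). l \<in> hom E (src E l) V \<and> u \<in> hom E (src E l) (U i) \<and> w \<cdot> l = inc i \<cdot> u}"
  have sub: "factoring (inc ` I) w \<subseteq> fst ` R"
  proof
    fix l assume l: "l \<in> factoring (inc ` I) w"
    obtain k u where k: "k \<in> I" and u: "u \<in> hom E (src E l) (U k)" "w \<cdot> l = inc k \<cdot> u" using fac[OF l] by blast
    show "l \<in> fst ` R"
    proof (cases "\<pi> (src E l) = {}")
      case True
      note ini = empty_initial[OF homD(4)[OF lh[OF l]] True]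
      obtain u' where u': "u' \<in> hom E (src E l) (U i)" using ini Us[OF i] unfolding is_initial_def by blast
      have "w \<cdot> l = inc i \<cdot> u'"
        using ini comp_hom[OF lh[OF l] w] comp_hom[OF u' ci[OF i]] homD(5)[OF w] unfolding is_initial_def by blast
      then have "(l, u') \<in> R" unfolding R_def using lh[OF l] u' by auto
      then show ?thesis by force
    next
      case False
      then have "k = i" using key[OF lh[OF l] False k u] sa ab by (simp split: if_splits)
      then have "(l, u) \<in> R" unfolding R_def using lh[OF l] u by auto
      then show ?thesis by force
    qed
  qed
  have "jepi (fst ` R) V"
    unfolding jepi_def
  proof (intro conjI ballI allI impI Vo)
    fix k assume "k \<in> fst ` R" then show "k \<in> ar E" "tgt E k = V" unfolding R_def by (auto simp: hom_def)
  next
    fix Y g h assume g: "g \<in> hom E V Y" and h: "h \<in> hom E V Y" and e: "\<forall>k\<in>fst ` R. g \<cdot> k = h \<cdot> k"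
    show "g = h" by (rule jepiD[OF J g h]) (use e sub in blast)
  qed
  then have "\<exists>h\<in>hom E V (U i). \<forall>(k, y)\<in>R. h \<cdot> k = y"
  proof (rule topos_likeD(4)[OF topos_like Us[OF i]])
    fix k y assume "(k, y) \<in> R" then show "y \<in> hom E (src E k) (U i)" unfolding R_def by auto
  next
    fix k y k' y' c d Z assume R: "(k, y) \<in> R" "(k', y') \<in> R" and c: "c \<in> hom E Z (src E k)" and d: "d \<in> hom E Z (src E k')"
      and e: "k \<cdot> c = k' \<cdot> d"
    have k: "k \<in> hom E (src E k) V" "y \<in> hom E (src E k) (U i)" "w \<cdot> k = inc i \<cdot> y"
      "k' \<in> hom E (src E k') V" "y' \<in> hom E (src E k') (U i)" "w \<cdot> k' = inc i \<cdot> y'" using R unfolding R_def by auto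
    show "y \<cdot> c = y' \<cdot> d"
    proof (rule coproduct_mono[OF cop i comp_hom[OF c k(2)] comp_hom[OF d k(5)]])
      show "inc i \<cdot> (y \<cdot> c) = inc i \<cdot> (y' \<cdot> d)"
        using comp_assoc[OF c k(2) ci[OF i]] comp_assoc[OF d k(5) ci[OF i]] comp_assoc[OF c k(1) w] comp_assoc[OF d k(4) w] k(3,6) e
        by simp
    qed
  qed
  then show ?thesis using i by blast
qed

text \<open>Every \<open>bang E (U i)\<close> factors through \<open>bang E UU\<close>.\<close>

lemma cover_cov:
  assumes cov: "is_cover E I U" and cop: "is_coproduct E I U UU inc" shows "cov UU"
  unfolding cov_def jepi_def
proof (intro conjI ballI allI impI)
  show UUo: "UU \<in> ob E" using cop unfolding is_coproduct_def by auto
  show "one \<in> ob E" by (rule one_ob)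
  note b = bang_hom[OF UUo]
  fix k assume "k \<in> {bang E UU}" then show "k \<in> ar E" "tgt E k = one" using b homD by auto
next
  have UUo: "UU \<in> ob E" using cop unfolding is_coproduct_def by auto
  note b = bang_hom[OF UUo]
  fix Y g h assume g: "g \<in> hom E one Y" and h: "h \<in> hom E one Y" and e: "\<forall>k\<in>{bang E UU}. g \<cdot> k = h \<cdot> k"
  have "g \<cdot> bang E (U i) = h \<cdot> bang E (U i)" if i: "i \<in> I" for i
  proof -
    note c = coproduct_inc[OF cop i]
    have "bang E (U i) = bang E UU \<cdot> inc i" by (rule one_eq[OF bang_hom[OF c(2)] comp_hom[OF c(1) b]])
    then show ?thesis using comp_assoc[OF c(1) b g] comp_assoc[OF c(1) b h] e by simp
  qed
  then show "g = h" using cov g h unfolding is_cover_def by (auto simp: hom_def)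
qed

section \<open>Representing objects are Galois\<close>

text \<open>Maps from a connected object to \<open>\<gamma> S\<close> are the elements of
  \<open>S\<close>, whatever the object.\<close>

lemma const_spl:
  assumes S: "small \<kappa> S" shows "spl W (\<gamma> S)"
proof (rule splI)
  show "\<gamma> S \<in> ob E" by (rule \<gamma>_ob[OF S])
  fix V assume V: "V \<in> CC W"
  show "\<exists>(S' :: 's set) \<beta>. small \<kappa> S' \<and> (\<forall>V'\<in>CC W. \<forall>v\<in>hom E V' V. bij_betw (\<beta> v) S' (hom E V' (\<gamma> S)) \<and> 
      (\<forall>s\<in>S'. \<beta> v s = \<beta> (idt E V) s \<cdot> v))"
  proof (intro exI conjI ballI)
    show "small \<kappa> S" by (rule S)
    fix V' v assume V': "V' \<in> CC W" and v: "v \<in> hom E V' V"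
    note Vc = CC_conn[OF V'] and s = homD(2)[OF v]
    show "bij_betw (\<lambda>s. const (src E v) S s) S (hom E V' (\<gamma> S))"
      unfolding s by (rule bij_betwI[of _ _ _ "val V' S"])
        (use const_hom[OF CC_ob[OF V'] S] val[OF Vc S] val_const[OF Vc S] in auto)
    fix x assume x: "x \<in> S"
    show "const (src E v) S x = const (src E (idt E V)) S x \<cdot> v"
      using const_comp[OF v S x] s CC_ob[OF V] by simp
  qed
qed

text \<open>On split objects, \<open>b\<close> is a universal element of the functor of maps from
  \<open>V\<close>. Cancelling \<open>b\<close> and factoring through \<open>b\<close> are thus
  possible for maps to split objects.\<close>

definition universal :: "'o \<Rightarrow> 'o \<Rightarrow> 'o \<Rightarrow> 'a \<Rightarrow> bool" where
  "universal W A V b \<longleftrightarrow> (\<forall>X. spl W X \<longrightarrow> bij_betw (\<lambda>f. f \<cdot> b) (hom E A X) (hom E V X))"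

text \<open>Yoneda: the image \<open>s0\<close> of the identity is a point of the fibre of
  \<open>A\<close> at \<open>i\<close>, and coordinates identify this fibre with the maps to
  \<open>A\<close> from the component of \<open>W\<close> at \<open>i\<close>.\<close>

lemma represents_universal:
  assumes W: "cov W" and i: "i \<in> \<pi> W" and rep: "represents (PP W) (fibre_ftor i) T"
  shows "\<exists>a\<in>hom E (cob W i) (tX T). universal W (tX T) (cob W i) a"
proof -
  have Wo: "W \<in> ob E" using W unfolding cov_def by auto
  obtain \<phi> where T: "T \<in> ptriple W" and \<phi>: "\<And>Y. Y \<in> ptriple W \<Longrightarrow> bij_betw (\<phi> Y) (hom (PP W) T Y) (fob (fibre_ftor i) Y)"
    and nat: "\<And>k h. k \<in> ar (PP W) \<Longrightarrow> h \<in> hom (PP W) T (asrc k) \<Longrightarrow>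
        \<phi> (atgt k) (cmp (PP W) k h) = body (far (fibre_ftor i) k) (\<phi> (asrc k) h)"
    using rep unfolding represents_def by auto
  interpret P: cat "PP W" by unfold_locales (rule category_pushout[OF W])
  have idT: "idt (PP W) T \<in> hom (PP W) T T" using P.id_hom T by simp
  define s0 where "s0 = \<phi> T (idt (PP W) T)"
  have s0: "s0 \<in> fibre (tp T) i" using bij_betwE[OF \<phi>[OF T]] idT unfolding s0_def fibre_ftor_def by auto
  then have s0': "s0 \<in> asrc (tp T)" "body (tp T) s0 = i" unfolding fibre_def by auto
  have V0: "cob W i \<in> CC W" using CC_cob[OF Wo _ i] id_hom[OF Wo] by blast
  note Vc = CC_conn[OF V0] and w = cin(1)[OF Wo i] and cw = cpt_cin[OF Wo i]
  obtain a where a: "a \<in> hom E (cob W i) (tX T)" "coord W T (cin W i) a = s0"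
    using coord_surj[OF Wo T Vc w s0'(1)] s0'(2) cw by metis
  have "bij_betw (\<lambda>f. f \<cdot> a) (hom E (tX T) X) (hom E (cob W i) X)" if X: "spl W X" for X
  proof -
    obtain T' where T': "T' \<in> ptriple W" "tX T' = X" using spl_ptriple[OF W X] by blast
    \<comment> \<open>The arrow of the push-out topos over \<open>f\<close>. Its effect on
      \<open>s0\<close> is the coordinate of \<open>f \<cdot> a\<close>, so precomposition with
      \<open>a\<close> corresponds to the bijection \<open>\<phi> T'\<close>.\<close>
    define K where "K f = Arrow T (f, THE h. pmor W T T' f h) T'" for f
    have K: "K f \<in> hom (PP W) T T'" "coord W T' (cin W i) (f \<cdot> a) = \<phi> T' (K f)" if f: "f \<in> hom E (tX T) X" for f
    proof -
      have m: "pmor W T T' f (THE h. pmor W T T' f h)" by (rule theI'[OF pmor_unique[OF W T T'(1)]]) (use f T' in simp)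
      then show Kh: "K f \<in> hom (PP W) T T'" unfolding hom_pushout K_def using T T' by blast
      have "\<phi> T' (K f) = body (far (fibre_ftor i) (K f)) s0"
        using nat[of "K f" "idt (PP W) T"] idT Kh P.id_right[OF Kh] unfolding s0_def by (simp add: hom_def K_def)
      also have "\<dots> = body (THE h. pmor W T T' f h) s0" using s0 unfolding fibre_ftor_def K_def by simp
      also have "\<dots> = coord W T' (cin W i) (f \<cdot> a)" using pmorD(4)[OF W T T'(1) m V0 w a(1)] a(2) by simp
      finally show "coord W T' (cin W i) (f \<cdot> a) = \<phi> T' (K f)" ..
    qed
    have Kb: "bij_betw K (hom E (tX T) X) (hom (PP W) T T')"
      unfolding bij_betw_def
    proof (intro conjI inj_onI set_eqI iffI)
      fix f g assume "K f = K g" then show "f = g" unfolding K_def by simp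
    next
      fix k assume "k \<in> K ` hom E (tX T) X" then show "k \<in> hom (PP W) T T'" using K(1) by auto
    next
      fix k assume "k \<in> hom (PP W) T T'"
      then obtain f h where k: "k = Arrow T (f, h) T'" "pmor W T T' f h" unfolding hom_pushout by blast
      have f: "f \<in> hom E (tX T) (tX T')" using pmorD(1)[OF W T T'(1) k(2)] .
      have "(THE h. pmor W T T' f h) = h" using pmor_unique[OF W T T'(1) f] k(2) by (rule the1_equality)
      then have "k = K f" unfolding K_def k by simp
      then show "k \<in> K ` hom E (tX T) X" using f T' by auto
    qed
    have c: "bij_betw (coord W T' (cin W i)) (hom E (cob W i) X) (fibre (tp T') i)"
      using coord_bij[OF Wo T'(1) Vc w] cw T'(2) by simp
    have "bij_betw (\<phi> T' \<circ> K) (hom E (tX T) X) (fibre (tp T') i)"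
      using bij_betw_trans[OF Kb \<phi>[OF T'(1)]] by (simp add: fibre_ftor_def)
    then have "bij_betw (coord W T' (cin W i) \<circ> (\<lambda>f. f \<cdot> a)) (hom E (tX T) X) (fibre (tp T') i)"
      using bij_betw_cong[of "hom E (tX T) X" "\<phi> T' \<circ> K" "coord W T' (cin W i) \<circ> (\<lambda>f. f \<cdot> a)"] K(2) by simp
    moreover have "(\<lambda>f. f \<cdot> a) ` hom E (tX T) X \<subseteq> hom E (cob W i) X" using comp_hom[OF a(1)] by auto
    ultimately show ?thesis using bij_betw_comp_iff2[OF c] by blast
  qed
  then show ?thesis using a(1) unfolding universal_def by blast
qed

end

text \<open>The push-out topos no longer appears: representability is reduced to one universal map
  \<open>a\<close> from one object of \<open>CC W\<close>.\<close>

locale galois = lc_topos \<kappa> E gup gdn gsh \<eta>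
  for \<kappa> :: "'s rel" and E :: "('o, 'a) cat" and gup gdn gsh \<eta> +
  fixes W A V0 :: 'o and a :: 'a
  assumes W: "cov W" and A: "spl W A" and V0: "V0 \<in> CC W" and a: "a \<in> hom E V0 A" and univ_a: "universal W A V0 a"
begin

lemma A_ob: "A \<in> ob E" using A unfolding spl_def by auto

lemma universal_eqI:
  assumes "universal W A V b" "spl W X" "f \<in> hom E A X" "g \<in> hom E A X" "f \<cdot> b = g \<cdot> b" shows "f = g"
  using assms bij_betw_imp_inj_on inj_onD unfolding universal_def by metis

lemma universal_surj:
  assumes "universal W A V b" "spl W X" "x \<in> hom E V X" obtains f where "f \<in> hom E A X" "f \<cdot> b = x"
proof -
  have "x \<in> (\<lambda>f. f \<cdot> b) ` hom E A X" using assms unfolding universal_def bij_betw_def by blast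
  then show thesis using that by auto
qed

text \<open>\<open>\<gamma> S\<close> is split, so \<open>f\<close> is determined by its restriction
  along \<open>a\<close>, which is constant as \<open>V0\<close> is connected.\<close>

lemma to_const:
  assumes S: "small \<kappa> S" and f: "f \<in> hom E A (\<gamma> S)"
  obtains s where "s \<in> S" "f = const A S s"
proof -
  define s where "s = val V0 S (f \<cdot> a)"
  have s: "s \<in> S" "f \<cdot> a = const V0 S s" using val[OF CC_conn[OF V0] S comp_hom[OF a f]] s_def by auto
  have "f = const A S s"
    by (rule universal_eqI[OF univ_a const_spl[OF S] f const_hom[OF A_ob S s(1)]]) (simp add: s const_comp[OF a S s(1)])
  then show thesis using s(1) that by blast
qed

text \<open>Universality is invariant under the transition maps, so it is the indicator of a map from
  \<open>A\<close> to a two-element constant object; that map is constant and takes the right value at \<open>a\<close>.\<close>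

lemma all_universal:
  assumes V: "V \<in> CC W" and b: "b \<in> hom E V A"
  shows "universal W A V b"
proof -
  obtain p q :: 's where pq: "p \<noteq> q" using ex_two by blast
  have sm: "small \<kappa> {p, q}" by (simp add: small_finite)
  have inv: "universal W A (src E (v \<cdot> u)) (v \<cdot> u) \<longleftrightarrow> universal W A (src E v) v"
    if V: "V \<in> CC W" "V' \<in> CC W" and v: "v \<in> hom E V A" and u: "u \<in> hom E V' V" for V V' v u
  proof -
    have "bij_betw (\<lambda>f. f \<cdot> (v \<cdot> u)) (hom E A X) (hom E V' X) \<longleftrightarrow> bij_betw (\<lambda>f. f \<cdot> v) (hom E A X) (hom E V X)"
      if X: "spl W X" for X
    proof -
      \<comment> \<open>Precomposition with \<open>u\<close> is bijective on maps to split objects,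
        so it neither creates nor destroys universality.\<close>
      have b: "bij_betw (\<lambda>x. x \<cdot> u) (hom E V X) (hom E V' X)" using X V u unfolding spl_def by blast
      have "(\<lambda>f. f \<cdot> v) ` hom E A X \<subseteq> hom E V X" using comp_hom[OF v] by auto
      then have "bij_betw (\<lambda>f. f \<cdot> v) (hom E A X) (hom E V X) \<longleftrightarrow>
          bij_betw ((\<lambda>x. x \<cdot> u) \<circ> (\<lambda>f. f \<cdot> v)) (hom E A X) (hom E V' X)"
        by (rule bij_betw_comp_iff2[OF b])
      also have "\<dots> \<longleftrightarrow> bij_betw (\<lambda>f. f \<cdot> (v \<cdot> u)) (hom E A X) (hom E V' X)"
        by (rule bij_betw_cong) (simp add: comp_assoc[OF u v])
      finally show ?thesis by simp
    qed
    then show ?thesis unfolding universal_def using homD(2)[OF v] homD(2)[OF comp_hom[OF u v]] by simp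
  qed
  obtain \<chi> where \<chi>: "\<chi> \<in> hom E A (\<gamma> {p, q})"
    "\<And>V v. V \<in> CC W \<Longrightarrow> v \<in> hom E V A \<Longrightarrow> \<chi> \<cdot> v = const V {p, q} (if universal W A (src E v) v then p else q)"
  proof -
    have "\<exists>f\<in>hom E A (\<gamma> {p, q}). \<forall>V\<in>CC W. \<forall>v\<in>hom E V A. f \<cdot> v = const V {p, q} (if universal W A (src E v) v then p else q)"
    proof (rule CC_indicator[OF W A_ob sm])
      fix V V' v u assume h: "V \<in> CC W" "V' \<in> CC W" "v \<in> hom E V A" "u \<in> hom E V' V"
      show "universal W A (src E (v \<cdot> u)) (v \<cdot> u) \<longleftrightarrow> universal W A (src E v) v" by (rule inv[OF h])
    qed auto
    then show thesis using that by blast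
  qed
  obtain s where s: "s \<in> {p, q}" "\<chi> = const A {p, q} s" using to_const[OF sm \<chi>(1)] .
  have val: "s = (if universal W A (src E v) v then p else q)" if V: "V \<in> CC W" and v: "v \<in> hom E V A" for V v
    using \<chi>(2)[OF V v] const_comp[OF v sm s(1)] s(2) const_eq_iff[OF CC_conn[OF V] sm s(1)] by simp
  have "s = p" using val[OF V0 a] univ_a homD(2)[OF a] by simp
  then show ?thesis using val[OF V b] pq homD(2)[OF b] by (simp split: if_splits)
qed

text \<open>As \<open>A\<close> is split, having a map to \<open>A\<close> is invariant along maps
  of \<open>CC W\<close>; it holds for \<open>V0\<close>.\<close>

lemma hom_A: "V \<in> CC W \<Longrightarrow> hom E V A \<noteq> {}"
proof (rule CC_connected[OF W _ V0, where T = "\<lambda>V. hom E V A \<noteq> {}"])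
  show "hom E V0 A \<noteq> {}" using a by blast
  fix V V' u assume V: "V \<in> CC W" "V' \<in> CC W" "u \<in> hom E V' V"
  then have "bij_betw (\<lambda>x. x \<cdot> u) (hom E V A) (hom E V' A)" using A unfolding spl_def by blast
  then show "hom E V' A \<noteq> {} \<longleftrightarrow> hom E V A \<noteq> {}" unfolding bij_betw_def by blast
qed

section \<open>\<open>A\<close> as a connected cover\<close>

lemma cov_A: "cov A"
  unfolding cov_def jepi_def
proof (intro conjI ballI allI impI A_ob one_ob)
  note b = bang_hom[OF A_ob]
  fix k assume "k \<in> {bang E A}" then show "k \<in> ar E" "tgt E k = one" using b homD by auto
next
  note b = bang_hom[OF A_ob]
  fix Y g h assume g: "g \<in> hom E one Y" and h: "h \<in> hom E one Y" and e: "\<forall>k\<in>{bang E A}. g \<cdot> k = h \<cdot> k"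
  show "g = h"
  proof (rule CC_ext[OF W g h])
    fix V v assume V: "V \<in> CC W" and v: "v \<in> hom E V one"
    obtain x where x: "x \<in> hom E V A" using hom_A[OF V] by blast
    have "v = bang E A \<cdot> x" by (rule one_eq[OF v comp_hom[OF x b]])
    then show "g \<cdot> v = h \<cdot> v" using comp_assoc[OF x b g] comp_assoc[OF x b h] e by simp
  qed
qed

lemma epi_A: "epi E (bang E A)"
proof -
  note b = bang_hom[OF A_ob]
  have J: "jepi {bang E A} one" using cov_A unfolding cov_def by auto
  show ?thesis unfolding epi_def
  proof (intro conjI ballI impI)
    show "bang E A \<in> ar E" using b homD by auto
    fix g h assume "g \<in> ar E" "h \<in> ar E" "src E g = tgt E (bang E A)" "src E h = tgt E (bang E A)" "tgt E g = tgt E h"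
      and e: "g \<cdot> bang E A = h \<cdot> bang E A"
    then have "g \<in> hom E one (tgt E h)" "h \<in> hom E one (tgt E h)" using homD(3)[OF b] by (auto simp: hom_def)
    then show "g = h" using jepiD[OF J] e by auto
  qed
qed

lemma cover_A: "is_cover E {()} (\<lambda>_. A)"
  using A_ob epi_A homD(3)[OF bang_hom[OF A_ob]] unfolding is_cover_def epi_def by simp

text \<open>Two different constants on \<open>V0\<close> factor through \<open>A\<close> along
  \<open>a\<close>.\<close>

lemma not_initial_A: "\<not> is_initial E A"
proof
  assume ini: "is_initial E A"
  obtain p q :: 's where pq: "p \<noteq> q" using ex_two by blast
  have sm: "small \<kappa> {p, q}" by (simp add: small_finite)
  have "const A {p, q} p = const A {p, q} q"
    using ini const_hom[OF A_ob sm] \<gamma>_ob[OF sm] unfolding is_initial_def by blast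
  then have "const V0 {p, q} p = const V0 {p, q} q" using const_comp[OF a sm] by (metis insertI1 insertI2)
  then show False using const_eq_iff[OF CC_conn[OF V0] sm] pq by auto
qed

text \<open>The map labelling the two summands is constant by \<open>to_const\<close>. On a summand
  with the other label two distinct constants agree, so it has no components and is initial.\<close>

lemma connected_A: "connected_object E A"
  unfolding connected_object_def
proof (intro conjI allI impI A_ob)
  fix Y inc assume cop: "is_coproduct E (UNIV :: bool set) Y A inc"
  obtain p q :: 's where pq: "p \<noteq> q" using ex_two by blast
  have sm: "small \<kappa> {p, q}" by (simp add: small_finite)
  note Yo = coproduct_inc(2)[OF cop UNIV_I] and ci = coproduct_inc(1)[OF cop UNIV_I]
  have "\<exists>!h. h \<in> hom E A (\<gamma> {p, q}) \<and> (\<forall>i\<in>UNIV. h \<cdot> inc i = const (Y i) {p, q} (if i then p else q))"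
    by (rule coproduct_map[OF cop const_hom[OF Yo sm] \<gamma>_ob[OF sm]]) auto
  then obtain \<chi> where \<chi>: "\<chi> \<in> hom E A (\<gamma> {p, q})" "\<And>i. \<chi> \<cdot> inc i = const (Y i) {p, q} (if i then p else q)" by blast
  obtain s where s: "s \<in> {p, q}" "\<chi> = const A {p, q} s" using to_const[OF sm \<chi>(1)] .
  have e: "const (Y i) {p, q} s = const (Y i) {p, q} (if i then p else q)" for i
    using \<chi>(2)[of i] const_comp[OF ci sm s(1)] s(2) by simp
  have ini: "is_initial E (Y i)" if "s \<noteq> (if i then p else q)" for i
  proof (rule empty_initial[OF Yo], rule ccontr)
    assume "\<pi> (Y i) \<noteq> {}"
    then have "s = (if i then p else q)" by (intro const_inj[OF Yo sm s(1) _ e]) auto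
    then show False using that by simp
  qed
  have "s \<noteq> p \<or> s \<noteq> q" using pq by auto
  then show "is_initial E (Y True) \<or> is_initial E (Y False)" using ini[of True] ini[of False] by (simp only: if_True if_False) blast
qed

text \<open>For an endomorphism \<open>e\<close> the map \<open>e \<cdot> a\<close> is universal
  too, so \<open>a\<close> factors through it, which gives a left inverse of \<open>e\<close>. The
  left inverse has a left inverse itself, so it is two-sided.\<close>

lemma Aut_A: "Aut E A = hom E A A"
proof -
  have left: "\<exists>g\<in>hom E A A. g \<cdot> e = idt E A" if e: "e \<in> hom E A A" for e
  proof -
    obtain g where g: "g \<in> hom E A A" "g \<cdot> (e \<cdot> a) = a"
      using universal_surj[OF all_universal[OF V0 comp_hom[OF a e]] A a] .
    have "g \<cdot> e = idt E A"
      by (rule universal_eqI[OF univ_a A comp_hom[OF e g(1)] id_hom[OF A_ob]])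
        (simp add: comp_assoc[OF a e g(1)] g(2) id_left[OF a])
    then show ?thesis using g(1) by blast
  qed
  have "iso E e" if e: "e \<in> hom E A A" for e
  proof -
    obtain g where g: "g \<in> hom E A A" "g \<cdot> e = idt E A" using left[OF e] by blast
    obtain k where k: "k \<in> hom E A A" "k \<cdot> g = idt E A" using left[OF g(1)] by blast
    have "k = k \<cdot> (g \<cdot> e)" using g(2) id_right[OF k(1)] by simp
    also have "\<dots> = e" using comp_assoc[OF e g(1) k(1)] k(2) id_left[OF e] by simp
    finally show ?thesis using isoI[OF e g(1) g(2)] k(2) by simp
  qed
  then show ?thesis unfolding Aut_def by auto
qed

lemma hom_A_copy:
  assumes X: "spl W X"
  obtains G :: "'s set" and e where "small \<kappa> G" "bij_betw e G (hom E A X)"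
proof -
  have "small \<kappa> (hom E V0 X)" using X V0 unfolding spl_def by auto
  moreover have "bij_betw (\<lambda>f. f \<cdot> a) (hom E A X) (hom E V0 X)" using univ_a X unfolding universal_def by auto
  ultimately have "small \<kappa> (hom E A X)" using small_bij by blast
  then show thesis using small_copy that by blast
qed

text \<open>For connected \<open>V\<close> each map \<open>x\<close> to \<open>A\<close> is
  universal, so any second map to \<open>A\<close> is \<open>f \<cdot> x\<close> for a unique
  endomorphism \<open>f\<close>, which is an automorphism by \<open>Aut_A\<close>.\<close>

lemma action_iso:
  assumes G: "small \<kappa> G" and e: "bij_betw e G (Aut E A)"
  shows "\<exists>m. canonical_action_map E gup A G e m \<and> iso E m"
proof -
  note e' = e[unfolded Aut_A] and gG = \<gamma>_ob[OF G]
  note p1 = pr_hom(1)[OF A_ob gG] and p2 = pr_hom(2)[OF A_ob gG] and q1 = pr_hom(1)[OF A_ob A_ob] and q2 = pr_hom(2)[OF A_ob A_ob]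
  have eh: "e g \<in> hom E A A" if "g \<in> G" for g using bij_betwE[OF e'] that by auto
  \<comment> \<open>By \<open>form\<close> a map \<open>z\<close> from a connected object is a pair
    of a map \<open>x\<close> and an element \<open>g\<close>; it is sent to the pair of
    \<open>x\<close> and \<open>e g \<cdot> x\<close>.\<close>
  define \<alpha> where "\<alpha> z = pairing E (pr1 E A (\<gamma> G) \<cdot> z) (e (val (src E z) G (pr2 E A (\<gamma> G) \<cdot> z)) \<cdot> (pr1 E A (\<gamma> G) \<cdot> z))" for z
  have \<alpha>: "\<alpha> (pairing E x (const V G g)) = pairing E x (e g \<cdot> x)" if V: "V \<in> CC W" and x: "x \<in> hom E V A" and g: "g \<in> G" for V x g
    unfolding \<alpha>_def using pairing[OF x const_hom[OF CC_ob[OF V] G g]] homD(2) val_const[OF CC_conn[OF V] G g] by simp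
  have form: "\<exists>x\<in>hom E V A. \<exists>g\<in>G. z = pairing E x (const V G g)" if V: "V \<in> CC W" and z: "z \<in> hom E V (prod_ob E A (\<gamma> G))" for V z
    using val[OF CC_conn[OF V] G comp_hom[OF z p2]] pairing_eta[OF z A_ob gG] comp_hom[OF z p1] by metis
  have "\<exists>m\<in>hom E (prod_ob E A (\<gamma> G)) (prod_ob E A A). \<forall>V\<in>CC W. \<forall>z\<in>hom E V (prod_ob E A (\<gamma> G)). m \<cdot> z = \<alpha> z"
  proof (rule CC_dense[OF W prod_ob_ob[OF A_ob gG] prod_ob_ob[OF A_ob A_ob]])
    fix V z assume V: "V \<in> CC W" and z: "z \<in> hom E V (prod_ob E A (\<gamma> G))"
    obtain x g where x: "x \<in> hom E V A" "g \<in> G" "z = pairing E x (const V G g)" using form[OF V z] by blast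
    show "\<alpha> z \<in> hom E V (prod_ob E A A)" unfolding x(3) \<alpha>[OF V x(1,2)] by (rule pairing(1)[OF x(1) comp_hom[OF x(1) eh[OF x(2)]]])
  next
    fix V V' z u assume V: "V \<in> CC W" and V': "V' \<in> CC W" and z: "z \<in> hom E V (prod_ob E A (\<gamma> G))" and u: "u \<in> hom E V' V"
    obtain x g where x: "x \<in> hom E V A" "g \<in> G" "z = pairing E x (const V G g)" using form[OF V z] by blast
    have "z \<cdot> u = pairing E (x \<cdot> u) (const V' G g)"
      unfolding x(3) pairing_comp[OF x(1) const_hom[OF CC_ob[OF V] G x(2)] u] const_comp[OF u G x(2)] ..
    then show "\<alpha> (z \<cdot> u) = \<alpha> z \<cdot> u"
      unfolding x(3) \<alpha>[OF V x(1,2)] pairing_comp[OF x(1) comp_hom[OF x(1) eh[OF x(2)]] u]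
      using \<alpha>[OF V' comp_hom[OF u x(1)] x(2)] comp_assoc[OF u x(1) eh[OF x(2)]] by (simp add: x(3))
  qed
  then obtain m where m: "m \<in> hom E (prod_ob E A (\<gamma> G)) (prod_ob E A A)"
    "\<And>V z. V \<in> CC W \<Longrightarrow> z \<in> hom E V (prod_ob E A (\<gamma> G)) \<Longrightarrow> m \<cdot> z = \<alpha> z" by blast
  have mp: "m \<cdot> pairing E x (const V G g) = pairing E x (e g \<cdot> x)" if V: "V \<in> CC W" and x: "x \<in> hom E V A" and g: "g \<in> G" for V x g
    using m(2)[OF V pairing(1)[OF x const_hom[OF CC_ob[OF V] G g]]] \<alpha>[OF that] by simp
  have "canonical_action_map E gup A G e m"
    unfolding canonical_action_map_def
  proof (intro conjI ballI m(1))
    fix g assume g: "g \<in> G"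
    have pt: "Arrow {g} (\<lambda>x\<in>{g}. x) G = pt g G" unfolding pt_def fn_def ..
    have go: "\<gamma> {g} \<in> ob E" by (simp add: \<gamma>_ob small_finite)
    note h = \<gamma>_hom[OF pt_hom[OF G g]] and iA = id_hom[OF A_ob]
    note r1 = pr_hom(1)[OF A_ob go] and r2 = pr_hom(2)[OF A_ob go] and pm = prod_map[OF iA h]
    note rp = pairing[OF r1 comp_hom[OF r1 eh[OF g]]]
    show "m \<cdot> prod_map E (idt E A) (far gup (Arrow {g} (\<lambda>x\<in>{g}. x) G)) = pairing E (pr1 E A (\<gamma> {g})) (e g \<cdot> pr1 E A (\<gamma> {g}))"
      unfolding pt
    proof (rule CC_ext[OF W comp_hom[OF pm(1) m(1)] rp(1)])
      fix V z assume V: "V \<in> CC W" and z: "z \<in> hom E V (prod_ob E A (\<gamma> {g}))"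
      note z1 = comp_hom[OF z r1] and z2 = comp_hom[OF z r2]
      have "prod_map E (idt E A) (far gup (pt g G)) \<cdot> z = pairing E (pr1 E A (\<gamma> {g}) \<cdot> z) (const V G g)"
        using pm(2)[OF z1 z2] pairing_eta[OF z A_ob go] id_left[OF z1] pt_const[OF G g z2] by simp
      then have "(m \<cdot> prod_map E (idt E A) (far gup (pt g G))) \<cdot> z = pairing E (pr1 E A (\<gamma> {g}) \<cdot> z) (e g \<cdot> (pr1 E A (\<gamma> {g}) \<cdot> z))"
        using comp_assoc[OF z pm(1) m(1)] mp[OF V z1 g] by simp
      also have "\<dots> = pairing E (pr1 E A (\<gamma> {g})) (e g \<cdot> pr1 E A (\<gamma> {g})) \<cdot> z"
        unfolding pairing_comp[OF r1 comp_hom[OF r1 eh[OF g]] z] comp_assoc[OF z r1 eh[OF g]] ..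
      finally show "(m \<cdot> prod_map E (idt E A) (far gup (pt g G))) \<cdot> z = pairing E (pr1 E A (\<gamma> {g})) (e g \<cdot> pr1 E A (\<gamma> {g})) \<cdot> z" .
    qed
  qed
  moreover have "iso E m"
  proof (rule CC_iso[OF W m(1)])
    fix V assume V: "V \<in> CC W"
    show "bij_betw (\<lambda>z. m \<cdot> z) (hom E V (prod_ob E A (\<gamma> G))) (hom E V (prod_ob E A A))"
      unfolding bij_betw_def
    proof (intro conjI inj_onI set_eqI iffI)
      fix z z' assume z: "z \<in> hom E V (prod_ob E A (\<gamma> G))" and z': "z' \<in> hom E V (prod_ob E A (\<gamma> G))" and eq: "m \<cdot> z = m \<cdot> z'"
      obtain x g where x: "x \<in> hom E V A" "g \<in> G" "z = pairing E x (const V G g)" using form[OF V z] by blast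
      obtain x' g' where x': "x' \<in> hom E V A" "g' \<in> G" "z' = pairing E x' (const V G g')" using form[OF V z'] by blast
      have *: "pairing E x (e g \<cdot> x) = pairing E x' (e g' \<cdot> x')" using eq mp[OF V x(1,2)] mp[OF V x'(1,2)] x(3) x'(3) by simp
      note P = pairing[OF x(1) comp_hom[OF x(1) eh[OF x(2)]]] and P' = pairing[OF x'(1) comp_hom[OF x'(1) eh[OF x'(2)]]]
      have xx: "x = x'" using * P(2) P'(2) by metis
      have "e g \<cdot> x = e g' \<cdot> x" using * P(3) P'(3) xx by metis
      then have "e g = e g'" using universal_eqI[OF all_universal[OF V x(1)] A eh[OF x(2)] eh[OF x'(2)]] by simp
      then have "g = g'" using inj_onD[OF bij_betw_imp_inj_on[OF e'] _ x(2) x'(2)] by simp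
      then show "z = z'" using xx x(3) x'(3) by simp
    next
      fix y assume "y \<in> (\<lambda>z. m \<cdot> z) ` hom E V (prod_ob E A (\<gamma> G))"
      then show "y \<in> hom E V (prod_ob E A A)" using comp_hom[OF _ m(1)] by auto
    next
      fix y assume y: "y \<in> hom E V (prod_ob E A A)"
      note y1 = comp_hom[OF y q1] and y2 = comp_hom[OF y q2]
      \<comment> \<open>Universality of the first coordinate of \<open>y\<close> supplies the group
        element that moves it to the second.\<close>
      obtain f where f: "f \<in> hom E A A" "f \<cdot> (pr1 E A A \<cdot> y) = pr2 E A A \<cdot> y" using universal_surj[OF all_universal[OF V y1] A y2] .
      have "f \<in> e ` G" using e' f(1) by (simp add: bij_betw_def)
      then obtain g where g: "g \<in> G" "e g = f" by auto
      have "y = m \<cdot> pairing E (pr1 E A A \<cdot> y) (const V G g)"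
        using mp[OF V y1 g(1)] g(2) f(2) pairing_eta[OF y A_ob A_ob] by simp
      then show "y \<in> (\<lambda>z. m \<cdot> z) ` hom E V (prod_ob E A (\<gamma> G))"
        using pairing(1)[OF y1 const_hom[OF CC_ob[OF V] G g(1)]] by (rule image_eqI)
    qed
  qed
  ultimately show ?thesis by blast
qed

theorem galois_A: "galois_object \<kappa> E gup A"
proof -
  obtain G :: "'s set" and e where "small \<kappa> G" "bij_betw e G (Aut E A)" using hom_A_copy[OF A] Aut_A by metis
  then show ?thesis unfolding galois_object_def
    using not_initial_A connected_A epi_A action_iso by blast
qed

text \<open>The trivialising set is a copy of \<open>hom E A X\<close>: composing with a map
  \<open>b\<close> to \<open>A\<close> is a bijection onto \<open>hom E V X\<close> because
  \<open>b\<close> is universal.\<close>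

lemma spl_split_A:
  assumes X: "spl W X" shows "split_object \<kappa> E gup {()} (\<lambda>_. A) X"
proof -
  have Xo: "X \<in> ob E" using X unfolding spl_def by auto
  obtain S :: "'s set" and e where S: "small \<kappa> S" and e: "bij_betw e S (hom E A X)" using hom_A_copy[OF X] .
  have eh: "e s \<in> hom E A X" if "s \<in> S" for s using bij_betwE[OF e] that by auto
  have "\<exists>\<theta>\<in>hom E (prod_ob E (\<gamma> S) A) (prod_ob E X A). iso E \<theta> \<and> pr2 E X A \<cdot> \<theta> = pr2 E (\<gamma> S) A"
  proof (rule trivialize[OF W Xo A_ob S, of "\<lambda>b s. e s \<cdot> b"])
    fix V b assume V: "V \<in> CC W" and b: "b \<in> hom E V A"
    have "bij_betw (\<lambda>f. f \<cdot> b) (hom E A X) (hom E V X)" using all_universal[OF V b] X unfolding universal_def by auto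
    from bij_betw_trans[OF e this] show "bij_betw (\<lambda>s. e s \<cdot> b) S (hom E V X)" by (simp add: comp_def)
  next
    fix V V' b u s assume "b \<in> hom E V A" "u \<in> hom E V' V" "s \<in> S"
    then show "e s \<cdot> (b \<cdot> u) = (e s \<cdot> b) \<cdot> u" using comp_assoc eh by metis
  qed
  then show ?thesis unfolding split_object_def using Xo S by (intro conjI exI[of _ "\<lambda>_. S"]) auto
qed

lemma split_A_spl: "split_object \<kappa> E gup {()} (\<lambda>_. A) X \<Longrightarrow> spl A X"
  by (rule split_object_spl[of "{()}" "\<lambda>_. A"]) (auto simp: A_ob CC_def)

text \<open>From left to right this goes through the splitting over \<open>A\<close>. For the
  converse, every object of \<open>CC W\<close> maps to \<open>A\<close>, so the condition for
  \<open>A\<close> covers more objects.\<close>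

lemma spl_A_iff: "spl W X \<longleftrightarrow> spl A X"
proof
  assume "spl W X" then show "spl A X" using split_A_spl spl_split_A by blast
next
  assume X: "spl A X"
  have "V \<in> CC A" if "V \<in> CC W" for V using hom_A[OF that] CC_conn[OF that] unfolding CC_def by simp
  then have "CC W \<subseteq> CC A" by blast
  then show "spl W X" using X unfolding spl_def by blast
qed

end

theorem proposition5p1p4:
  fixes \<kappa> :: "'s rel"
    and E :: "('o, 'a) cat"
    and gup :: "('s set, 's sarrow, 'o, 'a) ftor"
    and gdn gsh :: "('o, 'a, 's set, 's sarrow) ftor"
    and \<eta> :: "'o \<Rightarrow> 'a"
    and I :: "'i set" and U :: "'i \<Rightarrow> 'o" and UU :: 'o and inc :: "'i \<Rightarrow> 'a"
    and i :: 's
    and A :: "('o, 'a, 's) triple"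
  assumes "universe \<kappa>"
    and topos: "grothendieck_topos \<kappa> E"
    and structure_morphism: "geometric_morphism E (Sets \<kappa>) gup gdn"
    and locally_connected: "adjunction E (Sets \<kappa>) gsh gup \<eta>"
    and connected: "fully_faithful (Sets \<kappa>) E gup"
    and cover: "small \<kappa> I" "is_cover E I U" "is_coproduct E I U UU inc"
    and point: "i \<in> fob gsh UU"
    and representing: "represents (pushout_topos \<kappa> E gsh gup \<eta> UU) (fibre_ftor i) A"
  shows "galois_object \<kappa> E gup (tX A) \<and>
         connected_object E (tX A) \<and> is_cover E {()} (\<lambda>_. tX A) \<and>
         Split \<kappa> E gup I U = Split \<kappa> E gup {()} (\<lambda>_. tX A) \<and>
         equivalent_cats (pushout_topos \<kappa> E gsh gup \<eta> UU) (pushout_topos \<kappa> E gsh gup \<eta> (tX A))"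
proof -
  have "category E" using topos unfolding grothendieck_topos_def by auto
  interpret lc_topos \<kappa> E gup gdn gsh \<eta>
    by unfold_locales (fact | rule topos_like_topos[OF \<open>universe \<kappa>\<close> topos])+
  have W: "cov UU" by (rule cover_cov[OF cover(2,3)])
  have UUo: "UU \<in> ob E" using W unfolding cov_def by auto
  have A: "A \<in> pushout_ob \<kappa> E gsh gup \<eta> UU" using representing unfolding represents_def by auto
  obtain a where a: "a \<in> hom E (cob UU i) (tX A)" "universal UU (tX A) (cob UU i) a"
    using represents_universal[OF W point representing] by blast
  have V0: "cob UU i \<in> CC UU" using CC_cob[OF UUo _ point] id_hom[OF UUo] by blast
  interpret galois \<kappa> E gup gdn gsh \<eta> UU "tX A" "cob UU i" a
    by unfold_locales (fact W ptriple_spl[OF UUo A] V0 a)+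
  have U: "U k \<in> ob E" "hom E (U k) UU \<noteq> {}" if "k \<in> I" for k using coproduct_inc[OF cover(3) that] by auto
  \<comment> \<open>The members of the cover map to \<open>UU\<close>, and conversely a connected
    object over \<open>UU\<close> maps to one of them by \<open>coproduct_conn\<close>.\<close>
  have "split_object \<kappa> E gup I U X \<longleftrightarrow> spl UU X" for X
  proof
    show "split_object \<kappa> E gup I U X \<Longrightarrow> spl UU X"
    proof (rule split_object_spl[OF U(1)])
      fix V assume "V \<in> CC UU"
      then show "\<exists>i\<in>I. hom E V (U i) \<noteq> {}" using coproduct_conn[OF cover(3)] unfolding CC_def by blast
    qed
    show "spl UU X \<Longrightarrow> split_object \<kappa> E gup I U X" by (rule spl_split_object[OF W _ U])
  qed
  moreover have "split_object \<kappa> E gup {()} (\<lambda>_. tX A) X \<longleftrightarrow> spl UU X" for X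
    using spl_split_A split_A_spl spl_A_iff by blast
  ultimately have "split_object \<kappa> E gup I U = split_object \<kappa> E gup {()} (\<lambda>_. tX A)" by blast
  then have "Split \<kappa> E gup I U = Split \<kappa> E gup {()} (\<lambda>_. tX A)" unfolding Split_def by simp
  then show ?thesis
    using galois_A connected_A cover_A pushout_equivalent[OF W cov_A spl_A_iff] by blast
qed

end
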